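(* Let $A:\mathbb{R}^N\to\mathbb{R}^N$ be Lipschitz. Then $u\in H^1_A(\mathbb{R}^N)$ if and only if $u\in L^2(\mathbb{R}^N)$ and $$\sup_{0<\delta<1}J_\delta(u)<+\infty.$$ Moreover, we have, for $u\in H^1_A(\mathbb{R}^N)$, $$\lim_{\delta\searrow0}J_\delta(u)=Q_N\int_{\mathbb{R}^N}|\nabla u-\mathrm{i}A(x)u|^2\,dx$$ and $$\sup_{\delta>0}J_\delta(u)\le C_N\left(\int_{\mathbb{R}^N}|\nabla u-\mathrm{i}A(x)u|^2\,dx+\big(\|\nabla A\|_{L^\infty(\mathbb{R}^N)}^2+1\big)\int_{\mathbb{R}^N}|u|^2\,dx\right),$$ where $C_N$ is a positive constant depending only on $N$.
   Context: $N\ge1$ is an integer, $\mathrm{i}$ is the imaginary unit, $|\cdot|$ is the Euclidean norm, and functions $u$ are complex-valued. $H^1_A(\mathbb{R}^N)$ is the space of complex-valued $u\in L^2(\mathbb{R}^N)$ such that $\int_{\mathbb{R}^N}|\nabla u-\mathrm{i}A(x)u|^2dx<\infty$ (weak gradient). For measurable $u:\mathbb{R}^N\to\mathbb{C}$, $\Psi_u(x,y):=e^{\mathrm{i}(x-y)\cdot A\left(\frac{x+y}{2}\right)}u(y)$ for $x,y\in\mathbb{R}^N$ (so $\Psi_u(x,x)=u(x)$). For $u\in L^1_{\mathrm{loc}}(\mathbb{R}^N)$ and $\delta>0$, $$J_\delta(u):=\iint_{\{(x,y)\in\mathbb{R}^{2N}:\,|\Psi_u(x,y)-\Psi_u(x,x)|>\delta\}}\frac{\delta^2}{|x-y|^{N+2}}\,dx\,dy.$$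 $Q_N:=\frac12\int_{\mathbb{S}^{N-1}}|\boldsymbol{\omega}\cdot\sigma|^2d\sigma$, where $\mathbb{S}^{N-1}$ is the unit sphere of $\mathbb{R}^N$ and $\boldsymbol{\omega}$ is an arbitrary unit vector of $\mathbb{R}^N$ (the value does not depend on $\boldsymbol{\omega}$). $\nabla A$ is the a.e. defined Jacobian of $A$, and $\|\nabla A\|_{L^\infty(\mathbb{R}^N)}$ is the essential supremum of its Euclidean norm $|\nabla A(x)|$. *)

theory Defs
  imports "HOL-Analysis.Analysis" "HOL-Probability.Essential_Supremum"
begin

text \<open>The ambient space is \<open>real ^ 'n\<close>, so that the dimension is \<open>CARD('n)\<close>.
  Integrals of nonnegative functions take values in \<open>ennreal\<close>, and measurability is Lebesgue
  measurability throughout.\<close>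

section \<open>Weak gradients\<close>

definition pderiv_at :: "'n::finite \<Rightarrow> (real ^ 'n \<Rightarrow> real) \<Rightarrow> real ^ 'n \<Rightarrow> real" where
  "pderiv_at j \<phi> x = frechet_derivative \<phi> (at x) (axis j 1)"

primrec iter_pderiv :: "'n::finite list \<Rightarrow> (real ^ 'n \<Rightarrow> real) \<Rightarrow> real ^ 'n \<Rightarrow> real" where
  "iter_pderiv [] \<phi> = \<phi>"
| "iter_pderiv (j # js) \<phi> = pderiv_at j (iter_pderiv js \<phi>)"

text \<open>If all iterated partial derivatives are differentiable everywhere, then they are all
  continuous; hence this is the class of infinitely often differentiable functions.\<close>

definition smooth_fun :: "(real ^ 'n::finite \<Rightarrow> real) \<Rightarrow> bool" where
  "smooth_fun \<phi> \<longleftrightarrow> (\<forall>js x. iter_pderiv js \<phi> differentiable (at x))"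

definition test_fun :: "(real ^ 'n::finite \<Rightarrow> real) \<Rightarrow> bool" where
  "test_fun \<phi> \<longleftrightarrow> smooth_fun \<phi> \<and> compact (closure {x. \<phi> x \<noteq> 0})"

definition locally_integrable :: "(real ^ 'n::finite \<Rightarrow> complex) \<Rightarrow> bool" where
  "locally_integrable f \<longleftrightarrow> (\<forall>K. compact K \<longrightarrow> f absolutely_integrable_on K)"

text \<open>By linearity, testing against real test functions is the same as testing against complex
  ones.\<close>

definition has_weak_grad :: "(real ^ 'n::finite \<Rightarrow> complex) \<Rightarrow> (real ^ 'n \<Rightarrow> complex ^ 'n) \<Rightarrow> bool" where
  "has_weak_grad u G \<longleftrightarrow>
     locally_integrable u \<and>
     (\<forall>j. locally_integrable (\<lambda>x. G x $ j)) \<and>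
     (\<forall>\<phi> j. test_fun \<phi> \<longrightarrow>
        (LINT x|lebesgue. u x * complex_of_real (pderiv_at j \<phi> x)) =
        - (LINT x|lebesgue. G x $ j * complex_of_real (\<phi> x)))"

text \<open>A weak gradient is unique up to a null set, so the choice below is immaterial; the value is
  only meaningful if some weak gradient exists.\<close>

definition weak_grad :: "(real ^ 'n::finite \<Rightarrow> complex) \<Rightarrow> real ^ 'n \<Rightarrow> complex ^ 'n" where
  "weak_grad u = (SOME G. has_weak_grad u G)"

section \<open>The magnetic Sobolev space\<close>

definition sq_integral :: "(real ^ 'n::finite \<Rightarrow> complex) \<Rightarrow> ennreal" where
  "sq_integral u = (\<integral>\<^sup>+x. ennreal ((norm (u x))\<^sup>2) \<partial>lebesgue)"

definition L2_fun :: "(real ^ 'n::finite \<Rightarrow> complex) set" where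
  "L2_fun = {u. u \<in> borel_measurable lebesgue \<and> sq_integral u < \<infinity>}"

definition mag_grad ::
    "(real ^ 'n::finite \<Rightarrow> real ^ 'n) \<Rightarrow> (real ^ 'n \<Rightarrow> complex) \<Rightarrow> real ^ 'n \<Rightarrow> complex ^ 'n" where
  "mag_grad A u x = (\<chi> j. weak_grad u x $ j - \<i> * complex_of_real (A x $ j) * u x)"

definition mag_energy ::
    "(real ^ 'n::finite \<Rightarrow> real ^ 'n) \<Rightarrow> (real ^ 'n \<Rightarrow> complex) \<Rightarrow> ennreal" where
  "mag_energy A u = (\<integral>\<^sup>+x. ennreal ((norm (mag_grad A u x))\<^sup>2) \<partial>lebesgue)"

definition H1A :: "(real ^ 'n::finite \<Rightarrow> real ^ 'n) \<Rightarrow> (real ^ 'n \<Rightarrow> complex) set" where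
  "H1A A = {u \<in> L2_fun. (\<exists>G. has_weak_grad u G) \<and> mag_energy A u < \<infinity>}"

section \<open>The nonlocal functionals\<close>

definition Psi ::
    "(real ^ 'n::finite \<Rightarrow> real ^ 'n) \<Rightarrow> (real ^ 'n \<Rightarrow> complex) \<Rightarrow> real ^ 'n \<Rightarrow> real ^ 'n \<Rightarrow> complex"
  where
  "Psi A u x y = exp (\<i> * complex_of_real ((x - y) \<bullet> A ((x + y) /\<^sub>R 2))) * u y"

definition J ::
    "(real ^ 'n::finite \<Rightarrow> real ^ 'n) \<Rightarrow> real \<Rightarrow> (real ^ 'n \<Rightarrow> complex) \<Rightarrow> ennreal" where
  "J A \<delta> u =
     (\<integral>\<^sup>+(x, y) \<in> {(x, y). norm (Psi A u x y - Psi A u x x) > \<delta>}.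
        ennreal (\<delta>\<^sup>2 / norm (x - y) ^ (CARD('n) + 2)) \<partial>lebesgue)"

section \<open>Constants\<close>

text \<open>The surface measure of the unit sphere: the measure of a Borel set \<open>E\<close> of directions is
  \<open>CARD('n)\<close> times the volume of the cone \<open>{r *\<^sub>R \<theta> | r \<theta>. 0 < r \<and> r \<le> 1 \<and> \<theta> \<in> E}\<close>.  For
  \<open>CARD('n) = 1\<close> it is the counting measure on the two unit vectors.\<close>

definition sphere_measure :: "(real ^ 'n::finite) measure" where
  "sphere_measure =
     scale_measure (of_nat CARD('n))
       (distr (restrict_space lborel (cball 0 1 - {0})) borel (\<lambda>x. x /\<^sub>R norm x))"

definition Q :: "real ^ 'n::finite \<Rightarrow> real" where
  "Q \<omega> = 1 / 2 * (LINT \<sigma>:sphere 0 1|sphere_measure. \<bar>\<omega> \<bullet> \<sigma>\<bar>\<^sup>2)"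

text \<open>The norm on \<open>real ^ 'n ^ 'n\<close> is the Euclidean one, i.e. the square root of the sum of the
  squares of all entries.  The value of \<open>jacobian\<close> is arbitrary where \<open>A\<close> is not
  differentiable, which for Lipschitz \<open>A\<close> is a null set.\<close>

definition grad_sup_norm :: "(real ^ 'n::finite \<Rightarrow> real ^ 'n) \<Rightarrow> ennreal" where
  "grad_sup_norm A = esssup lebesgue (\<lambda>x. ennreal (norm (jacobian A (at x))))"

end

theory Submission
  imports Defs
begin

text \<open>Everything is expressed through the magnetic difference
  \<open>mdiff A u h x = exp (- \<i> h \<bullet> A (x + h / 2)) * u (x + h) - u x\<close>.  Substituting \<open>y = x + h\<close> turns the
  functional into an integral over \<open>h\<close> of \<open>\<delta>\<^sup>2 / norm h ^ (N + 2)\<close> times the measure of the set where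
  \<open>norm (mdiff A u h)\<close> exceeds \<open>\<delta>\<close> (\<open>J_eq_superlevel\<close>), where \<open>N\<close> is the dimension.

  If \<open>u\<close> has a weak gradient \<open>G\<close>, then on almost every segment \<open>mdiff A u h\<close> is the integral of
  \<open>cdot h (G - \<i> A u)\<close> up to a phase and an error of order \<open>(norm h)\<^sup>2 * norm u\<close>, because \<open>A\<close> is Lipschitz and
  the phase is evaluated at the midpoint (\<open>mdiff_segment\<close>).  For the upper bound, on the set where the
  average of a function \<open>f\<close> over a segment exceeds \<open>\<delta>\<close>, that part of the average where \<open>f\<close> is at most
  half of \<open>\<delta>\<close> can be discarded; Chebyshev's inequality for the remaining part and Fubini in \<open>h\<close> give a
  multiple of \<open>\<integral> f\<^sup>2\<close> (\<open>J_upper_bound\<close>).  For the limit, the substitution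
  \<open>h = \<delta> k\<close> removes \<open>\<delta>\<close> from the weight; the quotients \<open>mdiff A u (\<delta> k) / \<delta>\<close> converge to \<open>cdot k (G - \<i> A u)\<close> in
  \<open>L\<^sup>2\<close>, so their superlevel sets converge in measure for almost every \<open>k\<close>, and the upper bound supplies the
  dominating function (\<open>J_limit\<close>).  The constant \<open>Q\<close> appears when the limiting integral over \<open>k\<close> is
  evaluated in polar coordinates (\<open>nn_integral_superlevel\<close>, \<open>Q_eq\<close>).

  Conversely, let \<open>J A \<delta> u\<close> be at most \<open>K\<close> for \<open>0 < \<delta> < 1\<close>.  Truncating the values of \<open>u\<close> radially does not
  increase \<open>J\<close>, so \<open>u\<close> may be assumed bounded.  Summing over \<open>\<delta> = (1/2)^i\<close> for \<open>i \<le> m\<close> bounds the integral of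
  \<open>(norm (mdiff A u h x))\<^sup>2 / norm h ^ (N + 2)\<close> over the annulus \<open>(1/2)^m < norm h < 1\<close> by \<open>4 K m\<close> up to a
  constant (\<open>quadratic_bound\<close>).  The mass of the weight \<open>(norm h)\<^sup>2 / norm h ^ (N + 2)\<close> on this annulus grows
  linearly in \<open>m\<close> as well; after pairing with a test function and dividing by \<open>m\<close> the constant disappears,
  and what remains is that \<open>\<phi> \<mapsto> \<integral> u (\<partial>\<^sub>j \<phi> + \<i> A\<^sub>j \<phi>)\<close> is bounded in the \<open>L\<^sup>2\<close> norm of \<open>\<phi>\<close>
  (\<open>weak_bound\<close>).  The Riesz representation of this functional is the magnetic gradient
  (\<open>weak_gradient_from_J_bound\<close>).

  The last estimate of the theorem contains the essential supremum of the Jacobian, while \<open>J_upper_bound\<close>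
  contains a Lipschitz constant.  Comparing them requires Rademacher's theorem, since the
  Jacobian carries no information at points where \<open>A\<close> is not differentiable.  The weak gradient of a
  Lipschitz function comes from the converse direction with zero potential, and Lebesgue's
  differentiation theorem on lines makes it the classical one (\<open>rademacher\<close>,
  \<open>lipschitz_by_jacobian_bound\<close>).\<close>

section \<open>Lebesgue measure: invariances and polar coordinates\<close>

abbreviation L2_sq :: "('a::euclidean_space \<Rightarrow> 'b::real_normed_vector) \<Rightarrow> ennreal" where
  "L2_sq f \<equiv> \<integral>\<^sup>+x. ennreal ((norm (f x))\<^sup>2) \<partial>lborel"

lemma nn_integral_lborel_translate:
  fixes f :: "'a::euclidean_space \<Rightarrow> ennreal"
  assumes [measurable]: "f \<in> borel_measurable borel"
  shows "(\<integral>\<^sup>+x. f (c + x) \<partial>lborel) = (\<integral>\<^sup>+x. f x \<partial>lborel)"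
proof -
  have "(\<integral>\<^sup>+x. f x \<partial>lborel) = (\<integral>\<^sup>+x. f x \<partial>distr lborel borel ((+) c))"
    by (simp add: lborel_distr_plus)
  also have "\<dots> = (\<integral>\<^sup>+x. f (c + x) \<partial>lborel)"
    by (subst nn_integral_distr) auto
  finally show ?thesis ..
qed

lemma integral_lborel_translate:
  fixes f :: "'a::euclidean_space \<Rightarrow> 'b::{banach, second_countable_topology}"
  assumes [measurable]: "f \<in> borel_measurable borel"
  shows "(LINT x|lborel. f (c + x)) = (LINT x|lborel. f x)"
proof -
  have "(LINT x|lborel. f x) = (LINT x|distr lborel borel ((+) c). f x)"
    by (simp add: lborel_distr_plus)
  also have "\<dots> = (LINT x|lborel. f (c + x))"
    by (subst integral_distr) auto
  finally show ?thesis ..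
qed

lemma integrable_lborel_translate:
  fixes f :: "'a::euclidean_space \<Rightarrow> 'b::{banach, second_countable_topology}"
  assumes "integrable lborel f"
  shows "integrable lborel (\<lambda>x. f (c + x))"
proof -
  have "integrable (distr lborel borel ((+) c)) f"
    using assms by (simp add: lborel_distr_plus)
  then show ?thesis
    by (subst (asm) integrable_distr_eq) (use assms in auto)
qed

lemma AE_lborel_translate:
  fixes P :: "'a::euclidean_space \<Rightarrow> bool"
  assumes "AE x in lborel. P x"
  shows "AE x in lborel. P (c + x)"
proof (rule AE_distrD[where M'=borel and f="(+) c" and M=lborel])
  show "AE x in distr lborel borel ((+) c). P x"
    using assms by (subst lborel_distr_plus)
qed auto

lemma nn_integral_lborel_scale:
  fixes f :: "'a::euclidean_space \<Rightarrow> ennreal"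
  assumes [measurable]: "f \<in> borel_measurable borel" and c: "c > 0"
  shows "(\<integral>\<^sup>+x. f x \<partial>lborel) = ennreal (c ^ DIM('a)) * (\<integral>\<^sup>+x. f (c *\<^sub>R x) \<partial>lborel)"
proof -
  have "(\<integral>\<^sup>+x. f x \<partial>lborel) =
      (\<integral>\<^sup>+x. f x \<partial>density (distr lborel borel (\<lambda>x. 0 + c *\<^sub>R x)) (\<lambda>_. \<bar>c\<bar>^DIM('a)))"
    using lborel_affine[of c "0::'a"] c by simp
  also have "\<dots> = ennreal (c ^ DIM('a)) * (\<integral>\<^sup>+x. f (c *\<^sub>R x) \<partial>lborel)"
    using c by (subst nn_integral_density) (auto simp: nn_integral_distr nn_integral_cmult)
  finally show ?thesis .
qed

lemma emeasure_lborel_box_vec: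
  fixes l u :: "real ^ 'n::finite"
  assumes "\<And>i. l $ i \<le> u $ i"
  shows "emeasure lborel (box l u) = (\<Prod>i\<in>UNIV. ennreal (u $ i - l $ i))"
proof -
  have "\<And>b. b \<in> Basis \<Longrightarrow> l \<bullet> b \<le> u \<bullet> b"
    using assms by (auto simp: Basis_vec_def inner_axis)
  then have "emeasure lborel (box l u) = ennreal (\<Prod>b\<in>Basis. (u - l) \<bullet> b)"
    by (simp add: emeasure_lborel_box_eq)
  also have "(\<Prod>b\<in>Basis. (u - l) \<bullet> b) = (\<Prod>i\<in>UNIV. u $ i - l $ i)"
  proof -
    have "(\<Prod>b\<in>Basis. (u - l) \<bullet> b) = (\<Prod>b\<in>range (\<lambda>i. axis i (1::real)). (u - l) \<bullet> b)"
      by (rule prod.cong) (auto simp: Basis_vec_def)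
    also have "\<dots> = (\<Prod>i\<in>UNIV. (u - l) \<bullet> axis i 1)"
      by (subst prod.reindex) (auto simp: inj_on_def axis_eq_axis)
    finally show ?thesis by (simp add: inner_axis)
  qed
  finally show ?thesis
    using assms by (simp add: prod_ennreal)
qed

text \<open>Coordinate permutations and reflections determine the second moments of a radial weight: they make
  the diagonal ones equal and the mixed ones zero.\<close>

lemma lborel_distr_permute:
  fixes p :: "'n::finite \<Rightarrow> 'n"
  assumes p: "bij p"
  shows "distr lborel borel (\<lambda>x::real^'n. \<chi> i. x $ p i) = lborel"
proof (rule lborel_eqI[symmetric])
  let ?T = "\<lambda>x::real^'n. \<chi> i. x $ p i"
  have m[measurable]: "?T \<in> borel_measurable borel"
    by (intro borel_measurable_continuous_onI continuous_intros)
  show "sets (distr lborel borel ?T) = sets borel" by simp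
  fix l u :: "real ^ 'n" assume "\<And>b. b \<in> Basis \<Longrightarrow> l \<bullet> b \<le> u \<bullet> b"
  then have le: "l $ i \<le> u $ i" for i
    by (metis axis_in_Basis_iff cart_eq_inner_axis insertI1 Basis_real_def)
  let ?q = "inv p"
  have eq: "?T -` box l u = box (\<chi> i. l $ ?q i) (\<chi> i. u $ ?q i)"
    using p by (auto simp: mem_box_cart bij_inv_eq_iff) (metis p bij_inv_eq_iff)+
  have "emeasure (distr lborel borel ?T) (box l u) = emeasure lborel (box (\<chi> i. l $ ?q i) (\<chi> i. u $ ?q i))"
    by (simp add: emeasure_distr eq)
  also have "\<dots> = (\<Prod>i\<in>UNIV. ennreal (u $ ?q i - l $ ?q i))"
    by (subst emeasure_lborel_box_vec) (use le in auto)
  also have "\<dots> = (\<Prod>i\<in>UNIV. ennreal (u $ i - l $ i))"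
    using prod.reindex_bij_betw[OF bij_imp_bij_inv[OF p], of "\<lambda>i. ennreal (u $ i - l $ i)"] by simp
  also have "\<dots> = emeasure lborel (box l u)"
    using le by (simp add: emeasure_lborel_box_vec)
  also have "\<dots> = (\<Prod>b\<in>Basis. (u - l) \<bullet> b)"
    using \<open>\<And>b. b \<in> Basis \<Longrightarrow> l \<bullet> b \<le> u \<bullet> b\<close> by (simp add: emeasure_lborel_box_eq)
  finally show "emeasure (distr lborel borel ?T) (box l u) = (\<Prod>b\<in>Basis. (u - l) \<bullet> b)" .
qed

lemma lborel_distr_reflect:
  fixes s :: "'n::finite \<Rightarrow> real"
  assumes s: "\<And>i. \<bar>s i\<bar> = 1"
  shows "distr lborel borel (\<lambda>x::real^'n. \<chi> i. s i * x $ i) = lborel"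
proof (rule lborel_eqI[symmetric])
  let ?T = "\<lambda>x::real^'n. \<chi> i. s i * x $ i"
  have m[measurable]: "?T \<in> borel_measurable borel"
    by (intro borel_measurable_continuous_onI continuous_intros)
  show "sets (distr lborel borel ?T) = sets borel" by simp
  fix l u :: "real ^ 'n" assume "\<And>b. b \<in> Basis \<Longrightarrow> l \<bullet> b \<le> u \<bullet> b"
  then have le: "l $ i \<le> u $ i" for i
    by (metis axis_in_Basis_iff cart_eq_inner_axis insertI1 Basis_real_def)
  have s': "s i = 1 \<or> s i = -1" for i using s[of i] by auto
  define l' u' :: "real ^ 'n" where "l' = (\<chi> i. if s i = 1 then l $ i else - u $ i)"
    and "u' = (\<chi> i. if s i = 1 then u $ i else - l $ i)"
  have eq: "?T -` box l u = box l' u'"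
  proof -
    have "(l $ i < s i * x $ i \<and> s i * x $ i < u $ i) \<longleftrightarrow> (l' $ i < x $ i \<and> x $ i < u' $ i)" for x :: "real^'n" and i
      using s'[of i] by (auto simp: l'_def u'_def)
    then show ?thesis by (auto simp: mem_box_cart)
  qed
  have "emeasure (distr lborel borel ?T) (box l u) = emeasure lborel (box l' u')"
    by (simp add: emeasure_distr eq)
  also have "\<dots> = (\<Prod>i\<in>UNIV. ennreal (u' $ i - l' $ i))"
    by (subst emeasure_lborel_box_vec) (use le in \<open>auto simp: l'_def u'_def\<close>)
  also have "\<dots> = (\<Prod>i\<in>UNIV. ennreal (u $ i - l $ i))"
    by (rule prod.cong) (auto simp: l'_def u'_def)
  also have "\<dots> = emeasure lborel (box l u)"
    using le by (simp add: emeasure_lborel_box_vec)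
  also have "\<dots> = (\<Prod>b\<in>Basis. (u - l) \<bullet> b)"
    using \<open>\<And>b. b \<in> Basis \<Longrightarrow> l \<bullet> b \<le> u \<bullet> b\<close> by (simp add: emeasure_lborel_box_eq)
  finally show "emeasure (distr lborel borel ?T) (box l u) = (\<Prod>b\<in>Basis. (u - l) \<bullet> b)" .
qed

lemma ennreal_mult_swap: "0 \<le> a \<Longrightarrow> ennreal a * (X * ennreal b) = X * ennreal (a * b)"
  by (simp add: ennreal_mult' mult_ac)

text \<open>Averaging the scaling identity over the ball turns the volume integral into a radial one;
  the direction is represented by a point of the punctured ball instead of the sphere.\<close>

lemma nn_integral_polar:
  fixes F :: "'a::euclidean_space \<Rightarrow> ennreal"
  assumes [measurable]: "F \<in> borel_measurable borel"
  shows "(\<integral>\<^sup>+x. F x \<partial>lborel) =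
    (\<integral>\<^sup>+x. indicator (cball 0 1 - {0}) x * (ennreal DIM('a) *
      (\<integral>\<^sup>+r. indicator {0<..} r * (F ((r / norm x) *\<^sub>R x) * ennreal (r ^ (DIM('a) - 1))) \<partial>lborel)) \<partial>lborel)"
proof -
  let ?N = "DIM('a)"
  have N: "?N > 0" by simp
  have [measurable]: "(indicator (cball 0 1 - {0}) :: 'a \<Rightarrow> ennreal) \<in> borel_measurable borel"
    by (rule borel_measurable_indicator) auto
  have inner: "(\<integral>\<^sup>+r. indicator {0<..} r * (F ((r / norm x) *\<^sub>R x) * ennreal (r ^ (?N - 1))) \<partial>lborel)
      = (\<integral>\<^sup>+r. indicator {0<..} r * (F (r *\<^sub>R x) * ennreal (norm x ^ ?N * r ^ (?N - 1))) \<partial>lborel)"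
    if "x \<noteq> 0" for x :: 'a
  proof -
    have nx: "norm x > 0" using that by simp
    have e: "norm x * norm x ^ (?N - 1) = norm x ^ ?N"
      by (metis N power_minus_mult mult.commute)
    have pt: "ennreal (norm x) * (indicator {0<..} (0 + norm x * r) *
        (F (((0 + norm x * r) / norm x) *\<^sub>R x) * ennreal ((0 + norm x * r) ^ (?N - 1)))) =
      indicator {0<..} r * (F (r *\<^sub>R x) * ennreal (norm x ^ ?N * r ^ (?N - 1)))" for r :: real
    proof (cases "r > 0")
      case True
      have "norm x * (norm x * r) ^ (?N - 1) = norm x ^ ?N * r ^ (?N - 1)"
        using e by (simp add: power_mult_distrib mult.assoc[symmetric])
      then show ?thesis
        using True nx by (simp add: ennreal_mult_swap)
    next
      case False
      then show ?thesis using nx by (simp add: zero_less_mult_iff)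
    qed
    show ?thesis
      apply (subst nn_integral_real_affine[where c="norm x" and t=0])
        apply measurable
      using nx apply simp
      apply (subst nn_integral_cmult[symmetric])
       apply measurable
      apply (rule nn_integral_cong)
      using pt by simp
  qed
  have tail: "(\<integral>\<^sup>+r. (if norm y \<le> r then ennreal (?N * r powr (- 1 - real ?N)) else 0) \<partial>lborel) = ennreal (norm y powr - ?N)"
    if "y \<noteq> 0" for y :: 'a
  proof -
    have ny: "norm y > 0" using that by simp
    have "(\<integral>\<^sup>+r. ennreal (?N * r powr (- 1 - real ?N)) * indicator {norm y..} r \<partial>lborel) = ennreal (0 - (- (norm y powr - real ?N)))"
    proof (rule nn_integral_FTC_atLeast)
      show "((\<lambda>r. - (r powr - real ?N)) \<longlongrightarrow> 0) at_top"
        using tendsto_minus[OF tendsto_neg_powr[of "- real ?N", OF _ filterlim_ident]] N by simp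
      fix r assume "norm y \<le> r"
      then show "((\<lambda>r. - (r powr - real ?N)) has_real_derivative ?N * r powr (- 1 - real ?N)) (at r)"
        using ny using \<open>norm y \<le> r\<close> order.strict_trans2[OF ny \<open>norm y \<le> r\<close>] by (auto intro!: derivative_eq_intros simp: minus_diff_commute)
    qed (auto)
    moreover have "(\<integral>\<^sup>+r. (if norm y \<le> r then ennreal (?N * r powr (- 1 - real ?N)) else 0) \<partial>lborel) =
       (\<integral>\<^sup>+r. ennreal (?N * r powr (- 1 - real ?N)) * indicator {norm y..} r \<partial>lborel)"
      by (intro nn_integral_cong) (auto simp: indicator_def)
    ultimately show ?thesis by simp
  qed
  have "(\<integral>\<^sup>+x. indicator (cball 0 1 - {0}) x * (ennreal ?N *
      (\<integral>\<^sup>+r. indicator {0<..} r * (F ((r / norm x) *\<^sub>R x) * ennreal (r ^ (?N - 1))) \<partial>lborel)) \<partial>lborel)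
    = (\<integral>\<^sup>+x. (\<integral>\<^sup>+r. indicator (cball 0 1 - {0}) x * ennreal ?N *
        (indicator {0<..} r * (F (r *\<^sub>R x) * ennreal (norm x ^ ?N * r ^ (?N - 1)))) \<partial>lborel) \<partial>lborel)"
    apply (rule nn_integral_cong)
    apply (subst nn_integral_cmult)
     apply measurable
    using inner by (auto simp: indicator_def)
  also have "\<dots> = (\<integral>\<^sup>+r. (\<integral>\<^sup>+x. indicator (cball 0 1 - {0}) x * ennreal ?N *
        (indicator {0<..} r * (F (r *\<^sub>R x) * ennreal (norm x ^ ?N * r ^ (?N - 1)))) \<partial>lborel) \<partial>lborel)"
    by (rule lborel_pair.Fubini') measurable
  also have "\<dots> = (\<integral>\<^sup>+r. (\<integral>\<^sup>+y. indicator {0<..} r * ((if norm y \<le> r then ennreal (?N * r powr (- 1 - real ?N)) else 0) *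
         (indicator (- {0}) y * F y * ennreal (norm y ^ ?N))) \<partial>lborel) \<partial>lborel)" (is "nn_integral _ ?a1 = nn_integral _ ?b1")
  proof (rule nn_integral_cong)
    fix r :: real
    show "?a1 r = ?b1 r"
    proof (cases "r > 0")
      case r: True
      have p: "?N * r ^ (?N-1) * norm x ^ ?N = r ^ ?N * (?N * r powr (- 1 - real ?N)) * norm (r *\<^sub>R x) ^ ?N" for x :: 'a
      proof -
        have "r ^ ?N * r powr (-1 - real ?N) * r ^ ?N = r ^ (?N - 1)"
          using r by (simp add: powr_realpow[symmetric] powr_add[symmetric] of_nat_diff powr_diff)
        then show ?thesis using r by (simp add: power_mult_distrib mult_ac)
      qed
      show ?thesis
        apply (subst (2) nn_integral_lborel_scale[OF _ r])
         apply measurable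
        apply (subst nn_integral_cmult[symmetric])
         apply measurable
        apply (rule nn_integral_cong)
        subgoal for x
        proof (cases "x \<noteq> 0 \<and> norm x \<le> 1")
          case True
          then have "norm (r *\<^sub>R x) \<le> r" using r by (simp add: mult_left_le)
          then have "ennreal (r ^ ?N) * (indicator {0<..} r * ((if norm (r *\<^sub>R x) \<le> r then ennreal (?N * r powr (- 1 - real ?N)) else 0) *
              (indicator (- {0}) (r *\<^sub>R x) * F (r *\<^sub>R x) * ennreal (norm (r *\<^sub>R x) ^ ?N))))
            = ennreal (r ^ ?N) * (ennreal (?N * r powr (- 1 - real ?N)) * (F (r *\<^sub>R x) * ennreal (norm (r *\<^sub>R x) ^ ?N)))"
            using True r by simp
          also have "\<dots> = F (r *\<^sub>R x) * ennreal (r ^ ?N * (?N * r powr (- 1 - real ?N) * norm (r *\<^sub>R x) ^ ?N))"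
            using r by (subst ennreal_mult_swap, simp, subst ennreal_mult_swap, simp_all)
          also have "r ^ ?N * (?N * r powr (- 1 - real ?N) * norm (r *\<^sub>R x) ^ ?N) = ?N * (norm x ^ ?N * r ^ (?N-1))"
            using p[of x] by (simp only: mult_ac)
          also have "F (r *\<^sub>R x) * ennreal (?N * (norm x ^ ?N * r ^ (?N-1))) =
             ennreal ?N * (F (r *\<^sub>R x) * ennreal (norm x ^ ?N * r ^ (?N-1)))"
            by (subst ennreal_mult_swap) simp_all
          finally show ?thesis
            using True r by simp
        next
          case False
          then show ?thesis
            using r by (cases "x = 0") (auto simp: mult_le_cancel_left1)
        qed
        done
    qed simp
  qed
  also have "\<dots> = (\<integral>\<^sup>+y. (\<integral>\<^sup>+r. indicator {0<..} r * ((if norm y \<le> r then ennreal (?N * r powr (- 1 - real ?N)) else 0) *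
         (indicator (- {0}) y * F y * ennreal (norm y ^ ?N))) \<partial>lborel) \<partial>lborel)"
    by (rule lborel_pair.Fubini') measurable
  also have "\<dots> = (\<integral>\<^sup>+y. F y \<partial>lborel)"
  proof (rule nn_integral_cong_AE)
    have "AE y in lborel. y \<noteq> (0::'a)"
      by (rule AE_lborel_singleton)
    then show "AE y in lborel. (\<integral>\<^sup>+r. indicator {0<..} r * ((if norm y \<le> r then ennreal (?N * r powr (- 1 - real ?N)) else 0) *
         (indicator (- {0}) y * F y * ennreal (norm y ^ ?N))) \<partial>lborel) = F y"
    proof eventually_elim
      case (elim y)
      have "(\<integral>\<^sup>+r. indicator {0<..} r * ((if norm y \<le> r then ennreal (?N * r powr (- 1 - real ?N)) else 0) *
         (indicator (- {0}) y * F y * ennreal (norm y ^ ?N))) \<partial>lborel)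
       = (\<integral>\<^sup>+r. ((if norm y \<le> r then ennreal (?N * r powr (- 1 - real ?N)) else 0)) *
         (F y * ennreal (norm y ^ ?N)) \<partial>lborel)"
      proof -
        have "0 < r" if "norm y \<le> r" for r
          using elim that zero_less_norm_iff[of y] by linarith
        then show ?thesis by (intro nn_integral_cong) (auto simp: indicator_def)
      qed
      also have "\<dots> = ennreal (norm y powr - ?N) * (F y * ennreal (norm y ^ ?N))"
        by (subst nn_integral_multc) (use tail elim in auto)
      also have "\<dots> = F y * ennreal (norm y powr - ?N * norm y ^ ?N)"
        by (simp add: ennreal_mult'' mult_ac)
      also have "norm y powr - ?N * norm y ^ ?N = 1"
        using elim by (simp add: powr_realpow[symmetric] powr_add[symmetric])
      finally show ?case by simp
    qed
  qed
  finally show ?thesis ..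
qed

lemma nn_integral_radial:
  fixes F :: "real \<Rightarrow> ennreal"
  assumes [measurable]: "F \<in> borel_measurable borel"
  shows "(\<integral>\<^sup>+x. F (norm x) \<partial>(lborel :: 'a::euclidean_space measure)) =
    ennreal (DIM('a) * measure lborel (cball 0 1 :: 'a set)) *
      (\<integral>\<^sup>+r. indicator {0<..} r * (F r * ennreal (r ^ (DIM('a) - 1))) \<partial>lborel)"
proof -
  let ?I = "(\<integral>\<^sup>+r. indicator {0<..} r * (F r * ennreal (r ^ (DIM('a) - 1))) \<partial>lborel)"
  have "(\<integral>\<^sup>+x. F (norm x) \<partial>(lborel :: 'a measure)) =
    (\<integral>\<^sup>+(x::'a). indicator (cball 0 1 - {0}) x * (ennreal DIM('a) * ?I) \<partial>lborel)"
  proof (subst nn_integral_polar, measurable, rule nn_integral_cong)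
    fix x :: 'a
    have "(\<integral>\<^sup>+r. indicator {0<..} r * (F (norm ((r / norm x) *\<^sub>R x)) * ennreal (r ^ (DIM('a) - 1))) \<partial>lborel) = ?I" if "x \<noteq> 0"
      using that by (intro nn_integral_cong) (auto simp: indicator_def)
    then show "indicator (cball 0 1 - {0}) x * (ennreal DIM('a) *
      (\<integral>\<^sup>+r. indicator {0<..} r * (F (norm ((r / norm x) *\<^sub>R x)) * ennreal (r ^ (DIM('a) - 1))) \<partial>lborel)) =
      indicator (cball 0 1 - {0}) x * (ennreal DIM('a) * ?I)"
      by (cases "x = 0") auto
  qed
  also have "\<dots> = emeasure lborel (cball 0 1 - {0::'a}) * (ennreal DIM('a) * ?I)"
    by (subst nn_integral_multc) (auto intro!: borel_measurable_indicator)
  also have "emeasure lborel (cball 0 1 - {0::'a}) = ennreal (measure lborel (cball 0 1 :: 'a set))"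
    using emeasure_lborel_cball_finite[of "0::'a" 1]
    by (subst emeasure_Diff) (auto simp: emeasure_eq_ennreal_measure less_top)
  finally show ?thesis
    by (simp add: ennreal_mult' ennreal_mult mult_ac)
qed

lemma integral_lborel_reflect:
  fixes s :: "'n::finite \<Rightarrow> real" and f :: "real^'n \<Rightarrow> real"
  assumes s: "\<And>i. \<bar>s i\<bar> = 1" and [measurable]: "f \<in> borel_measurable borel"
  shows "(LINT x|lborel. f (\<chi> i. s i * x $ i)) = (LINT x|lborel. f x)"
proof -
  have [measurable]: "(\<lambda>x::real^'n. \<chi> i. s i * x $ i) \<in> borel_measurable borel"
    by (intro borel_measurable_continuous_onI continuous_intros)
  have "(LINT x|lborel. f x) = (LINT x|distr lborel borel (\<lambda>x::real^'n. \<chi> i. s i * x $ i). f x)"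
    by (simp add: lborel_distr_reflect s)
  then show ?thesis by (subst (asm) integral_distr) auto
qed

lemma integral_lborel_permute:
  fixes p :: "'n::finite \<Rightarrow> 'n" and f :: "real^'n \<Rightarrow> real"
  assumes p: "bij p" and [measurable]: "f \<in> borel_measurable borel"
  shows "(LINT x|lborel. f (\<chi> i. x $ p i)) = (LINT x|lborel. f x)"
proof -
  have [measurable]: "(\<lambda>x::real^'n. \<chi> i. x $ p i) \<in> borel_measurable borel"
    by (intro borel_measurable_continuous_onI continuous_intros)
  have "(LINT x|lborel. f x) = (LINT x|distr lborel borel (\<lambda>x::real^'n. \<chi> i. x $ p i). f x)"
    by (simp add: lborel_distr_permute p)
  then show ?thesis by (subst (asm) integral_distr) auto
qed

lemma borel_measurable_vec_nth [measurable]: "(\<lambda>x::'a::euclidean_space^'n::finite. x $ i) \<in> borel_measurable borel"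
  by (intro borel_measurable_continuous_onI continuous_intros)

lemma radial_second_moments:
  fixes w :: "real \<Rightarrow> real"
  assumes [measurable]: "w \<in> borel_measurable borel"
    and int: "integrable lborel (\<lambda>h::real^'n::finite. w (norm h) * (norm h)\<^sup>2)"
  shows "integrable lborel (\<lambda>h::real^'n. w (norm h) * (h $ i * h $ j))"
    and "(LINT h|lborel. w (norm h) * (h $ i * h $ j)) =
      (if i = j then (LINT h::real^'n|lborel. w (norm h) * (norm h)\<^sup>2) / CARD('n) else 0)"
proof -
  let ?f = "\<lambda>i j (h::real^'n). w (norm h) * (h $ i * h $ j)"
  have I: "integrable lborel (?f i j)" for i j
  proof (rule Bochner_Integration.integrable_bound[OF int])
    show "AE x in lborel. norm (?f i j x) \<le> norm (w (norm x) * (norm x)\<^sup>2)"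
      by (auto simp: abs_mult power2_eq_square intro!: mult_left_mono mult_mono component_le_norm_cart)
  qed measurable
  show "integrable lborel (?f i j)" by (rule I)
  have off: "integral\<^sup>L lborel (?f i j) = 0" if "i \<noteq> j"
  proof -
    define s where "s = (\<lambda>k. if k = i then -1 else 1 :: real)"
    have s: "\<bar>s k\<bar> = 1" for k by (simp add: s_def)
    have nrm: "norm (\<chi> k. s k * x $ k) = norm x" for x :: "real^'n"
      proof -
      have "(s k * x $ k)\<^sup>2 = (x $ k)\<^sup>2" for k by (simp add: s_def)
      then show ?thesis by (simp add: norm_vec_def L2_set_def)
    qed
    have "integral\<^sup>L lborel (?f i j) = (LINT x|lborel. ?f i j (\<chi> k. s k * x $ k))"
      by (rule integral_lborel_reflect[symmetric, where s=s]) (use s in auto)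
    also have "\<dots> = (LINT x|lborel. - ?f i j x)"
      using that unfolding nrm by (simp add: s_def)
    finally show ?thesis by simp
  qed
  have diag: "integral\<^sup>L lborel (?f i i) = integral\<^sup>L lborel (?f j j)" for i j
  proof -
    define p where "p = Transposition.transpose i j"
    have p: "bij p" by (simp add: p_def)
    have nrm: "norm (\<chi> k. x $ p k) = norm x" for x :: "real^'n"
      using sum.reindex_bij_betw[OF p, of "\<lambda>k. (x $ k)\<^sup>2"] by (simp add: norm_vec_def L2_set_def)
    have "integral\<^sup>L lborel (?f i i) = (LINT x|lborel. ?f i i (\<chi> k. x $ p k))"
      by (rule integral_lborel_permute[symmetric]) (use p in auto)
    also have "\<dots> = integral\<^sup>L lborel (?f j j)"
      unfolding nrm by (simp add: p_def)
    finally show ?thesis .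
  qed
  have "(LINT h::real^'n|lborel. w (norm h) * (norm h)\<^sup>2) = (LINT h|lborel. (\<Sum>k\<in>UNIV. ?f k k h))"
    by (simp add: norm_vec_def L2_set_def sum_nonneg sum_distrib_left power2_eq_square)
  also have "\<dots> = (\<Sum>k\<in>UNIV. integral\<^sup>L lborel (?f k k))"
    by (rule Bochner_Integration.integral_sum) (rule I)
  also have "\<dots> = (\<Sum>k\<in>(UNIV::'n set). integral\<^sup>L lborel (?f i i))"
    by (rule sum.cong) (use diag in auto)
  finally show "integral\<^sup>L lborel (?f i j) = (if i = j then (LINT h::real^'n|lborel. w (norm h) * (norm h)\<^sup>2) / CARD('n) else 0)"
    using off by auto
qed

text \<open>Bilinear, without conjugation: \<open>cdot h (G x)\<close> is the derivative of \<open>u\<close> in the real direction \<open>h\<close> if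
  \<open>G\<close> is the complex gradient of \<open>u\<close>.\<close>

definition cdot :: "real ^ 'n::finite \<Rightarrow> complex ^ 'n \<Rightarrow> complex" where
  "cdot h G = (\<Sum>j\<in>UNIV. complex_of_real (h $ j) * G $ j)"

lemma cdot_measurable [measurable]:
  assumes "f \<in> borel_measurable M" "g \<in> borel_measurable M"
  shows "(\<lambda>x. cdot (f x) (g x)) \<in> borel_measurable M"
proof -
  have 1: "(\<lambda>x. f x $ j) \<in> borel_measurable M" "(\<lambda>x. g x $ j) \<in> borel_measurable M" for j
    using assms by (auto intro: measurable_compose[OF _ borel_measurable_vec_nth])
  then show ?thesis unfolding cdot_def
    by (intro borel_measurable_sum borel_measurable_times measurable_compose[OF 1(1) borel_measurable_of_real] 1)
qed

lemma norm_cdot_le: "norm (cdot h G) \<le> norm h * norm G"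
proof -
  have "norm (cdot h G) \<le> (\<Sum>j\<in>UNIV. \<bar>h $ j\<bar> * \<bar>norm (G $ j)\<bar>)"
    unfolding cdot_def by (rule order_trans[OF norm_sum]) (simp add: norm_mult)
  also have "\<dots> \<le> L2_set (\<lambda>j. h $ j) UNIV * L2_set (\<lambda>j. norm (G $ j)) UNIV"
    by (rule L2_set_mult_ineq)
  finally show ?thesis by (simp add: norm_vec_def L2_set_def)
qed

lemma cdot_scaleR: "cdot (c *\<^sub>R h) G = complex_of_real c * cdot h G"
  by (simp add: cdot_def sum_distrib_left mult_ac)

lemma cdot_diff: "cdot h (a - b) = cdot h a - cdot h b"
  by (simp add: cdot_def sum_subtractf algebra_simps)

definition ball_vol :: "'n::finite itself \<Rightarrow> real" where
  "ball_vol _ = measure lborel (cball 0 1 :: (real ^ 'n) set)"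

lemma ball_vol_pos: "ball_vol TYPE('n::finite) > 0"
  by (simp add: ball_vol_def content_cball unit_ball_vol_pos)

text \<open>The function is quadratic in \<open>a\<close> with a radial weight, so the second moments of the weight decide;
  summing the diagonal ones gives the volume of the ball.\<close>

lemma ball_moment:
  fixes a :: "real ^ 'n::finite"
  shows "(\<integral>\<^sup>+x. indicator (cball 0 1 - {0}) x * ennreal ((a \<bullet> x)\<^sup>2 / (norm x)\<^sup>2) \<partial>lborel) =
    ennreal ((norm a)\<^sup>2 * ball_vol TYPE('n) / CARD('n))"
proof -
  define w where "w = (\<lambda>r::real. indicator {0<..1} r / r\<^sup>2)"
  have [measurable]: "w \<in> borel_measurable borel" unfolding w_def by measurable
  have w2: "w (norm h) * (norm h)\<^sup>2 = indicator (cball 0 1 - {0}) h" for h :: "real^'n"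
    by (auto simp: w_def indicator_def)
  have fin: "emeasure lborel (cball 0 1 - {0::real^'n}) < \<infinity>"
    by (rule order.strict_trans1[OF emeasure_mono emeasure_lborel_cball_finite[of 0 1]]) auto
  have int: "integrable lborel (\<lambda>h::real^'n. w (norm h) * (norm h)\<^sup>2)"
    unfolding w2 by (rule integrable_real_indicator) (use fin in auto)
  have M: "(LINT h::real^'n|lborel. w (norm h) * (norm h)\<^sup>2) = ball_vol TYPE('n)"
  proof -
    have "measure lborel (cball 0 1 - {0::real^'n}) = ball_vol TYPE('n)"
      unfolding ball_vol_def using emeasure_lborel_cball_finite[of "0::real^'n" 1]
      by (subst measure_Diff) (auto simp: less_top)
    then show ?thesis unfolding w2 by simp
  qed
  have sq: "w (norm x) * (a \<bullet> x)\<^sup>2 = (\<Sum>i\<in>UNIV. \<Sum>j\<in>UNIV. a $ i * a $ j * (w (norm x) * (x $ i * x $ j)))" for x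
    by (simp add: inner_vec_def power2_eq_square sum_product sum_distrib_left mult_ac)
  have "(\<integral>\<^sup>+x. indicator (cball 0 1 - {0}) x * ennreal ((a \<bullet> x)\<^sup>2 / (norm x)\<^sup>2) \<partial>lborel) =
     (\<integral>\<^sup>+x. ennreal (w (norm x) * (a \<bullet> x)\<^sup>2) \<partial>lborel)"
    by (intro nn_integral_cong) (auto simp: w_def indicator_def)
  also have "\<dots> = ennreal (LINT x|lborel. w (norm x) * (a \<bullet> x)\<^sup>2)"
  proof (rule nn_integral_eq_integral)
    show "integrable lborel (\<lambda>x. w (norm x) * (a \<bullet> x)\<^sup>2)"
      unfolding sq by (intro Bochner_Integration.integrable_sum integrable_mult_right radial_second_moments(1)[OF _ int]) auto
  qed (auto simp: w_def)
  also have "(LINT x|lborel. w (norm x) * (a \<bullet> x)\<^sup>2) =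
    (\<Sum>i\<in>UNIV. \<Sum>j\<in>UNIV. a $ i * a $ j * (LINT x|lborel. w (norm x) * (x $ i * x $ j)))"
    unfolding sq
    by (subst Bochner_Integration.integral_sum Bochner_Integration.integrable_sum |
        intro Bochner_Integration.integrable_sum integrable_mult_right radial_second_moments(1)[OF _ int] sum.cong refl | simp)+
  also have "\<dots> = (\<Sum>i\<in>UNIV. \<Sum>j\<in>UNIV. a $ i * a $ j * (if i = j then ball_vol TYPE('n) / CARD('n) else 0))"
    by (subst radial_second_moments(2)[OF _ int]) (auto simp: M cong: if_cong)
  also have "\<dots> = (norm a)\<^sup>2 * ball_vol TYPE('n) / CARD('n)"
    by (simp add: if_distrib norm_vec_def L2_set_def sum_nonneg power2_eq_square sum_distrib_right sum_divide_distrib cong: if_cong)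
  finally show ?thesis .
qed

lemma Q_eq:
  fixes \<omega> :: "real ^ 'n::finite"
  assumes "norm \<omega> = 1"
  shows "Q \<omega> = ball_vol TYPE('n) / 2"
proof -
  let ?B = "cball 0 1 - {0} :: (real^'n) set"
  have [measurable]: "(\<lambda>x::real^'n. x /\<^sub>R norm x) \<in> borel_measurable borel" by measurable
  have B[measurable]: "?B \<in> sets lborel" by auto
  have [measurable]: "sphere 0 1 \<in> sets (borel :: (real^'n) measure)" by (simp add: borel_closed)
  have sm: "sets (sphere_measure :: (real^'n) measure) = sets borel"
    by (simp add: sphere_measure_def)
  have "(LINT \<sigma>:sphere 0 1|sphere_measure. \<bar>\<omega> \<bullet> \<sigma>\<bar>\<^sup>2) =
     enn2real (\<integral>\<^sup>+\<sigma>. ennreal (indicator (sphere 0 1) \<sigma> * \<bar>\<omega> \<bullet> \<sigma>\<bar>\<^sup>2) \<partial>sphere_measure)"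
    unfolding set_lebesgue_integral_def
    by (subst integral_eq_nn_integral) (auto simp: measurable_cong_sets[OF sm refl])
  also have "(\<integral>\<^sup>+\<sigma>. ennreal (indicator (sphere 0 1) \<sigma> * \<bar>\<omega> \<bullet> \<sigma>\<bar>\<^sup>2) \<partial>sphere_measure) =
     of_nat CARD('n) * (\<integral>\<^sup>+x. ennreal (indicator (sphere 0 1) (x /\<^sub>R norm x) * \<bar>\<omega> \<bullet> (x /\<^sub>R norm x)\<bar>\<^sup>2) \<partial>restrict_space lborel ?B)"
    unfolding sphere_measure_def
    apply (subst nn_integral_scale_measure)
     apply measurable
    apply (subst nn_integral_distr)
      apply (rule measurable_restrict_space1)
      apply measurable
    done
  also have "(\<integral>\<^sup>+x. ennreal (indicator (sphere 0 1) (x /\<^sub>R norm x) * \<bar>\<omega> \<bullet> (x /\<^sub>R norm x)\<bar>\<^sup>2) \<partial>restrict_space lborel ?B)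
    = (\<integral>\<^sup>+x. indicator ?B x * ennreal ((\<omega> \<bullet> x)\<^sup>2 / (norm x)\<^sup>2) \<partial>lborel)"
    apply (subst nn_integral_restrict_space)
     apply simp
    apply (rule nn_integral_cong)
    apply (auto simp: indicator_def power_divide divide_inverse power_mult_distrib power_inverse mult_ac)
    done
  also have "\<dots> = ennreal (ball_vol TYPE('n) / CARD('n))"
    by (subst ball_moment) (simp add: assms)
  also have "of_nat CARD('n) * \<dots> = ennreal (ball_vol TYPE('n))"
    by (simp add: ennreal_of_nat_eq_real_of_nat flip: ennreal_mult')
  finally show ?thesis
    using ball_vol_pos[where 'n='n] by (simp add: Q_def)
qed

lemma norm_cdot_sq: "(norm (cdot x G))\<^sup>2 = ((\<chi> j. Re (G $ j)) \<bullet> x)\<^sup>2 + ((\<chi> j. Im (G $ j)) \<bullet> x)\<^sup>2"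
  by (simp add: cdot_def cmod_power2 inner_vec_def mult_ac)

lemma norm_sq_Re_Im: "(norm (G :: complex^'n::finite))\<^sup>2 = (norm (\<chi> j. Re (G $ j)))\<^sup>2 + (norm (\<chi> j. Im (G $ j)))\<^sup>2"
  by (simp add: norm_vec_def L2_set_def sum_nonneg cmod_power2 sum.distrib)

text \<open>For fixed direction \<open>\<sigma>\<close> the radial integral of \<open>1 / r ^ 3\<close> over \<open>r * norm (cdot \<sigma> G) > 1\<close> is
  \<open>(norm (cdot \<sigma> G))\<^sup>2 / 2\<close>; this is where the square of the gradient in the limit comes from.\<close>

lemma nn_integral_superlevel:
  fixes G :: "complex ^ 'n::finite"
  shows "(\<integral>\<^sup>+k. indicator {k. norm (cdot k G) > 1} k * ennreal (1 / norm k ^ (CARD('n) + 2)) \<partial>lborel) =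
    ennreal (ball_vol TYPE('n) / 2 * (norm G)\<^sup>2)"
proof -
  let ?N = "CARD('n)"
  define s where "s = (\<lambda>x. norm (cdot x G))"
  have [measurable]: "(indicator (cball 0 1 - {0}) :: real^'n \<Rightarrow> ennreal) \<in> borel_measurable borel"
    by (rule borel_measurable_indicator) auto
  have [measurable]: "s \<in> borel_measurable borel" unfolding s_def by measurable
  have s_scale: "s (c *\<^sub>R x) = \<bar>c\<bar> * s x" for c x by (simp add: s_def cdot_scaleR norm_mult)
  have s0: "s x \<ge> 0" for x by (simp add: s_def)
  have inner: "(\<integral>\<^sup>+r. indicator {0<..} r * (indicator {k. s k > 1} ((r / norm x) *\<^sub>R x) *
        ennreal (1 / norm ((r / norm x) *\<^sub>R x) ^ (?N + 2)) * ennreal (r ^ (?N - 1))) \<partial>lborel) =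
     ennreal ((s x)\<^sup>2 / (norm x)\<^sup>2 / 2)" if x: "x \<noteq> 0" for x
  proof (cases "s x = 0")
    case True
    then show ?thesis by (simp add: s_scale)
  next
    case False
    then have sx: "s x > 0" using s0[of x] by simp
    have nx: "norm x > 0" using x by simp
    define t where "t = norm x / s x"
    have t: "t > 0" using sx nx by (simp add: t_def)
    have Np: "?N > 0" by simp
    have pw: "1 / r ^ (?N + 2) * r ^ (?N - 1) = 1 / r ^ 3" if "r > 0" for r :: real
    proof -
      obtain m where "?N = Suc m" using Np gr0_conv_Suc by blast
      then show ?thesis using that by (simp add: field_simps power_add eval_nat_numeral)
    qed
    have "(\<integral>\<^sup>+r. indicator {0<..} r * (indicator {k. s k > 1} ((r / norm x) *\<^sub>R x) *
        ennreal (1 / norm ((r / norm x) *\<^sub>R x) ^ (?N + 2)) * ennreal (r ^ (?N - 1))) \<partial>lborel) =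
      (\<integral>\<^sup>+r. ennreal (1 / r ^ 3) * indicator {t..} r \<partial>lborel)"
    proof (rule nn_integral_cong_AE)
      have "AE r in lborel. r \<noteq> t" by (rule AE_lborel_singleton)
      then show "AE r in lborel. indicator {0<..} r * (indicator {k. s k > 1} ((r / norm x) *\<^sub>R x) *
        ennreal (1 / norm ((r / norm x) *\<^sub>R x) ^ (?N + 2)) * ennreal (r ^ (?N - 1))) =
        ennreal (1 / r ^ 3) * indicator {t..} r"
      proof eventually_elim
        case (elim r)
        show ?case
        proof (cases "r > 0")
          case True
          have "s ((r / norm x) *\<^sub>R x) > 1 \<longleftrightarrow> r > t"
            using True nx sx by (simp add: s_scale t_def field_simps)
          moreover have "norm ((r / norm x) *\<^sub>R x) = r" using True nx by simp
          moreover have "ennreal (1 / r ^ (?N + 2)) * ennreal (r ^ (?N - 1)) = ennreal (1 / r ^ 3)"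
            using pw[OF True] True by (subst ennreal_mult[symmetric]) auto
          ultimately show ?thesis using True elim by (auto simp: indicator_def)
        next
          case False
          then show ?thesis using t by (auto simp: indicator_def)
        qed
      qed
    qed
    also have "\<dots> = ennreal (0 - (- (1 / (2 * t\<^sup>2))))"
    proof (rule nn_integral_FTC_atLeast)
      have "filterlim (\<lambda>r::real. 2 * r\<^sup>2) at_top at_top"
        by (intro filterlim_tendsto_pos_mult_at_top[OF tendsto_const] filterlim_pow_at_top filterlim_ident) auto
      then show "((\<lambda>r::real. - (1 / (2 * r\<^sup>2))) \<longlongrightarrow> 0) at_top"
        using tendsto_minus[OF tendsto_divide_0[OF tendsto_const[of 1] filterlim_at_top_imp_at_infinity]] by simp
      fix r assume "t \<le> r"
      then have "r > 0" using t by simp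
      then show "((\<lambda>r. - (1 / (2 * r\<^sup>2))) has_real_derivative 1 / r ^ 3) (at r)"
        by (auto intro!: derivative_eq_intros simp: field_simps eval_nat_numeral)
      show "0 \<le> 1 / r ^ 3" using \<open>r > 0\<close> by simp
    qed simp
    also have "0 - (- (1 / (2 * t\<^sup>2))) = (s x)\<^sup>2 / (norm x)\<^sup>2 / 2"
      using sx nx by (simp add: t_def power_divide)
    finally show ?thesis .
  qed
  have "(\<integral>\<^sup>+k. indicator {k. s k > 1} k * ennreal (1 / norm k ^ (?N + 2)) \<partial>lborel) =
     (\<integral>\<^sup>+x. indicator (cball 0 1 - {0}) x * (ennreal ?N * ennreal ((s x)\<^sup>2 / (norm x)\<^sup>2 / 2)) \<partial>lborel)"
  proof (subst nn_integral_polar, measurable, rule nn_integral_cong)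
    fix x :: "real^'n"
    show "indicator (cball 0 1 - {0}) x * (ennreal DIM(real^'n) *
      (\<integral>\<^sup>+r. indicator {0<..} r * (indicator {k. s k > 1} ((r / norm x) *\<^sub>R x) *
        ennreal (1 / norm ((r / norm x) *\<^sub>R x) ^ (?N + 2)) * ennreal (r ^ (DIM(real^'n) - 1))) \<partial>lborel)) =
      indicator (cball 0 1 - {0}) x * (ennreal ?N * ennreal ((s x)\<^sup>2 / (norm x)\<^sup>2 / 2))"
      using inner[of x] by (cases "x = 0") auto
  qed
  also have "\<dots> = (\<integral>\<^sup>+x. ennreal (?N / 2) * (indicator (cball 0 1 - {0}) x * ennreal (((\<chi> j. Re (G $ j)) \<bullet> x)\<^sup>2 / (norm x)\<^sup>2)
      + indicator (cball 0 1 - {0}) x * ennreal (((\<chi> j. Im (G $ j)) \<bullet> x)\<^sup>2 / (norm x)\<^sup>2)) \<partial>lborel)" (is "nn_integral _ ?a1 = nn_integral _ ?b1")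
  proof (rule nn_integral_cong)
    fix x :: "real^'n"
    have "ennreal ?N * ennreal ((s x)\<^sup>2 / (norm x)\<^sup>2 / 2) = ennreal (?N / 2 * (((\<chi> j. Re (G $ j)) \<bullet> x)\<^sup>2 / (norm x)\<^sup>2 + ((\<chi> j. Im (G $ j)) \<bullet> x)\<^sup>2 / (norm x)\<^sup>2))"
      by (subst ennreal_mult'[symmetric]) (simp_all add: s_def norm_cdot_sq add_divide_distrib algebra_simps)
    also have "\<dots> = ennreal (?N / 2) * (ennreal (((\<chi> j. Re (G $ j)) \<bullet> x)\<^sup>2 / (norm x)\<^sup>2) + ennreal (((\<chi> j. Im (G $ j)) \<bullet> x)\<^sup>2 / (norm x)\<^sup>2))"
      by (subst ennreal_mult) (auto simp: ennreal_plus)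
    finally show "?a1 x = ?b1 x"
      by (auto simp: indicator_def)
  qed
  also have "\<dots> = ennreal (?N / 2) * (ennreal ((norm (\<chi> j. Re (G $ j)))\<^sup>2 * ball_vol TYPE('n) / ?N) + ennreal ((norm (\<chi> j. Im (G $ j)))\<^sup>2 * ball_vol TYPE('n) / ?N))"
    by (subst nn_integral_cmult, measurable, subst nn_integral_add) (measurable, simp add: ball_moment)
  also have "\<dots> = ennreal (?N / 2 * ((norm (\<chi> j. Re (G $ j)))\<^sup>2 * ball_vol TYPE('n) / ?N + (norm (\<chi> j. Im (G $ j)))\<^sup>2 * ball_vol TYPE('n) / ?N))"
    using ball_vol_pos[where 'n='n] by (subst ennreal_mult) (auto simp: ennreal_plus)
  also have "?N / 2 * ((norm (\<chi> j. Re (G $ j)))\<^sup>2 * ball_vol TYPE('n) / ?N + (norm (\<chi> j. Im (G $ j)))\<^sup>2 * ball_vol TYPE('n) / ?N)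
    = ball_vol TYPE('n) / 2 * (norm G)\<^sup>2"
    by (simp add: norm_sq_Re_Im[of G] field_simps)
  finally show ?thesis unfolding s_def .
qed

lemma nn_integral_norm_tail:
  assumes r: "r > 0" and p: "p > 0"
  shows "(\<integral>\<^sup>+h. indicator {h. norm h > r} h * ennreal (1 / norm h ^ (CARD('n) + p)) \<partial>(lborel :: (real^'n::finite) measure)) =
    ennreal (CARD('n) * ball_vol TYPE('n) / (p * r ^ p))"
proof -
  let ?N = "CARD('n)"
  have "(\<integral>\<^sup>+h. indicator {h. norm h > r} h * ennreal (1 / norm h ^ (?N + p)) \<partial>(lborel :: (real^'n) measure)) =
    (\<integral>\<^sup>+h. (indicator {r<..} (norm h) * ennreal (1 / norm h ^ (?N + p))) \<partial>(lborel :: (real^'n) measure))"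
    by (intro nn_integral_cong) (auto simp: indicator_def)
  also have "\<dots> = ennreal (?N * ball_vol TYPE('n)) * (\<integral>\<^sup>+t. indicator {0<..} t * ((indicator {r<..} t * ennreal (1 / t ^ (?N + p))) * ennreal (t ^ (?N - 1))) \<partial>lborel)"
    by (subst nn_integral_radial) (auto simp: ball_vol_def)
  also have "(\<integral>\<^sup>+t. indicator {0<..} t * ((indicator {r<..} t * ennreal (1 / t ^ (?N + p))) * ennreal (t ^ (?N - 1))) \<partial>lborel) =
     (\<integral>\<^sup>+t. ennreal (1 / t ^ (p + 1)) * indicator {r..} t \<partial>lborel)"
  proof (rule nn_integral_cong_AE)
    have "AE t in lborel. t \<noteq> r" by (rule AE_lborel_singleton)
    then show "AE t in lborel. indicator {0<..} t * ((indicator {r<..} t * ennreal (1 / t ^ (?N + p))) * ennreal (t ^ (?N - 1))) =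
       ennreal (1 / t ^ (p + 1)) * indicator {r..} t"
    proof eventually_elim
      case (elim t)
      have "1 / t ^ (?N + p) * t ^ (?N - 1) = 1 / t ^ (p + 1)" if "t > 0"
      proof -
        obtain m where "?N = Suc m" using gr0_conv_Suc[of ?N] by auto
        then show ?thesis using that by (simp add: field_simps power_add)
      qed
      then have "ennreal (1 / t ^ (?N + p)) * ennreal (t ^ (?N - 1)) = ennreal (1 / t ^ (p + 1))" if "t > 0"
        using that by (subst ennreal_mult[symmetric]) auto
      then show ?case using elim r by (auto simp: indicator_def)
    qed
  qed
  also have "\<dots> = ennreal (0 - (- (1 / (p * r ^ p))))"
  proof (rule nn_integral_FTC_atLeast)
    have "filterlim (\<lambda>t::real. t ^ p) at_top at_top"
      using p by (rule filterlim_pow_at_top) (rule filterlim_ident)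
    then have "filterlim (\<lambda>t::real. p * t ^ p) at_top at_top"
      using p by (intro filterlim_tendsto_pos_mult_at_top[OF tendsto_const]) auto
    then show "((\<lambda>t::real. - (1 / (p * t ^ p))) \<longlongrightarrow> 0) at_top"
      using tendsto_minus[OF tendsto_divide_0[OF tendsto_const[of 1] filterlim_at_top_imp_at_infinity]] by simp
    fix t assume "r \<le> t"
    then have t: "t > 0" using r by simp
    have e: "t ^ p * t ^ p = t ^ (p - 1) * t ^ (p + 1)"
      using p by (cases p) simp_all
    show "((\<lambda>t::real. - (1 / (p * t ^ p))) has_real_derivative 1 / t ^ (p + 1)) (at t)"
      using t p e by (auto intro!: derivative_eq_intros simp: field_simps)
    show "0 \<le> 1 / t ^ (p + 1)" using t by simp
  qed simp
  finally show ?thesis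
    using r ball_vol_pos[where 'n='n] by (simp add: ennreal_mult[symmetric])
qed

lemma nn_integral_norm_annulus_log:
  assumes r: "0 < r" "r < 1"
  shows "(\<integral>\<^sup>+h. indicator {h. r < norm h \<and> norm h < 1} h * ennreal (1 / norm h ^ CARD('n)) \<partial>(lborel :: (real^'n::finite) measure)) =
    ennreal (CARD('n) * ball_vol TYPE('n) * ln (1 / r))"
proof -
  let ?N = "CARD('n)"
  have "(\<integral>\<^sup>+h. indicator {h. r < norm h \<and> norm h < 1} h * ennreal (1 / norm h ^ ?N) \<partial>(lborel :: (real^'n) measure)) =
    (\<integral>\<^sup>+h. (indicator {r<..<1} (norm h) * ennreal (1 / norm h ^ ?N)) \<partial>(lborel :: (real^'n) measure))"
    by (intro nn_integral_cong) (auto simp: indicator_def)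
  also have "\<dots> = ennreal (?N * ball_vol TYPE('n)) * (\<integral>\<^sup>+t. indicator {0<..} t * ((indicator {r<..<1} t * ennreal (1 / t ^ ?N)) * ennreal (t ^ (?N - 1))) \<partial>lborel)"
    by (subst nn_integral_radial) (auto simp: ball_vol_def)
  also have "(\<integral>\<^sup>+t. indicator {0<..} t * ((indicator {r<..<1} t * ennreal (1 / t ^ ?N)) * ennreal (t ^ (?N - 1))) \<partial>lborel) =
     (\<integral>\<^sup>+t. ennreal (1 / t) * indicator {r..1} t \<partial>lborel)"
  proof (rule nn_integral_cong_AE)
    have "AE t in lborel. t \<noteq> r" "AE t in lborel. t \<noteq> (1::real)" by (rule AE_lborel_singleton)+
    then show "AE t in lborel. indicator {0<..} t * ((indicator {r<..<1} t * ennreal (1 / t ^ ?N)) * ennreal (t ^ (?N - 1))) =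
       ennreal (1 / t) * indicator {r..1} t"
    proof eventually_elim
      case (elim t)
      have "1 / t ^ ?N * t ^ (?N - 1) = 1 / t" if "t > 0"
      proof -
        obtain m where "?N = Suc m" using gr0_conv_Suc[of ?N] by auto
        then show ?thesis using that by (simp add: field_simps power_add)
      qed
      then have "ennreal (1 / t ^ ?N) * ennreal (t ^ (?N - 1)) = ennreal (1 / t)" if "t > 0"
        using that by (subst ennreal_mult[symmetric]) auto
      then show ?case using elim r by (auto simp: indicator_def)
    qed
  qed
  also have "\<dots> = ennreal (ln 1 - ln r)"
    using r by (intro nn_integral_FTC_Icc) (auto intro!: derivative_eq_intros)
  finally show ?thesis
    using r ball_vol_pos[where 'n='n] by (simp add: ennreal_mult[symmetric] ln_div)
qed

section \<open>Test functions\<close>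

lemma indicator_cball_measurable [measurable]:
  "(indicator (cball a r) :: 'a::euclidean_space \<Rightarrow> real) \<in> borel_measurable borel"
  "(indicator (cball a r) :: 'a \<Rightarrow> ennreal) \<in> borel_measurable borel"
  by (rule borel_measurable_indicator, simp)+

lemma iter_pderiv_append: "iter_pderiv (js @ [j]) \<phi> = iter_pderiv js (pderiv_at j \<phi>)"
  by (induction js) auto

lemma smooth_fun_pderiv: "smooth_fun \<phi> \<Longrightarrow> smooth_fun (pderiv_at j \<phi>)"
  unfolding smooth_fun_def by (metis iter_pderiv_append)

lemma smooth_fun_differentiable: "smooth_fun \<phi> \<Longrightarrow> \<phi> differentiable (at x)"
  unfolding smooth_fun_def by (metis iter_pderiv.simps(1))

text \<open>Smoothness is a greatest fixed point: a class of differentiable functions that is closed under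
  partial derivatives consists of smooth functions.\<close>

lemma smooth_fun_coinduct:
  assumes "\<phi> \<in> T" and "\<And>f x. f \<in> T \<Longrightarrow> f differentiable (at x)"
    and cl: "\<And>f j. f \<in> T \<Longrightarrow> pderiv_at j f \<in> T"
  shows "smooth_fun \<phi>"
proof -
  have "iter_pderiv js f \<in> T" if "f \<in> T" for js f
    using that by (induction js) (auto intro: cl)
  then show ?thesis unfolding smooth_fun_def using assms by blast
qed

lemma pderiv_at_eqI: "(f has_derivative f') (at x) \<Longrightarrow> pderiv_at j f x = f' (axis j 1)"
  unfolding pderiv_at_def using frechet_derivative_at[of f f' x] by simp

lemma linear_axis_expansion:
  fixes f :: "real ^ 'n::finite \<Rightarrow> 'b::real_vector"
  assumes "linear f"
  shows "f h = (\<Sum>j\<in>UNIV. (h $ j) *\<^sub>R f (axis j 1))"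
proof -
  have "h = (\<Sum>j\<in>UNIV. (h $ j) *\<^sub>R axis j 1)"
    using basis_expansion[of h] by (simp add: scalar_mult_eq_scaleR)
  then have "f h = f (\<Sum>j\<in>UNIV. (h $ j) *\<^sub>R axis j 1)" by simp
  also have "\<dots> = (\<Sum>j\<in>UNIV. (h $ j) *\<^sub>R f (axis j 1))"
    using assms by (simp add: linear_sum linear_scale)
  finally show ?thesis .
qed

lemma smooth_has_derivative:
  assumes "smooth_fun \<phi>"
  shows "(\<phi> has_derivative (\<lambda>h. \<Sum>j\<in>UNIV. h $ j * pderiv_at j \<phi> x)) (at x)"
proof -
  have d: "(\<phi> has_derivative frechet_derivative \<phi> (at x)) (at x)"
    using smooth_fun_differentiable[OF assms] frechet_derivative_works by blast
  have "frechet_derivative \<phi> (at x) = (\<lambda>h. \<Sum>j\<in>UNIV. h $ j * pderiv_at j \<phi> x)"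
  proof
    fix h
    show "frechet_derivative \<phi> (at x) h = (\<Sum>j\<in>UNIV. h $ j * pderiv_at j \<phi> x)"
      unfolding pderiv_at_def real_scaleR_def[symmetric]
      by (rule linear_axis_expansion[OF has_derivative_linear[OF d]])
  qed
  with d show ?thesis by simp
qed

lemma smooth_fun_continuous: "smooth_fun \<phi> \<Longrightarrow> continuous_on S \<phi>"
  by (meson continuous_at_imp_continuous_on differentiable_imp_continuous_within smooth_fun_differentiable)

lemma smooth_fun_measurable: "smooth_fun \<phi> \<Longrightarrow> \<phi> \<in> borel_measurable borel"
  by (simp add: borel_measurable_continuous_onI smooth_fun_continuous)

lemma smooth_fun_const: "smooth_fun (\<lambda>_. c)"
proof (rule smooth_fun_coinduct[where T="range (\<lambda>c _. c)"])
  fix f :: "real^'n \<Rightarrow> real" and j assume "f \<in> range (\<lambda>c _. c)"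
  then obtain c where f: "f = (\<lambda>_. c)" by auto
  have "pderiv_at j f = (\<lambda>_. 0)"
    unfolding f by (rule ext, subst pderiv_at_eqI[OF has_derivative_const]) simp
  then show "pderiv_at j f \<in> range (\<lambda>c _. c)" by blast
qed auto

text \<open>The partial derivatives of a product of two smooth functions are sums of such products, so products
  alone do not form a class closed under differentiation, but the sums that they generate do.\<close>

inductive_set smooth_alg :: "(real ^ 'n::finite \<Rightarrow> real) set" where
  mult: "smooth_fun f \<Longrightarrow> smooth_fun g \<Longrightarrow> (\<lambda>x. f x * g x) \<in> smooth_alg"
| add: "f \<in> smooth_alg \<Longrightarrow> g \<in> smooth_alg \<Longrightarrow> (\<lambda>x. f x + g x) \<in> smooth_alg"

lemma pderiv_at_mult:
  assumes "f differentiable (at x)" "g differentiable (at x)"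
  shows "pderiv_at j (\<lambda>x. f x * g x) x = pderiv_at j f x * g x + f x * pderiv_at j g x"
proof -
  have "((\<lambda>x. f x * g x) has_derivative (\<lambda>h. f x * frechet_derivative g (at x) h + frechet_derivative f (at x) h * g x)) (at x)"
    using assms by (intro has_derivative_mult) (simp_all add: frechet_derivative_works)
  from pderiv_at_eqI[OF this] show ?thesis by (simp add: pderiv_at_def)
qed

lemma pderiv_at_add:
  assumes "f differentiable (at x)" "g differentiable (at x)"
  shows "pderiv_at j (\<lambda>x. f x + g x) x = pderiv_at j f x + pderiv_at j g x"
proof -
  have "((\<lambda>x. f x + g x) has_derivative (\<lambda>h. frechet_derivative f (at x) h + frechet_derivative g (at x) h)) (at x)"
    using assms by (intro has_derivative_add) (simp_all add: frechet_derivative_works)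
  from pderiv_at_eqI[OF this] show ?thesis by (simp add: pderiv_at_def)
qed

lemma smooth_alg_smooth:
  assumes "f \<in> smooth_alg"
  shows "smooth_fun f"
proof -
  have d: "f differentiable (at x)" if "f \<in> smooth_alg" for f x
    using that by induction (auto simp: smooth_fun_differentiable intro!: differentiable_mult differentiable_add)
  have p: "pderiv_at j f \<in> smooth_alg" if "f \<in> smooth_alg" for f j
    using that
  proof induction
    case (mult f g)
    have "pderiv_at j (\<lambda>x. f x * g x) = (\<lambda>x. pderiv_at j f x * g x + f x * pderiv_at j g x)"
      using mult by (intro ext pderiv_at_mult smooth_fun_differentiable)
    then show ?case using mult by (auto intro!: smooth_alg.intros smooth_fun_pderiv)
  next
    case (add f g)
    have "pderiv_at j (\<lambda>x. f x + g x) = (\<lambda>x. pderiv_at j f x + pderiv_at j g x)"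
      using add by (intro ext pderiv_at_add d)
    then show ?case using add by (auto intro!: smooth_alg.intros)
  qed
  show ?thesis by (rule smooth_fun_coinduct[OF assms d p])
qed

lemma smooth_fun_mult: "smooth_fun f \<Longrightarrow> smooth_fun g \<Longrightarrow> smooth_fun (\<lambda>x. f x * g x)"
  by (rule smooth_alg_smooth) (rule smooth_alg.mult)

lemma smooth_fun_add:
  assumes "smooth_fun f" "smooth_fun g"
  shows "smooth_fun (\<lambda>x. f x + g x)"
proof -
  have "(\<lambda>x. f x * 1 + g x * 1) \<in> smooth_alg"
    using assms by (intro smooth_alg.intros smooth_fun_const)
  from smooth_alg_smooth[OF this] show ?thesis by simp
qed

lemma smooth_fun_prod:
  assumes "finite I" "\<And>i. i \<in> I \<Longrightarrow> smooth_fun (f i)"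
  shows "smooth_fun (\<lambda>x. \<Prod>i\<in>I. f i x)"
  using assms by (induction I rule: finite_induct) (auto intro: smooth_fun_mult smooth_fun_const)

lemma pderiv_at_translate:
  assumes "f differentiable (at (x + c))"
  shows "pderiv_at j (\<lambda>x. f (x + c)) x = pderiv_at j f (x + c)"
proof -
  have "((\<lambda>x. f (x + c)) has_derivative frechet_derivative f (at (x + c))) (at x)"
    using has_derivative_compose[of "\<lambda>x. x + c" "\<lambda>x. x" x UNIV f "frechet_derivative f (at (x + c))"] assms
    by (simp add: frechet_derivative_works has_derivative_add_const)
  from pderiv_at_eqI[OF this] show ?thesis by (simp add: pderiv_at_def)
qed

lemma smooth_fun_translate:
  assumes "smooth_fun f"
  shows "smooth_fun (\<lambda>x. f (x + c))"
proof (rule smooth_fun_coinduct[where T="{(\<lambda>x. f (x + c)) |f. smooth_fun f}"])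
  show "(\<lambda>x. f (x + c)) \<in> {(\<lambda>x. f (x + c)) |f. smooth_fun f}" using assms by auto
next
  fix g x assume "g \<in> {(\<lambda>x. f (x + c)) |f. smooth_fun f}"
  then obtain f where f: "g = (\<lambda>x. f (x + c))" "smooth_fun f" by auto
  show "g differentiable (at x)"
    unfolding f(1)
    by (rule differentiable_compose[of f "\<lambda>x. x + c"]) (use smooth_fun_differentiable[OF f(2)] in auto)
next
  fix g j assume "g \<in> {(\<lambda>x. f (x + c)) |f. smooth_fun f}"
  then obtain f where f: "g = (\<lambda>x. f (x + c))" "smooth_fun f" by auto
  then have "pderiv_at j g = (\<lambda>x. pderiv_at j f (x + c))"
    by (auto intro!: pderiv_at_translate smooth_fun_differentiable)
  then show "pderiv_at j g \<in> {(\<lambda>x. f (x + c)) |f. smooth_fun f}"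
    using smooth_fun_pderiv[OF f(2)] by auto
qed

text \<open>The functions \<open>p (1 / s) * exp (- 1 / s)\<close> with \<open>p\<close> a polynomial, extended by zero to
  \<open>s \<le> 0\<close>, are closed under differentiation, which gives smoothness by coinduction.\<close>

definition flat :: "real poly \<Rightarrow> real \<Rightarrow> real" where
  "flat p s = (if s > 0 then poly p (1 / s) * exp (- (1 / s)) else 0)"

lemma poly_exp_tendsto_0: "((\<lambda>t. poly p t * exp (- t)) \<longlongrightarrow> (0::real)) at_top"
proof -
  have "((\<lambda>t. \<Sum>i\<le>degree p. coeff p i * (t ^ i / exp t)) \<longlongrightarrow> (\<Sum>i\<le>degree p. coeff p i * 0)) at_top"
    by (intro tendsto_sum tendsto_mult tendsto_const tendsto_power_div_exp_0)
  then show ?thesis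
    by (simp add: poly_altdef sum_distrib_right exp_minus divide_inverse mult.assoc)
qed

lemma flat_has_derivative:
  "(flat p has_real_derivative flat ([:0,0,1:] * (p - pderiv p)) s) (at s)"
proof -
  consider "s > 0" | "s < 0" | "s = 0" by linarith
  then show ?thesis
  proof cases
    case 1
    have "((\<lambda>s. poly p (1 / s) * exp (- (1 / s))) has_real_derivative
        flat ([:0,0,1:] * (p - pderiv p)) s) (at s)"
      using 1 by (auto intro!: derivative_eq_intros DERIV_chain2[OF poly_DERIV] simp: flat_def field_simps power2_eq_square)
    moreover have "eventually (\<lambda>t. t > 0) (nhds s)"
      using 1 by (auto simp: eventually_nhds_metric dist_real_def intro!: exI[of _ s])
    then have "eventually (\<lambda>t. poly p (1 / t) * exp (- (1 / t)) = flat p t) (nhds s)"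
      by eventually_elim (simp add: flat_def)
    ultimately show ?thesis
      using DERIV_cong_ev[OF refl, of "\<lambda>t. poly p (1 / t) * exp (- (1 / t))" "flat p" s] by blast
  next
    case 2
    have "eventually (\<lambda>t. t < 0) (nhds s)"
      using 2 by (auto simp: eventually_nhds_metric dist_real_def intro!: exI[of _ "-s"])
    then have "eventually (\<lambda>t. 0 = flat p t) (nhds s)"
      by eventually_elim (simp add: flat_def)
    moreover have "((\<lambda>s. 0) has_real_derivative flat ([:0,0,1:] * (p - pderiv p)) s) (at s)"
      using 2 by (simp add: flat_def)
    ultimately show ?thesis
      using DERIV_cong_ev[OF refl, of "\<lambda>t. 0" "flat p" s] by blast
  next
    case 3
    have R: "((\<lambda>h. flat p h / h) \<longlongrightarrow> 0) (at_right 0)"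
    proof (subst filterlim_at_right_to_top)
      show "((\<lambda>x. flat p (inverse x) / inverse x) \<longlongrightarrow> 0) at_top"
      proof (rule Lim_transform_eventually[OF poly_exp_tendsto_0[of "[:0,1:] * p"]])
        show "eventually (\<lambda>x. poly ([:0,1:] * p) x * exp (- x) = flat p (inverse x) / inverse x) at_top"
          using eventually_gt_at_top[of 0] by eventually_elim (simp add: flat_def divide_inverse mult_ac)
      qed
    qed
    have L: "((\<lambda>h. flat p h / h) \<longlongrightarrow> 0) (at_left 0)"
    proof (rule Lim_transform_eventually[OF tendsto_const[of 0]])
      show "eventually (\<lambda>x. 0 = flat p x / x) (at_left 0)"
        by (auto simp: eventually_at flat_def intro!: exI[of _ 1])
    qed
    have "((\<lambda>h. flat p h / h) \<longlongrightarrow> 0) (at 0)"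
      by (rule filterlim_split_at[OF L R])
    then show ?thesis
      using 3 by (simp add: DERIV_def flat_def)
  qed
qed

text \<open>The derivative of a flat function is again one with another polynomial, hence the whole family
  satisfies the closure condition.\<close>

lemma smooth_fun_flat: "smooth_fun (\<lambda>x::real^'n::finite. flat p (\<alpha> * x $ i + \<beta>))"
proof (rule smooth_fun_coinduct[where T="range (\<lambda>p x. flat p (\<alpha> * x $ i + \<beta>))"])
  have D: "((\<lambda>x::real^'n. flat p (\<alpha> * x $ i + \<beta>)) has_derivative
     (\<lambda>h. flat ([:0,0,1:] * (p - pderiv p)) (\<alpha> * x $ i + \<beta>) * (\<alpha> * h $ i))) (at x)" for p x
    by (rule has_derivative_eq_rhs[OF has_derivative_compose[OF _ flat_has_derivative[unfolded has_field_derivative_def]]])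
       (auto intro!: derivative_eq_intros bounded_linear.has_derivative[OF bounded_linear_vec_nth])
  fix f :: "real^'n \<Rightarrow> real" and x j assume "f \<in> range (\<lambda>p x. flat p (\<alpha> * x $ i + \<beta>))"
  then obtain p where f: "f = (\<lambda>x. flat p (\<alpha> * x $ i + \<beta>))" by auto
  show "f differentiable (at x)" using D unfolding f by (auto simp: differentiable_def)
  have "pderiv_at j f = (\<lambda>x. flat (smult (\<alpha> * axis j 1 $ i) ([:0,0,1:] * (p - pderiv p))) (\<alpha> * x $ i + \<beta>))"
    unfolding f by (rule ext, subst pderiv_at_eqI[OF D]) (simp add: flat_def)
  then show "pderiv_at j f \<in> range (\<lambda>p x. flat p (\<alpha> * x $ i + \<beta>))" by blast
qed auto

definition box_bump :: "real ^ 'n::finite \<Rightarrow> real ^ 'n \<Rightarrow> nat \<Rightarrow> real ^ 'n \<Rightarrow> real" where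
  "box_bump a b n x = (\<Prod>i\<in>UNIV. flat 1 (Suc n * x $ i + (- (Suc n * a $ i))) *
     flat 1 (- real (Suc n) * x $ i + Suc n * b $ i))"

lemma flat1_bounds: "0 \<le> flat 1 s" "flat 1 s \<le> 1"
  by (auto simp: flat_def)

lemma box_bump_bounds: "0 \<le> box_bump a b n x" "box_bump a b n x \<le> 1"
  unfolding box_bump_def
  by (auto intro!: prod_nonneg prod_le_1 mult_nonneg_nonneg mult_le_one flat1_bounds)

lemma box_bump_outside:
  assumes "x \<notin> box a b"
  shows "box_bump a b n x = 0"
proof -
  obtain i where i: "x $ i \<le> a $ i \<or> b $ i \<le> x $ i"
    using assms by (auto simp: mem_box_cart not_less)
  have "flat 1 (Suc n * x $ i + (- (Suc n * a $ i))) * flat 1 (- real (Suc n) * x $ i + Suc n * b $ i) = 0"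
  proof -
    have "real (Suc n) * x $ i \<le> real (Suc n) * a $ i \<or> real (Suc n) * b $ i \<le> real (Suc n) * x $ i"
      using i by (metis mult_left_mono of_nat_0_le_iff)
    then have "\<not> 0 < Suc n * x $ i + (- (Suc n * a $ i)) \<or> \<not> 0 < - real (Suc n) * x $ i + Suc n * b $ i"
      by linarith
    then show ?thesis unfolding flat_def by auto
  qed
  then show ?thesis unfolding box_bump_def by (meson UNIV_I finite prod_zero_iff)
qed

lemma test_fun_box_bump: "test_fun (box_bump a b n)"
proof -
  have "smooth_fun (box_bump a b n)"
    unfolding box_bump_def[abs_def] by (intro smooth_fun_prod smooth_fun_mult smooth_fun_flat) auto
  moreover have "closure {x. box_bump a b n x \<noteq> 0} \<subseteq> cbox a b"
    using box_bump_outside[of _ a b n] box_subset_cbox[of a b] by (intro closure_minimal) auto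
  ultimately show ?thesis
    unfolding test_fun_def by (auto intro: bounded_subset[OF bounded_cbox] simp: compact_eq_bounded_closed)
qed

text \<open>Each factor is \<open>exp (- 1 / (Suc n * t))\<close> with \<open>t > 0\<close> inside the box, which tends to \<open>1\<close>.\<close>

lemma box_bump_tendsto: "(\<lambda>n. box_bump a b n x) \<longlonglongrightarrow> indicator (box a b) x"
proof (cases "x \<in> box a b")
  case True
  have F: "(\<lambda>n. flat 1 (real (Suc n) * d)) \<longlonglongrightarrow> 1" if "d > 0" for d :: real
  proof -
    have "(\<lambda>n. exp (- (inverse (real (Suc n)) * inverse d))) \<longlonglongrightarrow> exp (- (0 * inverse d))"
      by (intro tendsto_intros LIMSEQ_inverse_real_of_nat)
    then show ?thesis using that by (simp add: flat_def divide_inverse)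
  qed
  have "(\<lambda>n. \<Prod>i\<in>UNIV. flat 1 (real (Suc n) * (x $ i - a $ i)) * flat 1 (real (Suc n) * (b $ i - x $ i)))
      \<longlonglongrightarrow> (\<Prod>i\<in>(UNIV::'a set). 1 * 1)"
    using True by (intro tendsto_prod tendsto_mult F) (auto simp: mem_box_cart)
  then show ?thesis using True by (simp add: box_bump_def[abs_def] algebra_simps)
qed (simp add: box_bump_outside)

text \<open>Borel rather than Lebesgue measurable functions are used until the last section, so that
  compositions with translations and with segments remain measurable.\<close>

definition loc_int :: "('a::euclidean_space \<Rightarrow> 'b::{banach, second_countable_topology}) \<Rightarrow> bool" where
  "loc_int F \<longleftrightarrow> F \<in> borel_measurable borel \<and> (\<forall>R. integrable lborel (\<lambda>x. indicator (cball 0 R) x *\<^sub>R F x))"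

lemma loc_int_measurable: "loc_int F \<Longrightarrow> F \<in> borel_measurable borel"
  by (simp add: loc_int_def)

lemma loc_int_mult_continuous:
  fixes u :: "'a::euclidean_space \<Rightarrow> complex"
  assumes u: "loc_int u" and c: "continuous_on UNIV c"
  shows "loc_int (\<lambda>x. c x * u x)"
  unfolding loc_int_def
proof (intro conjI allI)
  note [measurable] = loc_int_measurable[OF u] borel_measurable_continuous_onI[OF c]
  show "(\<lambda>x. c x * u x) \<in> borel_measurable borel" by measurable
  fix R
  have "bounded (c ` cball 0 R)"
    by (intro compact_imp_bounded compact_continuous_image continuous_on_subset[OF c]) auto
  then obtain B where B: "\<forall>x\<in>cball 0 R. norm (c x) \<le> B" "B > 0" unfolding bounded_pos by auto
  have "integrable lborel (\<lambda>x. B *\<^sub>R (indicator (cball 0 R) x *\<^sub>R u x))"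
    using u by (intro integrable_scaleR_right) (auto simp: loc_int_def)
  then show "integrable lborel (\<lambda>x. indicator (cball 0 R) x *\<^sub>R (c x * u x))"
  proof (rule Bochner_Integration.integrable_bound)
    show "AE x in lborel. norm (indicator (cball 0 R) x *\<^sub>R (c x * u x)) \<le> norm (B *\<^sub>R (indicator (cball 0 R) x *\<^sub>R u x))"
      using B by (intro AE_I2) (auto simp: indicator_def norm_mult intro!: mult_right_mono)
  qed measurable
qed

lemma loc_int_add:
  fixes f g :: "'a::euclidean_space \<Rightarrow> complex"
  assumes "loc_int f" "loc_int g"
  shows "loc_int (\<lambda>x. f x + g x)"
  using assms by (auto simp: loc_int_def scaleR_add_right)

lemma loc_int_diff:
  fixes f g :: "'a::euclidean_space \<Rightarrow> complex"
  assumes "loc_int f" "loc_int g"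
  shows "loc_int (\<lambda>x. f x - g x)"
  using assms by (auto simp: loc_int_def scaleR_diff_right)

lemma loc_int_sum:
  fixes f :: "'n::finite \<Rightarrow> 'a::euclidean_space \<Rightarrow> complex"
  assumes "\<And>j. loc_int (f j)"
  shows "loc_int (\<lambda>x. \<Sum>j\<in>UNIV. f j x)"
  unfolding loc_int_def scaleR_sum_right
  using assms by (intro conjI allI borel_measurable_sum Bochner_Integration.integrable_sum) (auto simp: loc_int_def)

lemma loc_int_translate:
  fixes u :: "'a::euclidean_space \<Rightarrow> complex"
  assumes u: "loc_int u"
  shows "loc_int (\<lambda>x. u (h + x))"
  unfolding loc_int_def
proof (intro conjI allI)
  note [measurable] = loc_int_measurable[OF u]
  show "(\<lambda>x. u (h + x)) \<in> borel_measurable borel" by measurable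
  fix R
  have "integrable lborel (\<lambda>x. indicator (cball 0 (R + norm h)) (h + x) *\<^sub>R u (h + x))"
    by (rule integrable_lborel_translate) (use u in \<open>simp add: loc_int_def\<close>)
  then show "integrable lborel (\<lambda>x. indicator (cball 0 R) x *\<^sub>R u (h + x))"
  proof (rule Bochner_Integration.integrable_bound)
    have "norm (h + x) \<le> R + norm h" if "norm x \<le> R" for x using norm_triangle_ineq[of h x] that by simp
    then show "AE x in lborel. norm (indicator (cball 0 R) x *\<^sub>R u (h + x)) \<le> norm (indicator (cball 0 (R + norm h)) (h + x) *\<^sub>R u (h + x))"
      by (intro AE_I2) (auto simp: indicator_def)
  qed measurable
qed

lemma loc_int_bounded_support:
  fixes F :: "'a::euclidean_space \<Rightarrow> complex"
  assumes F: "loc_int F" and [measurable]: "g \<in> borel_measurable borel"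
    and R: "\<And>x. norm x > R \<Longrightarrow> g x = 0" and B: "\<And>x. norm (g x) \<le> B"
  shows "integrable lborel (\<lambda>x. F x * g x)"
proof (rule Bochner_Integration.integrable_bound)
  note [measurable] = loc_int_measurable[OF F]
  show "integrable lborel (\<lambda>x. B *\<^sub>R (indicator (cball 0 R) x *\<^sub>R F x))"
    using F by (intro integrable_scaleR_right) (auto simp: loc_int_def)
  show "AE x in lborel. norm (F x * g x) \<le> norm (B *\<^sub>R (indicator (cball 0 R) x *\<^sub>R F x))" (is "AE x in _. ?P1 x")
  proof (rule AE_I2)
    fix x
    have "B \<ge> 0" using B[of x] norm_ge_zero order_trans by blast
    then show "?P1 x"
      using R[of x] B[of x] by (cases "norm x \<le> R") (auto simp: norm_mult mult.commute[of B] intro!: mult_left_mono)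
  qed
qed (use loc_int_measurable[OF F] assms(2) in \<open>auto intro!: borel_measurable_times\<close>)

lemma test_fun_smooth: "test_fun \<phi> \<Longrightarrow> smooth_fun \<phi>"
  by (simp add: test_fun_def)

lemma test_fun_measurable: "test_fun \<phi> \<Longrightarrow> \<phi> \<in> borel_measurable borel"
  by (simp add: test_fun_def smooth_fun_measurable)

lemma test_fun_support:
  assumes "test_fun \<phi>"
  obtains R B where "R > 0" "B > 0" "\<And>x. norm x > R \<Longrightarrow> \<phi> x = 0" "\<And>x. \<bar>\<phi> x\<bar> \<le> B"
proof -
  have c: "compact (closure {x. \<phi> x \<noteq> 0})" using assms by (simp add: test_fun_def)
  then obtain R where R: "R > 0" "\<And>x. x \<in> closure {x. \<phi> x \<noteq> 0} \<Longrightarrow> norm x \<le> R"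
    using compact_imp_bounded[OF c] unfolding bounded_pos by auto
  have "bounded (\<phi> ` closure {x. \<phi> x \<noteq> 0})"
    by (intro compact_imp_bounded compact_continuous_image c smooth_fun_continuous test_fun_smooth assms)
  then obtain B where B: "B > 0" "\<And>x. x \<in> closure {x. \<phi> x \<noteq> 0} \<Longrightarrow> \<bar>\<phi> x\<bar> \<le> B"
    by (auto simp: bounded_pos)
  have s: "\<phi> x = 0 \<or> x \<in> closure {x. \<phi> x \<noteq> 0}" for x
    using closure_subset[of "{x. \<phi> x \<noteq> 0}"] by auto
  show thesis
  proof
    show "R > 0" "B > 0" by fact+
    show "norm x > R \<Longrightarrow> \<phi> x = 0" for x using s[of x] R(2)[of x] by force
    show "\<bar>\<phi> x\<bar> \<le> B" for x using s[of x] B by force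
  qed
qed

lemma test_fun_pderiv:
  assumes "test_fun \<phi>"
  shows "test_fun (pderiv_at j \<phi>)"
proof -
  have "{x. pderiv_at j \<phi> x \<noteq> 0} \<subseteq> closure {x. \<phi> x \<noteq> 0}"
  proof (rule subsetI, rule ccontr)
    fix x assume x: "x \<in> {x. pderiv_at j \<phi> x \<noteq> 0}" and n: "x \<notin> closure {x. \<phi> x \<noteq> 0}"
    have "(\<phi> has_derivative (\<lambda>_. 0)) (at x)"
    proof (rule has_derivative_transform_within_open[OF has_derivative_const[of 0]])
      show "open (- closure {x. \<phi> x \<noteq> 0})" by (intro open_Compl closed_closure)
      show "x \<in> - closure {x. \<phi> x \<noteq> 0}" using n by simp
      show "\<And>y. y \<in> - closure {x. \<phi> x \<noteq> 0} \<Longrightarrow> 0 = \<phi> y" using closure_subset[of "{x. \<phi> x \<noteq> 0}"] by auto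
    qed
    from pderiv_at_eqI[OF this] x show False by simp
  qed
  then have "closure {x. pderiv_at j \<phi> x \<noteq> 0} \<subseteq> closure {x. \<phi> x \<noteq> 0}"
    by (simp add: closure_minimal)
  then show ?thesis
    using assms unfolding test_fun_def
    by (auto intro: smooth_fun_pderiv bounded_subset simp: compact_eq_bounded_closed)
qed

lemma compact_support_I:
  fixes \<phi> :: "'a::euclidean_space \<Rightarrow> 'b::zero"
  assumes "\<And>x. norm x > R \<Longrightarrow> \<phi> x = 0"
  shows "compact (closure {x. \<phi> x \<noteq> 0})"
proof -
  have "{x. \<phi> x \<noteq> 0} \<subseteq> cball 0 R" using assms by (auto simp: not_less[symmetric])
  then have "bounded {x. \<phi> x \<noteq> 0}" using bounded_cball bounded_subset by blast
  then show ?thesis by (simp add: compact_closure)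
qed

lemma test_fun_translate:
  fixes c :: "real ^ 'n::finite"
  assumes "test_fun \<phi>"
  shows "test_fun (\<lambda>x. \<phi> (x + c))"
proof -
  obtain R B where R: "\<And>x::real^'n. norm x > R \<Longrightarrow> \<phi> x = 0" using test_fun_support[OF assms] by metis
  have "compact (closure {x. \<phi> (x + c) \<noteq> 0})"
  proof (rule compact_support_I[where R="R + norm c"])
    fix x :: "real^'n" assume "norm x > R + norm c"
    then have "norm (x + c) > R" using norm_triangle_ineq4[of "x + c" c] by simp
    then show "\<phi> (x + c) = 0" by (rule R)
  qed
  then show ?thesis using assms by (simp add: test_fun_def smooth_fun_translate)
qed

lemma test_fun_add:
  assumes "test_fun \<phi>" "test_fun \<psi>"
  shows "test_fun (\<lambda>x. \<phi> x + \<psi> x)"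
proof -
  obtain R1 R2 where R: "\<And>x. norm x > R1 \<Longrightarrow> \<phi> x = 0" "\<And>x. norm x > R2 \<Longrightarrow> \<psi> x = 0"
    using test_fun_support[OF assms(1)] test_fun_support[OF assms(2)] by metis
  have "compact (closure {x. \<phi> x + \<psi> x \<noteq> 0})"
    by (rule compact_support_I[where R="max R1 R2"]) (simp add: R)
  then show ?thesis using assms by (simp add: test_fun_def smooth_fun_add)
qed

lemma test_fun_scale:
  assumes "test_fun \<phi>"
  shows "test_fun (\<lambda>x. c * \<phi> x)"
proof -
  obtain R where R: "\<And>x. norm x > R \<Longrightarrow> \<phi> x = 0" using test_fun_support[OF assms] by metis
  have "compact (closure {x. c * \<phi> x \<noteq> 0})"
    by (rule compact_support_I[where R=R]) (simp add: R)
  then show ?thesis using assms by (simp add: test_fun_def smooth_fun_mult smooth_fun_const)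
qed

lemma integrable_mult_test_fun:
  fixes F :: "real ^ 'n::finite \<Rightarrow> complex"
  assumes F: "loc_int F" and t: "test_fun \<phi>"
  shows "integrable lborel (\<lambda>x. F x * complex_of_real (\<phi> x))"
proof -
  obtain R B where "\<And>x. norm x > R \<Longrightarrow> \<phi> x = 0" "\<And>x. \<bar>\<phi> x\<bar> \<le> B"
    using test_fun_support[OF t] by metis
  then show ?thesis
    using test_fun_measurable[OF t] by (intro loc_int_bounded_support[OF F, where R=R and B=B]) auto
qed

text \<open>Bump functions approximate the indicators of boxes, and a function whose integral over
  every box vanishes is zero at each of its Lebesgue points.\<close>

lemma fundamental_lemma_variations:
  fixes F :: "real ^ 'n::finite \<Rightarrow> complex"
  assumes F: "loc_int F"
    and zero: "\<And>\<phi>. test_fun \<phi> \<Longrightarrow> (LINT x|lborel. F x * complex_of_real (\<phi> x)) = 0"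
  shows "AE x in lborel. F x = 0"
proof -
  note [measurable] = loc_int_measurable[OF F]
  have box0: "(LINT x|lborel. indicator (box a b) x *\<^sub>R F x) = 0"
    and boxi: "set_integrable lborel (box a b) F" for a b :: "real^'n"
  proof -
    obtain R where R: "box a b \<subseteq> cball 0 R"
      using bounded_box[of a b] unfolding bounded_iff by (auto simp: subset_iff)
    have dom: "integrable lborel (\<lambda>x. norm (indicator (cball 0 R) x *\<^sub>R F x))"
      using F by (intro integrable_norm) (auto simp: loc_int_def)
    have "(\<lambda>n. LINT x|lborel. F x * complex_of_real (box_bump a b n x)) \<longlonglongrightarrow> (LINT x|lborel. indicator (box a b) x *\<^sub>R F x)"
    proof (rule integral_dominated_convergence[where w="\<lambda>x. norm (indicator (cball 0 R) x *\<^sub>R F x)"])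
      show "AE x in lborel. (\<lambda>n. F x * complex_of_real (box_bump a b n x)) \<longlonglongrightarrow> indicator (box a b) x *\<^sub>R F x" (is "AE x in _. ?P1 x")
      proof (rule AE_I2)
        fix x
        have "(\<lambda>n. F x * complex_of_real (box_bump a b n x)) \<longlonglongrightarrow> F x * complex_of_real (indicator (box a b) x)"
          by (intro tendsto_intros box_bump_tendsto)
        then show "?P1 x"
          by (simp add: scaleR_conv_of_real mult.commute)
      qed
      show "AE x in lborel. norm (F x * complex_of_real (box_bump a b n x)) \<le> norm (indicator (cball 0 R) x *\<^sub>R F x)" for n
      proof (rule AE_I2)
        fix x
        show "norm (F x * complex_of_real (box_bump a b n x)) \<le> norm (indicator (cball 0 R) x *\<^sub>R F x)"
          using R box_bump_outside[of x a b n] box_bump_bounds[of a b n x]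
          by (cases "x \<in> box a b") (auto simp: norm_mult mult_left_le subset_iff)
      qed
      show "(\<lambda>x. F x * complex_of_real (box_bump a b n x)) \<in> borel_measurable lborel" for n
        using test_fun_measurable[OF test_fun_box_bump] by measurable
    qed (use dom in auto)
    moreover have "(LINT x|lborel. F x * complex_of_real (box_bump a b n x)) = 0" for n
      by (rule zero) (rule test_fun_box_bump)
    ultimately show "(LINT x|lborel. indicator (box a b) x *\<^sub>R F x) = 0"
      by (simp add: LIMSEQ_const_iff)
    show "set_integrable lborel (box a b) F"
      unfolding set_integrable_def
    proof (rule Bochner_Integration.integrable_bound[OF dom])
      show "AE x in lborel. norm (indicator (box a b) x *\<^sub>R F x) \<le> norm (norm (indicator (cball 0 R) x *\<^sub>R F x))"
        using R by (intro AE_I2) (auto simp: indicator_def subset_iff)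
    qed measurable
  qed
  have I: "F integrable_on cbox a b" "integral (cbox a b) F = 0" for a b :: "real^'n"
  proof -
    have "F integrable_on box a b" "integral (box a b) F = 0"
      using set_borel_integral_eq_integral[OF boxi[of a b]] box0[of a b]
      by (auto simp: set_lebesgue_integral_def)
    then show "F integrable_on cbox a b" "integral (cbox a b) F = 0"
      by (auto simp: integrable_on_open_interval integral_open_interval)
  qed
  obtain N where N: "negligible N"
    "\<And>x e. \<lbrakk>x \<notin> N; 0 < e\<rbrakk> \<Longrightarrow> \<exists>d>0. \<forall>h. 0 < h \<and> h < d \<longrightarrow>
        norm (integral (cbox x (x + h *\<^sub>R One)) F /\<^sub>R h ^ DIM(real^'n) - F x) < e"
    using integrable_ccontinuous_explicit[of F] I(1) by metis
  have "F x = 0" if "x \<notin> N" for x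
  proof (rule ccontr)
    assume "F x \<noteq> 0"
    then have "norm (F x) > 0" by simp
    from N(2)[OF that this] obtain d :: real where d: "d > 0" "\<forall>h>0. \<not> h < d"
      unfolding I(2) by auto
    then show False using dense[OF d(1)] by auto
  qed
  then have "AE x in lebesgue. F x = 0"
    using N(1) by (auto simp: eventually_ae_filter negligible_iff_null_sets)
  then show ?thesis by (simp add: AE_completion_iff)
qed

section \<open>Weak gradients along segments\<close>

definition wgrad :: "(real ^ 'n::finite \<Rightarrow> complex) \<Rightarrow> (real ^ 'n \<Rightarrow> complex ^ 'n) \<Rightarrow> bool" where
  "wgrad u G \<longleftrightarrow> loc_int u \<and> loc_int G \<and>
    (\<forall>\<phi> j. test_fun \<phi> \<longrightarrow>
       (LINT x|lborel. u x * complex_of_real (pderiv_at j \<phi> x)) =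
       - (LINT x|lborel. G x $ j * complex_of_real (\<phi> x)))"

lemma loc_int_nth:
  assumes "loc_int (G :: real^'n::finite \<Rightarrow> complex ^ 'm::finite)"
  shows "loc_int (\<lambda>x. G x $ j)"
  unfolding loc_int_def
proof (intro conjI allI)
  note m[measurable] = loc_int_measurable[OF assms]
  show mj[measurable]: "(\<lambda>x. G x $ j) \<in> borel_measurable borel" by (rule measurable_compose[OF m borel_measurable_vec_nth])
  fix R
  have "integrable lborel (\<lambda>x. indicator (cball 0 R) x *\<^sub>R G x)"
    using assms by (simp add: loc_int_def)
  then show "integrable lborel (\<lambda>x. indicator (cball 0 R) x *\<^sub>R G x $ j)"
    by (rule Bochner_Integration.integrable_bound)
       (auto simp: indicator_def intro!: AE_I2 component_le_norm_cart Finite_Cartesian_Product.norm_nth_le)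
qed

lemma segment_integrable:
  fixes f :: "'a::euclidean_space \<Rightarrow> 'b::{banach, second_countable_topology}" and h :: 'a
  assumes f: "loc_int f"
  shows "integrable (lborel \<Otimes>\<^sub>M lborel)
    (\<lambda>(x, t). (indicator (cball 0 R) x * indicator {0..1} t) *\<^sub>R f (x + t *\<^sub>R h))"
proof (rule integrableI_bounded)
  note [measurable] = loc_int_measurable[OF f]
  show "(\<lambda>(x, t). (indicator (cball 0 R) x * indicator {0..1} t) *\<^sub>R f (x + t *\<^sub>R h))
      \<in> borel_measurable (lborel \<Otimes>\<^sub>M lborel)"
    by measurable
  have "(\<integral>\<^sup>+p. ennreal (norm (case p of (x, t) \<Rightarrow> (indicator (cball 0 R) x * indicator {0..1} t) *\<^sub>R f (x + t *\<^sub>R h)))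
      \<partial>(lborel \<Otimes>\<^sub>M lborel)) =
    (\<integral>\<^sup>+t. \<integral>\<^sup>+x. ennreal (norm ((indicator (cball 0 R) x * indicator {0..1} t) *\<^sub>R f (x + t *\<^sub>R h))) \<partial>lborel \<partial>lborel)"
    by (subst lborel_pair.nn_integral_snd[symmetric]) (auto intro!: measurable)
  also have "\<dots> \<le> (\<integral>\<^sup>+t. indicator {0..1} t * (\<integral>\<^sup>+x. ennreal (norm (indicator (cball 0 (R + norm h)) x *\<^sub>R f x)) \<partial>lborel) \<partial>(lborel::real measure))" (is "nn_integral _ ?l1 \<le> nn_integral _ ?r1")
  proof (rule nn_integral_mono)
    fix t :: real
    show "?l1 t \<le> ?r1 t"
    proof (cases "t \<in> {0..1}")
      case True
      have "(\<integral>\<^sup>+x. ennreal (norm ((indicator (cball 0 R) x * indicator {0..1} t) *\<^sub>R f (x + t *\<^sub>R h))) \<partial>lborel)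
        \<le> (\<integral>\<^sup>+x. ennreal (norm (indicator (cball 0 (R + norm h)) (t *\<^sub>R h + x) *\<^sub>R f (t *\<^sub>R h + x))) \<partial>lborel)" (is "nn_integral _ ?l2 \<le> nn_integral _ ?r2")
      proof (rule nn_integral_mono)
        fix x :: 'a
        have "norm (t *\<^sub>R h + x) \<le> R + norm h" if "norm x \<le> R"
        proof -
          have "norm (t *\<^sub>R h) \<le> norm h" using True by (simp add: mult_left_le_one_le)
          then show ?thesis using that norm_triangle_ineq[of "t *\<^sub>R h" x] by linarith
        qed
        then show "?l2 x \<le> ?r2 x"
          by (auto simp: indicator_def add.commute)
      qed
      also have "\<dots> = (\<integral>\<^sup>+x. ennreal (norm (indicator (cball 0 (R + norm h)) x *\<^sub>R f x)) \<partial>lborel)"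
        by (rule nn_integral_lborel_translate) measurable
      finally show ?thesis using True by simp
    qed simp
  qed
  also have "\<dots> = (\<integral>\<^sup>+x. ennreal (norm (indicator (cball 0 (R + norm h)) x *\<^sub>R f x)) \<partial>lborel)"
    by (subst nn_integral_multc) auto
  also have "\<dots> < \<infinity>"
    using f by (simp add: loc_int_def integrable_iff_bounded)
  finally show "(\<integral>\<^sup>+p. ennreal (norm (case p of (x, t) \<Rightarrow> (indicator (cball 0 R) x * indicator {0..1} t) *\<^sub>R f (x + t *\<^sub>R h)))
      \<partial>(lborel \<Otimes>\<^sub>M lborel)) < \<infinity>" .
qed

lemma segment_AE_integrable:
  fixes f :: "'a::euclidean_space \<Rightarrow> 'b::{banach, second_countable_topology}" and h :: 'a
  assumes f: "loc_int f"
  shows "AE x in lborel. integrable lborel (\<lambda>t. indicator {0..1} t *\<^sub>R f (x + t *\<^sub>R h))"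
proof -
  have "AE x in lborel. \<forall>n::nat. integrable lborel (\<lambda>t. (indicator (cball 0 (real n)) x * indicator {0..1} t) *\<^sub>R f (x + t *\<^sub>R h))"
    unfolding AE_all_countable
    by (rule allI, rule lborel_pair.AE_integrable_fst'[OF segment_integrable[OF f], simplified])
  then show ?thesis
  proof eventually_elim
    case (elim x)
    obtain n where "norm x \<le> real n" using real_arch_simple by blast
    then show ?case using elim[rule_format, of n] by simp
  qed
qed

lemma exp_bound [simp]: "norm (exp (- (\<i> * complex_of_real a))) = 1"
  using norm_exp_i_times[of "-a"] by simp

lemma integral_sum_cmult:
  fixes f :: "'j::finite \<Rightarrow> 'a \<Rightarrow> complex"
  assumes "\<And>j. integrable M (f j)"
  shows "(LINT y|M. (\<Sum>j\<in>UNIV. c j * f j y)) = (\<Sum>j\<in>UNIV. c j * (LINT y|M. f j y))"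
  by (subst Bochner_Integration.integral_sum) (auto intro: assms)

text \<open>Both sides are tested against \<open>\<phi>\<close>.  Fubini and a translation move the segment onto \<open>\<phi>\<close>, where the
  defining property of the weak gradient produces exactly the derivative in \<open>t\<close> of
  \<open>exp (- \<i> t \<theta>) * \<phi> (y - t h)\<close>, which the fundamental theorem of calculus integrates.\<close>

lemma segment_formula_fixed_phase:
  fixes u :: "real ^ 'n::finite \<Rightarrow> complex" and h :: "real ^ 'n" and \<theta> :: real
  assumes w: "wgrad u G"
  shows "AE x in lborel. exp (- (\<i> * complex_of_real \<theta>)) * u (x + h) - u x =
    (LINT t|lborel. indicator {0..1} t *\<^sub>R (exp (- (\<i> * complex_of_real (t * \<theta>))) *
       (cdot h (G (x + t *\<^sub>R h)) - \<i> * complex_of_real \<theta> * u (x + t *\<^sub>R h))))"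
proof -
  have u: "loc_int u" and G: "loc_int G" using w by (auto simp: wgrad_def)
  note [measurable] = loc_int_measurable[OF u] loc_int_measurable[OF G]
  define e where "e = (\<lambda>t. exp (- (\<i> * complex_of_real (t * \<theta>))))"
  have ne: "norm (e t) = 1" for t unfolding e_def by (rule exp_bound)
  have [measurable]: "e \<in> borel_measurable borel" unfolding e_def
    by (intro borel_measurable_continuous_onI continuous_intros)
  define v where "v = (\<lambda>y. cdot h (G y) - \<i> * complex_of_real \<theta> * u y)"
  have [measurable]: "v \<in> borel_measurable borel" unfolding v_def by measurable
  have v: "loc_int v" unfolding v_def cdot_def
    by (intro loc_int_diff loc_int_sum loc_int_mult_continuous[OF _ continuous_on_const] loc_int_nth G u)
  define K where "K = (\<lambda>x t. indicator {0..1} t *\<^sub>R (e t * v (x + t *\<^sub>R h)))"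
  have Kint: "integrable (lborel \<Otimes>\<^sub>M lborel) (\<lambda>(x, t). indicator (cball 0 R) x *\<^sub>R K x t)" for R
    by (rule Bochner_Integration.integrable_bound[OF segment_integrable[OF v, of R h]])
       (auto simp: K_def norm_mult ne)
  define F where "F = (\<lambda>x. LINT t|lborel. K x t)"
  have Fm[measurable]: "F \<in> borel_measurable borel"
    unfolding F_def K_def by measurable
  have Floc: "loc_int F"
    unfolding loc_int_def
  proof (intro conjI allI)
    fix R
    have "integrable lborel (\<lambda>x. LINT t|lborel. indicator (cball 0 R) x *\<^sub>R K x t)"
      using lborel_pair.integrable_fst'[OF Kint[of R]] by simp
    then show "integrable lborel (\<lambda>x. indicator (cball 0 R) x *\<^sub>R F x)"
      by (simp add: F_def)
  qed measurable
  define E where "E = (\<lambda>x. e 1 * u (h + x) - u x - F x)"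
  note uh = loc_int_translate[OF u, of h]
  have Eloc: "loc_int E" unfolding E_def
    by (intro loc_int_diff loc_int_mult_continuous[OF _ continuous_on_const] uh u Floc)
  have "AE x in lborel. E x = 0"
  proof (rule fundamental_lemma_variations[OF Eloc])
    fix \<phi> :: "real^'n \<Rightarrow> real" assume t: "test_fun \<phi>"
    obtain R B where R: "R > 0" "\<And>x. norm x > R \<Longrightarrow> \<phi> x = 0" and B: "B > 0" "\<And>x. \<bar>\<phi> x\<bar> \<le> B"
      using test_fun_support[OF t] by metis
    note sm = test_fun_smooth[OF t]
    have \<phi>c: "continuous_on UNIV \<phi>" by (rule smooth_fun_continuous[OF sm])
    have [measurable]: "\<phi> \<in> borel_measurable borel" by (rule test_fun_measurable[OF t])
    have [measurable]: "pderiv_at j \<phi> \<in> borel_measurable borel" for j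
      by (rule test_fun_measurable[OF test_fun_pderiv[OF t]])
    define D where "D = (\<lambda>y. \<Sum>j\<in>UNIV. h $ j * pderiv_at j \<phi> y)"
    have [measurable]: "D \<in> borel_measurable borel" unfolding D_def by measurable
    have Dc: "continuous_on UNIV D" unfolding D_def
      by (intro continuous_intros smooth_fun_continuous smooth_fun_pderiv sm)
    define g where "g = (\<lambda>y t. e t * complex_of_real (\<phi> (y - t *\<^sub>R h)))"
    define g' where "g' = (\<lambda>y t. - (e t * (\<i> * complex_of_real \<theta> * complex_of_real (\<phi> (y - t *\<^sub>R h)) + complex_of_real (D (y - t *\<^sub>R h)))))"
    have eD: "(e has_vector_derivative (- (\<i> * complex_of_real \<theta>) * e t)) (at t within S)" for t S
    proof -
      have "((\<lambda>z. exp (- (\<i> * (z * complex_of_real \<theta>)))) has_field_derivative (- (\<i> * complex_of_real \<theta>) * e t)) (at (complex_of_real t))"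
        unfolding e_def by (auto intro!: derivative_eq_intros)
      from has_vector_derivative_real_field[OF this] show ?thesis by (simp add: e_def)
    qed
    have gD: "(g y has_vector_derivative g' y t) (at t within S)" for y t S
    proof -
      have "((\<lambda>t. y - t *\<^sub>R h) has_derivative (\<lambda>s. - (s *\<^sub>R h))) (at t within S)"
        by (auto intro!: derivative_eq_intros)
      from has_derivative_compose[OF this has_derivative_at_withinI[OF smooth_has_derivative[OF sm], of "y - t *\<^sub>R h" UNIV]]
      have "((\<lambda>t. \<phi> (y - t *\<^sub>R h)) has_derivative (\<lambda>s. \<Sum>j\<in>UNIV. (- (s *\<^sub>R h)) $ j * pderiv_at j \<phi> (y - t *\<^sub>R h))) (at t within S)"
        by simp
      moreover have "(\<Sum>j\<in>UNIV. (- (s *\<^sub>R h)) $ j * pderiv_at j \<phi> (y - t *\<^sub>R h)) = s *\<^sub>R (- D (y - t *\<^sub>R h))" for s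
        by (simp add: D_def sum_distrib_left sum_negf mult_ac)
      ultimately have "((\<lambda>t. \<phi> (y - t *\<^sub>R h)) has_vector_derivative (- D (y - t *\<^sub>R h))) (at t within S)"
        by (simp add: has_vector_derivative_def)
      from has_vector_derivative_mult[OF eD bounded_linear.has_vector_derivative[OF bounded_linear_of_real this]]
      show ?thesis unfolding g_def g'_def by (simp add: algebra_simps)
    qed
    have phys: "continuous_on S (\<lambda>t. \<phi> (y - t *\<^sub>R h))" "continuous_on S (\<lambda>t. D (y - t *\<^sub>R h))" for y and S :: "real set"
      by (auto intro!: continuous_on_compose2[OF \<phi>c] continuous_on_compose2[OF Dc] continuous_intros)
    have g'c: "continuous_on {0..1} (g' y)" for y
      unfolding g'_def e_def by (intro continuous_intros phys)
    have FTC: "(LINT t|lborel. indicator {0..1} t *\<^sub>R g' y t) = g y 1 - g y 0" for y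
      by (rule integral_FTC_atLeastAtMost[OF _ gD g'c]) simp
    \<comment> \<open>the integral along the segment, tested against \<open>\<phi>\<close>\<close>
    have Kphi: "integrable (lborel \<Otimes>\<^sub>M lborel) (\<lambda>(x, t). K x t * complex_of_real (\<phi> x))"
    proof (rule Bochner_Integration.integrable_bound)
      show "integrable (lborel \<Otimes>\<^sub>M lborel) (\<lambda>p. B *\<^sub>R (case p of (x, t) \<Rightarrow> indicator (cball 0 R) x *\<^sub>R K x t))"
        by (intro integrable_scaleR_right Kint)
      show "(\<lambda>(x, t). K x t * complex_of_real (\<phi> x)) \<in> borel_measurable (lborel \<Otimes>\<^sub>M lborel)"
        unfolding K_def by measurable
      show "AE p in lborel \<Otimes>\<^sub>M lborel. norm (case p of (x, t) \<Rightarrow> K x t * complex_of_real (\<phi> x)) \<le> norm (B *\<^sub>R (case p of (x, t) \<Rightarrow> indicator (cball 0 R) x *\<^sub>R K x t))"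
      proof (rule AE_I2, clarify)
        fix x :: "real^'n" and t :: real
        show "norm (K x t * complex_of_real (\<phi> x)) \<le> norm (B *\<^sub>R (indicator (cball 0 R) x *\<^sub>R K x t))"
          using R(2)[of x] B(2)[of x] B(1)
          by (cases "norm x \<le> R") (auto simp: norm_mult mult.commute[of B] intro!: mult_left_mono)
      qed
    qed
    have tt: "test_fun (\<lambda>y. \<phi> (y - t *\<^sub>R h))" for t
      using test_fun_translate[OF t, of "- (t *\<^sub>R h)"] by simp
    have pt: "pderiv_at j (\<lambda>y. \<phi> (y - t *\<^sub>R h)) y = pderiv_at j \<phi> (y - t *\<^sub>R h)" for j t y
      using pderiv_at_translate[OF smooth_fun_differentiable[OF sm], of j "- (t *\<^sub>R h)" y] by simp
    have inner: "(LINT x|lborel. v (x + t *\<^sub>R h) * complex_of_real (\<phi> x)) =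
       (LINT y|lborel. - (u y * (\<i> * complex_of_real \<theta> * complex_of_real (\<phi> (y - t *\<^sub>R h)) + complex_of_real (D (y - t *\<^sub>R h)))))" for t
    proof -
      have "(LINT x|lborel. v (x + t *\<^sub>R h) * complex_of_real (\<phi> x)) = (LINT x|lborel. (\<lambda>y. v y * complex_of_real (\<phi> (y - t *\<^sub>R h))) (t *\<^sub>R h + x))"
        by (intro Bochner_Integration.integral_cong) (auto simp: add.commute)
      also have "\<dots> = (LINT y|lborel. v y * complex_of_real (\<phi> (y - t *\<^sub>R h)))"
        by (rule integral_lborel_translate) measurable
      also have "\<dots> = (LINT y|lborel. (\<Sum>j\<in>UNIV. complex_of_real (h $ j) * (G y $ j * complex_of_real (\<phi> (y - t *\<^sub>R h)))) - \<i> * complex_of_real \<theta> * (u y * complex_of_real (\<phi> (y - t *\<^sub>R h))))"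
        by (intro Bochner_Integration.integral_cong) (auto simp: v_def cdot_def algebra_simps sum_distrib_left sum_distrib_right)
      also have "\<dots> = (\<Sum>j\<in>UNIV. complex_of_real (h $ j) * (LINT y|lborel. G y $ j * complex_of_real (\<phi> (y - t *\<^sub>R h)))) - \<i> * complex_of_real \<theta> * (LINT y|lborel. u y * complex_of_real (\<phi> (y - t *\<^sub>R h)))"
        by (subst Bochner_Integration.integral_diff)
           (auto intro!: Bochner_Integration.integrable_sum integrable_mult_right integrable_mult_test_fun tt loc_int_nth G u integral_sum_cmult)
      also have "\<dots> = (\<Sum>j\<in>UNIV. (- complex_of_real (h $ j)) * (LINT y|lborel. u y * complex_of_real (pderiv_at j \<phi> (y - t *\<^sub>R h)))) - \<i> * complex_of_real \<theta> * (LINT y|lborel. u y * complex_of_real (\<phi> (y - t *\<^sub>R h)))"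
        using w tt unfolding wgrad_def by (simp flip: pt)
      also have "\<dots> = (LINT y|lborel. (\<Sum>j\<in>UNIV. (- complex_of_real (h $ j)) * (u y * complex_of_real (pderiv_at j \<phi> (y - t *\<^sub>R h)))) - \<i> * complex_of_real \<theta> * (u y * complex_of_real (\<phi> (y - t *\<^sub>R h))))"
      proof -
        have i1: "integrable lborel (\<lambda>y. u y * complex_of_real (pderiv_at j \<phi> (y - t *\<^sub>R h)))" for j
          using integrable_mult_test_fun[OF u test_fun_pderiv[OF tt[of t]], of j] unfolding pt .
        have i2: "integrable lborel (\<lambda>y. u y * complex_of_real (\<phi> (y - t *\<^sub>R h)))"
          by (rule integrable_mult_test_fun[OF u tt])
        show ?thesis
          apply (subst Bochner_Integration.integral_diff)
            apply (intro Bochner_Integration.integrable_sum integrable_mult_right i1)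
           apply (intro integrable_mult_right i2)
          apply (simp only: integral_sum_cmult[OF i1] integral_mult_right_zero)
          done
      qed
      also have "\<dots> = (LINT y|lborel. - (u y * (\<i> * complex_of_real \<theta> * complex_of_real (\<phi> (y - t *\<^sub>R h)) + complex_of_real (D (y - t *\<^sub>R h)))))"
        by (intro Bochner_Integration.integral_cong) (auto simp: D_def algebra_simps sum_distrib_left sum_negf)
      finally show ?thesis .
    qed
    obtain B1 where B1: "\<And>y. \<bar>D y\<bar> \<le> B1"
    proof -
      have "\<exists>B. \<forall>y. \<bar>pderiv_at j \<phi> y\<bar> \<le> B" for j
        using test_fun_support[OF test_fun_pderiv[OF t, of j]] by metis
      then obtain b where b: "\<And>j y. \<bar>pderiv_at j \<phi> y\<bar> \<le> b j" by metis
      have "\<bar>D y\<bar> \<le> (\<Sum>j\<in>UNIV. \<bar>h $ j\<bar> * b j)" for y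
        unfolding D_def by (rule order_trans[OF sum_abs]) (auto simp: abs_mult intro!: sum_mono mult_left_mono b)
      then show ?thesis using that by blast
    qed
    obtain R1 where R1: "\<And>y. norm y > R1 \<Longrightarrow> D y = 0"
    proof -
      have "\<exists>R. \<forall>y. norm y > R \<longrightarrow> pderiv_at j \<phi> y = 0" for j
        using test_fun_support[OF test_fun_pderiv[OF t, of j]] by metis
      then obtain r where r: "\<And>j y. norm y > r j \<Longrightarrow> pderiv_at j \<phi> y = 0" by metis
      have "D y = 0" if "norm y > Max (range r)" for y
      proof -
        have "r j < norm y" for j using that by (meson Max_ge finite finite_imageI order.strict_trans1 rangeI)
        then show ?thesis by (simp add: D_def r)
      qed
      then show ?thesis using that by blast
    qed
    have ug: "integrable (lborel \<Otimes>\<^sub>M lborel) (\<lambda>(y, t). indicator {0..1} t *\<^sub>R (u y * g' y t))"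
    proof (rule Bochner_Integration.integrable_bound)
      let ?R = "max R R1 + norm h" and ?B = "\<bar>\<theta>\<bar> * B + B1"
      have ii: "integrable (lborel \<Otimes>\<^sub>M lborel) (\<lambda>(y::real^'n, t::real). (indicator (cball 0 ?R) y * indicator {0..1} t) *\<^sub>R u (y + t *\<^sub>R 0))"
        by (rule segment_integrable[OF u])
      then show "integrable (lborel \<Otimes>\<^sub>M lborel) (\<lambda>p::(real^'n) \<times> real. ?B *\<^sub>R (case p of (y, t) \<Rightarrow> (indicator (cball 0 ?R) y * indicator {0..1} t) *\<^sub>R u y))"
        by (intro integrable_scaleR_right) simp
      show "(\<lambda>(y, t). indicator {0..1} t *\<^sub>R (u y * g' y t)) \<in> borel_measurable (lborel \<Otimes>\<^sub>M lborel)"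
        unfolding g'_def by measurable
      show "AE p in lborel \<Otimes>\<^sub>M lborel. norm (case p of (y, t) \<Rightarrow> indicator {0..1} t *\<^sub>R (u y * g' y t)) \<le> norm (?B *\<^sub>R (case p of (y, t) \<Rightarrow> (indicator (cball 0 ?R) y * indicator {0..1} t) *\<^sub>R u y))"
      proof (rule AE_I2, clarify)
        fix y :: "real^'n" and t :: real
        have "B1 \<ge> 0" using B1[of 0] by linarith
        then have Bn: "?B \<ge> 0" using B(1) by simp
        have g'b: "norm (g' y t) \<le> ?B"
        proof -
          have "norm (g' y t) \<le> norm (\<i> * complex_of_real \<theta> * complex_of_real (\<phi> (y - t *\<^sub>R h))) + norm (complex_of_real (D (y - t *\<^sub>R h)))"
            unfolding g'_def norm_minus_cancel norm_mult[of "e t"] ne mult_1 by (rule norm_triangle_ineq)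
          also have "\<dots> \<le> ?B"
            using B(2) B1 by (auto simp: norm_mult intro!: add_mono mult_left_mono)
          finally show ?thesis .
        qed
        have g'0: "g' y t = 0" if "norm y > ?R" "t \<in> {0..1}"
        proof -
          have "norm (t *\<^sub>R h) \<le> norm h" using that by (simp add: mult_left_le_one_le)
          moreover have "norm y \<le> norm (y - t *\<^sub>R h) + norm (t *\<^sub>R h)" using norm_triangle_ineq[of "y - t *\<^sub>R h" "t *\<^sub>R h"] by simp
          ultimately have "norm (y - t *\<^sub>R h) > R" "norm (y - t *\<^sub>R h) > R1" using that by auto
          then show ?thesis unfolding g'_def using R(2) R1 by simp
        qed
        show "norm (indicator {0..1} t *\<^sub>R (u y * g' y t)) \<le> norm (?B *\<^sub>R ((indicator (cball 0 ?R) y * indicator {0..1} t) *\<^sub>R u y))"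
        proof (cases "t \<in> {0..1} \<and> norm y \<le> ?R")
          case True
          then show ?thesis using g'b Bn by (auto simp: norm_mult mult.commute[of _ "norm (u y)"] intro!: mult_left_mono)
        next
          case False
          then show ?thesis using g'0 by (auto simp: indicator_def)
        qed
      qed
    qed
    have "(LINT x|lborel. F x * complex_of_real (\<phi> x)) = (LINT x|lborel. LINT t|lborel. K x t * complex_of_real (\<phi> x))"
      unfolding F_def by (simp add: integral_mult_left_zero)
    also have "\<dots> = (LINT t|lborel. LINT x|lborel. K x t * complex_of_real (\<phi> x))"
      by (rule lborel_pair.Fubini_integral[OF Kphi, symmetric])
    also have "\<dots> = (LINT t|lborel. LINT y|lborel. indicator {0..1} t *\<^sub>R (u y * g' y t))"
    proof (rule Bochner_Integration.integral_cong[OF refl])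
      fix t
      have "(LINT x|lborel. K x t * complex_of_real (\<phi> x)) = (LINT x|lborel. (indicator {0..1} t *\<^sub>R e t) * (v (x + t *\<^sub>R h) * complex_of_real (\<phi> x)))"
        by (simp add: K_def mult_ac)
      also have "\<dots> = (indicator {0..1} t *\<^sub>R e t) * (LINT x|lborel. v (x + t *\<^sub>R h) * complex_of_real (\<phi> x))"
        by (rule integral_mult_right_zero)
      also have "\<dots> = (LINT y|lborel. indicator {0..1} t *\<^sub>R (u y * g' y t))"
        unfolding inner by (subst integral_mult_right_zero[symmetric]) (simp add: g'_def mult_ac algebra_simps)
      finally show "(LINT x|lborel. K x t * complex_of_real (\<phi> x)) = (LINT y|lborel. indicator {0..1} t *\<^sub>R (u y * g' y t))" .
    qed
    also have "\<dots> = (LINT y|lborel. LINT t|lborel. indicator {0..1} t *\<^sub>R (u y * g' y t))"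
      by (rule lborel_pair.Fubini_integral[OF ug])
    also have "\<dots> = (LINT y|lborel. u y * (g y 1 - g y 0))"
    proof (rule Bochner_Integration.integral_cong[OF refl])
      fix y
      have "(LINT t|lborel. indicator {0..1} t *\<^sub>R (u y * g' y t)) = (LINT t|lborel. u y * (indicator {0..1} t *\<^sub>R g' y t))"
        by simp
      also have "\<dots> = u y * (g y 1 - g y 0)" by (simp only: integral_mult_right_zero FTC)
      finally show "(LINT t|lborel. indicator {0..1} t *\<^sub>R (u y * g' y t)) = u y * (g y 1 - g y 0)" .
    qed
    also have "\<dots> = (LINT y|lborel. e 1 * (u y * complex_of_real (\<phi> (y - h)))) - (LINT y|lborel. u y * complex_of_real (\<phi> y))"
    proof (subst Bochner_Integration.integral_diff[symmetric])
      show "integrable lborel (\<lambda>y. e 1 * (u y * complex_of_real (\<phi> (y - h))))"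
        using integrable_mult_test_fun[OF u tt[of 1]] by simp
      show "integrable lborel (\<lambda>y. u y * complex_of_real (\<phi> y))"
        by (rule integrable_mult_test_fun[OF u t])
      show "(LINT y|lborel. u y * (g y 1 - g y 0)) = (LINT y|lborel. e 1 * (u y * complex_of_real (\<phi> (y - h))) - u y * complex_of_real (\<phi> y))"
        by (simp add: g_def e_def algebra_simps)
    qed
    also have "(LINT y|lborel. e 1 * (u y * complex_of_real (\<phi> (y - h)))) = (LINT x|lborel. e 1 * u (h + x) * complex_of_real (\<phi> x))"
      by (subst integral_lborel_translate[where c=h, symmetric]) (auto simp: mult_ac)
    finally have FF: "(LINT x|lborel. F x * complex_of_real (\<phi> x)) = (LINT x|lborel. e 1 * u (h + x) * complex_of_real (\<phi> x)) - (LINT y|lborel. u y * complex_of_real (\<phi> y))" .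
    have "(LINT x|lborel. E x * complex_of_real (\<phi> x)) = (LINT x|lborel. (e 1 * (u (h + x) * complex_of_real (\<phi> x)) - u x * complex_of_real (\<phi> x)) - F x * complex_of_real (\<phi> x))"
      by (simp add: E_def algebra_simps)
    also have "\<dots> = ((LINT x|lborel. e 1 * (u (h + x) * complex_of_real (\<phi> x))) - (LINT x|lborel. u x * complex_of_real (\<phi> x))) - (LINT x|lborel. F x * complex_of_real (\<phi> x))"
      using integrable_mult_test_fun[OF uh t] integrable_mult_test_fun[OF u t] integrable_mult_test_fun[OF Floc t]
      by (subst Bochner_Integration.integral_diff; simp)+
    finally show "(LINT x|lborel. E x * complex_of_real (\<phi> x)) = 0"
      unfolding FF by (simp add: mult_ac)
  qed
  then show ?thesis
    by eventually_elim (simp add: E_def F_def K_def e_def v_def add.commute)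
qed

text \<open>The exceptional null set can be chosen independently of the phase, which is what allows
  the phase to depend on the base point below.\<close>

lemma segment_formula:
  fixes u :: "real ^ 'n::finite \<Rightarrow> complex" and h :: "real ^ 'n"
  assumes w: "wgrad u G"
  shows "AE x in lborel. \<forall>\<theta>. 
    integrable lborel (\<lambda>t. indicator {0..1} t *\<^sub>R (exp (- (\<i> * complex_of_real (t * \<theta>))) *
       (cdot h (G (x + t *\<^sub>R h)) - \<i> * complex_of_real \<theta> * u (x + t *\<^sub>R h)))) \<and>
    exp (- (\<i> * complex_of_real \<theta>)) * u (x + h) - u x =
    (LINT t|lborel. indicator {0..1} t *\<^sub>R (exp (- (\<i> * complex_of_real (t * \<theta>))) *
       (cdot h (G (x + t *\<^sub>R h)) - \<i> * complex_of_real \<theta> * u (x + t *\<^sub>R h))))"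
proof -
  have u: "loc_int u" and G: "loc_int G" using w by (auto simp: wgrad_def)
  note [measurable] = loc_int_measurable[OF u] loc_int_measurable[OF G]
  define k where "k = (\<lambda>x \<theta> t. indicator {0..1} t *\<^sub>R (exp (- (\<i> * complex_of_real (t * \<theta>))) *
       (cdot h (G (x + t *\<^sub>R h)) - \<i> * complex_of_real \<theta> * u (x + t *\<^sub>R h))))"
  have km[measurable]: "k x \<theta> \<in> borel_measurable borel" for x \<theta>
  proof -
    have [measurable]: "(\<lambda>t. exp (- (\<i> * complex_of_real (t * \<theta>)))) \<in> borel_measurable borel"
      by (intro borel_measurable_continuous_onI continuous_intros)
    show ?thesis unfolding k_def by measurable
  qed
  have nk: "norm (k x \<theta> t) \<le> norm h * norm (indicator {0..1} t *\<^sub>R G (x + t *\<^sub>R h)) + b * norm (indicator {0..1} t *\<^sub>R u (x + t *\<^sub>R h))"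
    if "\<bar>\<theta>\<bar> \<le> b" for x \<theta> t b
  proof -
    have "norm (cdot h (G (x + t *\<^sub>R h)) - \<i> * complex_of_real \<theta> * u (x + t *\<^sub>R h)) \<le> norm h * norm (G (x + t *\<^sub>R h)) + b * norm (u (x + t *\<^sub>R h))"
      using that by (intro order_trans[OF norm_triangle_ineq4] add_mono norm_cdot_le) (auto simp: norm_mult intro!: mult_right_mono)
    then show ?thesis
      unfolding k_def norm_scaleR norm_mult exp_bound by (auto simp: indicator_def)
  qed
  have "AE x in lborel. \<forall>\<theta>\<in>\<rat>. exp (- (\<i> * complex_of_real \<theta>)) * u (x + h) - u x = integral\<^sup>L lborel (k x \<theta>)"
    using segment_formula_fixed_phase[OF w, of _ h] unfolding k_def
    by (subst AE_ball_countable[OF countable_rat]) blast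
  with segment_AE_integrable[OF u, of h] segment_AE_integrable[OF G, of h]
  have "AE x in lborel. \<forall>\<theta>. integrable lborel (k x \<theta>) \<and> exp (- (\<i> * complex_of_real \<theta>)) * u (x + h) - u x = integral\<^sup>L lborel (k x \<theta>)"
  proof eventually_elim
    case (elim x)
    have dom: "integrable lborel (\<lambda>t. norm h * norm (indicator {0..1} t *\<^sub>R G (x + t *\<^sub>R h)) + b * norm (indicator {0..1} t *\<^sub>R u (x + t *\<^sub>R h)))" for b
      by (intro Bochner_Integration.integrable_add integrable_mult_right integrable_norm elim)
    show ?case
    proof (intro allI conjI)
      fix \<theta> :: real
      show "integrable lborel (k x \<theta>)"
      proof (rule Bochner_Integration.integrable_bound[OF dom[of "\<bar>\<theta>\<bar>"]])
        show "AE t in lborel. norm (k x \<theta> t) \<le> norm (norm h * norm (indicator {0..1} t *\<^sub>R G (x + t *\<^sub>R h)) + \<bar>\<theta>\<bar> * norm (indicator {0..1} t *\<^sub>R u (x + t *\<^sub>R h)))"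
          unfolding real_norm_def by (intro AE_I2 order_trans[OF nk abs_ge_self]) simp
      qed auto
      have "\<exists>q\<in>\<rat>. \<theta> < q \<and> q < \<theta> + inverse (real (Suc n))" for n
        by (rule Rats_dense_in_real) simp
      then obtain q where q: "\<And>n. q n \<in> \<rat>" "\<And>n. \<theta> < q n" "\<And>n. q n < \<theta> + inverse (real (Suc n))"
        by metis
      have ql: "q \<longlonglongrightarrow> \<theta>"
      proof (rule tendsto_sandwich[OF _ _ tendsto_const])
        show "(\<lambda>n. \<theta> + inverse (real (Suc n))) \<longlonglongrightarrow> \<theta>"
          using tendsto_add[OF tendsto_const[of \<theta>] LIMSEQ_inverse_real_of_nat] by simp
      qed (use q in \<open>auto intro!: always_eventually less_imp_le simp del: of_nat_Suc\<close>)
      have qb: "\<bar>q n\<bar> \<le> \<bar>\<theta>\<bar> + 1" for n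
      proof -
        have "inverse (real (Suc n)) \<le> 1" by (simp add: field_simps)
        then show ?thesis using q(2)[of n] q(3)[of n] by linarith
      qed
      have "(\<lambda>n. integral\<^sup>L lborel (k x (q n))) \<longlonglongrightarrow> integral\<^sup>L lborel (k x \<theta>)"
      proof (rule integral_dominated_convergence[OF _ _ dom[of "\<bar>\<theta>\<bar> + 1"]])
        show "AE t in lborel. (\<lambda>n. k x (q n) t) \<longlonglongrightarrow> k x \<theta> t"
          unfolding k_def by (intro AE_I2 tendsto_intros ql)
        show "AE t in lborel. norm (k x (q n) t) \<le> norm h * norm (indicator {0..1} t *\<^sub>R G (x + t *\<^sub>R h)) + (\<bar>\<theta>\<bar> + 1) * norm (indicator {0..1} t *\<^sub>R u (x + t *\<^sub>R h))" for n
          by (intro AE_I2 nk qb)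
      qed auto
      moreover have "(\<lambda>n. integral\<^sup>L lborel (k x (q n))) \<longlonglongrightarrow> exp (- (\<i> * complex_of_real \<theta>)) * u (x + h) - u x"
        unfolding elim(3)[rule_format, OF q(1), symmetric] by (intro tendsto_intros ql)
      ultimately show "exp (- (\<i> * complex_of_real \<theta>)) * u (x + h) - u x = integral\<^sup>L lborel (k x \<theta>)"
        using LIMSEQ_unique by blast
    qed
  qed
  then show ?thesis unfolding k_def .
qed

definition mdiff :: "(real ^ 'n::finite \<Rightarrow> real ^ 'n) \<Rightarrow> (real ^ 'n \<Rightarrow> complex) \<Rightarrow> real ^ 'n \<Rightarrow> real ^ 'n \<Rightarrow> complex" where
  "mdiff A u h x = exp (- (\<i> * complex_of_real (h \<bullet> A (x + h /\<^sub>R 2)))) * u (x + h) - u x"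

abbreviation local_mdiff_sq :: "(real ^ 'n::finite \<Rightarrow> real ^ 'n) \<Rightarrow> (real ^ 'n \<Rightarrow> complex) \<Rightarrow> real \<Rightarrow> real ^ 'n \<Rightarrow> ennreal" where
  "local_mdiff_sq A v R h \<equiv> \<integral>\<^sup>+x. indicator (cball 0 R) x * ennreal ((norm (mdiff A v h x))\<^sup>2) \<partial>lborel"

definition mgrad :: "(real ^ 'n::finite \<Rightarrow> real ^ 'n) \<Rightarrow> (real ^ 'n \<Rightarrow> complex) \<Rightarrow> (real ^ 'n \<Rightarrow> complex ^ 'n) \<Rightarrow> real ^ 'n \<Rightarrow> complex ^ 'n" where
  "mgrad A u G x = (\<chi> j. G x $ j - \<i> * complex_of_real (A x $ j) * u x)"

lemma cdot_mgrad: "cdot h (mgrad A u G y) = cdot h (G y) - \<i> * complex_of_real (h \<bullet> A y) * u y"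
  by (simp add: cdot_def mgrad_def inner_vec_def algebra_simps sum_subtractf sum_distrib_left sum_distrib_right)

text \<open>The midpoint is at distance at most \<open>norm h / 2\<close> from every point of the segment, which makes the
  error quadratic in \<open>h\<close>.\<close>

lemma lipschitz_phase:
  fixes A :: "real ^ 'n::finite \<Rightarrow> real ^ 'n"
  assumes L: "L-lipschitz_on UNIV A" and t: "0 \<le> t" "t \<le> 1"
  shows "\<bar>h \<bullet> A (x + t *\<^sub>R h) - h \<bullet> A (x + h /\<^sub>R 2)\<bar> \<le> L / 2 * (norm h)\<^sup>2"
proof -
  have "\<bar>h \<bullet> A (x + t *\<^sub>R h) - h \<bullet> A (x + h /\<^sub>R 2)\<bar> = \<bar>h \<bullet> (A (x + t *\<^sub>R h) - A (x + h /\<^sub>R 2))\<bar>"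
    by (simp add: inner_diff_right)
  also have "\<dots> \<le> norm h * norm (A (x + t *\<^sub>R h) - A (x + h /\<^sub>R 2))"
    by (rule Cauchy_Schwarz_ineq2)
  also have "\<dots> \<le> norm h * (L * dist (x + t *\<^sub>R h) (x + h /\<^sub>R 2))"
    using lipschitz_onD[OF L, of "x + t *\<^sub>R h" "x + h /\<^sub>R 2"] by (intro mult_left_mono) (auto simp: dist_norm)
  also have "dist (x + t *\<^sub>R h) (x + h /\<^sub>R 2) = \<bar>t - 1/2\<bar> * norm h"
  proof -
    have "x + t *\<^sub>R h - (x + h /\<^sub>R 2) = (t - 1/2) *\<^sub>R h" by (simp add: scaleR_diff_left)
    then show ?thesis unfolding dist_norm by simp
  qed
  also have "norm h * (L * (\<bar>t - 1/2\<bar> * norm h)) \<le> norm h * (L * (1 / 2 * norm h))"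
  proof -
    have "\<bar>t - 1/2\<bar> \<le> 1/2" using t unfolding abs_le_iff by auto
    then show ?thesis using lipschitz_on_nonneg[OF L] by (intro mult_left_mono mult_right_mono) auto
  qed
  finally show ?thesis by (simp add: power2_eq_square mult_ac)
qed

lemma lipschitz_phase_error:
  fixes A :: "real ^ 'n::finite \<Rightarrow> real ^ 'n"
  assumes L: "L-lipschitz_on UNIV A" and t: "0 \<le> t" "t \<le> 1"
  shows "norm (\<i> * complex_of_real (h \<bullet> A (x + t *\<^sub>R h) - h \<bullet> A (x + h /\<^sub>R 2)) * z) \<le> L / 2 * (norm h)\<^sup>2 * norm z"
  using mult_right_mono[OF lipschitz_phase[OF L t, of h x] norm_ge_zero[of z]]
  unfolding norm_mult norm_of_real by simp

text \<open>Freezing the phase at the value \<open>h \<bullet> A (x + h / 2)\<close> and letting it grow linearly along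
  the segment leaves an error that is quadratic in \<open>h\<close> with the Lipschitz constant of \<open>A\<close> as factor.\<close>

lemma mdiff_segment:
  fixes u :: "real ^ 'n::finite \<Rightarrow> complex" and h :: "real ^ 'n"
  assumes w: "wgrad u G"
  shows "AE x in lborel.
    integrable lborel (\<lambda>t. indicator {0..1} t *\<^sub>R (exp (- (\<i> * complex_of_real (t * (h \<bullet> A (x + h /\<^sub>R 2))))) *
       (cdot h (mgrad A u G (x + t *\<^sub>R h)) + \<i> * complex_of_real (h \<bullet> A (x + t *\<^sub>R h) - h \<bullet> A (x + h /\<^sub>R 2)) * u (x + t *\<^sub>R h)))) \<and>
    mdiff A u h x =
    (LINT t|lborel. indicator {0..1} t *\<^sub>R (exp (- (\<i> * complex_of_real (t * (h \<bullet> A (x + h /\<^sub>R 2))))) *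
       (cdot h (mgrad A u G (x + t *\<^sub>R h)) + \<i> * complex_of_real (h \<bullet> A (x + t *\<^sub>R h) - h \<bullet> A (x + h /\<^sub>R 2)) * u (x + t *\<^sub>R h))))"
  using segment_formula[OF w, of h]
proof eventually_elim
  case (elim x)
  have e: "cdot h (mgrad A u G (x + t *\<^sub>R h)) + \<i> * complex_of_real (h \<bullet> A (x + t *\<^sub>R h) - h \<bullet> A (x + h /\<^sub>R 2)) * u (x + t *\<^sub>R h)
    = cdot h (G (x + t *\<^sub>R h)) - \<i> * complex_of_real (h \<bullet> A (x + h /\<^sub>R 2)) * u (x + t *\<^sub>R h)" for t
    by (simp add: cdot_mgrad algebra_simps)
  show ?case unfolding e mdiff_def using elim by blast
qed

lemma norm_integral_le_nn_integral:
  fixes f :: "'a \<Rightarrow> 'b::{banach, second_countable_topology}"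
  shows "ennreal (norm (integral\<^sup>L M f)) \<le> (\<integral>\<^sup>+x. ennreal (norm (f x)) \<partial>M)"
  by (cases "integrable M f") (auto simp: integral_norm_bound_ennreal not_integrable_integral_eq)

lemma mdiff_bound:
  fixes u :: "real ^ 'n::finite \<Rightarrow> complex" and h :: "real ^ 'n"
  assumes w: "wgrad u G" and L: "L-lipschitz_on UNIV A"
  shows "AE x in lborel. ennreal (norm (mdiff A u h x)) \<le>
    (\<integral>\<^sup>+t. indicator {0..1} t * ennreal (norm h * norm (mgrad A u G (x + t *\<^sub>R h)) + L / 2 * (norm h)\<^sup>2 * norm (u (x + t *\<^sub>R h))) \<partial>lborel)"
  using mdiff_segment[OF w, of h A]
proof eventually_elim
  case (elim x)
  show ?case
    unfolding elim[THEN conjunct2]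
  proof (rule order_trans[OF norm_integral_le_nn_integral nn_integral_mono])
    fix t :: real
    have "norm (cdot h (mgrad A u G (x + t *\<^sub>R h)) + \<i> * complex_of_real (h \<bullet> A (x + t *\<^sub>R h) - h \<bullet> A (x + h /\<^sub>R 2)) * u (x + t *\<^sub>R h))
      \<le> norm h * norm (mgrad A u G (x + t *\<^sub>R h)) + L / 2 * (norm h)\<^sup>2 * norm (u (x + t *\<^sub>R h))" if "0 \<le> t" "t \<le> 1"
      by (intro order_trans[OF norm_triangle_ineq] add_mono norm_cdot_le lipschitz_phase_error L that)
    then show "ennreal (norm (indicator {0..1} t *\<^sub>R (exp (- (\<i> * complex_of_real (t * (h \<bullet> A (x + h /\<^sub>R 2))))) *
       (cdot h (mgrad A u G (x + t *\<^sub>R h)) + \<i> * complex_of_real (h \<bullet> A (x + t *\<^sub>R h) - h \<bullet> A (x + h /\<^sub>R 2)) * u (x + t *\<^sub>R h)))))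
      \<le> indicator {0..1} t * ennreal (norm h * norm (mgrad A u G (x + t *\<^sub>R h)) + L / 2 * (norm h)\<^sup>2 * norm (u (x + t *\<^sub>R h)))"
      unfolding norm_scaleR norm_mult exp_bound by (auto simp: indicator_def intro!: ennreal_leI)
  qed
qed

text \<open>The quotient by \<open>norm h\<close> of each of the three terms is small in the mean: the first by continuity of
  translations, the second by dominated convergence, the third because of the extra factor \<open>norm h\<close>.\<close>

lemma mdiff_approx:
  fixes u :: "real ^ 'n::finite \<Rightarrow> complex" and h :: "real ^ 'n"
  assumes w: "wgrad u G" and L: "L-lipschitz_on UNIV A"
  shows "AE x in lborel. ennreal (norm (mdiff A u h x - cdot h (mgrad A u G x))) \<le>
    (\<integral>\<^sup>+t. indicator {0..1} t * ennreal (norm h * norm (mgrad A u G (x + t *\<^sub>R h) - mgrad A u G x)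
       + norm h * norm (exp (- (\<i> * complex_of_real (t * (h \<bullet> A (x + h /\<^sub>R 2))))) - 1) * norm (mgrad A u G x)
       + L / 2 * (norm h)\<^sup>2 * norm (u (x + t *\<^sub>R h))) \<partial>lborel)"
  using mdiff_segment[OF w, of h A]
proof eventually_elim
  case (elim x)
  let ?g = "mgrad A u G"
  let ?e = "\<lambda>t. exp (- (\<i> * complex_of_real (t * (h \<bullet> A (x + h /\<^sub>R 2)))))"
  let ?k = "\<lambda>t. indicator {0..1} t *\<^sub>R (?e t *
       (cdot h (?g (x + t *\<^sub>R h)) + \<i> * complex_of_real (h \<bullet> A (x + t *\<^sub>R h) - h \<bullet> A (x + h /\<^sub>R 2)) * u (x + t *\<^sub>R h)))"
  have c: "(LINT t|lborel. indicator {0..1::real} t *\<^sub>R cdot h (?g x)) = cdot h (?g x)"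
    by simp
  have "mdiff A u h x - cdot h (?g x) = integral\<^sup>L lborel ?k - (LINT t|lborel. indicator {0..1::real} t *\<^sub>R cdot h (?g x))"
    unfolding c using elim by simp
  also have "\<dots> = (LINT t|lborel. ?k t - indicator {0..1} t *\<^sub>R cdot h (?g x))"
    by (rule Bochner_Integration.integral_diff[symmetric]) (use elim in auto)
  finally have eq: "mdiff A u h x - cdot h (?g x) = (LINT t|lborel. ?k t - indicator {0..1} t *\<^sub>R cdot h (?g x))" .
  show ?case
    unfolding eq
  proof (rule order_trans[OF norm_integral_le_nn_integral nn_integral_mono])
    fix t :: real
    have "norm (?e t * (cdot h (?g (x + t *\<^sub>R h)) + \<i> * complex_of_real (h \<bullet> A (x + t *\<^sub>R h) - h \<bullet> A (x + h /\<^sub>R 2)) * u (x + t *\<^sub>R h)) - cdot h (?g x))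
      \<le> norm h * norm (?g (x + t *\<^sub>R h) - ?g x) + norm h * norm (?e t - 1) * norm (?g x) + L / 2 * (norm h)\<^sup>2 * norm (u (x + t *\<^sub>R h))"
      if t: "0 \<le> t" "t \<le> 1"
    proof -
      have split: "?e t * (cdot h (?g (x + t *\<^sub>R h)) + \<i> * complex_of_real (h \<bullet> A (x + t *\<^sub>R h) - h \<bullet> A (x + h /\<^sub>R 2)) * u (x + t *\<^sub>R h)) - cdot h (?g x)
        = (?e t * cdot h (?g (x + t *\<^sub>R h) - ?g x) + (?e t - 1) * cdot h (?g x)) + ?e t * (\<i> * complex_of_real (h \<bullet> A (x + t *\<^sub>R h) - h \<bullet> A (x + h /\<^sub>R 2)) * u (x + t *\<^sub>R h))"
        by (simp add: cdot_diff algebra_simps)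
      have 1: "norm (?e t * cdot h (?g (x + t *\<^sub>R h) - ?g x)) \<le> norm h * norm (?g (x + t *\<^sub>R h) - ?g x)"
        unfolding norm_mult exp_bound by (simp add: norm_cdot_le)
      have 2: "norm ((?e t - 1) * cdot h (?g x)) \<le> norm h * norm (?e t - 1) * norm (?g x)"
        using mult_left_mono[OF norm_cdot_le[of h "?g x"], of "norm (?e t - 1)"] by (simp add: norm_mult mult_ac)
      have 3: "norm (?e t * (\<i> * complex_of_real (h \<bullet> A (x + t *\<^sub>R h) - h \<bullet> A (x + h /\<^sub>R 2)) * u (x + t *\<^sub>R h))) \<le> L / 2 * (norm h)\<^sup>2 * norm (u (x + t *\<^sub>R h))"
        using lipschitz_phase_error[OF L t, of h x "u (x + t *\<^sub>R h)"] unfolding norm_mult[of "?e t"] exp_bound mult_1 .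
      show ?thesis
        unfolding split by (intro order_trans[OF norm_triangle_ineq] add_mono 1 2 3)
    qed
    then show "ennreal (norm (?k t - indicator {0..1} t *\<^sub>R cdot h (?g x)))
      \<le> indicator {0..1} t * ennreal (norm h * norm (?g (x + t *\<^sub>R h) - ?g x) + norm h * norm (?e t - 1) * norm (?g x) + L / 2 * (norm h)\<^sup>2 * norm (u (x + t *\<^sub>R h)))"
      by (auto simp: indicator_def intro!: ennreal_leI)
  qed
qed

section \<open>The upper bound\<close>

lemma lipschitz_measurable:
  assumes "L-lipschitz_on UNIV (A :: real^'n::finite \<Rightarrow> real ^ 'm::finite)"
  shows "A \<in> borel_measurable borel"
  using lipschitz_on_continuous_on[OF assms] by (rule borel_measurable_continuous_onI)

lemma mdiff_measurable2:
  assumes [measurable]: "u \<in> borel_measurable borel" "A \<in> borel_measurable borel"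
  shows "(\<lambda>p. mdiff A u (fst p) (snd p)) \<in> borel_measurable (borel \<Otimes>\<^sub>M borel)"
proof -
  have [measurable]: "(\<lambda>s. exp (- (\<i> * complex_of_real s))) \<in> borel_measurable borel"
    by (intro borel_measurable_continuous_onI continuous_intros)
  show ?thesis unfolding mdiff_def by measurable
qed

lemma mdiff_measurable [measurable]:
  assumes [measurable]: "u \<in> borel_measurable borel" "A \<in> borel_measurable borel"
    "f \<in> borel_measurable M" "g \<in> borel_measurable M"
  shows "(\<lambda>x. mdiff A u (f x) (g x)) \<in> borel_measurable M"
  using measurable_compose[of "\<lambda>x. (f x, g x)" M "borel \<Otimes>\<^sub>M borel", OF _ mdiff_measurable2[OF assms(1,2)]]
  by simp

definition superlevel :: "(real ^ 'n::finite \<Rightarrow> real ^ 'n) \<Rightarrow> (real ^ 'n \<Rightarrow> complex) \<Rightarrow> real \<Rightarrow> real ^ 'n \<Rightarrow> ennreal" where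
  "superlevel A u \<delta> h = emeasure lborel {x. \<delta> < norm (mdiff A u h x)}"

lemma superlevel_measurable [measurable]:
  assumes [measurable]: "u \<in> borel_measurable borel" "A \<in> borel_measurable borel"
  shows "superlevel A u \<delta> \<in> borel_measurable borel"
proof -
  have "(\<lambda>h. emeasure lborel (Pair h -` {p. \<delta> < norm (mdiff A u (fst p) (snd p))})) \<in> borel_measurable lborel"
  proof (rule lborel.measurable_emeasure_Pair)
    have "{p \<in> space (lborel \<Otimes>\<^sub>M lborel). \<delta> < norm (mdiff A u (fst p) (snd p))} \<in> sets (lborel \<Otimes>\<^sub>M lborel)"
      by measurable
    then show "{p. \<delta> < norm (mdiff A u (fst p) (snd p))} \<in> sets (lborel \<Otimes>\<^sub>M lborel)"
      by (simp add: space_pair_measure)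
  qed
  then show ?thesis by (simp add: superlevel_def[abs_def] vimage_def)
qed

lemma Psi_diff: "norm (Psi A u x (x + h) - Psi A u x x) = norm (mdiff A u h x)"
proof -
  have "(x + (x + h)) /\<^sub>R 2 = x + h /\<^sub>R 2"
    by (simp add: vec_eq_iff field_simps)
  then show ?thesis by (simp add: Psi_def mdiff_def)
qed

lemma J_eq_superlevel:
  fixes u :: "real ^ 'n::finite \<Rightarrow> complex"
  assumes [measurable]: "u \<in> borel_measurable borel" "A \<in> borel_measurable borel"
  shows "J A \<delta> u = (\<integral>\<^sup>+h. ennreal (\<delta>\<^sup>2 / norm h ^ (CARD('n) + 2)) * superlevel A u \<delta> h \<partial>lborel)"
proof -
  have [measurable]: "(\<lambda>s. exp (\<i> * complex_of_real s)) \<in> borel_measurable borel"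
    by (intro borel_measurable_continuous_onI continuous_intros)
  define f :: "real^'n \<Rightarrow> real^'n \<Rightarrow> ennreal" where "f = (\<lambda>x y. ennreal (\<delta>\<^sup>2 / norm (x - y) ^ (CARD('n) + 2)) *
     (if \<delta> < norm (Psi A u x y - Psi A u x x) then 1 else 0))"
  have fm[measurable]: "(\<lambda>p. f (fst p) (snd p)) \<in> borel_measurable (lborel \<Otimes>\<^sub>M lborel)"
    unfolding f_def Psi_def by measurable
  have "J A \<delta> u = (\<integral>\<^sup>+p. f (fst p) (snd p) \<partial>lborel)"
    unfolding J_def nn_integral_completion
    by (intro nn_integral_cong) (auto simp: f_def indicator_def)
  also have "\<dots> = (\<integral>\<^sup>+p. f (fst p) (snd p) \<partial>(lborel \<Otimes>\<^sub>M lborel))"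
    by (simp add: lborel_prod)
  also have "\<dots> = (\<integral>\<^sup>+x. \<integral>\<^sup>+y. f x y \<partial>lborel \<partial>lborel)"
    by (subst lborel.nn_integral_fst[symmetric]) (auto intro: fm)
  also have "\<dots> = (\<integral>\<^sup>+x. \<integral>\<^sup>+h. f x (x + h) \<partial>lborel \<partial>lborel)"
  proof (rule nn_integral_cong)
    fix x :: "real^'n"
    have "f x \<in> borel_measurable borel" using measurable_Pair2[OF fm, of x] by simp
    then show "(\<integral>\<^sup>+y. f x y \<partial>lborel) = (\<integral>\<^sup>+h. f x (x + h) \<partial>lborel)"
      by (rule nn_integral_lborel_translate[symmetric])
  qed
  also have "\<dots> = (\<integral>\<^sup>+x. \<integral>\<^sup>+h. ennreal (\<delta>\<^sup>2 / norm h ^ (CARD('n) + 2)) * indicator {x. \<delta> < norm (mdiff A u h x)} x \<partial>lborel \<partial>lborel)"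
    by (intro nn_integral_cong) (simp add: f_def Psi_diff indicator_def)
  also have "\<dots> = (\<integral>\<^sup>+h. \<integral>\<^sup>+x. ennreal (\<delta>\<^sup>2 / norm h ^ (CARD('n) + 2)) * indicator {x. \<delta> < norm (mdiff A u h x)} x \<partial>lborel \<partial>lborel)"
    by (rule lborel_pair.Fubini') measurable
  also have "\<dots> = (\<integral>\<^sup>+h. ennreal (\<delta>\<^sup>2 / norm h ^ (CARD('n) + 2)) * superlevel A u \<delta> h \<partial>lborel)"
    unfolding superlevel_def
    by (intro nn_integral_cong, subst nn_integral_cmult) (auto simp: nn_integral_indicator)
  finally show ?thesis .
qed

text \<open>The contribution of the points where \<open>f\<close> lies below \<open>\<delta> / (2 * norm h)\<close> to the integral
  along a segment of length \<open>norm h\<close> is at most \<open>\<delta> / 2\<close>, so the values above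
  this level contribute the rest, and Chebyshev's inequality is applied to them alone.\<close>

lemma segment_superlevel:
  fixes f :: "'a::euclidean_space \<Rightarrow> real"
  assumes [measurable]: "f \<in> borel_measurable borel" and f0: "\<And>x. 0 \<le> f x" and \<delta>: "\<delta> > 0"
  shows "emeasure lborel {x. ennreal \<delta> < (\<integral>\<^sup>+t. indicator {0..1} t * ennreal (norm h * f (x + t *\<^sub>R h)) \<partial>lborel)}
    \<le> ennreal (2 * norm h / \<delta>) * (\<integral>\<^sup>+x. ennreal (f x) * indicator {x. \<delta> < 2 * norm h * f x} x \<partial>lborel)"
proof -
  let ?I = "\<lambda>x. \<integral>\<^sup>+t. indicator {0..1} t * ennreal (norm h * f (x + t *\<^sub>R h)) \<partial>lborel"
  define f1 where "f1 = (\<lambda>x. if \<delta> < 2 * norm h * f x then f x else 0)"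
  have f10: "f1 x \<ge> 0" for x using f0 by (simp add: f1_def)
  have [measurable]: "f1 \<in> borel_measurable borel" unfolding f1_def by measurable
  let ?I1 = "\<lambda>x. \<integral>\<^sup>+t. indicator {0..1} t * ennreal (norm h * f1 (x + t *\<^sub>R h)) \<partial>lborel"
  have pt: "?I x \<le> ?I1 x + ennreal (\<delta> / 2)" for x
  proof -
    have "?I x \<le> (\<integral>\<^sup>+t. indicator {0..1} t * ennreal (norm h * f1 (x + t *\<^sub>R h)) + indicator {0..1} t * ennreal (\<delta> / 2) \<partial>lborel)" (is "nn_integral _ ?l1 \<le> nn_integral _ ?r1")
    proof (rule nn_integral_mono)
      fix t :: real
      have "norm h * f (x + t *\<^sub>R h) \<le> norm h * f1 (x + t *\<^sub>R h) + \<delta> / 2"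
        using \<delta> by (auto simp: f1_def not_less)
      then have "ennreal (norm h * f (x + t *\<^sub>R h)) \<le> ennreal (norm h * f1 (x + t *\<^sub>R h) + \<delta> / 2)"
        by (rule ennreal_leI)
      also have "\<dots> = ennreal (norm h * f1 (x + t *\<^sub>R h)) + ennreal (\<delta> / 2)"
        using f10 \<delta> by (intro ennreal_plus) auto
      finally have "ennreal (norm h * f (x + t *\<^sub>R h)) \<le> ennreal (norm h * f1 (x + t *\<^sub>R h)) + ennreal (\<delta> / 2)" .
      then show "?l1 t \<le> ?r1 t"
        by (auto simp: indicator_def)
    qed
    also have "\<dots> = ?I1 x + ennreal (\<delta> / 2)"
      by (subst nn_integral_add) (auto simp: nn_integral_multc)
    finally show ?thesis .
  qed
  have [measurable]: "?I \<in> borel_measurable borel" "?I1 \<in> borel_measurable borel" by measurable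
  have "emeasure lborel {x. ennreal \<delta> < ?I x} = (\<integral>\<^sup>+x. indicator {x. ennreal \<delta> < ?I x} x \<partial>lborel)"
    by (subst nn_integral_indicator) auto
  also have "\<dots> \<le> (\<integral>\<^sup>+x. ennreal (2 / \<delta>) * ?I1 x \<partial>lborel)"
  proof (rule nn_integral_mono)
    fix x
    show "indicator {x. ennreal \<delta> < ?I x} x \<le> ennreal (2 / \<delta>) * ?I1 x"
    proof (cases "ennreal \<delta> < ?I x")
      case True
      have "ennreal (\<delta> / 2) \<le> ?I1 x"
      proof (rule ccontr)
        assume "\<not> ennreal (\<delta> / 2) \<le> ?I1 x"
        then have "?I1 x + ennreal (\<delta> / 2) \<le> ennreal (\<delta> / 2) + ennreal (\<delta> / 2)"
          by (intro add_mono) auto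
        also have "\<dots> = ennreal \<delta>" using \<delta> by (simp flip: ennreal_plus)
        finally show False using pt[of x] True by simp
      qed
      then have "ennreal (2 / \<delta>) * ennreal (\<delta> / 2) \<le> ennreal (2 / \<delta>) * ?I1 x"
        by (rule mult_left_mono) simp
      then show ?thesis using True \<delta> by (simp flip: ennreal_mult)
    qed simp
  qed
  also have "\<dots> = ennreal (2 / \<delta>) * (\<integral>\<^sup>+x. ?I1 x \<partial>lborel)"
    by (rule nn_integral_cmult) measurable
  also have "(\<integral>\<^sup>+x. ?I1 x \<partial>lborel) = (\<integral>\<^sup>+t. \<integral>\<^sup>+x. indicator {0..1} t * ennreal (norm h * f1 (x + t *\<^sub>R h)) \<partial>lborel \<partial>(lborel::real measure))"
    by (rule lborel_pair.Fubini') measurable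
  also have "\<dots> = (\<integral>\<^sup>+t. indicator {0..1} t * (\<integral>\<^sup>+x. ennreal (norm h * f1 x) \<partial>lborel) \<partial>(lborel::real measure))" (is "nn_integral _ ?a1 = nn_integral _ ?b1")
  proof (rule nn_integral_cong)
    fix t :: real
    have "(\<integral>\<^sup>+x. ennreal (norm h * f1 (x + t *\<^sub>R h)) \<partial>lborel) = (\<integral>\<^sup>+x. ennreal (norm h * f1 x) \<partial>lborel)"
      using nn_integral_lborel_translate[of "\<lambda>x. ennreal (norm h * f1 x)" "t *\<^sub>R h"] by (simp add: add.commute)
    then show "?a1 t = ?b1 t"
      by (simp add: nn_integral_cmult)
  qed
  also have "\<dots> = (\<integral>\<^sup>+x. ennreal (norm h * f1 x) \<partial>lborel)"
    by (subst nn_integral_multc) auto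
  also have "\<dots> = ennreal (norm h) * (\<integral>\<^sup>+x. ennreal (f x) * indicator {x. \<delta> < 2 * norm h * f x} x \<partial>lborel)"
    by (subst nn_integral_cmult[symmetric]) (auto simp: f1_def ennreal_mult' indicator_def intro!: nn_integral_cong)
  also have "ennreal (2 / \<delta>) * (ennreal (norm h) * (\<integral>\<^sup>+x. ennreal (f x) * indicator {x. \<delta> < 2 * norm h * f x} x \<partial>lborel)) =
     ennreal (2 * norm h / \<delta>) * (\<integral>\<^sup>+x. ennreal (f x) * indicator {x. \<delta> < 2 * norm h * f x} x \<partial>lborel)"
    using \<delta> by (simp add: mult.assoc[symmetric] flip: ennreal_mult)
  finally show ?thesis .
qed

text \<open>By Fubini: for fixed \<open>x\<close> the integral of \<open>\<delta> / norm h ^ (N + 1)\<close> over \<open>norm h > \<delta> / (2 * f x)\<close> is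
  proportional to \<open>f x\<close>, independently of \<open>\<delta>\<close>.\<close>

lemma nn_integral_truncated_tail:
  fixes f :: "real^'n::finite \<Rightarrow> real"
  assumes [measurable]: "f \<in> borel_measurable borel" and f0: "\<And>x. 0 \<le> f x" and \<delta>: "\<delta> > 0"
  shows "(\<integral>\<^sup>+h. ennreal (\<delta>\<^sup>2 / norm h ^ (CARD('n) + 2)) *
      (ennreal (2 * norm h / \<delta>) * (\<integral>\<^sup>+x. ennreal (f x) * indicator {x. \<delta> < 2 * norm h * f x} x \<partial>lborel)) \<partial>(lborel :: (real^'n) measure))
    = ennreal (4 * CARD('n) * ball_vol TYPE('n)) * (\<integral>\<^sup>+x. ennreal ((f x)\<^sup>2) \<partial>lborel)"
proof -
  let ?N = "CARD('n)"
  have "(\<integral>\<^sup>+h. ennreal (\<delta>\<^sup>2 / norm h ^ (?N + 2)) *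
      (ennreal (2 * norm h / \<delta>) * (\<integral>\<^sup>+x. ennreal (f x) * indicator {x. \<delta> < 2 * norm h * f x} x \<partial>lborel)) \<partial>(lborel :: (real^'n) measure))
    = (\<integral>\<^sup>+h. \<integral>\<^sup>+x. ennreal (2 * \<delta> * f x) * (ennreal (1 / norm h ^ (?N + 1)) * (if \<delta> < 2 * norm h * f x then 1 else 0)) \<partial>lborel \<partial>(lborel :: (real^'n) measure))"
  proof (rule nn_integral_cong)
    fix h :: "real^'n"
    have c: "ennreal (\<delta>\<^sup>2 / norm h ^ (?N + 2)) * ennreal (2 * norm h / \<delta>) = ennreal (2 * \<delta>) * ennreal (1 / norm h ^ (?N + 1))"
    proof (cases "h = 0")
      case False
      then have "\<delta>\<^sup>2 / norm h ^ (?N + 2) * (2 * norm h / \<delta>) = 2 * \<delta> * (1 / norm h ^ (?N + 1))"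
        using \<delta> by (simp add: field_simps power2_eq_square)
      then show ?thesis using \<delta> by (simp flip: ennreal_mult)
    qed simp
    have "ennreal (\<delta>\<^sup>2 / norm h ^ (?N + 2)) * (ennreal (2 * norm h / \<delta>) * (\<integral>\<^sup>+x. ennreal (f x) * indicator {x. \<delta> < 2 * norm h * f x} x \<partial>lborel))
      = (ennreal (2 * \<delta>) * ennreal (1 / norm h ^ (?N + 1))) * (\<integral>\<^sup>+x. ennreal (f x) * indicator {x. \<delta> < 2 * norm h * f x} x \<partial>lborel)"
      by (simp only: c mult.assoc[symmetric])
    also have "\<dots> = (\<integral>\<^sup>+x. (ennreal (2 * \<delta>) * ennreal (1 / norm h ^ (?N + 1))) * (ennreal (f x) * indicator {x. \<delta> < 2 * norm h * f x} x) \<partial>lborel)"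
      by (rule nn_integral_cmult[symmetric]) measurable
    also have "\<dots> = (\<integral>\<^sup>+x. ennreal (2 * \<delta> * f x) * (ennreal (1 / norm h ^ (?N + 1)) * (if \<delta> < 2 * norm h * f x then 1 else 0)) \<partial>lborel)"
      using \<delta> f0 by (intro nn_integral_cong) (auto simp: ennreal_mult mult_ac)
    finally show "ennreal (\<delta>\<^sup>2 / norm h ^ (?N + 2)) * (ennreal (2 * norm h / \<delta>) * (\<integral>\<^sup>+x. ennreal (f x) * indicator {x. \<delta> < 2 * norm h * f x} x \<partial>lborel))
      = (\<integral>\<^sup>+x. ennreal (2 * \<delta> * f x) * (ennreal (1 / norm h ^ (?N + 1)) * (if \<delta> < 2 * norm h * f x then 1 else 0)) \<partial>lborel)" .
  qed
  also have "\<dots> = (\<integral>\<^sup>+x. \<integral>\<^sup>+h. ennreal (2 * \<delta> * f x) * (ennreal (1 / norm h ^ (?N + 1)) * (if \<delta> < 2 * norm h * f x then 1 else 0)) \<partial>(lborel :: (real^'n) measure) \<partial>lborel)"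
    by (rule lborel_pair.Fubini') measurable
  also have "\<dots> = (\<integral>\<^sup>+x. ennreal (4 * ?N * ball_vol TYPE('n)) * ennreal ((f x)\<^sup>2) \<partial>lborel)" (is "nn_integral _ ?a1 = nn_integral _ ?b1")
  proof (rule nn_integral_cong)
    fix x
    show "?a1 x = ?b1 x"
    proof (cases "f x = 0")
      case False
      then have fx: "f x > 0" using f0[of x] by simp
      have "(\<integral>\<^sup>+h. ennreal (2 * \<delta> * f x) * (ennreal (1 / norm h ^ (?N + 1)) * (if \<delta> < 2 * norm h * f x then 1 else 0)) \<partial>(lborel :: (real^'n) measure))
        = ennreal (2 * \<delta> * f x) * (\<integral>\<^sup>+h. indicator {h. norm h > \<delta> / (2 * f x)} h * ennreal (1 / norm h ^ (?N + 1)) \<partial>(lborel :: (real^'n) measure))"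
        by (subst nn_integral_cmult[symmetric])
           (use fx in \<open>auto intro!: nn_integral_cong simp: indicator_def field_simps\<close>)
      also have "\<dots> = ennreal (2 * \<delta> * f x) * ennreal (?N * ball_vol TYPE('n) / (1 * (\<delta> / (2 * f x)) ^ 1))"
        by (subst nn_integral_norm_tail) (use fx \<delta> in auto)
      also have "\<dots> = ennreal (4 * ?N * ball_vol TYPE('n) * (f x)\<^sup>2)"
        using fx \<delta> ball_vol_pos[where 'n='n]
        by (subst ennreal_mult[symmetric]) (auto simp: field_simps power2_eq_square)
      finally show ?thesis using ball_vol_pos[where 'n='n] by (simp add: ennreal_mult)
    qed simp
  qed
  also have "\<dots> = ennreal (4 * ?N * ball_vol TYPE('n)) * (\<integral>\<^sup>+x. ennreal ((f x)\<^sup>2) \<partial>lborel)"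
    by (rule nn_integral_cmult) measurable
  finally show ?thesis .
qed

lemma wgrad_measurable:
  assumes "wgrad u G"
  shows "u \<in> borel_measurable borel" "G \<in> borel_measurable borel"
  using assms by (auto simp: wgrad_def loc_int_measurable)

lemma borel_measurable_vec_lambda:
  fixes f :: "'n::finite \<Rightarrow> 'a \<Rightarrow> complex"
  assumes "\<And>j. f j \<in> borel_measurable M"
  shows "(\<lambda>x. \<chi> j. f j x) \<in> borel_measurable M"
proof (rule borel_measurable_euclidean_space[THEN iffD2], rule ballI)
  fix i :: "complex ^ 'n" assume "i \<in> Basis"
  then obtain k b where i: "i = axis k b" by (auto simp: Basis_vec_def)
  show "(\<lambda>x. (\<chi> j. f j x) \<bullet> i) \<in> borel_measurable M"
    using assms unfolding i by (simp add: inner_axis)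
qed

lemma mgrad_measurable:
  assumes "u \<in> borel_measurable borel" "G \<in> borel_measurable borel" "A \<in> borel_measurable borel"
  shows "mgrad A u G \<in> borel_measurable borel"
  unfolding mgrad_def[abs_def]
proof (rule borel_measurable_vec_lambda)
  fix j
  have "(\<lambda>x. G x $ j) \<in> borel_measurable borel" "(\<lambda>x. A x $ j) \<in> borel_measurable borel"
    using assms by (auto intro: measurable_compose[OF _ borel_measurable_vec_nth])
  then show "(\<lambda>x. G x $ j - \<i> * complex_of_real (A x $ j) * u x) \<in> borel_measurable borel"
    using assms(1) by measurable
qed

text \<open>For \<open>norm h \<le> 1\<close> the quadratic phase error is absorbed by \<open>L * norm (u x) * norm h\<close>, so one function
  times \<open>norm h\<close> dominates the integrand on every short segment.\<close>

definition grad_majorant :: "(real ^ 'n::finite \<Rightarrow> real ^ 'n) \<Rightarrow> (real ^ 'n \<Rightarrow> complex) \<Rightarrow> (real ^ 'n \<Rightarrow> complex ^ 'n) \<Rightarrow> real \<Rightarrow> real ^ 'n \<Rightarrow> real" where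
  "grad_majorant A u G L x = norm (mgrad A u G x) + L * norm (u x)"

lemma superlevel_near:
  fixes u :: "real ^ 'n::finite \<Rightarrow> complex"
  assumes w: "wgrad u G" and L: "L-lipschitz_on UNIV A" and h: "norm h \<le> 1" and \<delta>: "\<delta> > 0"
  shows "superlevel A u \<delta> h \<le> ennreal (2 * norm h / \<delta>) *
    (\<integral>\<^sup>+x. ennreal (grad_majorant A u G L x) * indicator {x. \<delta> < 2 * norm h * grad_majorant A u G L x} x \<partial>lborel)"
proof -
  note [measurable] = wgrad_measurable[OF w] lipschitz_measurable[OF L]
  have [measurable]: "mgrad A u G \<in> borel_measurable borel" by (rule mgrad_measurable) measurable
  let ?f = "grad_majorant A u G L"
  have L0: "L \<ge> 0" by (rule lipschitz_on_nonneg[OF L])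
  have [measurable]: "?f \<in> borel_measurable borel" unfolding grad_majorant_def[abs_def] by measurable
  have f0: "?f x \<ge> 0" for x using L0 by (simp add: grad_majorant_def)
  have "superlevel A u \<delta> h \<le> emeasure lborel {x. ennreal \<delta> < (\<integral>\<^sup>+t. indicator {0..1} t * ennreal (norm h * ?f (x + t *\<^sub>R h)) \<partial>lborel)}"
    unfolding superlevel_def
  proof (rule emeasure_mono_AE)
    show "AE x in lborel. x \<in> {x. \<delta> < norm (mdiff A u h x)} \<longrightarrow> x \<in> {x. ennreal \<delta> < (\<integral>\<^sup>+t. indicator {0..1} t * ennreal (norm h * ?f (x + t *\<^sub>R h)) \<partial>lborel)}"
      using mdiff_bound[OF w L, of h]
    proof eventually_elim
      case (elim x)
      have "(\<integral>\<^sup>+t. indicator {0..1} t * ennreal (norm h * norm (mgrad A u G (x + t *\<^sub>R h)) + L / 2 * (norm h)\<^sup>2 * norm (u (x + t *\<^sub>R h))) \<partial>lborel)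
        \<le> (\<integral>\<^sup>+t. indicator {0..1} t * ennreal (norm h * ?f (x + t *\<^sub>R h)) \<partial>lborel)"
      proof (intro nn_integral_mono mult_left_mono ennreal_leI)
        fix t :: real
        have "L / 2 * (norm h)\<^sup>2 \<le> L * norm h"
        proof -
          have "norm h * norm h \<le> norm h * 2" using h by (intro mult_left_mono) auto
          then have "L * (norm h * norm h) \<le> L * (norm h * 2)" using L0 by (rule mult_left_mono)
          then show ?thesis by (simp add: power2_eq_square)
        qed
        then have "L / 2 * (norm h)\<^sup>2 * norm (u (x + t *\<^sub>R h)) \<le> L * norm h * norm (u (x + t *\<^sub>R h))"
          by (rule mult_right_mono) simp
        then show "norm h * norm (mgrad A u G (x + t *\<^sub>R h)) + L / 2 * (norm h)\<^sup>2 * norm (u (x + t *\<^sub>R h)) \<le> norm h * ?f (x + t *\<^sub>R h)"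
          by (simp add: grad_majorant_def algebra_simps)
      qed simp
      from order_trans[OF elim this] show ?case
      proof (intro impI CollectI, elim CollectE)
        assume le: "ennreal (norm (mdiff A u h x)) \<le> (\<integral>\<^sup>+t. indicator {0..1} t * ennreal (norm h * ?f (x + t *\<^sub>R h)) \<partial>lborel)"
          and "\<delta> < norm (mdiff A u h x)"
        then have "ennreal \<delta> < ennreal (norm (mdiff A u h x))" using \<delta> by (intro ennreal_lessI) auto
        then show "ennreal \<delta> < (\<integral>\<^sup>+t. indicator {0..1} t * ennreal (norm h * ?f (x + t *\<^sub>R h)) \<partial>lborel)"
          using le by (rule order.strict_trans2)
      qed
    qed
  qed measurable
  also have "\<dots> \<le> ennreal (2 * norm h / \<delta>) * (\<integral>\<^sup>+x. ennreal (?f x) * indicator {x. \<delta> < 2 * norm h * ?f x} x \<partial>lborel)"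
    by (rule segment_superlevel) (use f0 \<delta> in auto)
  finally show ?thesis .
qed

text \<open>If \<open>norm (mdiff A u h x)\<close> exceeds \<open>\<delta>\<close>, one of \<open>norm (u x)\<close>, \<open>norm (u (x + h))\<close> exceeds \<open>\<delta> / 2\<close>.\<close>

lemma superlevel_far:
  fixes u :: "real ^ 'n::finite \<Rightarrow> complex"
  assumes [measurable]: "u \<in> borel_measurable borel" "A \<in> borel_measurable borel"
  shows "superlevel A u \<delta> h \<le> 2 * emeasure lborel {x. \<delta> / 2 < norm (u x)}"
proof -
  have "superlevel A u \<delta> h \<le> emeasure lborel ({x. \<delta> / 2 < norm (u x)} \<union> {x. \<delta> / 2 < norm (u (h + x))})"
    unfolding superlevel_def
  proof (rule emeasure_mono)
    show "{x. \<delta> < norm (mdiff A u h x)} \<subseteq> {x. \<delta> / 2 < norm (u x)} \<union> {x. \<delta> / 2 < norm (u (h + x))}"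
    proof
      fix x assume "x \<in> {x. \<delta> < norm (mdiff A u h x)}"
      moreover have "norm (mdiff A u h x) \<le> norm (u (h + x)) + norm (u x)"
        unfolding mdiff_def by (rule order_trans[OF norm_triangle_ineq4]) (simp add: norm_mult add.commute)
      ultimately show "x \<in> {x. \<delta> / 2 < norm (u x)} \<union> {x. \<delta> / 2 < norm (u (h + x))}" by auto
    qed
  qed measurable
  also have "\<dots> \<le> emeasure lborel {x. \<delta> / 2 < norm (u x)} + emeasure lborel {x. \<delta> / 2 < norm (u (h + x))}"
    by (rule emeasure_subadditive) auto
  also have "emeasure lborel {x. \<delta> / 2 < norm (u (h + x))} = emeasure lborel {x. \<delta> / 2 < norm (u x)}"
  proof -
    have "(\<integral>\<^sup>+x. indicator {x. \<delta> / 2 < norm (u x)} (h + x) \<partial>lborel) = (\<integral>\<^sup>+x. indicator {x. \<delta> / 2 < norm (u x)} x \<partial>lborel)"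
      by (rule nn_integral_lborel_translate) measurable
    moreover have "(\<integral>\<^sup>+x. indicator {x. \<delta> / 2 < norm (u x)} (h + x) \<partial>lborel) = (\<integral>\<^sup>+x. indicator {x. \<delta> / 2 < norm (u (h + x))} x \<partial>lborel)"
      by (intro nn_integral_cong) (auto simp: indicator_def)
    ultimately show ?thesis by simp
  qed
  finally show ?thesis by (simp add: mult_2)
qed

lemma emeasure_superlevel_sq:
  fixes u :: "'a::euclidean_space \<Rightarrow> complex"
  assumes [measurable]: "u \<in> borel_measurable borel" and c: "c > 0"
  shows "emeasure lborel {x. c < norm (u x)} \<le> ennreal (1 / c\<^sup>2) * L2_sq u"
proof -
  have "emeasure lborel {x. c < norm (u x)} = (\<integral>\<^sup>+x. indicator {x. c < norm (u x)} x \<partial>lborel)"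
    by (subst nn_integral_indicator) auto
  also have "\<dots> \<le> (\<integral>\<^sup>+x. ennreal (1 / c\<^sup>2) * ennreal ((norm (u x))\<^sup>2) \<partial>lborel)" (is "nn_integral _ ?a1 \<le> nn_integral _ ?b1")
  proof (rule nn_integral_mono)
    fix x
    have "1 \<le> 1 / c\<^sup>2 * (norm (u x))\<^sup>2" if "c < norm (u x)"
      using that c power_mono[of c "norm (u x)" 2] by (simp add: field_simps)
    then show "?a1 x \<le> ?b1 x"
      by (auto simp: indicator_def ennreal_mult[symmetric])
  qed
  also have "\<dots> = ennreal (1 / c\<^sup>2) * L2_sq u"
    by (rule nn_integral_cmult) measurable
  finally show ?thesis .
qed

lemma grad_majorant_sq:
  fixes u :: "real ^ 'n::finite \<Rightarrow> complex"
  assumes [measurable]: "u \<in> borel_measurable borel" "G \<in> borel_measurable borel" "A \<in> borel_measurable borel" and L: "L \<ge> 0"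
  shows "(\<integral>\<^sup>+x. ennreal ((grad_majorant A u G L x)\<^sup>2) \<partial>lborel) \<le>
    2 * L2_sq (mgrad A u G) + ennreal (2 * L\<^sup>2) * L2_sq u"
proof -
  have [measurable]: "mgrad A u G \<in> borel_measurable borel" by (rule mgrad_measurable) measurable
  have "(\<integral>\<^sup>+x. ennreal ((grad_majorant A u G L x)\<^sup>2) \<partial>lborel) \<le>
     (\<integral>\<^sup>+x. 2 * ennreal ((norm (mgrad A u G x))\<^sup>2) + ennreal (2 * L\<^sup>2) * ennreal ((norm (u x))\<^sup>2) \<partial>lborel)" (is "nn_integral _ ?l1 \<le> nn_integral _ ?r1")
  proof (rule nn_integral_mono)
    fix x
    have "(a + b)\<^sup>2 \<le> 2 * a\<^sup>2 + 2 * b\<^sup>2" for a b :: real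
      using zero_le_power2[of "a - b"] by (simp add: power2_eq_square algebra_simps)
    from this[of "norm (mgrad A u G x)" "L * norm (u x)"]
    have "(grad_majorant A u G L x)\<^sup>2 \<le> 2 * (norm (mgrad A u G x))\<^sup>2 + 2 * L\<^sup>2 * (norm (u x))\<^sup>2"
      by (simp add: grad_majorant_def power_mult_distrib)
    then have "ennreal ((grad_majorant A u G L x)\<^sup>2) \<le> ennreal (2 * (norm (mgrad A u G x))\<^sup>2 + 2 * L\<^sup>2 * (norm (u x))\<^sup>2)"
      by (rule ennreal_leI)
    then show "?l1 x \<le> ?r1 x"
      by (simp add: ennreal_mult)
  qed
  also have "\<dots> = 2 * L2_sq (mgrad A u G) + ennreal (2 * L\<^sup>2) * L2_sq u"
    by (subst nn_integral_add) (auto simp: nn_integral_cmult)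
  finally show ?thesis .
qed

text \<open>Short steps are controlled through the gradient, steps longer than one through \<open>u\<close> itself, where
  the weight is integrable at infinity.\<close>

lemma J_upper_bound:
  fixes u :: "real ^ 'n::finite \<Rightarrow> complex"
  assumes w: "wgrad u G" and L: "L-lipschitz_on UNIV A" and \<delta>: "\<delta> > 0"
  shows "J A \<delta> u \<le> ennreal (8 * CARD('n) * ball_vol TYPE('n)) *
    (L2_sq (mgrad A u G) + ennreal (L\<^sup>2 + 1) * L2_sq u)"
proof -
  note [measurable] = wgrad_measurable[OF w] lipschitz_measurable[OF L]
  have L0: "L \<ge> 0" by (rule lipschitz_on_nonneg[OF L])
  have [measurable]: "mgrad A u G \<in> borel_measurable borel" by (rule mgrad_measurable) measurable
  let ?N = "CARD('n)" and ?f = "grad_majorant A u G L"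
  have [measurable]: "?f \<in> borel_measurable borel" unfolding grad_majorant_def[abs_def] by measurable
  have f0: "?f x \<ge> 0" for x using L0 by (simp add: grad_majorant_def)
  let ?E = "\<integral>\<^sup>+x. ennreal ((norm (mgrad A u G x))\<^sup>2) \<partial>lborel" and ?S = "\<integral>\<^sup>+x. ennreal ((norm (u x))\<^sup>2) \<partial>lborel"
  let ?W = "\<lambda>h. ennreal (2 * norm h / \<delta>) * (\<integral>\<^sup>+x. ennreal (?f x) * indicator {x. \<delta> < 2 * norm h * ?f x} x \<partial>lborel)"
  have "J A \<delta> u = (\<integral>\<^sup>+h. ennreal (\<delta>\<^sup>2 / norm h ^ (?N + 2)) * superlevel A u \<delta> h \<partial>lborel)"
    by (rule J_eq_superlevel) measurable
  also have "\<dots> \<le> (\<integral>\<^sup>+h. ennreal (\<delta>\<^sup>2 / norm h ^ (?N + 2)) * ?W h + indicator {h. norm h > 1} h * ennreal (1 / norm h ^ (?N + 2)) * (8 * ?S) \<partial>(lborel::(real^'n) measure))" (is "nn_integral _ ?l1 \<le> nn_integral _ ?r1")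
  proof (rule nn_integral_mono)
    fix h :: "real^'n"
    show "?l1 h \<le> ?r1 h"
    proof (cases "norm h \<le> 1")
      case True
      then show ?thesis
        by (intro order_trans[OF mult_left_mono[OF superlevel_near[OF w L True \<delta>]]]) auto
    next
      case False
      have "superlevel A u \<delta> h \<le> 2 * (ennreal (1 / (\<delta> / 2)\<^sup>2) * ?S)"
        by (rule order_trans[OF superlevel_far mult_left_mono[OF emeasure_superlevel_sq]]) (use \<delta> in auto)
      then have "ennreal (\<delta>\<^sup>2 / norm h ^ (?N + 2)) * superlevel A u \<delta> h \<le> ennreal (\<delta>\<^sup>2 / norm h ^ (?N + 2)) * (2 * (ennreal (1 / (\<delta> / 2)\<^sup>2) * ?S))"
        by (rule mult_left_mono) simp
      also have "\<dots> = (ennreal (\<delta>\<^sup>2 / norm h ^ (?N + 2)) * ennreal (2 * (1 / (\<delta> / 2)\<^sup>2))) * ?S"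
      proof -
        have "2 * ennreal (1 / (\<delta> / 2)\<^sup>2) = ennreal (2 * (1 / (\<delta> / 2)\<^sup>2))"
          by (subst ennreal_mult') (simp_all add: ennreal_numeral)
        show ?thesis unfolding \<open>2 * ennreal (1 / (\<delta> / 2)\<^sup>2) = ennreal (2 * (1 / (\<delta> / 2)\<^sup>2))\<close>[symmetric] by (simp only: mult_ac)
      qed
      also have "ennreal (\<delta>\<^sup>2 / norm h ^ (?N + 2)) * ennreal (2 * (1 / (\<delta> / 2)\<^sup>2)) = ennreal (1 / norm h ^ (?N + 2) * 8)"
        using \<delta> by (subst ennreal_mult[symmetric]) (auto simp: field_simps)
      also have "\<dots> * ?S = indicator {h. norm h > 1} h * ennreal (1 / norm h ^ (?N + 2)) * (8 * ?S)"
      proof -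
        have e8: "ennreal (1 / norm h ^ (?N + 2) * 8) = ennreal (1 / norm h ^ (?N + 2)) * 8"
          using ennreal_mult''[of 8 "1 / norm h ^ (?N + 2)"] by simp
        have i1: "indicator {h. norm h > 1} h = (1::ennreal)" using False by simp
        show ?thesis unfolding e8 i1 by (simp only: mult_ac mult_1_left)
      qed
      finally show ?thesis by (simp add: add_increasing)
    qed
  qed
  also have "\<dots> = ennreal (4 * ?N * ball_vol TYPE('n)) * (\<integral>\<^sup>+x. ennreal ((?f x)\<^sup>2) \<partial>lborel) + ennreal (?N * ball_vol TYPE('n) / 2) * (8 * ?S)"
  proof (subst nn_integral_add)
    have "(\<integral>\<^sup>+h. indicator {h. norm h > 1} h * ennreal (1 / norm h ^ (?N + 2)) * (8 * ?S) \<partial>(lborel::(real^'n) measure)) =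
       (\<integral>\<^sup>+h. indicator {h. norm h > 1} h * ennreal (1 / norm h ^ (?N + 2)) \<partial>(lborel::(real^'n) measure)) * (8 * ?S)"
      by (rule nn_integral_multc) measurable
    also have "(\<integral>\<^sup>+h. indicator {h. norm h > 1} h * ennreal (1 / norm h ^ (?N + 2)) \<partial>(lborel::(real^'n) measure)) = ennreal (?N * ball_vol TYPE('n) / 2)"
      by (subst nn_integral_norm_tail) auto
    finally show "(\<integral>\<^sup>+h. ennreal (\<delta>\<^sup>2 / norm h ^ (?N + 2)) * ?W h \<partial>(lborel::(real^'n) measure)) + (\<integral>\<^sup>+h. indicator {h. norm h > 1} h * ennreal (1 / norm h ^ (?N + 2)) * (8 * ?S) \<partial>(lborel::(real^'n) measure)) =
      ennreal (4 * ?N * ball_vol TYPE('n)) * (\<integral>\<^sup>+x. ennreal ((?f x)\<^sup>2) \<partial>lborel) + ennreal (?N * ball_vol TYPE('n) / 2) * (8 * ?S)"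
      by (simp only: nn_integral_truncated_tail[OF \<open>?f \<in> borel_measurable borel\<close> f0 \<delta>])
  qed measurable
  also have "\<dots> \<le> ennreal (4 * ?N * ball_vol TYPE('n)) * (2 * ?E + ennreal (2 * L\<^sup>2) * ?S) + ennreal (?N * ball_vol TYPE('n) / 2) * (8 * ?S)"
    by (intro add_mono mult_left_mono grad_majorant_sq L0 order_refl) auto
  also have "\<dots> = ennreal (8 * ?N * ball_vol TYPE('n)) * ?E + ennreal (8 * ?N * ball_vol TYPE('n) * L\<^sup>2 + 4 * ?N * ball_vol TYPE('n)) * ?S"
  proof -
    let ?k = "?N * ball_vol TYPE('n)"
    have k: "?k \<ge> 0" using ball_vol_pos[where 'n='n] by simp
    have 1: "ennreal (4 * ?k) * 2 = ennreal (8 * ?k)"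
    proof -
      have "ennreal (4 * ?k * 2) = ennreal (4 * ?k) * ennreal 2" by (rule ennreal_mult'') simp
      moreover have "4 * ?k * 2 = 8 * ?k" by simp
      ultimately show ?thesis by (simp only: ennreal_numeral)
    qed
    have 2: "ennreal (4 * ?k) * ennreal (2 * L\<^sup>2) + ennreal (?k / 2) * 8 = ennreal (8 * ?k * L\<^sup>2 + 4 * ?k)"
    proof -
      have "ennreal (4 * ?k * (2 * L\<^sup>2)) = ennreal (4 * ?k) * ennreal (2 * L\<^sup>2)" by (rule ennreal_mult'') simp
      moreover have "ennreal (?k / 2 * 8) = ennreal (?k / 2) * ennreal 8" by (rule ennreal_mult'') simp
      moreover have "ennreal (4 * ?k * (2 * L\<^sup>2) + ?k / 2 * 8) = ennreal (4 * ?k * (2 * L\<^sup>2)) + ennreal (?k / 2 * 8)"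
        using ball_vol_pos[where 'n='n] by (intro ennreal_plus) (auto intro!: mult_nonneg_nonneg)
      moreover have "4 * ?k * (2 * L\<^sup>2) + ?k / 2 * 8 = 8 * ?k * L\<^sup>2 + 4 * ?k" by simp
      ultimately show ?thesis by (simp only: ennreal_numeral)
    qed
    have "ennreal (4 * ?k) * (2 * ?E + ennreal (2 * L\<^sup>2) * ?S) + ennreal (?k / 2) * (8 * ?S)
       = (ennreal (4 * ?k) * 2) * ?E + (ennreal (4 * ?k) * ennreal (2 * L\<^sup>2) + ennreal (?k / 2) * 8) * ?S"
      by (simp add: algebra_simps)
    then show ?thesis unfolding 1 2 by (simp add: mult.assoc)
  qed
  also have "\<dots> \<le> ennreal (8 * ?N * ball_vol TYPE('n)) * ?E + ennreal (8 * ?N * ball_vol TYPE('n) * (L\<^sup>2 + 1)) * ?S"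
    using ball_vol_pos[where 'n='n] by (intro add_mono mult_right_mono ennreal_leI order_refl) (auto simp: algebra_simps)
  also have "\<dots> = ennreal (8 * ?N * ball_vol TYPE('n)) * (?E + ennreal (L\<^sup>2 + 1) * ?S)"
    using ball_vol_pos[where 'n='n] by (simp add: ennreal_mult algebra_simps)
  finally show ?thesis .
qed

section \<open>Continuity of translations in the mean square\<close>

lemma ennreal_tendsto_0I:
  fixes f :: "'a \<Rightarrow> ennreal"
  assumes "\<And>e::real. e > 0 \<Longrightarrow> eventually (\<lambda>n. f n \<le> ennreal e) F"
  shows "(f \<longlongrightarrow> 0) F"
proof (rule order_tendstoI)
  fix a :: ennreal assume "0 < a"
  then obtain b where b: "0 < b" "b < a" using dense by blast
  then obtain e where e: "b = ennreal e" "e \<ge> 0" by (cases b) auto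
  then have "e > 0" using b by simp
  from assms[OF this] show "eventually (\<lambda>n. f n < a) F"
    by eventually_elim (use b e in auto)
qed simp

lemma sq_sum3: "(a + b + c)\<^sup>2 \<le> 3 * (a\<^sup>2 + b\<^sup>2 + c\<^sup>2)" for a b c :: real
proof -
  have "3 * (a\<^sup>2 + b\<^sup>2 + c\<^sup>2) - (a + b + c)\<^sup>2 = (a - b)\<^sup>2 + (b - c)\<^sup>2 + (a - c)\<^sup>2"
    by (simp add: power2_eq_square algebra_simps)
  then show ?thesis using zero_le_power2[of "a - b"] zero_le_power2[of "b - c"] zero_le_power2[of "a - c"] by linarith
qed

abbreviation radial_proj :: "real \<Rightarrow> 'a::euclidean_space \<Rightarrow> 'a" where
  "radial_proj M \<equiv> closest_point (cball 0 M)"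

lemma radial_proj_lipschitz: "M \<ge> 0 \<Longrightarrow> dist (radial_proj M a) (radial_proj M b) \<le> dist a b"
  by (rule closest_point_lipschitz) auto

lemma radial_proj_norm: "M \<ge> 0 \<Longrightarrow> norm (radial_proj M a) \<le> M"
  using closest_point_in_set[of "cball 0 M" a] by auto

lemma radial_proj_zero: "M \<ge> 0 \<Longrightarrow> radial_proj M 0 = 0"
  by (rule closest_point_self) auto

lemma radial_proj_le: "M \<ge> 0 \<Longrightarrow> norm (radial_proj M a) \<le> norm a"
  using radial_proj_lipschitz[of M a 0] radial_proj_zero[of M, where 'a='a] by (simp add: dist_norm)

lemma radial_proj_id: "norm a \<le> M \<Longrightarrow> radial_proj M a = a"
  by (rule closest_point_self) auto

lemma radial_proj_continuous: "M \<ge> 0 \<Longrightarrow> continuous_on S (radial_proj M)"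
  by (rule continuous_on_closest_point) auto

text \<open>A measurable function is the almost everywhere limit of continuous functions; cutting these off in
  value and in space provides a dominating function, so the convergence also holds in mean square.\<close>

lemma L2_approx_bounded:
  fixes f :: "'a::euclidean_space \<Rightarrow> 'b::euclidean_space"
  assumes [measurable]: "f \<in> borel_measurable borel" and B: "\<And>x. norm (f x) \<le> B" and R: "\<And>x. norm x > R \<Longrightarrow> f x = 0"
    and e: "e > 0"
  shows "\<exists>c. continuous_on UNIV c \<and> (\<forall>x. norm x > R + 1 \<longrightarrow> c x = 0) \<and> (\<integral>\<^sup>+x. ennreal ((norm (f x - c x))\<^sup>2) \<partial>lborel) \<le> ennreal e"
proof -
  have B0: "B \<ge> 0" using B[of 0] norm_ge_zero order_trans by blast
  have "f \<in> borel_measurable lebesgue" by (intro measurable_completion) simp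
  then have "f measurable_on UNIV"
    by (simp add: lebesgue_measurable_imp_measurable_on)
  then obtain N g where N: "negligible N" and gc: "\<And>n. continuous_on UNIV (g n)"
    and gl: "\<And>x. x \<notin> N \<Longrightarrow> (\<lambda>n. g n x) \<longlonglongrightarrow> f x"
    by (auto simp: measurable_on_def)
  define \<kappa> where "\<kappa> = (\<lambda>x::'a. max 0 (min 1 (R + 1 - norm x)))"
  define c where "c = (\<lambda>n x. \<kappa> x *\<^sub>R radial_proj B (g n x))"
  have cc: "continuous_on UNIV (c n)" for n
    unfolding c_def \<kappa>_def
    by (intro continuous_intros continuous_on_compose2[OF radial_proj_continuous[OF B0, of UNIV] gc]) auto
  have [measurable]: "c n \<in> borel_measurable borel" for n
    by (rule borel_measurable_continuous_onI[OF cc])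
  have c0: "c n x = 0" if "norm x > R + 1" for n x using that by (simp add: c_def \<kappa>_def)
  have cb: "norm (c n x) \<le> B" for n x
  proof -
    have "\<bar>\<kappa> x\<bar> * norm (radial_proj B (g n x)) \<le> 1 * B"
      using radial_proj_norm[OF B0] by (intro mult_mono) (auto simp: \<kappa>_def)
    then show ?thesis by (simp add: c_def)
  qed
  have AEl: "AE x in lborel. (\<lambda>n. c n x) \<longlonglongrightarrow> f x"
  proof -
    have "AE x in lebesgue. x \<notin> N"
      using N by (auto simp: negligible_iff_null_sets intro: AE_not_in)
    then have "AE x in lborel. x \<notin> N" by (simp add: AE_completion_iff)
    then show ?thesis
    proof eventually_elim
      case (elim x)
      have "(\<lambda>n. radial_proj B (g n x)) \<longlonglongrightarrow> radial_proj B (f x)"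
        by (rule continuous_on_tendsto_compose[OF radial_proj_continuous[OF B0, of UNIV] gl[OF elim]]) auto
      then have "(\<lambda>n. radial_proj B (g n x)) \<longlonglongrightarrow> f x" using B[of x] by (simp add: radial_proj_id)
      then have l: "(\<lambda>n. c n x) \<longlonglongrightarrow> \<kappa> x *\<^sub>R f x" unfolding c_def by (intro tendsto_intros)
      have "\<kappa> x *\<^sub>R f x = f x"
      proof (cases "norm x \<le> R")
        case True then show ?thesis by (simp add: \<kappa>_def)
      next
        case False then show ?thesis using R[of x] by simp
      qed
      with l show ?case by simp
    qed
  qed
  have "(\<lambda>n. \<integral>\<^sup>+x. ennreal ((norm (f x - c n x))\<^sup>2) \<partial>lborel) \<longlonglongrightarrow> (\<integral>\<^sup>+x. 0 \<partial>(lborel::'a measure))"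
  proof (rule nn_integral_dominated_convergence[where w="\<lambda>x. indicator (cball 0 (R + 1)) x * ennreal ((2 * B)\<^sup>2)"])
    show "AE x in lborel. ennreal ((norm (f x - c j x))\<^sup>2) \<le> indicator (cball 0 (R + 1)) x * ennreal ((2 * B)\<^sup>2)" for j
    proof (rule AE_I2)
      fix x
      have "(norm (f x - c j x))\<^sup>2 \<le> (2 * B)\<^sup>2"
        using norm_triangle_ineq4[of "f x" "c j x"] B[of x] cb[of j x] by (intro power_mono) auto
      then show "ennreal ((norm (f x - c j x))\<^sup>2) \<le> indicator (cball 0 (R + 1)) x * ennreal ((2 * B)\<^sup>2)"
        using R[of x] c0[of x j] by (cases "norm x \<le> R + 1") (auto intro: ennreal_leI)
    qed
    show "(\<integral>\<^sup>+x. indicator (cball 0 (R + 1)) x * ennreal ((2 * B)\<^sup>2) \<partial>(lborel::'a measure)) < \<infinity>"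
      using emeasure_lborel_cball_finite[of "0::'a" "R+1"]
      by (subst nn_integral_multc) (auto simp: ennreal_mult_less_top borel_measurable_indicator)
    show "AE x in lborel. (\<lambda>n. ennreal ((norm (f x - c n x))\<^sup>2)) \<longlonglongrightarrow> 0"
      using AEl
    proof eventually_elim
      case (elim x)
      have "(\<lambda>n. ennreal ((norm (f x - c n x))\<^sup>2)) \<longlonglongrightarrow> ennreal ((norm (f x - f x))\<^sup>2)"
        by (intro tendsto_ennrealI tendsto_intros elim)
      then show ?case by simp
    qed
    show "(\<lambda>x. indicator (cball 0 (R + 1)) x * ennreal ((2 * B)\<^sup>2)) \<in> borel_measurable (lborel::'a measure)"
      by (rule borel_measurable_times_ennreal) (auto intro: borel_measurable_indicator)
  qed measurable
  then have "(\<lambda>n. \<integral>\<^sup>+x. ennreal ((norm (f x - c n x))\<^sup>2) \<partial>lborel) \<longlonglongrightarrow> 0" by simp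
  then have "eventually (\<lambda>n. (\<integral>\<^sup>+x. ennreal ((norm (f x - c n x))\<^sup>2) \<partial>lborel) < ennreal e) sequentially"
    using e by (intro order_tendstoD) auto
  then obtain n where "(\<integral>\<^sup>+x. ennreal ((norm (f x - c n x))\<^sup>2) \<partial>lborel) < ennreal e"
    by (auto simp: eventually_sequentially)
  then show ?thesis using cc c0 by (intro exI[of _ "c n"]) auto
qed

lemma sq_norm_diff_le: "(norm (a - c))\<^sup>2 \<le> 2 * (norm (a - b))\<^sup>2 + 2 * (norm (b - c))\<^sup>2"
  for a b c :: "'b::real_normed_vector"
proof -
  have "norm (a - c) \<le> norm (a - b) + norm (b - c)" using norm_triangle_ineq[of "a - b" "b - c"] by simp
  then have "(norm (a - c))\<^sup>2 \<le> (norm (a - b) + norm (b - c))\<^sup>2" by (intro power_mono) auto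
  also have "\<dots> \<le> 2 * (norm (a - b))\<^sup>2 + 2 * (norm (b - c))\<^sup>2"
    using zero_le_power2[of "norm (a - b) - norm (b - c)"] by (simp add: power2_eq_square algebra_simps)
  finally show ?thesis .
qed

lemma nn_integral_sq_diff_le:
  fixes f g h :: "'a::euclidean_space \<Rightarrow> 'b::euclidean_space"
  assumes [measurable]: "f \<in> borel_measurable borel" "g \<in> borel_measurable borel" "h \<in> borel_measurable borel"
  shows "(\<integral>\<^sup>+x. ennreal ((norm (f x - h x))\<^sup>2) \<partial>lborel) \<le>
    2 * (\<integral>\<^sup>+x. ennreal ((norm (f x - g x))\<^sup>2) \<partial>lborel) + 2 * (\<integral>\<^sup>+x. ennreal ((norm (g x - h x))\<^sup>2) \<partial>lborel)"
proof -
  have "(\<integral>\<^sup>+x. ennreal ((norm (f x - h x))\<^sup>2) \<partial>lborel) \<le>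
    (\<integral>\<^sup>+x. 2 * ennreal ((norm (f x - g x))\<^sup>2) + 2 * ennreal ((norm (g x - h x))\<^sup>2) \<partial>lborel)" (is "nn_integral _ ?l1 \<le> nn_integral _ ?r1")
  proof (rule nn_integral_mono)
    fix x
    have "ennreal ((norm (f x - h x))\<^sup>2) \<le> ennreal (2 * (norm (f x - g x))\<^sup>2 + 2 * (norm (g x - h x))\<^sup>2)"
      by (intro ennreal_leI sq_norm_diff_le)
    then show "?l1 x \<le> ?r1 x"
      by (simp add: ennreal_mult')
  qed
  also have "\<dots> = 2 * (\<integral>\<^sup>+x. ennreal ((norm (f x - g x))\<^sup>2) \<partial>lborel) + 2 * (\<integral>\<^sup>+x. ennreal ((norm (g x - h x))\<^sup>2) \<partial>lborel)"
    by (subst nn_integral_add) (auto simp: nn_integral_cmult)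
  finally show ?thesis .
qed

lemma L2_approx_truncation:
  fixes f :: "'a::euclidean_space \<Rightarrow> 'b::euclidean_space"
  assumes [measurable]: "f \<in> borel_measurable borel" and fin: "L2_sq f < \<infinity>"
  shows "(\<lambda>n. \<integral>\<^sup>+x. ennreal ((norm (f x - indicator (cball 0 (real n)) x *\<^sub>R radial_proj (real n) (f x)))\<^sup>2) \<partial>lborel) \<longlonglongrightarrow> 0"
proof -
  have m[measurable]: "(\<lambda>x. indicator (cball 0 (real n)) x *\<^sub>R radial_proj (real n) (f x)) \<in> borel_measurable borel" for n
    by (intro borel_measurable_scaleR borel_measurable_indicator measurable_compose[OF assms(1) borel_measurable_continuous_onI] radial_proj_continuous) auto
  have "(\<lambda>n. \<integral>\<^sup>+x. ennreal ((norm (f x - indicator (cball 0 (real n)) x *\<^sub>R radial_proj (real n) (f x)))\<^sup>2) \<partial>lborel) \<longlonglongrightarrow> (\<integral>\<^sup>+x. 0 \<partial>(lborel::'a measure))"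
  proof (rule nn_integral_dominated_convergence[where w="\<lambda>x. 4 * ennreal ((norm (f x))\<^sup>2)"])
    show "AE x in lborel. ennreal ((norm (f x - indicator (cball 0 (real j)) x *\<^sub>R radial_proj (real j) (f x)))\<^sup>2) \<le> 4 * ennreal ((norm (f x))\<^sup>2)" for j
    proof (rule AE_I2)
      fix x
      have "norm (indicator (cball 0 (real j)) x *\<^sub>R radial_proj (real j) (f x)) \<le> norm (f x)"
        using radial_proj_le[of "real j" "f x"] by (auto simp: indicator_def)
      then have "(norm (f x - indicator (cball 0 (real j)) x *\<^sub>R radial_proj (real j) (f x)))\<^sup>2 \<le> (2 * norm (f x))\<^sup>2"
        using norm_triangle_ineq4[of "f x" "indicator (cball 0 (real j)) x *\<^sub>R radial_proj (real j) (f x)"] by (intro power_mono) auto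
      then have "ennreal ((norm (f x - indicator (cball 0 (real j)) x *\<^sub>R radial_proj (real j) (f x)))\<^sup>2) \<le> ennreal (4 * (norm (f x))\<^sup>2)"
        by (intro ennreal_leI) (simp add: power_mult_distrib)
      then show "ennreal ((norm (f x - indicator (cball 0 (real j)) x *\<^sub>R radial_proj (real j) (f x)))\<^sup>2) \<le> 4 * ennreal ((norm (f x))\<^sup>2)"
        by (simp add: ennreal_mult')
    qed
    show "(\<integral>\<^sup>+x. 4 * ennreal ((norm (f x))\<^sup>2) \<partial>lborel) < \<infinity>"
      using fin by (simp add: nn_integral_cmult ennreal_mult_less_top)
    show "AE x in lborel. (\<lambda>n. ennreal ((norm (f x - indicator (cball 0 (real n)) x *\<^sub>R radial_proj (real n) (f x)))\<^sup>2)) \<longlonglongrightarrow> 0" (is "AE x in _. ?P1 x")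
    proof (rule AE_I2)
      fix x :: 'a
      obtain m where m: "max (norm x) (norm (f x)) \<le> real m" using real_arch_simple by blast
      show "?P1 x"
      proof (rule tendsto_eventually, rule eventually_sequentiallyI[of m])
        fix n assume "m \<le> n"
        then have "norm x \<le> real n" "norm (f x) \<le> real n" using m by auto
        then show "ennreal ((norm (f x - indicator (cball 0 (real n)) x *\<^sub>R radial_proj (real n) (f x)))\<^sup>2) = 0"
          by (simp add: radial_proj_id)
      qed
    qed
  qed measurable
  then show ?thesis by simp
qed

lemma L2_approx_continuous:
  fixes f :: "'a::euclidean_space \<Rightarrow> 'b::euclidean_space"
  assumes [measurable]: "f \<in> borel_measurable borel" and fin: "L2_sq f < \<infinity>" and e: "e > 0"
  obtains c R where "continuous_on UNIV c" "\<And>x. norm x > R \<Longrightarrow> c x = 0" "(\<integral>\<^sup>+x. ennreal ((norm (f x - c x))\<^sup>2) \<partial>lborel) \<le> ennreal e"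
proof -
  have "eventually (\<lambda>n. (\<integral>\<^sup>+x. ennreal ((norm (f x - indicator (cball 0 (real n)) x *\<^sub>R radial_proj (real n) (f x)))\<^sup>2) \<partial>lborel) < ennreal (e / 4)) sequentially"
    using e by (intro order_tendstoD[OF L2_approx_truncation[OF assms(1,2)]]) auto
  then obtain n where n: "(\<integral>\<^sup>+x. ennreal ((norm (f x - indicator (cball 0 (real n)) x *\<^sub>R radial_proj (real n) (f x)))\<^sup>2) \<partial>lborel) < ennreal (e / 4)"
    by (auto simp: eventually_sequentially)
  define g where "g = (\<lambda>x. indicator (cball 0 (real n)) x *\<^sub>R radial_proj (real n) (f x))"
  have m[measurable]: "g \<in> borel_measurable borel" unfolding g_def
    by (intro borel_measurable_scaleR borel_measurable_indicator measurable_compose[OF assms(1) borel_measurable_continuous_onI] radial_proj_continuous) auto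
  have "\<exists>c. continuous_on UNIV c \<and> (\<forall>x. norm x > real n + 1 \<longrightarrow> c x = 0) \<and> (\<integral>\<^sup>+x. ennreal ((norm (g x - c x))\<^sup>2) \<partial>lborel) \<le> ennreal (e / 4)"
  proof (rule L2_approx_bounded[where B="real n"])
    show "norm (g x) \<le> real n" for x
      using radial_proj_norm[of "real n" "f x"] by (auto simp: g_def indicator_def)
  qed (use e m in \<open>auto simp: g_def\<close>)
  then obtain c where c: "continuous_on UNIV c" "\<And>x. norm x > real n + 1 \<Longrightarrow> c x = 0" "(\<integral>\<^sup>+x. ennreal ((norm (g x - c x))\<^sup>2) \<partial>lborel) \<le> ennreal (e / 4)"
    by blast
  have [measurable]: "c \<in> borel_measurable borel" by (rule borel_measurable_continuous_onI[OF c(1)])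
  have "(\<integral>\<^sup>+x. ennreal ((norm (f x - c x))\<^sup>2) \<partial>lborel) \<le> 2 * (\<integral>\<^sup>+x. ennreal ((norm (f x - g x))\<^sup>2) \<partial>lborel) + 2 * (\<integral>\<^sup>+x. ennreal ((norm (g x - c x))\<^sup>2) \<partial>lborel)"
    by (rule nn_integral_sq_diff_le) measurable
  also have "\<dots> \<le> 2 * ennreal (e / 4) + 2 * ennreal (e / 4)"
  proof -
    have "(\<integral>\<^sup>+x. ennreal ((norm (f x - g x))\<^sup>2) \<partial>lborel) \<le> ennreal (e / 4)"
      using n by (simp add: g_def)
    then show ?thesis using c(3) by (intro add_mono mult_left_mono) auto
  qed
  also have "\<dots> = ennreal e"
    using e by (simp flip: ennreal_plus ennreal_mult ennreal_numeral)
  finally show thesis using that c by blast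
qed

text \<open>For a continuous function of compact support this is uniform continuity; the general case follows by
  approximation because translations preserve the integral.\<close>

lemma L2_translation_continuous:
  fixes f :: "'a::euclidean_space \<Rightarrow> 'b::euclidean_space"
  assumes [measurable]: "f \<in> borel_measurable borel" and fin: "L2_sq f < \<infinity>"
    and z: "z \<longlonglongrightarrow> 0"
  shows "(\<lambda>n. \<integral>\<^sup>+x. ennreal ((norm (f (x + z n) - f x))\<^sup>2) \<partial>lborel) \<longlonglongrightarrow> 0"
proof (rule ennreal_tendsto_0I)
  fix e :: real assume e: "e > 0"
  obtain c R where c: "continuous_on UNIV c" "\<And>x. norm x > R \<Longrightarrow> c x = 0" "(\<integral>\<^sup>+x. ennreal ((norm (f x - c x))\<^sup>2) \<partial>lborel) \<le> ennreal (e / 12)"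
    using L2_approx_continuous[OF assms(1) fin, of "e / 12"] e by auto
  have [measurable]: "c \<in> borel_measurable borel" by (rule borel_measurable_continuous_onI[OF c(1)])
  obtain B where B: "\<And>x. norm (c x) \<le> B"
  proof -
    have "bounded (c ` cball 0 R)"
      by (intro compact_imp_bounded compact_continuous_image continuous_on_subset[OF c(1)]) auto
    then obtain B where "\<forall>x\<in>cball 0 R. norm (c x) \<le> B" "B > 0" unfolding bounded_pos by auto
    then have "norm (c x) \<le> B" for x using c(2)[of x] by (cases "norm x \<le> R") auto
    then show ?thesis by (rule that)
  qed
  obtain Z where Z: "\<And>n. norm (z n) \<le> Z"
    using convergent_imp_Bseq[OF convergentI[OF z]] by (auto simp: Bseq_def)
  have "(\<lambda>n. \<integral>\<^sup>+x. ennreal ((norm (c (x + z n) - c x))\<^sup>2) \<partial>lborel) \<longlonglongrightarrow> (\<integral>\<^sup>+x. 0 \<partial>(lborel::'a measure))"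
  proof (rule nn_integral_dominated_convergence[where w="\<lambda>x. indicator (cball 0 (R + Z)) x * ennreal ((2 * B)\<^sup>2)"])
    show "AE x in lborel. ennreal ((norm (c (x + z j) - c x))\<^sup>2) \<le> indicator (cball 0 (R + Z)) x * ennreal ((2 * B)\<^sup>2)" for j
    proof (rule AE_I2)
      fix x
      have b: "(norm (c (x + z j) - c x))\<^sup>2 \<le> (2 * B)\<^sup>2"
        using norm_triangle_ineq4[of "c (x + z j)" "c x"] B[of x] B[of "x + z j"] by (intro power_mono) auto
      have "c (x + z j) = 0 \<and> c x = 0" if "norm x > R + Z"
      proof -
        have "norm x \<le> norm (x + z j) + norm (z j)" using norm_triangle_ineq4[of "x + z j" "z j"] by simp
        moreover have "0 \<le> norm (z j)" by simp
        ultimately have "norm (x + z j) > R" "norm x > R" using that Z[of j] by linarith+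
        then show ?thesis using c(2) by simp
      qed
      then show "ennreal ((norm (c (x + z j) - c x))\<^sup>2) \<le> indicator (cball 0 (R + Z)) x * ennreal ((2 * B)\<^sup>2)"
        using b by (cases "norm x \<le> R + Z") (auto intro: ennreal_leI)
    qed
    show "(\<integral>\<^sup>+x. indicator (cball 0 (R + Z)) x * ennreal ((2 * B)\<^sup>2) \<partial>(lborel::'a measure)) < \<infinity>"
      using emeasure_lborel_cball_finite[of "0::'a" "R+Z"]
      by (subst nn_integral_multc) (auto simp: ennreal_mult_less_top borel_measurable_indicator)
    show "AE x in lborel. (\<lambda>n. ennreal ((norm (c (x + z n) - c x))\<^sup>2)) \<longlonglongrightarrow> 0" (is "AE x in _. ?P1 x")
    proof (rule AE_I2)
      fix x
      have "(\<lambda>n. c (x + z n)) \<longlonglongrightarrow> c (x + 0)"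
        by (rule continuous_on_tendsto_compose[OF c(1) tendsto_add[OF tendsto_const z]]) auto
      then have "(\<lambda>n. ennreal ((norm (c (x + z n) - c x))\<^sup>2)) \<longlonglongrightarrow> ennreal ((norm (c (x + 0) - c x))\<^sup>2)"
        by (intro tendsto_ennrealI tendsto_intros)
      then show "?P1 x" by simp
    qed
    show "(\<lambda>x. indicator (cball 0 (R + Z)) x * ennreal ((2 * B)\<^sup>2)) \<in> borel_measurable (lborel::'a measure)"
      by (rule borel_measurable_times_ennreal) (auto intro: borel_measurable_indicator)
  qed measurable
  then have "eventually (\<lambda>n. (\<integral>\<^sup>+x. ennreal ((norm (c (x + z n) - c x))\<^sup>2) \<partial>lborel) < ennreal (e / 12)) sequentially"
    using e by (intro order_tendstoD) auto
  then show "eventually (\<lambda>n. (\<integral>\<^sup>+x. ennreal ((norm (f (x + z n) - f x))\<^sup>2) \<partial>lborel) \<le> ennreal e) sequentially"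
  proof eventually_elim
    case (elim n)
    have tr: "(\<integral>\<^sup>+x. ennreal ((norm (f (x + z n) - c (x + z n)))\<^sup>2) \<partial>lborel) = (\<integral>\<^sup>+x. ennreal ((norm (f x - c x))\<^sup>2) \<partial>lborel)"
      using nn_integral_lborel_translate[of "\<lambda>x. ennreal ((norm (f x - c x))\<^sup>2)" "z n"] by (simp add: add.commute)
    have "(\<integral>\<^sup>+x. ennreal ((norm (f (x + z n) - f x))\<^sup>2) \<partial>lborel) \<le>
       2 * (\<integral>\<^sup>+x. ennreal ((norm (f (x + z n) - c (x + z n)))\<^sup>2) \<partial>lborel) + 2 * (\<integral>\<^sup>+x. ennreal ((norm (c (x + z n) - f x))\<^sup>2) \<partial>lborel)"
      by (rule nn_integral_sq_diff_le) measurable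
    also have "\<dots> \<le> 2 * (\<integral>\<^sup>+x. ennreal ((norm (f (x + z n) - c (x + z n)))\<^sup>2) \<partial>lborel) + 2 *
       (2 * (\<integral>\<^sup>+x. ennreal ((norm (c (x + z n) - c x))\<^sup>2) \<partial>lborel) + 2 * (\<integral>\<^sup>+x. ennreal ((norm (c x - f x))\<^sup>2) \<partial>lborel))"
    proof (intro add_mono order_refl mult_left_mono)
      show "(\<integral>\<^sup>+x. ennreal ((norm (c (x + z n) - f x))\<^sup>2) \<partial>lborel) \<le>
         2 * (\<integral>\<^sup>+x. ennreal ((norm (c (x + z n) - c x))\<^sup>2) \<partial>lborel) + 2 * (\<integral>\<^sup>+x. ennreal ((norm (c x - f x))\<^sup>2) \<partial>lborel)"
        by (rule nn_integral_sq_diff_le) measurable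
    qed simp
    also have "\<dots> \<le> 2 * ennreal (e / 12) + 2 * (2 * ennreal (e / 12) + 2 * ennreal (e / 12))"
      unfolding tr using c(3) elim by (intro add_mono mult_left_mono) (auto simp: norm_minus_commute)
    also have "\<dots> \<le> ennreal e"
      using e by (simp flip: ennreal_plus ennreal_mult ennreal_numeral)
    finally show ?case .
  qed
qed

section \<open>The limit\<close>

lemma ennreal_lincomb3:
  assumes "0 \<le> a" "0 \<le> b" "0 \<le> c" "0 \<le> x" "0 \<le> y" "0 \<le> z"
  shows "ennreal (a * x + b * y + c * z) = ennreal a * ennreal x + ennreal b * ennreal y + ennreal c * ennreal z"
  using assms by (simp add: ennreal_plus ennreal_mult)

lemma superlevel_measurable_comp [measurable]:
  assumes "u \<in> borel_measurable borel" "A \<in> borel_measurable borel" "f \<in> borel_measurable M"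
  shows "(\<lambda>x. superlevel A u \<delta> (f x)) \<in> borel_measurable M"
  by (rule measurable_compose[OF assms(3) superlevel_measurable[OF assms(1,2)]])

text \<open>The pointwise estimate on segments is squared by the Cauchy-Schwarz inequality in \<open>t\<close>, integrated in
  \<open>x\<close>, and then each of its three terms tends to zero boundedly in \<open>t\<close>.\<close>

lemma mdiff_quotient_L2:
  fixes u :: "real ^ 'n::finite \<Rightarrow> complex"
  assumes w: "wgrad u G" and L: "L-lipschitz_on UNIV A"
    and ufin: "L2_sq u < \<infinity>"
    and gfin: "L2_sq (mgrad A u G) < \<infinity>"
    and d: "d \<longlonglongrightarrow> 0" "\<And>n. d n > 0"
  shows "(\<lambda>n. \<integral>\<^sup>+x. ennreal ((norm (mdiff A u (d n *\<^sub>R k) x / complex_of_real (d n) - cdot k (mgrad A u G x)))\<^sup>2) \<partial>lborel) \<longlonglongrightarrow> 0"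
proof -
  note [measurable] = wgrad_measurable[OF w] lipschitz_measurable[OF L]
  have L0: "L \<ge> 0" by (rule lipschitz_on_nonneg[OF L])
  define g where "g = mgrad A u G"
  have [measurable]: "g \<in> borel_measurable borel" unfolding g_def by (rule mgrad_measurable) measurable
  define S where "S = L2_sq u"
  define E where "E = L2_sq g"
  have fin: "S < \<infinity>" "E < \<infinity>" using ufin gfin by (auto simp: S_def E_def g_def)
  define e where "e = (\<lambda>n t x. exp (- (\<i> * complex_of_real (t * ((d n *\<^sub>R k) \<bullet> A (x + (d n *\<^sub>R k) /\<^sub>R 2))))))"
  have em[measurable]: "(\<lambda>p. e n (f p) (h p)) \<in> borel_measurable M"
    if [measurable]: "f \<in> borel_measurable M" "h \<in> borel_measurable M" for n f h and M :: "'c measure"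
  proof -
    have [measurable]: "(\<lambda>s. exp (- (\<i> * complex_of_real s))) \<in> borel_measurable borel"
      by (intro borel_measurable_continuous_onI continuous_intros)
    show ?thesis unfolding e_def by measurable
  qed
  have ne: "norm (e n t x) = 1" for n t x unfolding e_def by (rule exp_bound)
  let ?y = "\<lambda>n t x. x + t *\<^sub>R (d n *\<^sub>R k)"
  let ?q = "\<lambda>n x. mdiff A u (d n *\<^sub>R k) x / complex_of_real (d n) - cdot k (g x)"
  let ?\<kappa> = "ennreal (3 * (norm k)\<^sup>2)" and ?\<mu> = "\<lambda>n. ennreal (3 * (d n * (L / 2 * (norm k)\<^sup>2))\<^sup>2)"
  let ?a = "\<lambda>n t x. norm k * norm (g (?y n t x) - g x)"
  let ?b = "\<lambda>n t x. norm k * norm (e n t x - 1) * norm (g x)"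
  let ?c = "\<lambda>n t x. d n * (L / 2 * (norm k)\<^sup>2) * norm (u (?y n t x))"
  define Y where "Y = (\<lambda>n t. \<integral>\<^sup>+x. ennreal ((?a n t x + ?b n t x + ?c n t x)\<^sup>2) \<partial>lborel)"
  have Ym[measurable]: "Y n \<in> borel_measurable borel" for n unfolding Y_def by measurable
  have le: "(\<integral>\<^sup>+x. ennreal ((norm (?q n x))\<^sup>2) \<partial>lborel)
      \<le> (\<integral>\<^sup>+t. indicator {0..1} t * Y n t \<partial>lborel)" for n
  proof -
    have "(\<integral>\<^sup>+x. ennreal ((norm (?q n x))\<^sup>2) \<partial>lborel)
      \<le> (\<integral>\<^sup>+x. \<integral>\<^sup>+t. indicator {0..1} t * ennreal ((?a n t x + ?b n t x + ?c n t x)\<^sup>2) \<partial>lborel \<partial>lborel)"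
    proof (rule nn_integral_mono_AE)
      show "AE x in lborel. ennreal ((norm (?q n x))\<^sup>2) \<le>
        (\<integral>\<^sup>+t. indicator {0..1} t * ennreal ((?a n t x + ?b n t x + ?c n t x)\<^sup>2) \<partial>lborel)"
        using mdiff_approx[OF w L, of "d n *\<^sub>R k"]
      proof eventually_elim
        case (elim x)
        let ?s = "\<lambda>t. ?a n t x + ?b n t x + ?c n t x"
        have s0: "?s t \<ge> 0" for t using d(2)[of n] L0 by simp
        have "mdiff A u (d n *\<^sub>R k) x / complex_of_real (d n) - cdot k (g x) = (mdiff A u (d n *\<^sub>R k) x - cdot (d n *\<^sub>R k) (g x)) / complex_of_real (d n)"
          using d(2)[of n] by (simp add: cdot_scaleR diff_divide_distrib)
        then have "norm (?q n x) = (1 / d n) * norm (mdiff A u (d n *\<^sub>R k) x - cdot (d n *\<^sub>R k) (g x))"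
          using d(2)[of n] by (simp add: norm_divide)
        then have "ennreal (norm (?q n x)) = ennreal (1 / d n) * ennreal (norm (mdiff A u (d n *\<^sub>R k) x - cdot (d n *\<^sub>R k) (g x)))"
          by (simp only: ennreal_mult''[OF norm_ge_zero])
        also have "\<dots> \<le> ennreal (1 / d n) * (\<integral>\<^sup>+t. indicator {0..1} t * ennreal (norm (d n *\<^sub>R k) * norm (g (?y n t x) - g x)
           + norm (d n *\<^sub>R k) * norm (e n t x - 1) * norm (g x)
           + L / 2 * (norm (d n *\<^sub>R k))\<^sup>2 * norm (u (?y n t x))) \<partial>lborel)"
          using elim unfolding g_def e_def by (rule mult_left_mono) simp
        also have "\<dots> = (\<integral>\<^sup>+t. indicator {0..1} t * ennreal (?s t) \<partial>lborel)"
        proof -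
          have r: "1 / d n * (norm (d n *\<^sub>R k) * norm (g (?y n t x) - g x)
           + norm (d n *\<^sub>R k) * norm (e n t x - 1) * norm (g x)
           + L / 2 * (norm (d n *\<^sub>R k))\<^sup>2 * norm (u (?y n t x))) = ?s t" for t
            using d(2)[of n] by (simp add: field_simps power2_eq_square)
          have r': "ennreal (1 / d n) * ennreal (norm (d n *\<^sub>R k) * norm (g (?y n t x) - g x)
           + norm (d n *\<^sub>R k) * norm (e n t x - 1) * norm (g x)
           + L / 2 * (norm (d n *\<^sub>R k))\<^sup>2 * norm (u (?y n t x))) = ennreal (?s t)" for t
            unfolding r[symmetric] using d(2)[of n] by (intro ennreal_mult'[symmetric]) simp
          show ?thesis
            apply (subst nn_integral_cmult[symmetric])
             apply measurable
            apply (rule nn_integral_cong)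
            apply (simp only: mult.left_commute[of "ennreal (1 / d n)"] r')
            done
        qed
        finally have b1: "ennreal (norm (?q n x)) \<le> (\<integral>\<^sup>+t. indicator {0..1} t * ennreal (?s t) \<partial>lborel)" .
        have "ennreal ((norm (?q n x))\<^sup>2) = (ennreal (norm (?q n x)))\<^sup>2"
          by (simp add: ennreal_power)
        also have "\<dots> \<le> (\<integral>\<^sup>+t. indicator {0..1} t * ennreal (?s t) \<partial>lborel)\<^sup>2"
          by (rule power_mono[OF b1]) simp
        also have "\<dots> = (\<integral>\<^sup>+t. indicator {0..1} t * (indicator {0..1} t * ennreal (?s t)) \<partial>lborel)\<^sup>2"
          by (intro arg_cong[where f="\<lambda>z. z\<^sup>2"] nn_integral_cong) (auto simp: indicator_def)
        also have "\<dots> \<le> (\<integral>\<^sup>+t. (indicator {0..1} t)\<^sup>2 \<partial>(lborel::real measure)) * (\<integral>\<^sup>+t. (indicator {0..1} t * ennreal (?s t))\<^sup>2 \<partial>lborel)"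
          by (rule Cauchy_Schwarz_nn_integral) measurable
        also have "(\<integral>\<^sup>+t. (indicator {0..1} t)\<^sup>2 \<partial>(lborel::real measure)) = (\<integral>\<^sup>+t. indicator {0..1} t \<partial>(lborel::real measure))"
          by (intro nn_integral_cong) (auto simp: indicator_def)
        also have "\<dots> = 1" by simp
        also have "(\<integral>\<^sup>+t. (indicator {0..1} t * ennreal (?s t))\<^sup>2 \<partial>lborel) = (\<integral>\<^sup>+t. indicator {0..1} t * ennreal ((?s t)\<^sup>2) \<partial>lborel)"
          using s0 by (intro nn_integral_cong) (auto simp: indicator_def ennreal_power)
        finally show ?case by simp
      qed
    qed
    also have "\<dots> = (\<integral>\<^sup>+t. \<integral>\<^sup>+x. indicator {0..1} t * ennreal ((?a n t x + ?b n t x + ?c n t x)\<^sup>2) \<partial>lborel \<partial>lborel)"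
      by (rule lborel_pair.Fubini') measurable
    also have "\<dots> = (\<integral>\<^sup>+t. indicator {0..1} t * Y n t \<partial>lborel)"
      unfolding Y_def by (intro nn_integral_cong nn_integral_cmult) measurable
    finally show ?thesis .
  qed
  define T where "T = (\<lambda>n t. \<integral>\<^sup>+x. ennreal ((norm (g (?y n t x) - g x))\<^sup>2) \<partial>lborel)"
  define P where "P = (\<lambda>n t. \<integral>\<^sup>+x. ennreal ((norm (e n t x - 1) * norm (g x))\<^sup>2) \<partial>lborel)"
  have YTP: "Y n t \<le> ?\<kappa> * T n t + ?\<kappa> * P n t + ?\<mu> n * S" for n t
  proof -
    have uS: "(\<integral>\<^sup>+x. ennreal ((norm (u (?y n t x)))\<^sup>2) \<partial>lborel) = S"
      using nn_integral_lborel_translate[of "\<lambda>x. ennreal ((norm (u x))\<^sup>2)" "t *\<^sub>R (d n *\<^sub>R k)"] by (simp add: add.commute S_def)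
    have "Y n t \<le> (\<integral>\<^sup>+x. ?\<kappa> * ennreal ((norm (g (?y n t x) - g x))\<^sup>2) +
       ?\<kappa> * ennreal ((norm (e n t x - 1) * norm (g x))\<^sup>2) + ?\<mu> n * ennreal ((norm (u (?y n t x)))\<^sup>2) \<partial>lborel)"
      unfolding Y_def
    proof (rule nn_integral_mono)
      fix x
      have "(?a n t x + ?b n t x + ?c n t x)\<^sup>2 \<le> 3 * ((?a n t x)\<^sup>2 + (?b n t x)\<^sup>2 + (?c n t x)\<^sup>2)"
        by (rule sq_sum3)
      also have "\<dots> = 3 * (norm k)\<^sup>2 * (norm (g (?y n t x) - g x))\<^sup>2 + 3 * (norm k)\<^sup>2 * (norm (e n t x - 1) * norm (g x))\<^sup>2
         + 3 * (d n * (L / 2 * (norm k)\<^sup>2))\<^sup>2 * (norm (u (?y n t x)))\<^sup>2"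
        by (simp only: power_mult_distrib distrib_left mult_ac)
      finally have "ennreal ((?a n t x + ?b n t x + ?c n t x)\<^sup>2) \<le> ennreal (3 * (norm k)\<^sup>2 * (norm (g (?y n t x) - g x))\<^sup>2 + 3 * (norm k)\<^sup>2 * (norm (e n t x - 1) * norm (g x))\<^sup>2
         + 3 * (d n * (L / 2 * (norm k)\<^sup>2))\<^sup>2 * (norm (u (?y n t x)))\<^sup>2)"
        by (rule ennreal_leI)
      also have "\<dots> = ?\<kappa> * ennreal ((norm (g (?y n t x) - g x))\<^sup>2) +
       ?\<kappa> * ennreal ((norm (e n t x - 1) * norm (g x))\<^sup>2) + ?\<mu> n * ennreal ((norm (u (?y n t x)))\<^sup>2)"
        by (rule ennreal_lincomb3) auto
      finally show "ennreal ((?a n t x + ?b n t x + ?c n t x)\<^sup>2) \<le> ?\<kappa> * ennreal ((norm (g (?y n t x) - g x))\<^sup>2) +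
       ?\<kappa> * ennreal ((norm (e n t x - 1) * norm (g x))\<^sup>2) + ?\<mu> n * ennreal ((norm (u (?y n t x)))\<^sup>2)" .
    qed
    also have "\<dots> = ?\<kappa> * T n t + ?\<kappa> * P n t + ?\<mu> n * S"
      unfolding T_def P_def uS[symmetric]
      by (subst nn_integral_add, measurable, subst nn_integral_add, measurable) (simp add: nn_integral_cmult)
    finally show ?thesis .
  qed
  have Tb: "T n t \<le> 4 * E" for n t
  proof -
    have "(\<integral>\<^sup>+x. ennreal ((norm (g (?y n t x)))\<^sup>2) \<partial>lborel) = E"
      using nn_integral_lborel_translate[of "\<lambda>x. ennreal ((norm (g x))\<^sup>2)" "t *\<^sub>R (d n *\<^sub>R k)"] by (simp add: add.commute E_def)
    moreover have "T n t \<le> 2 * (\<integral>\<^sup>+x. ennreal ((norm (g (?y n t x) - 0))\<^sup>2) \<partial>lborel) + 2 * (\<integral>\<^sup>+x. ennreal ((norm (0 - g x))\<^sup>2) \<partial>lborel)"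
      unfolding T_def by (rule nn_integral_sq_diff_le) measurable
    ultimately have "T n t \<le> 2 * E + 2 * E" by (simp add: E_def)
    then show ?thesis by (simp flip: distrib_right)
  qed
  have e1: "norm (e n t x - 1) \<le> 2" for n t x
    using norm_triangle_ineq4[of "e n t x" 1] ne by simp
  have pb: "ennreal ((norm (e n t x - 1) * norm (g x))\<^sup>2) \<le> 4 * ennreal ((norm (g x))\<^sup>2)" for n t x
  proof -
    have "(norm (e n t x - 1) * norm (g x))\<^sup>2 \<le> (2 * norm (g x))\<^sup>2"
      using e1 by (intro power_mono mult_right_mono) auto
    then have "ennreal ((norm (e n t x - 1) * norm (g x))\<^sup>2) \<le> ennreal (4 * (norm (g x))\<^sup>2)"
      by (intro ennreal_leI) (simp add: power_mult_distrib)
    then show ?thesis by (simp add: ennreal_mult')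
  qed
  have Pb: "P n t \<le> 4 * E" for n t
  proof -
    have "P n t \<le> (\<integral>\<^sup>+x. 4 * ennreal ((norm (g x))\<^sup>2) \<partial>lborel)" unfolding P_def by (intro nn_integral_mono pb)
    then show ?thesis unfolding E_def by (simp add: nn_integral_cmult)
  qed
  obtain D where D: "\<And>n. \<bar>d n\<bar> \<le> D"
    using convergent_imp_Bseq[OF convergentI[OF d(1)]] by (auto simp: Bseq_def)
  let ?W = "?\<kappa> * (4 * E) + ?\<kappa> * (4 * E) + ennreal (3 * (D * (L / 2 * (norm k)\<^sup>2))\<^sup>2) * S"
  have Yb: "Y n t \<le> ?W" for n t
  proof -
    have "(d n * (L / 2 * (norm k)\<^sup>2))\<^sup>2 \<le> (D * (L / 2 * (norm k)\<^sup>2))\<^sup>2"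
      using D[of n] d(2)[of n] L0 by (intro power_mono mult_right_mono) auto
    then show ?thesis
      by (intro order_trans[OF YTP] add_mono mult_left_mono mult_right_mono Tb Pb ennreal_leI) auto
  qed
  have Tl: "(\<lambda>n. T n t) \<longlonglongrightarrow> 0" for t
    unfolding T_def
  proof (rule L2_translation_continuous)
    have "(\<lambda>n. t *\<^sub>R (d n *\<^sub>R k)) \<longlonglongrightarrow> t *\<^sub>R (0 *\<^sub>R k)" by (intro tendsto_intros d)
    then show "(\<lambda>n. t *\<^sub>R (d n *\<^sub>R k)) \<longlonglongrightarrow> 0" by simp
  qed (use fin in \<open>auto simp: E_def\<close>)
  have Pl: "(\<lambda>n. P n t) \<longlonglongrightarrow> 0" for t
  proof -
    have "(\<lambda>n. P n t) \<longlonglongrightarrow> (\<integral>\<^sup>+x. 0 \<partial>(lborel::(real^'n) measure))"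
      unfolding P_def
    proof (rule nn_integral_dominated_convergence[where w="\<lambda>x. 4 * ennreal ((norm (g x))\<^sup>2)"])
      show "(\<integral>\<^sup>+x. 4 * ennreal ((norm (g x))\<^sup>2) \<partial>lborel) < \<infinity>"
        using fin by (simp add: nn_integral_cmult ennreal_mult_less_top E_def)
      show "AE x in lborel. (\<lambda>n. ennreal ((norm (e n t x - 1) * norm (g x))\<^sup>2)) \<longlonglongrightarrow> 0" (is "AE x in _. ?P1 x")
      proof (rule AE_I2)
        fix x
        have "(\<lambda>n. A (x + (d n *\<^sub>R k) /\<^sub>R 2)) \<longlonglongrightarrow> A (x + (0 *\<^sub>R k) /\<^sub>R 2)"
        proof (rule continuous_on_tendsto_compose[OF lipschitz_on_continuous_on[OF L]])
          show "(\<lambda>n. x + (d n *\<^sub>R k) /\<^sub>R 2) \<longlonglongrightarrow> x + (0 *\<^sub>R k) /\<^sub>R 2" by (intro tendsto_intros d)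
        qed auto
        then have "(\<lambda>n. e n t x) \<longlonglongrightarrow> exp (- (\<i> * complex_of_real (t * ((0 *\<^sub>R k) \<bullet> A (x + (0 *\<^sub>R k) /\<^sub>R 2)))))"
          unfolding e_def by (intro tendsto_intros d)
        then have "(\<lambda>n. ennreal ((norm (e n t x - 1) * norm (g x))\<^sup>2)) \<longlonglongrightarrow> ennreal ((norm (exp (- (\<i> * complex_of_real (t * ((0 *\<^sub>R k) \<bullet> A (x + (0 *\<^sub>R k) /\<^sub>R 2))))) - 1) * norm (g x))\<^sup>2)"
          by (intro tendsto_ennrealI tendsto_intros)
        then show "?P1 x" by simp
      qed
    qed (auto intro: pb)
    then show ?thesis by simp
  qed
  have Yl: "(\<lambda>n. Y n t) \<longlonglongrightarrow> 0" for t
  proof (rule tendsto_sandwich[OF _ _ tendsto_const[of 0]])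
    have "(\<lambda>n. ?\<mu> n * S) \<longlonglongrightarrow> ennreal (3 * (0 * (L / 2 * (norm k)\<^sup>2))\<^sup>2) * S"
    proof (rule tendsto_mult_ennreal[OF tendsto_ennrealI tendsto_const])
      show "(\<lambda>n. 3 * (d n * (L / 2 * (norm k)\<^sup>2))\<^sup>2) \<longlonglongrightarrow> 3 * (0 * (L / 2 * (norm k)\<^sup>2))\<^sup>2"
        by (intro tendsto_intros d)
    qed (use fin in auto)
    moreover have "(\<lambda>n. ?\<kappa> * T n t) \<longlonglongrightarrow> ?\<kappa> * 0"
      by (rule tendsto_mult_ennreal[OF tendsto_const Tl]) auto
    moreover have "(\<lambda>n. ?\<kappa> * P n t) \<longlonglongrightarrow> ?\<kappa> * 0"
      by (rule tendsto_mult_ennreal[OF tendsto_const Pl]) auto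
    ultimately show "(\<lambda>n. ?\<kappa> * T n t + ?\<kappa> * P n t + ?\<mu> n * S) \<longlonglongrightarrow> 0"
      using tendsto_add[of "\<lambda>n. ?\<kappa> * T n t + ?\<kappa> * P n t" 0 sequentially
          "\<lambda>n. ?\<mu> n * S" 0]
        tendsto_add[of "\<lambda>n. ?\<kappa> * T n t" 0 sequentially "\<lambda>n. ?\<kappa> * P n t" 0]
      by simp
  qed (use YTP in \<open>simp_all del: power_mult_distrib times_divide_eq_left times_divide_eq_right\<close>)
  have "(\<lambda>n. \<integral>\<^sup>+t. indicator {0..1} t * Y n t \<partial>lborel) \<longlonglongrightarrow> (\<integral>\<^sup>+t. 0 \<partial>(lborel::real measure))"
  proof (rule nn_integral_dominated_convergence[where w="\<lambda>t. indicator {0..1} t * ?W"])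
    show "AE t in lborel. indicator {0..1} t * Y j t \<le> indicator {0..1} t * ?W" for j
      by (intro AE_I2 mult_left_mono Yb) auto
    show "(\<integral>\<^sup>+t. indicator {0..1} t * ?W \<partial>(lborel::real measure)) < \<infinity>"
      using fin by (subst nn_integral_multc) (auto simp: ennreal_mult_less_top ennreal_add_less_top)
    show "AE t in lborel. (\<lambda>n. indicator {0..1} t * Y n t) \<longlonglongrightarrow> 0" (is "AE x in _. ?P2 x")
    proof (rule AE_I2)
      fix t :: real
      show "?P2 t"
        using Yl[of t] by (cases "t \<in> {0..1}") auto
    qed
  qed measurable
  then have l0: "(\<lambda>n. \<integral>\<^sup>+t. indicator {0..1} t * Y n t \<partial>lborel) \<longlonglongrightarrow> 0" by simp
  show ?thesis
    unfolding g_def[symmetric]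
    by (rule tendsto_sandwich[OF _ _ tendsto_const l0]) (auto intro: le always_eventually)
qed

text \<open>Outside a set of small measure \<open>F n\<close> and \<open>f\<close> differ by less than \<open>\<eta>\<close>, so the two superlevel sets differ
  only there and where \<open>norm (f x)\<close> is within \<open>\<eta>\<close> of \<open>1\<close>; the latter sets shrink to the null level set.\<close>

lemma level_set_convergence:
  fixes f :: "'a::euclidean_space \<Rightarrow> complex"
  assumes [measurable]: "f \<in> borel_measurable borel" "\<And>n::nat. F n \<in> borel_measurable borel"
    and fin: "L2_sq f < \<infinity>"
    and conv: "(\<lambda>n. \<integral>\<^sup>+x. ennreal ((norm (F n x - f x))\<^sup>2) \<partial>lborel) \<longlonglongrightarrow> 0"
    and null: "emeasure lborel {x. norm (f x) = 1} = 0"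
  shows "(\<lambda>n. emeasure lborel {x. 1 < norm (F n x)}) \<longlonglongrightarrow> emeasure lborel {x. 1 < norm (f x)}"
proof -
  define \<eta> where "\<eta> = (\<lambda>j. inverse (real (Suc (Suc j))))"
  have \<eta>: "0 < \<eta> j" "\<eta> j \<le> 1/2" for j by (auto simp: \<eta>_def field_simps)
  have \<eta>l: "\<eta> \<longlonglongrightarrow> 0" unfolding \<eta>_def using LIMSEQ_inverse_real_of_nat by (rule LIMSEQ_Suc)
  have \<eta>mono: "\<eta> j \<le> \<eta> i" if "i \<le> j" for i j using that by (auto simp: \<eta>_def field_simps)
  define B where "B = (\<lambda>j. {x. 1 - \<eta> j < norm (f x) \<and> norm (f x) \<le> 1 + \<eta> j})"
  have Bm[measurable]: "B j \<in> sets lborel" for j unfolding B_def by measurable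
  have finlev: "emeasure lborel {x. c < norm (f x)} < \<infinity>" if "c > 0" for c
    by (rule order.strict_trans1[OF emeasure_superlevel_sq]) (use fin that in \<open>auto simp: ennreal_mult_less_top\<close>)
  have "(\<lambda>j. emeasure lborel (B j)) \<longlonglongrightarrow> emeasure lborel (\<Inter>j. B j)"
  proof (rule Lim_emeasure_decseq)
    show "decseq B" unfolding decseq_def B_def using \<eta>mono by (fastforce intro: order.strict_trans1 order_trans)
    fix j
    have "emeasure lborel (B j) \<le> emeasure lborel {x. 1/4 < norm (f x)}"
      using \<eta>(2)[of j] by (intro emeasure_mono) (auto simp: B_def)
    then show "emeasure lborel (B j) \<noteq> \<infinity>" using finlev[of "1/4"] by (auto simp: top_unique)
  qed (use Bm in auto)
  moreover have "(\<Inter>j. B j) = {x. norm (f x) = 1}"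
  proof
    show "{x. norm (f x) = 1} \<subseteq> (\<Inter>j. B j)" using \<eta> by (auto simp: B_def intro: less_imp_le)
    show "(\<Inter>j. B j) \<subseteq> {x. norm (f x) = 1}"
    proof
      fix x assume "x \<in> (\<Inter>j. B j)"
      then have b: "1 - \<eta> j \<le> norm (f x)" "norm (f x) \<le> 1 + \<eta> j" for j by (auto simp: B_def intro: less_imp_le)
      have "(\<lambda>j. 1 - \<eta> j) \<longlonglongrightarrow> 1 - 0" "(\<lambda>j. 1 + \<eta> j) \<longlonglongrightarrow> 1 + 0" by (intro tendsto_intros \<eta>l)+
      then have "1 \<le> norm (f x)" "norm (f x) \<le> 1"
        using LIMSEQ_le_const2[of "\<lambda>j. 1 - \<eta> j" 1 "norm (f x)"] LIMSEQ_le_const[of "\<lambda>j. 1 + \<eta> j" 1 "norm (f x)"] b by auto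
      then show "x \<in> {x. norm (f x) = 1}" by simp
    qed
  qed
  ultimately have Bl: "(\<lambda>j. emeasure lborel (B j)) \<longlonglongrightarrow> 0" using null by simp
  define m where "m = emeasure lborel {x. 1 < norm (f x)}"
  define mn where "mn = (\<lambda>n. emeasure lborel {x. 1 < norm (F n x)})"
  have mfin: "m < \<infinity>" unfolding m_def using finlev[of 1] by simp
  have close: "eventually (\<lambda>n. mn n \<le> m + ennreal e \<and> m \<le> mn n + ennreal e) sequentially" if e: "e > 0" for e :: real
  proof -
    have "eventually (\<lambda>j. emeasure lborel (B j) < ennreal (e / 2)) sequentially"
      using e by (intro order_tendstoD[OF Bl]) auto
    then obtain j where j: "emeasure lborel (B j) < ennreal (e / 2)" by (auto simp: eventually_sequentially)
    have "eventually (\<lambda>n. (\<integral>\<^sup>+x. ennreal ((norm (F n x - f x))\<^sup>2) \<partial>lborel) < ennreal ((\<eta> j)\<^sup>2 * (e / 2))) sequentially"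
      using e \<eta>(1)[of j] by (intro order_tendstoD[OF conv]) auto
    then show ?thesis
    proof eventually_elim
      case (elim n)
      define D where "D = {x. \<eta> j < norm (F n x - f x)}"
      have [measurable]: "D \<in> sets lborel" unfolding D_def by measurable
      have "emeasure lborel D \<le> ennreal (1 / (\<eta> j)\<^sup>2) * (\<integral>\<^sup>+x. ennreal ((norm (F n x - f x))\<^sup>2) \<partial>lborel)"
        unfolding D_def by (rule emeasure_superlevel_sq) (use \<eta> in auto)
      also have "\<dots> \<le> ennreal (1 / (\<eta> j)\<^sup>2) * ennreal ((\<eta> j)\<^sup>2 * (e / 2))"
        using elim by (intro mult_left_mono) auto
      also have "\<dots> = ennreal (e / 2)"
        using \<eta>(1)[of j] e by (subst ennreal_mult[symmetric]) auto
      finally have De: "emeasure lborel D \<le> ennreal (e / 2)" .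
      have "emeasure lborel (B j \<union> D) \<le> emeasure lborel (B j) + emeasure lborel D"
        by (rule emeasure_subadditive) measurable
      also have "\<dots> \<le> ennreal (e / 2) + ennreal (e / 2)" using j De by (intro add_mono) auto
      also have "\<dots> = ennreal e" using e by (subst ennreal_plus[symmetric]) auto
      finally have r: "emeasure lborel (B j \<union> D) \<le> ennreal e" .
      have near: "norm (F n x) \<le> norm (f x) + \<eta> j" "norm (f x) \<le> norm (F n x) + \<eta> j" if "x \<notin> D" for x
        using that norm_triangle_ineq2[of "F n x" "f x"] norm_triangle_ineq2[of "f x" "F n x"]
        by (auto simp: D_def norm_minus_commute)
      have "mn n \<le> emeasure lborel ({x. 1 < norm (f x)} \<union> (B j \<union> D))"
        unfolding mn_def
      proof (rule emeasure_mono)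
        show "{x. 1 < norm (F n x)} \<subseteq> {x. 1 < norm (f x)} \<union> (B j \<union> D)"
        proof
          fix x assume "x \<in> {x. 1 < norm (F n x)}"
          then show "x \<in> {x. 1 < norm (f x)} \<union> (B j \<union> D)"
            using near(1)[of x] \<eta>(1)[of j] by (cases "x \<in> D") (auto simp: B_def)
        qed
      qed measurable
      also have "\<dots> \<le> m + emeasure lborel (B j \<union> D)"
        unfolding m_def by (rule emeasure_subadditive) measurable
      finally have 1: "mn n \<le> m + ennreal e" using r by (meson add_left_mono order_trans)
      have "m \<le> emeasure lborel ({x. 1 < norm (F n x)} \<union> (B j \<union> D))"
        unfolding m_def
      proof (rule emeasure_mono)
        show "{x. 1 < norm (f x)} \<subseteq> {x. 1 < norm (F n x)} \<union> (B j \<union> D)"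
        proof
          fix x assume "x \<in> {x. 1 < norm (f x)}"
          then show "x \<in> {x. 1 < norm (F n x)} \<union> (B j \<union> D)"
            using near(2)[of x] \<eta>(1)[of j] by (cases "x \<in> D") (auto simp: B_def)
        qed
      qed measurable
      also have "\<dots> \<le> mn n + emeasure lborel (B j \<union> D)"
        unfolding mn_def by (rule emeasure_subadditive) measurable
      finally have 2: "m \<le> mn n + ennreal e" using r by (meson add_left_mono order_trans)
      show ?case using 1 2 by simp
    qed
  qed
  obtain m' where m': "m = ennreal m'" "m' \<ge> 0" using mfin by (cases m) auto
  have "mn \<longlonglongrightarrow> m"
  proof (rule order_tendstoI)
    fix a assume "m < a"
    then obtain b where b: "m < b" "b < a" using dense by blast
    then obtain b' where b': "b = ennreal b'" "b' \<ge> 0" by (cases b) auto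
    have "b' - m' > 0" using b m' b' by (simp add: ennreal_less_iff)
    from close[OF this] show "eventually (\<lambda>n. mn n < a) sequentially"
    proof eventually_elim
      case (elim n)
      have "m + ennreal (b' - m') = b" using m' b' \<open>b' - m' > 0\<close> by (subst m', subst ennreal_plus[symmetric]) auto
      then show ?case using elim b by (metis order.strict_trans1)
    qed
  next
    fix a assume a: "a < m"
    then obtain a' where a': "a = ennreal a'" "a' \<ge> 0" using mfin by (cases a) auto
    have d: "(m' - a') / 2 > 0" using a m' a' by (simp add: ennreal_less_iff)
    from close[OF this] show "eventually (\<lambda>n. a < mn n) sequentially"
    proof eventually_elim
      case (elim n)
      show ?case
      proof (rule ccontr)
        assume "\<not> a < mn n"
        then have "mn n + ennreal ((m' - a') / 2) \<le> ennreal a' + ennreal ((m' - a') / 2)"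
          using a' by (intro add_mono) auto
        also have "\<dots> = ennreal (a' + (m' - a') / 2)" using d a' by (intro ennreal_plus[symmetric]) auto
        finally have "ennreal m' \<le> ennreal (a' + (m' - a') / 2)" using elim m' by (meson order_trans)
        then have "m' \<le> a' + (m' - a') / 2" using d a' by (subst (asm) ennreal_le_iff) auto
        then show False using d by (simp add: field_simps)
      qed
    qed
  qed
  then show ?thesis unfolding m_def mn_def .
qed

text \<open>Every ray from the origin meets the level set in at most one point.\<close>

lemma cdot_level_null:
  fixes G :: "complex ^ 'n::finite"
  shows "emeasure lborel {k. norm (cdot k G) = 1} = 0"
proof -
  have "emeasure lborel {k. norm (cdot k G) = 1} = (\<integral>\<^sup>+k. indicator {k. norm (cdot k G) = 1} k \<partial>lborel)"
    by (subst nn_integral_indicator) auto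
  also have "\<dots> = (\<integral>\<^sup>+x. indicator (cball 0 1 - {0}) x * (ennreal DIM(real^'n) *
      (\<integral>\<^sup>+r. indicator {0<..} r * (indicator {k. norm (cdot k G) = 1} ((r / norm x) *\<^sub>R x) * ennreal (r ^ (DIM(real^'n) - 1))) \<partial>lborel)) \<partial>lborel)"
    by (rule nn_integral_polar) measurable
  also have "\<dots> = (\<integral>\<^sup>+x. 0 \<partial>(lborel :: (real^'n) measure))"
  proof (rule nn_integral_cong)
    fix x :: "real^'n"
    have "(\<integral>\<^sup>+r. indicator {0<..} r * (indicator {k. norm (cdot k G) = 1} ((r / norm x) *\<^sub>R x) * ennreal (r ^ (DIM(real^'n) - 1))) \<partial>lborel) = (\<integral>\<^sup>+r. 0 \<partial>(lborel::real measure))"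
      if "x \<noteq> 0"
    proof (rule nn_integral_cong_AE)
      have "AE r in lborel. r \<noteq> norm x / norm (cdot x G)" by (rule AE_lborel_singleton)
      then show "AE r in lborel. indicator {0<..} r * (indicator {k. norm (cdot k G) = 1} ((r / norm x) *\<^sub>R x) * ennreal (r ^ (DIM(real^'n) - 1))) = 0"
      proof eventually_elim
        case (elim r)
        have "norm (cdot ((r / norm x) *\<^sub>R x) G) \<noteq> 1" if "r > 0"
        proof
          assume one: "norm (cdot ((r / norm x) *\<^sub>R x) G) = 1"
          have "norm (cdot ((r / norm x) *\<^sub>R x) G) = r / norm x * norm (cdot x G)"
            using that by (simp add: cdot_scaleR norm_mult norm_divide)
          then have q: "r / norm x * norm (cdot x G) = 1" unfolding one by (rule sym)
          have "r * norm (cdot x G) = (r / norm x * norm (cdot x G)) * norm x" using \<open>x \<noteq> 0\<close> by simp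
          then have "r * norm (cdot x G) = norm x" unfolding q by simp
          moreover from this have "norm (cdot x G) \<noteq> 0" using \<open>x \<noteq> 0\<close> by (metis mult_zero_right norm_eq_zero)
          ultimately have "r * norm (cdot x G) = norm x" "norm (cdot x G) \<noteq> 0" by blast+
          then have "r = norm x / norm (cdot x G)" by (metis nonzero_mult_div_cancel_right)
          then show False using elim by simp
        qed
        then show ?case by (auto simp: indicator_def)
      qed
    qed
    then show "indicator (cball 0 1 - {0}) x * (ennreal DIM(real^'n) *
      (\<integral>\<^sup>+r. indicator {0<..} r * (indicator {k. norm (cdot k G) = 1} ((r / norm x) *\<^sub>R x) * ennreal (r ^ (DIM(real^'n) - 1))) \<partial>lborel)) = 0"
      by (cases "x = 0") auto
  qed
  finally show ?thesis by simp
qed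

text \<open>Fubini exchanges the roles of \<open>k\<close> and \<open>x\<close>, so that the convergence of superlevel sets is available
  for almost every direction \<open>k\<close>.\<close>

lemma cdot_level_null_AE:
  fixes g :: "real ^ 'n::finite \<Rightarrow> complex ^ 'n"
  assumes [measurable]: "g \<in> borel_measurable borel"
  shows "AE k in lborel. emeasure lborel {x. norm (cdot k (g x)) = 1} = 0"
proof -
  have sm: "{p \<in> space (lborel \<Otimes>\<^sub>M lborel). norm (cdot (fst p) (g (snd p))) \<noteq> 1} \<in> sets (lborel \<Otimes>\<^sub>M lborel)"
    by measurable
  have s1[measurable]: "{k. norm (cdot k (g x)) = 1} \<in> sets lborel" "{x. norm (cdot k (g x)) = 1} \<in> sets lborel" for k x
    by measurable
  have "AE x in lborel. AE k in lborel. norm (cdot k (g x)) \<noteq> 1"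
  proof (rule AE_I2)
    fix x
    have "{k. norm (cdot k (g x)) = 1} \<in> null_sets lborel"
      using cdot_level_null[of "g x"] by (intro null_setsI) auto
    from AE_not_in[OF this] show "AE k in lborel. norm (cdot k (g x)) \<noteq> 1" by simp
  qed
  moreover have "(AE k in lborel. AE x in lborel. norm (cdot k (g x)) \<noteq> 1) \<longleftrightarrow> (AE x in lborel. AE k in lborel. norm (cdot k (g x)) \<noteq> 1)"
    by (rule lborel_pair.AE_commute) (use sm in simp)
  ultimately have "AE k in lborel. AE x in lborel. norm (cdot k (g x)) \<noteq> 1" by simp
  then show ?thesis
    by eventually_elim (subst (asm) AE_iff_measurable[OF _ refl], auto)
qed

lemma J_rescaled:
  fixes u :: "real ^ 'n::finite \<Rightarrow> complex"
  assumes [measurable]: "u \<in> borel_measurable borel" "A \<in> borel_measurable borel" and \<delta>: "\<delta> > 0"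
  shows "J A \<delta> u = (\<integral>\<^sup>+k. ennreal (1 / norm k ^ (CARD('n) + 2)) * superlevel A u \<delta> (\<delta> *\<^sub>R k) \<partial>lborel)"
proof -
  have "J A \<delta> u = ennreal (\<delta> ^ CARD('n)) * (\<integral>\<^sup>+k. ennreal (\<delta>\<^sup>2 / norm (\<delta> *\<^sub>R k) ^ (CARD('n) + 2)) * superlevel A u \<delta> (\<delta> *\<^sub>R k) \<partial>lborel)"
    unfolding J_eq_superlevel[OF assms(1,2)] by (subst nn_integral_lborel_scale[OF _ \<delta>]) simp_all
  also have "\<dots> = (\<integral>\<^sup>+k. ennreal (\<delta> ^ CARD('n)) * (ennreal (\<delta>\<^sup>2 / norm (\<delta> *\<^sub>R k) ^ (CARD('n) + 2)) * superlevel A u \<delta> (\<delta> *\<^sub>R k)) \<partial>lborel)"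
    by (rule nn_integral_cmult[symmetric]) measurable
  also have "\<dots> = (\<integral>\<^sup>+k. ennreal (1 / norm k ^ (CARD('n) + 2)) * superlevel A u \<delta> (\<delta> *\<^sub>R k) \<partial>lborel)" (is "nn_integral _ ?a1 = nn_integral _ ?b1")
  proof (rule nn_integral_cong)
    fix k :: "real^'n"
    have "\<delta> ^ CARD('n) * (\<delta>\<^sup>2 / norm (\<delta> *\<^sub>R k) ^ (CARD('n) + 2)) = 1 / norm k ^ (CARD('n) + 2)"
      using \<delta> by (simp add: power_mult_distrib power_add power2_eq_square)
    moreover have "ennreal (\<delta> ^ CARD('n) * (\<delta>\<^sup>2 / norm (\<delta> *\<^sub>R k) ^ (CARD('n) + 2))) = ennreal (\<delta> ^ CARD('n)) * ennreal (\<delta>\<^sup>2 / norm (\<delta> *\<^sub>R k) ^ (CARD('n) + 2))"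
      using \<delta> by (intro ennreal_mult) auto
    ultimately show "?a1 k = ?b1 k"
      by (simp only: mult.assoc[symmetric])
  qed
  finally show ?thesis .
qed

text \<open>After the substitution \<open>h = \<delta> *\<^sub>R k\<close> the integrand converges for almost every \<open>k\<close>, and the
  bound that proves the uniform estimate does not depend on \<open>\<delta>\<close> and dominates it.\<close>

lemma J_limit_sequence:
  fixes u :: "real ^ 'n::finite \<Rightarrow> complex"
  assumes w: "wgrad u G" and L: "L-lipschitz_on UNIV A"
    and ufin: "L2_sq u < \<infinity>"
    and gfin: "L2_sq (mgrad A u G) < \<infinity>"
    and d: "d \<longlonglongrightarrow> 0" "\<And>n. d n > 0"
  shows "(\<lambda>n. J A (d n) u) \<longlonglongrightarrow> ennreal (ball_vol TYPE('n) / 2) * L2_sq (mgrad A u G)"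
proof -
  note [measurable] = wgrad_measurable[OF w] lipschitz_measurable[OF L]
  have L0: "L \<ge> 0" by (rule lipschitz_on_nonneg[OF L])
  let ?N = "CARD('n)"
  define g where "g = mgrad A u G"
  have [measurable]: "g \<in> borel_measurable borel" unfolding g_def by (rule mgrad_measurable) measurable
  define f where "f = grad_majorant A u G L"
  have fm[measurable]: "f \<in> borel_measurable borel" unfolding f_def grad_majorant_def[abs_def] g_def[symmetric] by measurable
  have f0: "f x \<ge> 0" for x using L0 by (simp add: f_def grad_majorant_def)
  have ffin: "(\<integral>\<^sup>+x. ennreal ((f x)\<^sup>2) \<partial>lborel) < \<infinity>"
    unfolding f_def
    by (rule order.strict_trans1[OF grad_majorant_sq]) (use ufin gfin L0 in \<open>auto simp: ennreal_mult_less_top ennreal_add_less_top\<close>)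
  define wt where "wt = (\<lambda>k::real^'n. ennreal (1 / norm k ^ (?N + 2)))"
  have [measurable]: "wt \<in> borel_measurable borel" unfolding wt_def by measurable
  define m where "m = (\<lambda>k. emeasure lborel {x. 1 < norm (cdot k (g x))})"
  have mm[measurable]: "m \<in> borel_measurable borel"
  proof -
    have "(\<lambda>k. emeasure lborel (Pair k -` {p. 1 < norm (cdot (fst p) (g (snd p)))})) \<in> borel_measurable lborel"
    proof (rule lborel.measurable_emeasure_Pair)
      have "{p \<in> space (lborel \<Otimes>\<^sub>M lborel). 1 < norm (cdot (fst p) (g (snd p)))} \<in> sets (lborel \<Otimes>\<^sub>M lborel)"
        by measurable
      then show "{p. 1 < norm (cdot (fst p) (g (snd p)))} \<in> sets (lborel \<Otimes>\<^sub>M lborel)"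
        by (simp add: space_pair_measure)
    qed
    then show ?thesis by (simp add: m_def vimage_def)
  qed
  have sl: "(\<lambda>n. superlevel A u (d n) (d n *\<^sub>R k)) \<longlonglongrightarrow> m k" if k: "emeasure lborel {x. norm (cdot k (g x)) = 1} = 0" for k
  proof -
    define F where "F = (\<lambda>n x. mdiff A u (d n *\<^sub>R k) x / complex_of_real (d n))"
    have [measurable]: "F n \<in> borel_measurable borel" for n unfolding F_def by measurable
    have "(\<lambda>n. emeasure lborel {x. 1 < norm (F n x)}) \<longlonglongrightarrow> emeasure lborel {x. 1 < norm (cdot k (g x))}"
    proof (rule level_set_convergence)
      have "(\<integral>\<^sup>+x. ennreal ((norm (cdot k (g x)))\<^sup>2) \<partial>lborel) \<le> (\<integral>\<^sup>+x. ennreal ((norm k)\<^sup>2) * ennreal ((norm (g x))\<^sup>2) \<partial>lborel)" (is "nn_integral _ ?l1 \<le> nn_integral _ ?r1")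
      proof (rule nn_integral_mono)
        fix x
        have "(norm (cdot k (g x)))\<^sup>2 \<le> (norm k * norm (g x))\<^sup>2" by (intro power_mono norm_cdot_le) auto
        then show "?l1 x \<le> ?r1 x"
          by (simp add: power_mult_distrib ennreal_leI flip: ennreal_mult)
      qed
      also have "\<dots> < \<infinity>" using gfin unfolding g_def[symmetric] by (simp add: nn_integral_cmult ennreal_mult_less_top)
      finally show "(\<integral>\<^sup>+x. ennreal ((norm (cdot k (g x)))\<^sup>2) \<partial>lborel) < \<infinity>" .
      show "(\<lambda>n. \<integral>\<^sup>+x. ennreal ((norm (F n x - cdot k (g x)))\<^sup>2) \<partial>lborel) \<longlonglongrightarrow> 0"
        unfolding F_def g_def by (rule mdiff_quotient_L2[OF w L ufin gfin d])
    qed (use k in measurable)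
    moreover have "superlevel A u (d n) (d n *\<^sub>R k) = emeasure lborel {x. 1 < norm (F n x)}" for n
      using d(2)[of n] by (simp add: superlevel_def F_def norm_divide field_simps)
    ultimately show ?thesis by (simp add: m_def)
  qed
  define nearf where "nearf = (\<lambda>n k. if d n * norm k \<le> 1 then wt k * superlevel A u (d n) (d n *\<^sub>R k) else 0)"
  define farf where "farf = (\<lambda>n k. if d n * norm k \<le> 1 then 0 else wt k * superlevel A u (d n) (d n *\<^sub>R k))"
  have [measurable]: "nearf n \<in> borel_measurable borel" "farf n \<in> borel_measurable borel" for n
    unfolding nearf_def farf_def by measurable
  have Js: "J A (d n) u = (\<integral>\<^sup>+k. nearf n k \<partial>lborel) + (\<integral>\<^sup>+k. farf n k \<partial>lborel)" for n
    unfolding J_rescaled[OF wgrad_measurable(1)[OF w] lipschitz_measurable[OF L] d(2)]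
    by (subst nn_integral_add[symmetric]) (auto simp: nearf_def farf_def wt_def intro!: nn_integral_cong)
  define W where "W = (\<lambda>k::real^'n. ennreal (1\<^sup>2 / norm k ^ (?N + 2)) *
      (ennreal (2 * norm k / 1) * (\<integral>\<^sup>+x. ennreal (f x) * indicator {x. 1 < 2 * norm k * f x} x \<partial>lborel)))"
  have Wm[measurable]: "W \<in> borel_measurable borel"
  proof -
    have "W = (\<lambda>k. ennreal (1\<^sup>2 / norm k ^ (?N + 2)) *
      (ennreal (2 * norm k / 1) * (\<integral>\<^sup>+x. ennreal (f x) * (if 1 < 2 * norm k * f x then 1 else 0) \<partial>lborel)))"
      unfolding W_def by (intro ext arg_cong2[where f="(*)"] refl nn_integral_cong) (simp add: indicator_def)
    also have "\<dots> \<in> borel_measurable borel" by measurable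
    finally show ?thesis .
  qed
  have "(\<lambda>n. \<integral>\<^sup>+k. nearf n k \<partial>lborel) \<longlonglongrightarrow> (\<integral>\<^sup>+k. wt k * m k \<partial>lborel)"
  proof (rule nn_integral_dominated_convergence[where w=W])
    show "(\<integral>\<^sup>+k. W k \<partial>lborel) < \<infinity>"
      unfolding W_def nn_integral_truncated_tail[OF fm f0 zero_less_one]
      using ffin by (simp add: ennreal_mult_less_top)
    show "AE k in lborel. nearf n k \<le> W k" for n
    proof (rule AE_I2)
      fix k :: "real^'n"
      show "nearf n k \<le> W k"
      proof (cases "d n * norm k \<le> 1")
        case True
        have "superlevel A u (d n) (d n *\<^sub>R k) \<le> ennreal (2 * norm (d n *\<^sub>R k) / d n) *
            (\<integral>\<^sup>+x. ennreal (f x) * indicator {x. d n < 2 * norm (d n *\<^sub>R k) * f x} x \<partial>lborel)"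
          unfolding f_def by (rule superlevel_near[OF w L _ d(2)]) (use True d(2)[of n] in simp)
        also have "\<dots> = ennreal (2 * norm k / 1) * (\<integral>\<^sup>+x. ennreal (f x) * indicator {x. 1 < 2 * norm k * f x} x \<partial>lborel)"
        proof -
          have "d n < 2 * norm (d n *\<^sub>R k) * f x \<longleftrightarrow> 1 < 2 * norm k * f x" for x
          proof -
            have "2 * norm (d n *\<^sub>R k) * f x = d n * (2 * norm k * f x)" using d(2)[of n] by simp
            then show ?thesis using d(2)[of n] by (metis mult.right_neutral mult_less_cancel_left_pos)
          qed
          then show ?thesis using d(2)[of n] by simp
        qed
        finally show ?thesis
          unfolding nearf_def W_def wt_def if_P[OF True] one_power2 by (rule mult_left_mono) simp
      next
        case False
        then show ?thesis by (simp add: nearf_def)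
      qed
    qed
    show "AE k in lborel. (\<lambda>n. nearf n k) \<longlonglongrightarrow> wt k * m k"
      using cdot_level_null_AE[of g, simplified]
    proof eventually_elim
      case (elim k)
      have "(\<lambda>n. d n * norm k) \<longlonglongrightarrow> 0 * norm k" by (intro tendsto_intros d)
      then have "eventually (\<lambda>n. d n * norm k < 1) sequentially" by (intro order_tendstoD) auto
      then have ev: "eventually (\<lambda>n. wt k * superlevel A u (d n) (d n *\<^sub>R k) = nearf n k) sequentially"
        by eventually_elim (simp add: nearf_def)
      have "(\<lambda>n. wt k * superlevel A u (d n) (d n *\<^sub>R k)) \<longlonglongrightarrow> wt k * m k"
        by (rule tendsto_mult_ennreal[OF tendsto_const sl[OF elim]]) 
           (auto simp: wt_def m_def cdot_def)
      then show ?case by (rule Lim_transform_eventually[OF _ ev])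
    qed
  qed measurable
  moreover have "(\<integral>\<^sup>+k. wt k * m k \<partial>lborel) = ennreal (ball_vol TYPE('n) / 2) * L2_sq g"
  proof -
    have "(\<integral>\<^sup>+k. wt k * m k \<partial>lborel) = (\<integral>\<^sup>+k. \<integral>\<^sup>+x. (if 1 < norm (cdot k (g x)) then 1 else 0) * wt k \<partial>lborel \<partial>lborel)"
    proof (rule nn_integral_cong)
      fix k
      have "m k = (\<integral>\<^sup>+x. indicator {x. 1 < norm (cdot k (g x))} x \<partial>lborel)"
        unfolding m_def by (subst nn_integral_indicator) auto
      also have "\<dots> = (\<integral>\<^sup>+x. (if 1 < norm (cdot k (g x)) then 1 else 0) \<partial>lborel)"
        by (intro nn_integral_cong) (simp add: indicator_def)
      finally show "wt k * m k = (\<integral>\<^sup>+x. (if 1 < norm (cdot k (g x)) then 1 else 0) * wt k \<partial>lborel)"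
        by (subst nn_integral_multc) (auto simp: mult.commute)
    qed
    also have "\<dots> = (\<integral>\<^sup>+x. \<integral>\<^sup>+k. (if 1 < norm (cdot k (g x)) then 1 else 0) * wt k \<partial>lborel \<partial>lborel)"
      by (rule lborel_pair.Fubini') measurable
    also have "\<dots> = (\<integral>\<^sup>+x. ennreal (ball_vol TYPE('n) / 2) * ennreal ((norm (g x))\<^sup>2) \<partial>lborel)" (is "nn_integral _ ?a1 = nn_integral _ ?b1")
    proof (rule nn_integral_cong)
      fix x
      have "(\<integral>\<^sup>+k. (if 1 < norm (cdot k (g x)) then 1 else 0) * wt k \<partial>lborel) = (\<integral>\<^sup>+k. indicator {k. norm (cdot k (g x)) > 1} k * ennreal (1 / norm k ^ (?N + 2)) \<partial>lborel)"
        by (intro nn_integral_cong) (simp add: indicator_def wt_def)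
      also have "\<dots> = ennreal (ball_vol TYPE('n) / 2 * (norm (g x))\<^sup>2)" by (rule nn_integral_superlevel)
      finally show "?a1 x = ?b1 x"
        by (simp only: ennreal_mult''[OF zero_le_power2])
    qed
    also have "\<dots> = ennreal (ball_vol TYPE('n) / 2) * L2_sq g"
      by (rule nn_integral_cmult) measurable
    finally show ?thesis .
  qed
  ultimately have near: "(\<lambda>n. \<integral>\<^sup>+k. nearf n k \<partial>lborel) \<longlonglongrightarrow> ennreal (ball_vol TYPE('n) / 2) * L2_sq g" by simp
  have far: "(\<lambda>n. \<integral>\<^sup>+k. farf n k \<partial>lborel) \<longlonglongrightarrow> 0"
  proof -
    let ?C = "ennreal (?N * ball_vol TYPE('n))"
    define q where "q = (\<lambda>n. \<integral>\<^sup>+x. ennreal ((d n)\<^sup>2) * (if d n / 2 < norm (u x) then 1 else 0) \<partial>lborel)"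
    have le: "(\<integral>\<^sup>+k. farf n k \<partial>lborel) \<le> ?C * q n" for n
    proof -
      let ?e = "emeasure lborel {x. d n / 2 < norm (u x)}"
      have e: "?e = (\<integral>\<^sup>+x. (if d n / 2 < norm (u x) then 1 else 0) \<partial>lborel)"
      proof -
        have "?e = (\<integral>\<^sup>+x. indicator {x. d n / 2 < norm (u x)} x \<partial>lborel)"
          by (subst nn_integral_indicator) auto
        also have "\<dots> = (\<integral>\<^sup>+x. (if d n / 2 < norm (u x) then 1 else 0) \<partial>lborel)"
          by (intro nn_integral_cong) (simp add: indicator_def)
        finally show ?thesis .
      qed
      have "(\<integral>\<^sup>+k. farf n k \<partial>lborel) \<le> (\<integral>\<^sup>+k. (indicator {k. norm k > 1 / d n} k * ennreal (1 / norm k ^ (?N + 2))) * (2 * ?e) \<partial>(lborel::(real^'n) measure))" (is "nn_integral _ ?l2 \<le> nn_integral _ ?r2")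
      proof (rule nn_integral_mono)
        fix k :: "real^'n"
        have "d n * norm k \<le> 1 \<longleftrightarrow> \<not> norm k > 1 / d n" using d(2)[of n] by (simp add: field_simps not_less)
        then show "?l2 k \<le> ?r2 k"
          using mult_left_mono[OF superlevel_far[OF wgrad_measurable(1)[OF w] lipschitz_measurable[OF L], of "d n" "d n *\<^sub>R k"], of "ennreal (1 / norm k ^ (?N + 2))"]
          unfolding farf_def wt_def by (cases "d n * norm k \<le> 1") (simp_all del: power_Suc add_2_eq_Suc')
      qed
      also have "\<dots> = ennreal (?N * ball_vol TYPE('n) / (2 * (1 / d n) ^ 2)) * (2 * ?e)"
        using d(2)[of n] nn_integral_norm_tail[of "1 / d n" 2, where 'n='n] by (subst nn_integral_multc) auto
      also have "\<dots> = (ennreal (?N * ball_vol TYPE('n) / (2 * (1 / d n) ^ 2)) * ennreal 2) * ?e"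
        by (simp add: mult.assoc)
      also have "ennreal (?N * ball_vol TYPE('n) / (2 * (1 / d n) ^ 2)) * ennreal 2 = ?C * ennreal ((d n)\<^sup>2)"
      proof -
        have "?N * ball_vol TYPE('n) / (2 * (1 / d n) ^ 2) * 2 = ?N * ball_vol TYPE('n) * (d n)\<^sup>2"
          using d(2)[of n] by (simp add: field_simps)
        then show ?thesis
          using ball_vol_pos[where 'n='n] by (simp only: ennreal_mult''[symmetric] zero_le_power2 zero_le_numeral)
      qed
      also have "?C * ennreal ((d n)\<^sup>2) * ?e = ?C * q n"
        unfolding q_def e by (subst nn_integral_cmult) (auto simp: mult.assoc)
      finally show ?thesis .
    qed
    have "q \<longlonglongrightarrow> (\<integral>\<^sup>+x. 0 \<partial>(lborel::(real^'n) measure))"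
      unfolding q_def
    proof (rule nn_integral_dominated_convergence[where w="\<lambda>x. 4 * ennreal ((norm (u x))\<^sup>2)"])
      show "(\<integral>\<^sup>+x. 4 * ennreal ((norm (u x))\<^sup>2) \<partial>lborel) < \<infinity>"
        using ufin by (simp add: nn_integral_cmult ennreal_mult_less_top)
      show "AE x in lborel. ennreal ((d n)\<^sup>2) * (if d n / 2 < norm (u x) then 1 else 0) \<le> 4 * ennreal ((norm (u x))\<^sup>2)" for n
      proof (rule AE_I2)
        fix x
        show "ennreal ((d n)\<^sup>2) * (if d n / 2 < norm (u x) then 1 else 0) \<le> 4 * ennreal ((norm (u x))\<^sup>2)"
        proof (cases "d n / 2 < norm (u x)")
          case True
          then have "(d n)\<^sup>2 \<le> (2 * norm (u x))\<^sup>2" using d(2)[of n] by (intro power_mono) auto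
          then have "ennreal ((d n)\<^sup>2) \<le> ennreal (4 * (norm (u x))\<^sup>2)" by (intro ennreal_leI) (simp add: power_mult_distrib)
          then show ?thesis using True by (simp add: ennreal_mult')
        qed simp
      qed
      show "AE x in lborel. (\<lambda>n. ennreal ((d n)\<^sup>2) * (if d n / 2 < norm (u x) then 1 else 0)) \<longlonglongrightarrow> 0"
      proof (rule AE_I2, rule tendsto_sandwich[OF _ _ tendsto_const])
        fix x
        have "(\<lambda>n. ennreal ((d n)\<^sup>2)) \<longlonglongrightarrow> ennreal (0\<^sup>2)" by (intro tendsto_ennrealI tendsto_intros d)
        then show "(\<lambda>n. ennreal ((d n)\<^sup>2)) \<longlonglongrightarrow> 0" by simp
      qed auto
    qed measurable
    then have "(\<lambda>n. ?C * q n) \<longlonglongrightarrow> ?C * 0" by (intro tendsto_mult_ennreal tendsto_const) auto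
    then have l0: "(\<lambda>n. ?C * q n) \<longlonglongrightarrow> 0" by simp
    show ?thesis by (rule tendsto_sandwich[OF _ _ tendsto_const l0]) (use le in auto)
  qed
  show ?thesis unfolding Js g_def[symmetric] using tendsto_add[OF near far] by simp
qed

lemma J_limit:
  fixes u :: "real ^ 'n::finite \<Rightarrow> complex"
  assumes w: "wgrad u G" and L: "L-lipschitz_on UNIV A"
    and ufin: "L2_sq u < \<infinity>"
    and gfin: "L2_sq (mgrad A u G) < \<infinity>"
  shows "((\<lambda>\<delta>. J A \<delta> u) \<longlongrightarrow> ennreal (ball_vol TYPE('n) / 2) * L2_sq (mgrad A u G)) (at_right 0)"
  unfolding tendsto_at_iff_sequentially
proof (intro allI impI)
  fix d :: "nat \<Rightarrow> real" assume "\<forall>i. d i \<in> {0<..} - {0}" "d \<longlonglongrightarrow> 0"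
  then show "((\<lambda>\<delta>. J A \<delta> u) \<circ> d) \<longlonglongrightarrow> ennreal (ball_vol TYPE('n) / 2) * L2_sq (mgrad A u G)"
    unfolding o_def by (intro J_limit_sequence[OF w L ufin gfin]) auto
qed

section \<open>Bounded functionals on subspaces of square-integrable functions\<close>

lemma integrable_mult_sq:
  fixes f g :: "'a \<Rightarrow> real"
  assumes [measurable]: "f \<in> borel_measurable M" "g \<in> borel_measurable M"
    and "integrable M (\<lambda>x. (f x)\<^sup>2)" "integrable M (\<lambda>x. (g x)\<^sup>2)"
  shows "integrable M (\<lambda>x. f x * g x)"
proof (rule Bochner_Integration.integrable_bound)
  show "integrable M (\<lambda>x. (f x)\<^sup>2 + (g x)\<^sup>2)" using assms by simp
  show "AE x in M. norm (f x * g x) \<le> norm ((f x)\<^sup>2 + (g x)\<^sup>2)"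
  proof (rule AE_I2)
    fix x
    have "0 \<le> (\<bar>f x\<bar> - \<bar>g x\<bar>)\<^sup>2" "0 \<le> (f x)\<^sup>2" "0 \<le> (g x)\<^sup>2" by simp_all
    then have "2 * (\<bar>f x\<bar> * \<bar>g x\<bar>) \<le> (f x)\<^sup>2 + (g x)\<^sup>2" by (simp add: power2_eq_square algebra_simps)
    moreover have "0 \<le> \<bar>f x\<bar> * \<bar>g x\<bar>" by simp
    moreover have "norm (f x * g x) = \<bar>f x\<bar> * \<bar>g x\<bar>" "norm ((f x)\<^sup>2 + (g x)\<^sup>2) = (f x)\<^sup>2 + (g x)\<^sup>2"
      by (simp_all add: abs_mult)
    ultimately show "norm (f x * g x) \<le> norm ((f x)\<^sup>2 + (g x)\<^sup>2)" by linarith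
  qed
qed measurable

lemma integral_mult_weighted_bound:
  fixes f g :: "'a \<Rightarrow> real"
  assumes [measurable]: "f \<in> borel_measurable M" "g \<in> borel_measurable M"
    and i: "integrable M (\<lambda>x. (f x)\<^sup>2)" "integrable M (\<lambda>x. (g x)\<^sup>2)" and s: "s > 0"
  shows "\<bar>LINT x|M. f x * g x\<bar> \<le> (LINT x|M. (f x)\<^sup>2) / s + s * (LINT x|M. (g x)\<^sup>2)"
proof -
  have "\<bar>LINT x|M. f x * g x\<bar> \<le> (LINT x|M. \<bar>f x * g x\<bar>)"
    by (rule integral_abs_bound)
  also have "\<dots> \<le> (LINT x|M. (f x)\<^sup>2 / s + s * (g x)\<^sup>2)"
  proof (rule integral_mono)
    show "integrable M (\<lambda>x. \<bar>f x * g x\<bar>)" by (intro integrable_abs integrable_mult_sq i) measurable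
    show "integrable M (\<lambda>x. (f x)\<^sup>2 / s + s * (g x)\<^sup>2)" using i by simp
    fix x
    have "0 \<le> (\<bar>f x\<bar> - s * \<bar>g x\<bar>)\<^sup>2" by simp
    then have "2 * s * (\<bar>f x\<bar> * \<bar>g x\<bar>) \<le> (f x)\<^sup>2 + s\<^sup>2 * (g x)\<^sup>2" by (simp add: power2_eq_square algebra_simps)
    moreover have "s * (\<bar>f x\<bar> * \<bar>g x\<bar>) \<le> 2 * s * (\<bar>f x\<bar> * \<bar>g x\<bar>)" using s by simp
    ultimately have "s * (\<bar>f x\<bar> * \<bar>g x\<bar>) \<le> (f x)\<^sup>2 + s\<^sup>2 * (g x)\<^sup>2" by linarith
    then show "\<bar>f x * g x\<bar> \<le> (f x)\<^sup>2 / s + s * (g x)\<^sup>2"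
      using s by (simp add: abs_mult field_simps power2_eq_square)
  qed
  also have "\<dots> = (LINT x|M. (f x)\<^sup>2) / s + s * (LINT x|M. (g x)\<^sup>2)"
    using i by simp
  finally show ?thesis .
qed

text \<open>A sequence that is Cauchy in mean square at a geometric rate converges almost everywhere and
  in mean square.\<close>

lemma L2_complete_geometric:
  fixes v :: "nat \<Rightarrow> 'a \<Rightarrow> real"
  assumes [measurable]: "\<And>n. v n \<in> borel_measurable M"
    and int: "\<And>n. integrable M (\<lambda>x. (v n x)\<^sup>2)"
    and C: "\<And>n k. n \<le> k \<Longrightarrow> (LINT x|M. (v n x - v k x)\<^sup>2) \<le> 4 * (1/8)^n * (1/8)^n"
  shows "\<exists>g\<in>borel_measurable M. integrable M (\<lambda>x. (g x)\<^sup>2) \<and> (\<forall>n. (LINT x|M. (g x - v n x)\<^sup>2) \<le> 4 * (1/8)^n * (1/8)^n)"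
proof -
  have idiff: "integrable M (\<lambda>x. (v n x - v k x)\<^sup>2)" for n k
  proof -
    have "integrable M (\<lambda>x. (v n x)\<^sup>2 + (v k x)\<^sup>2 - 2 * (v n x * v k x))"
      by (intro Bochner_Integration.integrable_diff Bochner_Integration.integrable_add integrable_mult_right integrable_mult_sq int) measurable
    then show ?thesis by (simp add: power2_eq_square algebra_simps)
  qed
  have nnC: "(\<integral>\<^sup>+x. ennreal ((v n x - v k x)\<^sup>2) \<partial>M) \<le> ennreal (4 * (1/8)^n * (1/8)^n)" if "n \<le> k" for n k
    using C[OF that] nn_integral_eq_integral[OF idiff[of n k]] by (simp add: ennreal_leI)
  \<comment> \<open>the factor \<open>16 ^ n\<close> still leaves a convergent series, and forces consecutive differences to decay like \<open>(1/4)^n\<close> almost everywhere\<close>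
  have "(\<integral>\<^sup>+x. (\<Sum>n. ennreal (16 ^ n * (v n x - v (Suc n) x)\<^sup>2)) \<partial>M) = (\<Sum>n. \<integral>\<^sup>+x. ennreal (16 ^ n * (v n x - v (Suc n) x)\<^sup>2) \<partial>M)"
    by (rule nn_integral_suminf) measurable
  also have "\<dots> \<le> (\<Sum>n. ennreal (4 * (1/4)^n))"
  proof (rule suminf_le)
    fix n
    have "(\<integral>\<^sup>+x. ennreal (16 ^ n * (v n x - v (Suc n) x)\<^sup>2) \<partial>M) = ennreal (16 ^ n) * (\<integral>\<^sup>+x. ennreal ((v n x - v (Suc n) x)\<^sup>2) \<partial>M)"
      by (subst nn_integral_cmult[symmetric]) (auto simp: ennreal_mult)
    also have "\<dots> \<le> ennreal (16 ^ n) * ennreal (4 * (1/8)^n * (1/8)^n)"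
      by (intro mult_left_mono nnC) auto
    also have "\<dots> = ennreal (16 ^ n * (4 * (1/8)^n * (1/8)^n))"
      by (subst ennreal_mult) auto
    also have "16 ^ n * (4 * (1/8)^n * (1/8)^n) = 4 * (1/4::real)^n"
    proof -
      have "(16::real) ^ n * ((1/8)^n * (1/8)^n) = (16 * (1/8) * (1/8)) ^ n" by (simp only: power_mult_distrib mult.assoc)
      then show ?thesis by simp
    qed
    finally show "(\<integral>\<^sup>+x. ennreal (16 ^ n * (v n x - v (Suc n) x)\<^sup>2) \<partial>M) \<le> ennreal (4 * (1/4)^n)" .
  qed auto
  also have "\<dots> = ennreal (\<Sum>n. 4 * (1/4)^n)"
    by (rule suminf_ennreal2) (auto intro!: summable_mult summable_geometric)
  also have "\<dots> < \<infinity>" by simp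
  finally have "(\<integral>\<^sup>+x. (\<Sum>n. ennreal (16 ^ n * (v n x - v (Suc n) x)\<^sup>2)) \<partial>M) \<noteq> \<infinity>" by simp
  then have "AE x in M. (\<Sum>n. ennreal (16 ^ n * (v n x - v (Suc n) x)\<^sup>2)) \<noteq> \<infinity>"
    by (intro nn_integral_noteq_infinite) measurable
  then have conv: "AE x in M. convergent (\<lambda>n. v n x)"
  proof eventually_elim
    case (elim x)
    then obtain K where K: "(\<Sum>n. ennreal (16 ^ n * (v n x - v (Suc n) x)\<^sup>2)) = ennreal K" "K \<ge> 0"
      using less_top_ennreal[THEN iffD1, of "\<Sum>n. ennreal (16 ^ n * (v n x - v (Suc n) x)\<^sup>2)"]
      by (auto simp only: less_top infinity_ennreal_def)
    have b: "\<bar>v (Suc n) x - v n x\<bar> \<le> sqrt K * (1/4) ^ n" for n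
    proof -
      have "ennreal (16 ^ n * (v n x - v (Suc n) x)\<^sup>2) \<le> ennreal K"
      proof -
        define T where "T = (\<lambda>n. ennreal (16 ^ n * (v n x - v (Suc n) x)\<^sup>2))"
        have "sum T {n} \<le> suminf T" by (rule sum_le_suminf) (auto intro: summableI)
        then have "T n \<le> suminf T" by simp
        then show ?thesis using K(1) by (simp only: T_def)
      qed
      then have "16 ^ n * (v n x - v (Suc n) x)\<^sup>2 \<le> K" using K(2) by simp
      moreover have "16 ^ n * (v n x - v (Suc n) x)\<^sup>2 = (4 ^ n * \<bar>v (Suc n) x - v n x\<bar>)\<^sup>2"
      proof -
        have "(16::real) ^ n = (4 ^ n)\<^sup>2" by (simp add: power2_eq_square flip: power_mult_distrib)
        moreover have "(v n x - v (Suc n) x)\<^sup>2 = \<bar>v (Suc n) x - v n x\<bar>\<^sup>2" by (simp add: power2_commute)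
        ultimately show ?thesis by (simp only: power_mult_distrib)
      qed
      ultimately have "4 ^ n * \<bar>v (Suc n) x - v n x\<bar> \<le> sqrt K" by (simp add: real_le_rsqrt)
      then show ?thesis by (simp add: field_simps power_divide)
    qed
    have "summable (\<lambda>n. v (Suc n) x - v n x)"
      by (rule summable_comparison_test'[where g="\<lambda>n. sqrt K * (1/4) ^ n" and N=0])
         (use b in \<open>auto intro!: summable_mult summable_geometric\<close>)
    then have "convergent (\<lambda>n. \<Sum>k<n. v (Suc k) x - v k x)" by (simp add: summable_iff_convergent)
    then have "convergent (\<lambda>n. v n x - v 0 x)" by (simp only: sum_lessThan_telescope[of "\<lambda>k. v k x"])
    then show ?case by (simp add: convergent_diff_const_right_iff)
  qed
  define g where "g = (\<lambda>x. lim (\<lambda>n. v n x))"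
  have gm[measurable]: "g \<in> borel_measurable M" unfolding g_def by (rule borel_measurable_lim_metric) measurable
  have gl: "AE x in M. (\<lambda>n. v n x) \<longlonglongrightarrow> g x"
    using conv by eventually_elim (simp add: g_def convergent_LIMSEQ_iff)
  have Fa: "(\<integral>\<^sup>+x. ennreal ((g x - v k x)\<^sup>2) \<partial>M) \<le> ennreal (4 * (1/8)^k * (1/8)^k)" for k
  proof -
    have "(\<integral>\<^sup>+x. ennreal ((g x - v k x)\<^sup>2) \<partial>M) = (\<integral>\<^sup>+x. liminf (\<lambda>n. ennreal ((v n x - v k x)\<^sup>2)) \<partial>M)"
    proof (rule nn_integral_cong_AE)
      show "AE x in M. ennreal ((g x - v k x)\<^sup>2) = liminf (\<lambda>n. ennreal ((v n x - v k x)\<^sup>2))"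
        using gl
      proof eventually_elim
        case (elim x)
        have "(\<lambda>n. ennreal ((v n x - v k x)\<^sup>2)) \<longlonglongrightarrow> ennreal ((g x - v k x)\<^sup>2)"
          by (intro tendsto_ennrealI tendsto_intros elim)
        from lim_imp_Liminf[OF sequentially_bot this] show ?case by (rule sym)
      qed
    qed
    also have "\<dots> \<le> liminf (\<lambda>n. \<integral>\<^sup>+x. ennreal ((v n x - v k x)\<^sup>2) \<partial>M)"
      by (rule nn_integral_liminf) measurable
    also have "\<dots> \<le> ennreal (4 * (1/8)^k * (1/8)^k)"
    proof (rule Liminf_le)
      show "eventually (\<lambda>n. (\<integral>\<^sup>+x. ennreal ((v n x - v k x)\<^sup>2) \<partial>M) \<le> ennreal (4 * (1/8)^k * (1/8)^k)) sequentially"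
        using eventually_ge_at_top[of k]
      proof eventually_elim
        case (elim n)
        have "(\<integral>\<^sup>+x. ennreal ((v n x - v k x)\<^sup>2) \<partial>M) = (\<integral>\<^sup>+x. ennreal ((v k x - v n x)\<^sup>2) \<partial>M)"
          by (intro nn_integral_cong arg_cong[where f=ennreal] power2_commute)
        then show ?case using nnC[OF elim] by simp
      qed
    qed simp
    finally show ?thesis .
  qed
  have ig: "integrable M (\<lambda>x. (g x - v k x)\<^sup>2)" for k
    using Fa[of k] by (intro integrableI_bounded) (auto simp: less_top[symmetric] top_unique intro: order.strict_trans1)
  have "integrable M (\<lambda>x. (g x)\<^sup>2)"
  proof (rule Bochner_Integration.integrable_bound)
    show "integrable M (\<lambda>x. 2 * (g x - v 0 x)\<^sup>2 + 2 * (v 0 x)\<^sup>2)" using ig[of 0] int[of 0] by simp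
    show "AE x in M. norm ((g x)\<^sup>2) \<le> norm (2 * (g x - v 0 x)\<^sup>2 + 2 * (v 0 x)\<^sup>2)" (is "AE x in _. ?P1 x")
    proof (rule AE_I2)
      fix x
      have "0 \<le> (g x - 2 * v 0 x)\<^sup>2" by simp
      then have "(g x)\<^sup>2 \<le> 2 * (g x - v 0 x)\<^sup>2 + 2 * (v 0 x)\<^sup>2" by (simp add: power2_eq_square algebra_simps)
      then show "?P1 x" by simp
    qed
  qed measurable
  moreover have "(LINT x|M. (g x - v n x)\<^sup>2) \<le> 4 * (1/8)^n * (1/8)^n" for n
    using Fa[of n] nn_integral_eq_integral[OF ig[of n]] by (simp add: ennreal_le_iff)
  ultimately show ?thesis using gm by blast
qed

text \<open>The representing function is the limit of a minimising sequence of
  \<open>v \<mapsto> (LINT x|M. (v x)\<^sup>2) - 2 * l v\<close> over \<open>V\<close>.\<close>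

lemma L2_functional_representation:
  fixes V :: "('a \<Rightarrow> real) set" and l :: "('a \<Rightarrow> real) \<Rightarrow> real"
  assumes V0: "(\<lambda>_. 0) \<in> V"
    and Vadd: "\<And>v w. v \<in> V \<Longrightarrow> w \<in> V \<Longrightarrow> (\<lambda>x. v x + w x) \<in> V"
    and Vscale: "\<And>v c. v \<in> V \<Longrightarrow> (\<lambda>x. c * v x) \<in> V"
    and Vm: "\<And>v. v \<in> V \<Longrightarrow> v \<in> borel_measurable M"
    and Vi: "\<And>v. v \<in> V \<Longrightarrow> integrable M (\<lambda>x. (v x)\<^sup>2)"
    and ladd: "\<And>v w. v \<in> V \<Longrightarrow> w \<in> V \<Longrightarrow> l (\<lambda>x. v x + w x) = l v + l w"
    and lscale: "\<And>v c. v \<in> V \<Longrightarrow> l (\<lambda>x. c * v x) = c * l v"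
    and bound: "\<And>v. v \<in> V \<Longrightarrow> \<bar>l v\<bar> \<le> C * sqrt (LINT x|M. (v x)\<^sup>2)"
  shows "\<exists>g\<in>borel_measurable M. integrable M (\<lambda>x. (g x)\<^sup>2) \<and> (\<forall>v\<in>V. l v = (LINT x|M. g x * v x))"
proof -
  define q where "q = (\<lambda>v :: 'a \<Rightarrow> real. LINT x|M. (v x)\<^sup>2)"
  define F where "F = (\<lambda>v. q v - 2 * l v)"
  have q0: "q v \<ge> 0" for v unfolding q_def by simp
  have Fb: "F v \<ge> - C\<^sup>2" if "v \<in> V" for v
  proof -
    have "0 \<le> (sqrt (q v) - C)\<^sup>2" by simp
    then have "2 * (C * sqrt (q v)) \<le> q v + C\<^sup>2" using q0[of v] by (simp add: power2_eq_square algebra_simps)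
    then show ?thesis using bound[OF that] unfolding F_def q_def by linarith
  qed
  have bdd: "bdd_below (F ` V)" using Fb by (intro bdd_belowI2[where m="- C\<^sup>2"]) auto
  define m where "m = Inf (F ` V)"
  have mle: "m \<le> F v" if "v \<in> V" for v unfolding m_def using bdd that by (rule cINF_lower)
  have ex: "\<exists>v\<in>V. F v < m + (1/8)^n * (1/8)^n" for n
  proof -
    have "m < m + (1/8)^n * (1/8)^n" by simp
    then show ?thesis unfolding m_def using V0 by (subst (asm) (1) cINF_less_iff) (auto simp: bdd)
  qed
  then obtain v where vV: "\<And>n. v n \<in> V" and vF: "\<And>n. F (v n) < m + (1/8)^n * (1/8)^n" by metis
  have exp2: "q (\<lambda>x. a x + c * b x) = q a + 2 * c * (LINT x|M. a x * b x) + c\<^sup>2 * q b" if "a \<in> V" "b \<in> V" for a b c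
  proof -
    have i: "integrable M (\<lambda>x. a x * b x)" "integrable M (\<lambda>x. (a x)\<^sup>2)" "integrable M (\<lambda>x. (b x)\<^sup>2)"
      using that by (auto intro!: integrable_mult_sq Vm Vi)
    have "q (\<lambda>x. a x + c * b x) = (LINT x|M. (a x)\<^sup>2 + 2 * c * (a x * b x) + c\<^sup>2 * (b x)\<^sup>2)"
      unfolding q_def by (intro Bochner_Integration.integral_cong) (auto simp: power2_eq_square algebra_simps)
    also have "\<dots> = q a + 2 * c * (LINT x|M. a x * b x) + c\<^sup>2 * q b"
      unfolding q_def using i by simp
    finally show ?thesis .
  qed
  have Fexp: "F (\<lambda>x. a x + c * b x) = F a + 2 * c * ((LINT x|M. a x * b x) - l b) + c\<^sup>2 * q b" if "a \<in> V" "b \<in> V" for a b c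
    unfolding F_def exp2[OF that] using that by (simp add: ladd Vscale lscale algebra_simps)
  \<comment> \<open>the parallelogram identity makes minimising sequences Cauchy\<close>
  have par: "q (\<lambda>x. a x - b x) = 2 * (F a + F b - 2 * F (\<lambda>x. (1/2) * (a x + b x)))" if "a \<in> V" "b \<in> V" for a b
  proof -
    have ab: "(\<lambda>x. a x + b x) \<in> V" using that by (rule Vadd)
    have "q (\<lambda>x. (1/2) * (a x + b x)) = (1/4) * q (\<lambda>x. a x + b x)"
      unfolding q_def power_mult_distrib by (simp add: power2_eq_square)
    moreover have "l (\<lambda>x. (1/2) * (a x + b x)) = (1/2) * (l a + l b)"
      by (simp only: lscale[OF ab] ladd[OF that])
    moreover have "q (\<lambda>x. a x + b x) = q a + 2 * (LINT x|M. a x * b x) + q b" using exp2[OF that, of 1] by simp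
    moreover have "q (\<lambda>x. a x - b x) = q a - 2 * (LINT x|M. a x * b x) + q b" using exp2[OF that, of "-1"] by simp
    ultimately show ?thesis unfolding F_def by simp
  qed
  have C4: "q (\<lambda>x. v n x - v k x) \<le> 4 * (1/8)^n * (1/8)^n" if "n \<le> k" for n k
  proof -
    have "m \<le> F (\<lambda>x. (1/2) * (v n x + v k x))" by (intro mle Vscale Vadd vV)
    then have "q (\<lambda>x. v n x - v k x) \<le> 2 * ((1/8)^n * (1/8)^n + (1/8)^k * (1/8)^k)"
    proof -
      have arith: "2 * (a + b - 2 * c) \<le> 2 * (p + r)" if "m \<le> c" "a < m + p" "b < m + r" for a b c p r :: real
        using that by argo
      show ?thesis unfolding par[OF vV vV] by (rule arith[OF \<open>m \<le> F (\<lambda>x. (1/2) * (v n x + v k x))\<close> vF vF])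
    qed
    also have "(1/8)^k * (1/8)^k \<le> (1/8)^n * (1/8::real)^n"
      using that by (intro mult_mono power_decreasing) auto
    finally show ?thesis by simp
  qed
  have "\<exists>g\<in>borel_measurable M. integrable M (\<lambda>x. (g x)\<^sup>2) \<and> (\<forall>n. (LINT x|M. (g x - v n x)\<^sup>2) \<le> 4 * (1/8)^n * (1/8)^n)"
    by (rule L2_complete_geometric) (use vV Vm Vi C4 in \<open>auto simp: q_def\<close>)
  then obtain g where gm: "g \<in> borel_measurable M" and gi: "integrable M (\<lambda>x. (g x)\<^sup>2)"
    and gv: "\<And>n. (LINT x|M. (g x - v n x)\<^sup>2) \<le> 4 * (1/8)^n * (1/8)^n" by blast
  have "l w = (LINT x|M. g x * w x)" if w: "w \<in> V" for w
  proof -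
    note [measurable] = gm Vm[OF w] Vm[OF vV]
    have iv: "integrable M (\<lambda>x. v n x * w x)" and ig: "integrable M (\<lambda>x. g x * w x)" for n
      by (auto intro!: integrable_mult_sq Vi vV w gi)
    have igv: "integrable M (\<lambda>x. (g x - v n x)\<^sup>2)" for n
    proof -
      have "integrable M (\<lambda>x. (g x)\<^sup>2 + (v n x)\<^sup>2 - 2 * (g x * v n x))"
        by (intro Bochner_Integration.integrable_diff Bochner_Integration.integrable_add integrable_mult_right integrable_mult_sq gi Vi vV) measurable
      then show ?thesis by (simp add: power2_eq_square algebra_simps)
    qed
    have b: "\<bar>(LINT x|M. v n x * w x) - l w\<bar> \<le> (1/8)^n * (q w + 1)" for n
    proof -
      let ?b = "(LINT x|M. v n x * w x) - l w" and ?s = "(1/8)^n :: real"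
      have "m \<le> F (\<lambda>x. v n x + c * w x)" for c by (intro mle Vadd Vscale vV w)
      then have P: "m \<le> F (v n) + 2 * c * ?b + c\<^sup>2 * q w" for c unfolding Fexp[OF vV w] .
      have s: "?s > 0" by simp
      have "- (?s * ?s) \<le> 2 * c * ?b + c\<^sup>2 * q w" for c using P[of c] vF[of n] by linarith
      from this[of ?s] this[of "- ?s"] have "2 * ?s * ?b \<le> ?s * ?s + ?s * ?s * q w" "- (2 * ?s * ?b) \<le> ?s * ?s + ?s * ?s * q w"
        by (simp_all add: power2_eq_square)
      then have "?s * (2 * \<bar>?b\<bar>) \<le> ?s * (?s * (q w + 1))" by (simp add: abs_if algebra_simps)
      then have "2 * \<bar>?b\<bar> \<le> ?s * (q w + 1)" using s by (simp only: mult_le_cancel_left_pos)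
      moreover have "0 \<le> \<bar>?b\<bar>" by (rule abs_ge_zero)
      ultimately show ?thesis by argo
    qed
    have c: "\<bar>(LINT x|M. g x * w x) - (LINT x|M. v n x * w x)\<bar> \<le> (1/8)^n * (4 + q w)" for n
    proof -
      have "(LINT x|M. g x * w x) - (LINT x|M. v n x * w x) = (LINT x|M. (g x - v n x) * w x)"
        by (subst Bochner_Integration.integral_diff[symmetric, OF ig iv]) (simp add: algebra_simps)
      also have "\<bar>\<dots>\<bar> \<le> (LINT x|M. (g x - v n x)\<^sup>2) / (1/8)^n + (1/8)^n * (LINT x|M. (w x)\<^sup>2)"
        by (rule integral_mult_weighted_bound) (use igv Vi[OF w] in auto)
      also have "\<dots> \<le> (4 * (1/8)^n * (1/8)^n) / (1/8)^n + (1/8)^n * q w"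
        unfolding q_def by (intro add_mono divide_right_mono gv order_refl) auto
      also have "\<dots> = (1/8)^n * (4 + q w)" by (simp add: algebra_simps)
      finally show ?thesis .
    qed
    have d: "\<bar>(LINT x|M. g x * w x) - l w\<bar> \<le> (1/8)^n * (5 + 2 * q w)" for n
    proof -
      have "(1/8)^n * (4 + q w) + (1/8)^n * (q w + 1) = (1/8)^n * (5 + 2 * q w)" by (simp add: algebra_simps)
      then show ?thesis using b[of n] c[of n] by linarith
    qed
    have "(\<lambda>n. (1/8::real)^n * (5 + 2 * q w)) \<longlonglongrightarrow> 0 * (5 + 2 * q w)"
      by (intro tendsto_intros LIMSEQ_realpow_zero) auto
    then have "\<bar>(LINT x|M. g x * w x) - l w\<bar> \<le> 0 * (5 + 2 * q w)"
      by (rule LIMSEQ_le_const) (use d in blast)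
    then show ?thesis by simp
  qed
  then show ?thesis using gm gi by blast
qed

section \<open>From the nonlocal bound to the weak gradient\<close>

lemma radial_proj_formula:
  fixes a :: "'a::euclidean_space"
  assumes M: "M \<ge> 0"
  shows "radial_proj M a = (if norm a \<le> M then a else (M / norm a) *\<^sub>R a)"
proof (cases "norm a \<le> M")
  case False
  have na: "norm a > 0" using False M by linarith
  have "(M / norm a) *\<^sub>R a = radial_proj M a"
  proof (rule closest_point_unique)
    show "(M / norm a) *\<^sub>R a \<in> cball 0 M" using na M by simp
    have "dist a ((M / norm a) *\<^sub>R a) = norm a - M"
    proof -
      have "a - (M / norm a) *\<^sub>R a = (1 - M / norm a) *\<^sub>R a" by (simp add: scaleR_diff_left)
      moreover have "\<bar>1 - M / norm a\<bar> = 1 - M / norm a" using False na by simp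
      ultimately have "dist a ((M / norm a) *\<^sub>R a) = (1 - M / norm a) * norm a" unfolding dist_norm by simp
      then show ?thesis using na by (simp add: left_diff_distrib)
    qed
    then show "\<forall>z\<in>cball 0 M. dist a ((M / norm a) *\<^sub>R a) \<le> dist a z"
    proof (intro ballI)
      fix z :: 'a assume e: "dist a ((M / norm a) *\<^sub>R a) = norm a - M" and "z \<in> cball 0 M"
      then show "dist a ((M / norm a) *\<^sub>R a) \<le> dist a z"
        using norm_triangle_ineq2[of a z] by (simp only: e dist_norm mem_cball_0)
    qed
  qed auto
  then show ?thesis using False by simp
qed (simp add: radial_proj_id)

lemma radial_proj_rotate:
  fixes z e :: complex
  assumes "M \<ge> 0" "norm e = 1"
  shows "radial_proj M (e * z) = e * radial_proj M z"
  using assms by (simp add: radial_proj_formula norm_mult)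

text \<open>Radial truncation commutes with the phase and is nonexpansive; hence it does not increase
  the superlevel sets.\<close>

lemma mdiff_truncation:
  assumes "M \<ge> 0"
  shows "norm (mdiff A (\<lambda>x. radial_proj M (u x)) h x) \<le> norm (mdiff A u h x)"
proof -
  have "mdiff A (\<lambda>x. radial_proj M (u x)) h x = radial_proj M (exp (- (\<i> * complex_of_real (h \<bullet> A (x + h /\<^sub>R 2)))) * u (x + h)) - radial_proj M (u x)"
    unfolding mdiff_def by (subst radial_proj_rotate) (use assms in auto)
  then show ?thesis
    using radial_proj_lipschitz[OF assms, of "exp (- (\<i> * complex_of_real (h \<bullet> A (x + h /\<^sub>R 2)))) * u (x + h)" "u x"]
    by (simp add: mdiff_def dist_norm)
qed

lemma radial_proj_measurable [measurable]:
  fixes u :: "'b \<Rightarrow> 'a::euclidean_space"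
  assumes "M \<ge> 0" "u \<in> borel_measurable N"
  shows "(\<lambda>x. radial_proj M (u x)) \<in> borel_measurable N"
  by (rule measurable_compose[OF assms(2) borel_measurable_continuous_onI[OF radial_proj_continuous[OF assms(1)]]])

lemma superlevel_truncation:
  assumes [measurable]: "u \<in> borel_measurable borel" "A \<in> borel_measurable borel" and M: "M \<ge> 0"
  shows "superlevel A (\<lambda>x. radial_proj M (u x)) \<delta> h \<le> superlevel A u \<delta> h"
  unfolding superlevel_def
proof (rule emeasure_mono)
  show "{x. \<delta> < norm (mdiff A (\<lambda>x. radial_proj M (u x)) h x)} \<subseteq> {x. \<delta> < norm (mdiff A u h x)}"
  proof
    fix x assume "x \<in> {x. \<delta> < norm (mdiff A (\<lambda>x. radial_proj M (u x)) h x)}"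
    then show "x \<in> {x. \<delta> < norm (mdiff A u h x)}"
      using mdiff_truncation[OF M, of A u h x] by simp
  qed
qed measurable

lemma J_truncation:
  fixes u :: "real ^ 'n::finite \<Rightarrow> complex"
  assumes [measurable]: "u \<in> borel_measurable borel" "A \<in> borel_measurable borel" and M: "M \<ge> 0"
  shows "J A \<delta> (\<lambda>x. radial_proj M (u x)) \<le> J A \<delta> u"
proof -
  have [measurable]: "(\<lambda>x. radial_proj M (u x)) \<in> borel_measurable borel" using M by measurable
  show ?thesis
    by (subst (1 2) J_eq_superlevel, measurable) (intro nn_integral_mono mult_left_mono superlevel_truncation M, auto)
qed

text \<open>If \<open>(1/2)^i\<close> is the first dyadic value below \<open>a\<close>, then \<open>a \<le> 2 * (1/2)^i\<close>.\<close>

lemma dyadic_layer: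
  fixes a :: real
  assumes "0 \<le> a" "a \<le> 1"
  shows "a\<^sup>2 \<le> ((1/2)^m)\<^sup>2 + (\<Sum>i\<in>{1..m}. 4 * ((1/2)^i)\<^sup>2 * (if (1/2)^i < a then 1 else 0))"
proof (induction m)
  case 0
  then show ?case using assms by (simp add: power_le_one)
next
  case (Suc m)
  let ?S = "\<Sum>i\<in>{1..m}. 4 * ((1/2)^i)\<^sup>2 * (if (1/2)^i < a then 1 else 0) :: real"
  have S0: "?S \<ge> 0" by (intro sum_nonneg) auto
  show ?case
  proof (cases "(1/2)^Suc m < a")
    case True
    have "((1/2)^m)\<^sup>2 = 4 * ((1/2::real)^Suc m)\<^sup>2" by (simp add: power_divide power2_eq_square)
    moreover have "0 \<le> ((1/2::real)^Suc m)\<^sup>2" by simp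
    moreover have "(\<Sum>i\<in>{1..Suc m}. 4 * ((1/2)^i)\<^sup>2 * (if (1/2)^i < a then 1 else 0)) = ?S + 4 * ((1/2)^Suc m)\<^sup>2"
      using True by simp
    ultimately show ?thesis using Suc.IH by linarith
  next
    case False
    then have "a\<^sup>2 \<le> ((1/2)^Suc m)\<^sup>2" using assms by (intro power_mono) auto
    then show ?thesis using False S0 by simp
  qed
qed

text \<open>The critical weight, for which the second moment diverges only logarithmically; each dyadic shell
  contributes the same amount, and \<open>m\<close> counts the shells.\<close>

definition annulus_weight :: "nat \<Rightarrow> real ^ 'n::finite \<Rightarrow> real" where
  "annulus_weight m h = (if (1/2)^m < norm h \<and> norm h < 1 then 1 / norm h ^ (CARD('n) + 2) else 0)"

lemma annulus_weight_nonneg: "0 \<le> annulus_weight m h"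
  by (simp add: annulus_weight_def)

lemma annulus_weight_measurable [measurable]: "annulus_weight m \<in> borel_measurable borel"
  unfolding annulus_weight_def[abs_def] by measurable

lemma annulus_weight_moment2:
  assumes "m > 0"
  shows "(\<integral>\<^sup>+h. ennreal (annulus_weight m h * (norm h)\<^sup>2) \<partial>(lborel :: (real^'n::finite) measure)) =
    ennreal (CARD('n) * ball_vol TYPE('n) * (m * ln 2))"
proof -
  have "(\<integral>\<^sup>+h. ennreal (annulus_weight m h * (norm h)\<^sup>2) \<partial>(lborel :: (real^'n) measure)) =
    (\<integral>\<^sup>+h. indicator {h. (1/2)^m < norm h \<and> norm h < 1} h * ennreal (1 / norm h ^ CARD('n)) \<partial>(lborel :: (real^'n) measure))" (is "nn_integral _ ?a1 = nn_integral _ ?b1")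
  proof (rule nn_integral_cong)
    fix h :: "real^'n"
    have "1 / norm h ^ (CARD('n) + 2) * (norm h)\<^sup>2 = 1 / norm h ^ CARD('n)" if "norm h > 0"
      using that by (simp add: power_add power2_eq_square)
    moreover have "norm h > 0" if "(1/2)^m < norm h"
      using that by (meson order.strict_trans zero_less_divide_1_iff zero_less_numeral zero_less_power)
    ultimately show "?a1 h = ?b1 h"
      by (auto simp: annulus_weight_def indicator_def)
  qed
  also have "\<dots> = ennreal (CARD('n) * ball_vol TYPE('n) * ln (1 / (1/2)^m))"
    by (rule nn_integral_norm_annulus_log) (use assms in \<open>auto simp: power_less_one_iff\<close>)
  also have "ln (1 / (1/2)^m) = m * ln (2::real)" by (simp add: power_divide ln_realpow)
  finally show ?thesis .
qed

lemma annulus_weight_moment3: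
  "(\<integral>\<^sup>+h. ennreal (annulus_weight m h * (norm h * (norm h)\<^sup>2)) \<partial>(lborel :: (real^'n::finite) measure)) \<le>
    ennreal (CARD('n) * ball_vol TYPE('n))"
proof -
  let ?N = "CARD('n)"
  have "(\<integral>\<^sup>+h. ennreal (annulus_weight m h * (norm h * (norm h)\<^sup>2)) \<partial>(lborel :: (real^'n) measure)) \<le>
    (\<integral>\<^sup>+h. (indicator {0<..<1} (norm h) * ennreal (norm h / norm h ^ ?N)) \<partial>(lborel :: (real^'n) measure))"
  proof (rule nn_integral_mono)
    fix h :: "real^'n"
    have "1 / norm h ^ (?N + 2) * (norm h * (norm h)\<^sup>2) = norm h / norm h ^ ?N" if "norm h > 0"
      using that by (simp add: power_add power2_eq_square)
    moreover have "norm h > 0" if "(1/2)^m < norm h"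
      using that by (meson order.strict_trans zero_less_divide_1_iff zero_less_numeral zero_less_power)
    ultimately show "ennreal (annulus_weight m h * (norm h * (norm h)\<^sup>2)) \<le> indicator {0<..<1} (norm h) * ennreal (norm h / norm h ^ ?N)"
      by (auto simp: annulus_weight_def indicator_def)
  qed
  also have "\<dots> = ennreal (?N * ball_vol TYPE('n)) * (\<integral>\<^sup>+t. indicator {0<..} t * ((indicator {0<..<1} t * ennreal (t / t ^ ?N)) * ennreal (t ^ (?N - 1))) \<partial>lborel)"
    by (subst nn_integral_radial) (auto simp: ball_vol_def)
  also have "(\<integral>\<^sup>+t. indicator {0<..} t * ((indicator {0<..<1} t * ennreal (t / t ^ ?N)) * ennreal (t ^ (?N - 1))) \<partial>lborel) \<le> (\<integral>\<^sup>+t. indicator {0..1} t \<partial>(lborel::real measure))" (is "nn_integral _ ?l1 \<le> nn_integral _ ?r1")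
  proof (rule nn_integral_mono)
    fix t :: real
    have "t / t ^ ?N * t ^ (?N - 1) = 1" if "t > 0"
    proof -
      obtain k where "?N = Suc k" using gr0_conv_Suc[of ?N] by auto
      then show ?thesis using that by simp
    qed
    then have "ennreal (t / t ^ ?N) * ennreal (t ^ (?N - 1)) = 1" if "t > 0"
      using that by (subst ennreal_mult[symmetric]) auto
    then show "?l1 t \<le> ?r1 t"
      by (auto simp: indicator_def)
  qed
  also have "(\<integral>\<^sup>+t. indicator {0..1} t \<partial>(lborel::real measure)) = 1" by simp
  finally show ?thesis by (simp add: mult_left_mono)
qed

text \<open>Summing the bound on \<open>J\<close> over the dyadic values \<open>\<delta> = 1/2, \<dots>, (1/2)^m\<close> controls a quadratic
  difference functional, up to a term that stays bounded as \<open>m\<close> grows; it grows at most like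
  \<open>4 * K * m\<close>.\<close>

lemma quadratic_bound:
  fixes v :: "real ^ 'n::finite \<Rightarrow> complex"
  assumes [measurable]: "v \<in> borel_measurable borel" "A \<in> borel_measurable borel"
    and M: "\<And>x. norm (v x) \<le> M" and K: "\<And>\<delta>. 0 < \<delta> \<Longrightarrow> \<delta> < 1 \<Longrightarrow> J A \<delta> v \<le> ennreal K" and K0: "K \<ge> 0"
  shows "\<exists>C\<ge>0. \<forall>m>0. (\<integral>\<^sup>+h. ennreal (annulus_weight m h) * local_mdiff_sq A v R h \<partial>lborel)
     \<le> ennreal (4 * K * m + C)"
proof -
  let ?N = "CARD('n)"
  let ?\<beta> = "measure lborel (cball 0 R :: (real^'n) set)"
  have \<beta>: "emeasure lborel (cball 0 R :: (real^'n) set) = ennreal ?\<beta>"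
    using emeasure_lborel_cball_finite[of "0::real^'n" R] by (intro emeasure_eq_ennreal_measure) auto
  have M0: "M \<ge> 0" using M[of 0] norm_ge_zero order_trans by blast
  \<comment> \<open>small values below the last dyadic level, and the large values \<open>norm (mdiff A v h x) > 1\<close>\<close>
  define C where "C = ?N * ball_vol TYPE('n) / 2 * ?\<beta> + 4 * M\<^sup>2 * (4 * K)"
  have C0: "C \<ge> 0" unfolding C_def using ball_vol_pos[where 'n='n] K0 by simp
  have "(\<integral>\<^sup>+h. ennreal (annulus_weight m h) * local_mdiff_sq A v R h \<partial>lborel)
     \<le> ennreal (4 * K * m + C)" if m: "m > 0" for m :: nat
  proof -
    let ?t = "(1/2::real)^m"
    define wt where "wt = (\<lambda>h::real^'n. ennreal (1 / norm h ^ (?N + 2)))"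
    have [measurable]: "wt \<in> borel_measurable borel" unfolding wt_def by measurable
    have aw: "ennreal (annulus_weight m h) \<le> wt h" for h by (auto simp: annulus_weight_def wt_def)
    have pt: "(norm (mdiff A v h x))\<^sup>2 \<le> ?t\<^sup>2 + (\<Sum>i\<in>{1..m}. 4 * ((1/2)^i)\<^sup>2 * (if (1/2)^i < norm (mdiff A v h x) then 1 else 0))
        + 4 * M\<^sup>2 * (if 1/2 < norm (mdiff A v h x) then 1 else 0)" for h x
    proof -
      let ?a = "norm (mdiff A v h x)" and ?S = "\<Sum>i\<in>{1..m}. 4 * ((1/2)^i)\<^sup>2 * (if (1/2)^i < norm (mdiff A v h x) then 1 else 0) :: real"
      have S0: "0 \<le> ?S" by (intro sum_nonneg) auto
      have "0 \<le> ?t\<^sup>2" "0 \<le> 4 * M\<^sup>2 * (if 1/2 < ?a then 1 else 0)" by auto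
      show ?thesis
      proof (cases "?a \<le> 1")
        case True
        with dyadic_layer[of ?a m] have "?a\<^sup>2 \<le> ?t\<^sup>2 + ?S" by simp
        then show ?thesis using \<open>0 \<le> 4 * M\<^sup>2 * (if 1/2 < ?a then 1 else 0)\<close> by linarith
      next
        case False
        have "?a \<le> norm (v (x + h)) + norm (v x)"
          unfolding mdiff_def by (rule order_trans[OF norm_triangle_ineq4]) (simp add: norm_mult)
        then have "?a\<^sup>2 \<le> (2 * M)\<^sup>2" using M[of x] M[of "x + h"] by (intro power_mono) auto
        then have "?a\<^sup>2 \<le> 4 * M\<^sup>2 * (if 1/2 < ?a then 1 else 0)" using False by (simp add: power_mult_distrib)
        then show ?thesis using S0 \<open>0 \<le> ?t\<^sup>2\<close> by linarith
      qed
    qed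
    have inner: "local_mdiff_sq A v R h \<le>
       ennreal (?t\<^sup>2) * ennreal ?\<beta> + (\<Sum>i\<in>{1..m}. ennreal (4 * ((1/2)^i)\<^sup>2) * superlevel A v ((1/2)^i) h) + ennreal (4 * M\<^sup>2) * superlevel A v (1/2) h" for h
    proof -
      have sl: "(\<integral>\<^sup>+x. c * (if d < norm (mdiff A v h x) then 1 else 0) \<partial>lborel) = c * superlevel A v d h" for d :: real and c :: ennreal
      proof -
        have "superlevel A v d h = (\<integral>\<^sup>+x. indicator {x. d < norm (mdiff A v h x)} x \<partial>lborel)"
          unfolding superlevel_def by (subst nn_integral_indicator) auto
        also have "\<dots> = (\<integral>\<^sup>+x. (if d < norm (mdiff A v h x) then 1 else 0) \<partial>lborel)"
          by (intro nn_integral_cong) (simp add: indicator_def)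
        finally show ?thesis by (simp add: nn_integral_cmult)
      qed
      have "local_mdiff_sq A v R h \<le>
        (\<integral>\<^sup>+x. ennreal (?t\<^sup>2) * indicator (cball 0 R) x + (\<Sum>i\<in>{1..m}. ennreal (4 * ((1/2)^i)\<^sup>2) * (if (1/2)^i < norm (mdiff A v h x) then 1 else 0))
          + ennreal (4 * M\<^sup>2) * (if 1/2 < norm (mdiff A v h x) then 1 else 0) \<partial>lborel)" (is "nn_integral _ ?l1 \<le> nn_integral _ ?r1")
      proof (rule nn_integral_mono)
        fix x
        have "ennreal ((norm (mdiff A v h x))\<^sup>2) \<le> ennreal (?t\<^sup>2 + (\<Sum>i\<in>{1..m}. 4 * ((1/2)^i)\<^sup>2 * (if (1/2)^i < norm (mdiff A v h x) then 1 else 0))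
          + 4 * M\<^sup>2 * (if 1/2 < norm (mdiff A v h x) then 1 else 0))"
          by (intro ennreal_leI pt)
        also have "\<dots> = ennreal (?t\<^sup>2) + (\<Sum>i\<in>{1..m}. ennreal (4 * ((1/2)^i)\<^sup>2 * (if (1/2)^i < norm (mdiff A v h x) then 1 else 0)))
          + ennreal (4 * M\<^sup>2 * (if 1/2 < norm (mdiff A v h x) then 1 else 0))"
          by (simp add: ennreal_plus sum_nonneg sum_ennreal)
        also have "\<dots> = ennreal (?t\<^sup>2) + (\<Sum>i\<in>{1..m}. ennreal (4 * ((1/2)^i)\<^sup>2) * (if (1/2)^i < norm (mdiff A v h x) then 1 else 0))
          + ennreal (4 * M\<^sup>2) * (if 1/2 < norm (mdiff A v h x) then 1 else 0)"
          by (intro arg_cong2[where f="(+)"] refl sum.cong) auto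
        finally show "?l1 x \<le> ?r1 x"
          by (cases "x \<in> cball 0 R") auto
      qed
      also have "\<dots> = ennreal (?t\<^sup>2) * ennreal ?\<beta> + (\<Sum>i\<in>{1..m}. ennreal (4 * ((1/2)^i)\<^sup>2) * superlevel A v ((1/2)^i) h) + ennreal (4 * M\<^sup>2) * superlevel A v (1/2) h"
        by (subst nn_integral_add, measurable, subst nn_integral_add, measurable, subst nn_integral_sum, measurable)
           (simp only: sl nn_integral_cmult_indicator \<beta> sets_lborel borel_closed closed_cball)
      finally show ?thesis .
    qed
    have "(\<integral>\<^sup>+h. ennreal (annulus_weight m h) * local_mdiff_sq A v R h \<partial>lborel)
      \<le> (\<integral>\<^sup>+h. (indicator {h. norm h > ?t} h * ennreal (1 / norm h ^ (?N + 2))) * (ennreal (?t\<^sup>2) * ennreal ?\<beta>)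
          + (\<Sum>i\<in>{1..m}. 4 * (ennreal (((1/2)^i)\<^sup>2 / norm h ^ (?N + 2)) * superlevel A v ((1/2)^i) h))
          + ennreal (4 * M\<^sup>2 * 4) * (ennreal ((1/2)\<^sup>2 / norm h ^ (?N + 2)) * superlevel A v (1/2) h) \<partial>lborel)" (is "nn_integral _ ?a1 \<le> nn_integral _ ?b1")
    proof (rule nn_integral_mono)
      fix h :: "real^'n"
      have "ennreal (annulus_weight m h) * local_mdiff_sq A v R h
        \<le> ennreal (annulus_weight m h) * (ennreal (?t\<^sup>2) * ennreal ?\<beta> + (\<Sum>i\<in>{1..m}. ennreal (4 * ((1/2)^i)\<^sup>2) * superlevel A v ((1/2)^i) h) + ennreal (4 * M\<^sup>2) * superlevel A v (1/2) h)"
        by (intro mult_left_mono inner) auto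
      also have "\<dots> = ennreal (annulus_weight m h) * (ennreal (?t\<^sup>2) * ennreal ?\<beta>)
         + (\<Sum>i\<in>{1..m}. ennreal (annulus_weight m h) * (ennreal (4 * ((1/2)^i)\<^sup>2) * superlevel A v ((1/2)^i) h))
         + ennreal (annulus_weight m h) * (ennreal (4 * M\<^sup>2) * superlevel A v (1/2) h)"
        by (simp add: distrib_left sum_distrib_left)
      also have "\<dots> \<le> ?b1 h"
      proof (intro add_mono sum_mono)
        show "ennreal (annulus_weight m h) * (ennreal (?t\<^sup>2) * ennreal ?\<beta>) \<le> (indicator {h. norm h > ?t} h * ennreal (1 / norm h ^ (?N + 2))) * (ennreal (?t\<^sup>2) * ennreal ?\<beta>)"
          by (intro mult_right_mono) (auto simp: annulus_weight_def indicator_def)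
        fix i
        have "ennreal (annulus_weight m h) * (ennreal (4 * ((1/2)^i)\<^sup>2) * superlevel A v ((1/2)^i) h) \<le> wt h * (ennreal (4 * ((1/2)^i)\<^sup>2) * superlevel A v ((1/2)^i) h)"
          by (intro mult_right_mono aw) auto
        also have "\<dots> = 4 * (ennreal (((1/2)^i)\<^sup>2 / norm h ^ (?N + 2)) * superlevel A v ((1/2)^i) h)"
        proof -
          have "wt h * ennreal (4 * ((1/2)^i)\<^sup>2) = ennreal (4 * (((1/2)^i)\<^sup>2 / norm h ^ (?N + 2)))"
            unfolding wt_def by (subst ennreal_mult[symmetric]) auto
          also have "\<dots> = 4 * ennreal (((1/2)^i)\<^sup>2 / norm h ^ (?N + 2))"
            by (subst ennreal_mult) auto
          finally show ?thesis by (simp only: mult.assoc[symmetric])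
        qed
        finally show "ennreal (annulus_weight m h) * (ennreal (4 * ((1/2)^i)\<^sup>2) * superlevel A v ((1/2)^i) h) \<le> 4 * (ennreal (((1/2)^i)\<^sup>2 / norm h ^ (?N + 2)) * superlevel A v ((1/2)^i) h)" .
      next
        have "ennreal (annulus_weight m h) * (ennreal (4 * M\<^sup>2) * superlevel A v (1/2) h) \<le> wt h * (ennreal (4 * M\<^sup>2) * superlevel A v (1/2) h)"
          by (intro mult_right_mono aw) auto
        also have "\<dots> = ennreal (4 * M\<^sup>2 * 4) * (ennreal ((1/2)\<^sup>2 / norm h ^ (?N + 2)) * superlevel A v (1/2) h)"
        proof -
          have "wt h * ennreal (4 * M\<^sup>2) = ennreal (4 * M\<^sup>2 * 4) * ennreal ((1/2)\<^sup>2 / norm h ^ (?N + 2))"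
            unfolding wt_def by (subst (1 2) ennreal_mult[symmetric]) (auto simp: power2_eq_square)
          then show ?thesis by (simp only: mult.assoc[symmetric])
        qed
        finally show "ennreal (annulus_weight m h) * (ennreal (4 * M\<^sup>2) * superlevel A v (1/2) h) \<le> ennreal (4 * M\<^sup>2 * 4) * (ennreal ((1/2)\<^sup>2 / norm h ^ (?N + 2)) * superlevel A v (1/2) h)" .
      qed
      finally show "?a1 h \<le> ?b1 h" .
    qed
    also have "\<dots> = ennreal (?N * ball_vol TYPE('n) / (2 * ?t ^ 2)) * (ennreal (?t\<^sup>2) * ennreal ?\<beta>)
      + (\<Sum>i\<in>{1..m}. 4 * J A ((1/2)^i) v) + ennreal (4 * M\<^sup>2 * 4) * J A (1/2) v"
    proof -
      have 1: "(\<integral>\<^sup>+h. (indicator {h. norm h > ?t} h * ennreal (1 / norm h ^ (?N + 2))) * (ennreal (?t\<^sup>2) * ennreal ?\<beta>) \<partial>(lborel::(real^'n) measure))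
         = ennreal (?N * ball_vol TYPE('n) / (2 * ?t ^ 2)) * (ennreal (?t\<^sup>2) * ennreal ?\<beta>)"
        using nn_integral_norm_tail[of ?t 2, where 'n='n] by (subst nn_integral_multc) auto
      have 2: "(\<integral>\<^sup>+h. c * (ennreal (d\<^sup>2 / norm h ^ (?N + 2)) * superlevel A v d h) \<partial>lborel) = c * J A d v" for c d
        unfolding J_eq_superlevel[OF assms(1,2)] by (rule nn_integral_cmult) measurable
      show ?thesis
        by (subst nn_integral_add, measurable, subst nn_integral_add, measurable, subst nn_integral_sum, measurable) (simp only: 1 2)
    qed
    also have "\<dots> \<le> ennreal (?N * ball_vol TYPE('n) / (2 * ?t ^ 2)) * (ennreal (?t\<^sup>2) * ennreal ?\<beta>)
      + (\<Sum>i\<in>{1..m}. 4 * ennreal K) + ennreal (4 * M\<^sup>2 * 4) * ennreal K"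
      by (intro add_mono sum_mono mult_left_mono K order_refl) (auto simp: power_less_one_iff)
    also have "\<dots> = ennreal (?N * ball_vol TYPE('n) / 2 * ?\<beta>) + ennreal (4 * K * m) + ennreal (4 * M\<^sup>2 * (4 * K))"
    proof -
      have "ennreal (?N * ball_vol TYPE('n) / (2 * ?t ^ 2)) * (ennreal (?t\<^sup>2) * ennreal ?\<beta>) = ennreal (?N * ball_vol TYPE('n) / (2 * ?t ^ 2) * (?t\<^sup>2 * ?\<beta>))"
      proof -
        have "ennreal (?N * ball_vol TYPE('n) / (2 * ?t ^ 2) * (?t\<^sup>2 * ?\<beta>)) = ennreal (?N * ball_vol TYPE('n) / (2 * ?t ^ 2)) * ennreal (?t\<^sup>2 * ?\<beta>)"
          by (rule ennreal_mult'') simp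
        moreover have "ennreal (?t\<^sup>2 * ?\<beta>) = ennreal (?t\<^sup>2) * ennreal ?\<beta>" by (rule ennreal_mult'') simp
        ultimately show ?thesis by (simp only:)
      qed
      also have "?N * ball_vol TYPE('n) / (2 * ?t ^ 2) * (?t\<^sup>2 * ?\<beta>) = ?N * ball_vol TYPE('n) / 2 * ?\<beta>"
        by simp
      finally have 1: "ennreal (?N * ball_vol TYPE('n) / (2 * ?t ^ 2)) * (ennreal (?t\<^sup>2) * ennreal ?\<beta>) = ennreal (?N * ball_vol TYPE('n) / 2 * ?\<beta>)" .
      have 2: "(\<Sum>i\<in>{1..m}. 4 * ennreal K) = ennreal (4 * K * m)"
      proof -
        have "4 * ennreal K = ennreal (4 * K)" using K0 by (subst ennreal_mult) auto
        then have "(\<Sum>i\<in>{1..m}. 4 * ennreal K) = of_nat m * ennreal (4 * K)" by simp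
        also have "\<dots> = ennreal (m * (4 * K))" by (subst ennreal_mult) (use K0 in \<open>auto simp: ennreal_of_nat_eq_real_of_nat\<close>)
        finally show ?thesis by (simp add: mult_ac)
      qed
      have 3: "ennreal (4 * M\<^sup>2 * 4) * ennreal K = ennreal (4 * M\<^sup>2 * (4 * K))"
        using K0 by (subst ennreal_mult[symmetric]) (auto simp: mult_ac)
      show ?thesis unfolding 1 2 3 ..
    qed
    also have "\<dots> = ennreal (4 * K * m + C)"
    proof -
      have "?N * ball_vol TYPE('n) / 2 * ?\<beta> \<ge> 0" using ball_vol_pos[where 'n='n] by simp
      then have "ennreal (?N * ball_vol TYPE('n) / 2 * ?\<beta>) + ennreal (4 * K * m) + ennreal (4 * M\<^sup>2 * (4 * K)) = ennreal (?N * ball_vol TYPE('n) / 2 * ?\<beta> + 4 * K * m + 4 * M\<^sup>2 * (4 * K))"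
        using K0 by (subst ennreal_plus[symmetric], simp, simp, subst ennreal_plus[symmetric]) auto
      then show ?thesis by (simp add: C_def add_ac)
    qed
    finally show ?thesis .
  qed
  then show ?thesis using C0 by blast
qed

lemma exp_phase_1: "norm (exp (- (\<i> * complex_of_real a)) - 1) \<le> \<bar>a\<bar>"
  using Taylor_exp[of "- (\<i> * complex_of_real a)" 0] by (simp add: norm_mult)

lemma exp_phase_2: "norm (exp (- (\<i> * complex_of_real a)) - 1 + \<i> * complex_of_real a) \<le> a\<^sup>2"
  using Taylor_exp[of "- (\<i> * complex_of_real a)" 1] by (simp add: norm_mult algebra_simps power2_eq_square)

lemma linear_sum_bound:
  fixes h :: "real ^ 'n::finite"
  assumes "\<And>j. \<bar>c j\<bar> \<le> b j"
  shows "\<bar>\<Sum>j\<in>UNIV. h $ j * c j\<bar> \<le> (\<Sum>j\<in>UNIV. b j) * norm h"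
proof -
  have "\<bar>\<Sum>j\<in>UNIV. h $ j * c j\<bar> \<le> (\<Sum>j\<in>UNIV. \<bar>h $ j * c j\<bar>)" by (rule sum_abs)
  also have "\<dots> \<le> (\<Sum>j\<in>UNIV. norm h * b j)"
    unfolding abs_mult using assms by (intro sum_mono mult_mono component_le_norm_cart) auto
  finally show ?thesis by (simp add: sum_distrib_left mult.commute)
qed

lemma test_fun_lipschitz:
  fixes \<psi> :: "real ^ 'n::finite \<Rightarrow> real"
  assumes t: "test_fun \<psi>"
  obtains B where "B \<ge> 0" "\<And>x y. \<bar>\<psi> x - \<psi> y\<bar> \<le> B * norm (x - y)"
proof -
  have "\<exists>b. \<forall>y. \<bar>pderiv_at j \<psi> y\<bar> \<le> b" for j
    using test_fun_support[OF test_fun_pderiv[OF t, of j]] by metis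
  then obtain b where b: "\<And>j y. \<bar>pderiv_at j \<psi> y\<bar> \<le> b j" by metis
  have b0: "0 \<le> b j" for j using b[of j 0] by linarith
  have "norm (\<psi> x - \<psi> y) \<le> (\<Sum>j\<in>UNIV. b j) * norm (x - y)" for x y
  proof (rule differentiable_bound[OF convex_UNIV])
    show "(\<psi> has_derivative (\<lambda>h. \<Sum>j\<in>UNIV. h $ j * pderiv_at j \<psi> z)) (at z within UNIV)" for z
      using smooth_has_derivative[OF test_fun_smooth[OF t]] by simp
    show "onorm (\<lambda>h. \<Sum>j\<in>UNIV. h $ j * pderiv_at j \<psi> z) \<le> (\<Sum>j\<in>UNIV. b j)" for z
      by (rule onorm_le) (use linear_sum_bound[of "\<lambda>j. pderiv_at j \<psi> z" b] b in simp)
  qed auto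
  then show thesis using that[of "\<Sum>j\<in>UNIV. b j"] b0 by (simp add: sum_nonneg)
qed

lemma test_fun_taylor:
  fixes \<phi> :: "real ^ 'n::finite \<Rightarrow> real"
  assumes t: "test_fun \<phi>"
  obtains B where "B \<ge> 0" "\<And>y h. \<bar>\<phi> (y - h) - \<phi> y + (\<Sum>j\<in>UNIV. h $ j * pderiv_at j \<phi> y)\<bar> \<le> B * (norm h)\<^sup>2"
proof -
  have "\<exists>b\<ge>0. \<forall>x y. \<bar>pderiv_at j \<phi> x - pderiv_at j \<phi> y\<bar> \<le> b * norm (x - y)" for j
    using test_fun_lipschitz[OF test_fun_pderiv[OF t, of j]] by metis
  then obtain b where b0: "\<And>j. b j \<ge> 0" and b: "\<And>j x y. \<bar>pderiv_at j \<phi> x - pderiv_at j \<phi> y\<bar> \<le> b j * norm (x - y)" by metis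
  have "\<bar>\<phi> (y - h) - \<phi> y + (\<Sum>j\<in>UNIV. h $ j * pderiv_at j \<phi> y)\<bar> \<le> (\<Sum>j\<in>UNIV. b j) * (norm h)\<^sup>2" for y h
  proof -
    let ?g = "\<lambda>z. \<phi> z - (\<Sum>j\<in>UNIV. z $ j * pderiv_at j \<phi> y)"
    have "norm (?g (y - h) - ?g y) \<le> (\<Sum>j\<in>UNIV. b j * norm h) * norm (y - h - y)"
    proof (rule differentiable_bound[OF convex_cball])
      fix z assume z: "z \<in> cball y (norm h)"
      have "((\<lambda>z. \<Sum>j\<in>UNIV. z $ j * pderiv_at j \<phi> y) has_derivative (\<lambda>z. \<Sum>j\<in>UNIV. z $ j * pderiv_at j \<phi> y)) (at z within cball y (norm h))"
        by (auto intro!: has_derivative_sum derivative_eq_intros bounded_linear.has_derivative[OF bounded_linear_vec_nth])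
      from has_derivative_diff[OF has_derivative_at_withinI[OF smooth_has_derivative[OF test_fun_smooth[OF t], of z]] this]
      show "(?g has_derivative (\<lambda>h. \<Sum>j\<in>UNIV. h $ j * (pderiv_at j \<phi> z - pderiv_at j \<phi> y))) (at z within cball y (norm h))"
        by (simp add: right_diff_distrib sum_subtractf)
      show "onorm (\<lambda>h. \<Sum>j\<in>UNIV. h $ j * (pderiv_at j \<phi> z - pderiv_at j \<phi> y)) \<le> (\<Sum>j\<in>UNIV. b j * norm h)"
      proof (rule onorm_le)
        fix k :: "real^'n"
        have "\<bar>pderiv_at j \<phi> z - pderiv_at j \<phi> y\<bar> \<le> b j * norm h" for j
        proof -
          have "b j * norm (z - y) \<le> b j * norm h"
            using z b0 by (intro mult_left_mono) (auto simp: dist_norm norm_minus_commute)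
          then show ?thesis using b[of j z y] by linarith
        qed
        then show "norm (\<Sum>j\<in>UNIV. k $ j * (pderiv_at j \<phi> z - pderiv_at j \<phi> y)) \<le> (\<Sum>j\<in>UNIV. b j * norm h) * norm k"
          using linear_sum_bound[of "\<lambda>j. pderiv_at j \<phi> z - pderiv_at j \<phi> y" "\<lambda>j. b j * norm h" k] by simp
      qed
    qed (auto simp: dist_norm)
    moreover have "?g (y - h) - ?g y = \<phi> (y - h) - \<phi> y + (\<Sum>j\<in>UNIV. h $ j * pderiv_at j \<phi> y)"
      by (simp add: left_diff_distrib sum_subtractf)
    ultimately show ?thesis by (simp add: sum_distrib_right power2_eq_square mult.assoc)
  qed
  then show thesis using that[of "\<Sum>j\<in>UNIV. b j"] b0 by (simp add: sum_nonneg)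
qed

text \<open>The formal adjoint of the magnetic derivative: it carries the sign of \<open>\<partial>\<^sub>j + \<i> A\<^sub>j\<close> so that integration
  by parts moves it to \<open>- (\<partial>\<^sub>j - \<i> A\<^sub>j)\<close> acting on \<open>u\<close>.\<close>

definition mag_pderiv :: "(real ^ 'n::finite \<Rightarrow> real ^ 'n) \<Rightarrow> (real ^ 'n \<Rightarrow> real) \<Rightarrow> 'n \<Rightarrow> real ^ 'n \<Rightarrow> complex" where
  "mag_pderiv A \<phi> j x = complex_of_real (pderiv_at j \<phi> x) + \<i> * complex_of_real (A x $ j * \<phi> x)"

lemma mag_pderiv_measurable:
  assumes "test_fun \<phi>" "A \<in> borel_measurable borel"
  shows "mag_pderiv A \<phi> j \<in> borel_measurable borel"
proof -
  note [measurable] = test_fun_measurable[OF assms(1)] test_fun_measurable[OF test_fun_pderiv[OF assms(1)]]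
    measurable_compose[OF assms(2) borel_measurable_vec_nth]
  show ?thesis unfolding mag_pderiv_def[abs_def] by measurable
qed

lemma mag_pderiv_bounded_support:
  fixes A :: "real ^ 'n::finite \<Rightarrow> real ^ 'n"
  assumes t: "test_fun \<phi>" and L: "L-lipschitz_on UNIV A"
  obtains R B where "\<And>x. norm x > R \<Longrightarrow> mag_pderiv A \<phi> j x = 0" "\<And>x. norm (mag_pderiv A \<phi> j x) \<le> B" "B \<ge> 0"
proof -
  obtain R1 B1 where 1: "\<And>x. norm x > R1 \<Longrightarrow> \<phi> x = 0" "\<And>x. \<bar>\<phi> x\<bar> \<le> B1" "B1 > 0"
    using test_fun_support[OF t] by metis
  obtain R2 B2 where 2: "\<And>x. norm x > R2 \<Longrightarrow> pderiv_at j \<phi> x = 0" "\<And>x. \<bar>pderiv_at j \<phi> x\<bar> \<le> B2" "B2 > 0"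
    using test_fun_support[OF test_fun_pderiv[OF t, of j]] by metis
  let ?R = "max R1 R2"
  have s: "mag_pderiv A \<phi> j x = 0" if "norm x > ?R" for x
    using that 1(1)[of x] 2(1)[of x] by (simp add: mag_pderiv_def)
  let ?a = "norm (A 0) + L * \<bar>?R\<bar>"
  have L0: "L \<ge> 0" by (rule lipschitz_on_nonneg[OF L])
  have "norm (mag_pderiv A \<phi> j x) \<le> B2 + ?a * B1" for x
  proof (cases "norm x \<le> ?R")
    case True
    have "norm (A x) \<le> norm (A 0) + norm (A x - A 0)" using norm_triangle_ineq[of "A 0" "A x - A 0"] by simp
    also have "norm (A x - A 0) \<le> L * norm x"
      using lipschitz_onD[OF L, of x 0] by (simp add: dist_norm)
    also have "L * norm x \<le> L * \<bar>?R\<bar>" using True L0 by (intro mult_left_mono) auto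
    finally have "\<bar>A x $ j\<bar> \<le> ?a" using component_le_norm_cart[of "A x" j] by linarith
    moreover have "norm (mag_pderiv A \<phi> j x) \<le> \<bar>pderiv_at j \<phi> x\<bar> + \<bar>A x $ j\<bar> * \<bar>\<phi> x\<bar>"
      unfolding mag_pderiv_def by (rule order_trans[OF norm_triangle_ineq]) (simp add: norm_mult abs_mult)
    moreover have "\<bar>A x $ j\<bar> * \<bar>\<phi> x\<bar> \<le> ?a * B1"
      using 1 calculation(1) by (intro mult_mono) auto
    ultimately show ?thesis using 2(2)[of x] by linarith
  next
    case False
    then have "mag_pderiv A \<phi> j x = 0" by (intro s) linarith
    moreover have "0 \<le> B2 + ?a * B1" using 1(3) 2(3) L0 by (intro add_nonneg_nonneg mult_nonneg_nonneg) auto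
    ultimately show ?thesis by simp
  qed
  moreover have "0 \<le> B2 + ?a * B1" using 1(3) 2(3) L0 by (intro add_nonneg_nonneg mult_nonneg_nonneg) auto
  ultimately show thesis using s by (intro that[of ?R "B2 + ?a * B1"])
qed

lemma bounded_loc_int:
  fixes v :: "'a::euclidean_space \<Rightarrow> complex"
  assumes [measurable]: "v \<in> borel_measurable borel" and M: "\<And>x. norm (v x) \<le> M"
  shows "loc_int v"
  unfolding loc_int_def
proof (intro conjI allI)
  fix R
  show "integrable lborel (\<lambda>x. indicator (cball 0 R) x *\<^sub>R v x)"
  proof (rule Bochner_Integration.integrable_bound)
    show "integrable lborel (\<lambda>x::'a. M * indicator (cball 0 R) x :: real)"
      using emeasure_lborel_cball_finite[of "0::'a" R] by (intro integrable_mult_right integrable_real_indicator) auto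
    show "AE x in lborel. norm (indicator (cball 0 R) x *\<^sub>R v x) \<le> norm (M * indicator (cball 0 R) x :: real)"
      using order_trans[OF M abs_ge_self] by (intro AE_I2) (auto simp: indicator_def)
  qed measurable
qed fact

text \<open>The adjoint of the magnetic difference is again one, with step \<open>- h\<close> and the potential evaluated at
  the same midpoint.\<close>

lemma mdiff_test_integral:
  fixes v :: "real ^ 'n::finite \<Rightarrow> complex"
  assumes [measurable]: "v \<in> borel_measurable borel" "A \<in> borel_measurable borel"
    and M: "\<And>x. norm (v x) \<le> M" and t: "test_fun \<phi>"
  shows "(LINT x|lborel. mdiff A v h x * complex_of_real (\<phi> x)) =
    (LINT y|lborel. v y * (exp (- (\<i> * complex_of_real (h \<bullet> A (y - h /\<^sub>R 2)))) * complex_of_real (\<phi> (y - h)) - complex_of_real (\<phi> y)))"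
proof -
  note v = bounded_loc_int[OF assms(1) M]
  have [measurable]: "\<phi> \<in> borel_measurable borel" by (rule test_fun_measurable[OF t])
  have [measurable]: "(\<lambda>s. exp (- (\<i> * complex_of_real s))) \<in> borel_measurable borel"
    by (intro borel_measurable_continuous_onI continuous_intros)
  obtain R B where R: "\<And>x. norm x > R \<Longrightarrow> \<phi> x = 0" "\<And>x. \<bar>\<phi> x\<bar> \<le> B"
    using test_fun_support[OF t] by metis
  let ?e = "\<lambda>y. exp (- (\<i> * complex_of_real (h \<bullet> A (y - h /\<^sub>R 2))))"
  have i1: "integrable lborel (\<lambda>y. v y * (?e y * complex_of_real (\<phi> (y - h))))"
  proof (rule loc_int_bounded_support[OF v, where R="R + norm h" and B=B])
    fix y :: "real^'n" assume "norm y > R + norm h"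
    then have "norm (y - h) > R" using norm_triangle_ineq[of "y - h" h] by simp
    then show "?e y * complex_of_real (\<phi> (y - h)) = 0" using R by simp
  qed (measurable, simp add: norm_mult R)
  have i2: "integrable lborel (\<lambda>y. v y * complex_of_real (\<phi> y))" by (rule integrable_mult_test_fun[OF v t])
  define F where "F = (\<lambda>y. v y * (?e y * complex_of_real (\<phi> (y - h))))"
  have Fm[measurable]: "F \<in> borel_measurable borel" unfolding F_def by measurable
  have e: "F (h + x) = exp (- (\<i> * complex_of_real (h \<bullet> A (x + h /\<^sub>R 2)))) * v (x + h) * complex_of_real (\<phi> x)" for x
  proof -
    have "h + x - h /\<^sub>R 2 = x + h /\<^sub>R 2" by (simp add: vec_eq_iff field_simps)
    then have "F (h + x) = v (h + x) * (exp (- (\<i> * complex_of_real (h \<bullet> A (x + h /\<^sub>R 2)))) * complex_of_real (\<phi> (h + x - h)))"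
      by (simp only: F_def)
    then show ?thesis by (simp add: add.commute[of h x] mult_ac)
  qed
  have i3: "integrable lborel (\<lambda>x. F (h + x))" by (rule integrable_lborel_translate) (use i1 F_def in simp)
  have "(LINT x|lborel. mdiff A v h x * complex_of_real (\<phi> x)) = (LINT x|lborel. F (h + x) - v x * complex_of_real (\<phi> x))"
    unfolding e mdiff_def by (simp add: algebra_simps)
  also have "\<dots> = (LINT x|lborel. F (h + x)) - (LINT x|lborel. v x * complex_of_real (\<phi> x))"
    by (rule Bochner_Integration.integral_diff[OF i3 i2])
  also have "(LINT x|lborel. F (h + x)) = (LINT x|lborel. F x)" by (rule integral_lborel_translate[OF Fm])
  also have "\<dots> - (LINT x|lborel. v x * complex_of_real (\<phi> x)) = (LINT y|lborel. F y - v y * complex_of_real (\<phi> y))"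
    by (rule Bochner_Integration.integral_diff[symmetric]) (use i1 i2 F_def in auto)
  finally show ?thesis by (simp add: F_def algebra_simps)
qed

text \<open>Expansion of the adjoint difference of a test function to first order: the potential at the midpoint
  may be replaced by its value at \<open>y\<close> at the cost of a quadratic error, since \<open>A\<close> is Lipschitz.\<close>

lemma test_fun_mag_taylor:
  fixes A :: "real ^ 'n::finite \<Rightarrow> real ^ 'n"
  assumes t: "test_fun \<phi>" and L: "L-lipschitz_on UNIV A"
  obtains R C where "C \<ge> 0" "\<And>h y. norm h \<le> 1 \<Longrightarrow>
     norm (exp (- (\<i> * complex_of_real (h \<bullet> A (y - h /\<^sub>R 2)))) * complex_of_real (\<phi> (y - h)) - complex_of_real (\<phi> y)
       + (\<Sum>j\<in>UNIV. complex_of_real (h $ j) * mag_pderiv A \<phi> j y)) \<le> C * (norm h)\<^sup>2 * indicator (cball 0 R) y"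
proof -
  have L0: "L \<ge> 0" by (rule lipschitz_on_nonneg[OF L])
  obtain R0 B0 where 0: "\<And>x. norm x > R0 \<Longrightarrow> \<phi> x = 0" "\<And>x. \<bar>\<phi> x\<bar> \<le> B0" "B0 > 0" "R0 > 0"
    using test_fun_support[OF t] by metis
  have "\<exists>R b. b \<ge> 0 \<and> (\<forall>x. norm x > R \<longrightarrow> mag_pderiv A \<phi> j x = 0) \<and> (\<forall>x. \<bar>pderiv_at j \<phi> x\<bar> \<le> b)" for j
  proof -
    obtain R2 B2 where "\<And>x. \<bar>pderiv_at j \<phi> x\<bar> \<le> B2" "B2 > 0" using test_fun_support[OF test_fun_pderiv[OF t, of j]] by metis
    moreover obtain R where "\<And>x. norm x > R \<Longrightarrow> mag_pderiv A \<phi> j x = 0" using mag_pderiv_bounded_support[OF t L] by metis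
    ultimately show ?thesis by (intro exI[of _ R] exI[of _ B2]) auto
  qed
  then obtain r b where b0: "\<And>j. b j \<ge> 0" and r: "\<And>j x. norm x > r j \<Longrightarrow> mag_pderiv A \<phi> j x = 0" and b: "\<And>j x. \<bar>pderiv_at j \<phi> x\<bar> \<le> b j"
    by metis
  obtain B2 where B2: "B2 \<ge> 0" "\<And>y h. \<bar>\<phi> (y - h) - \<phi> y + (\<Sum>j\<in>UNIV. h $ j * pderiv_at j \<phi> y)\<bar> \<le> B2 * (norm h)\<^sup>2"
    using test_fun_taylor[OF t] by metis
  define R where "R = max (R0 + 1) (Max (range r))"
  define a where "a = norm (A 0) + L * (R + 1)"
  have R0': "R > 0" using 0(4) by (simp add: R_def)
  define b1 where "b1 = (\<Sum>j\<in>UNIV. b j)"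
  have b1: "b1 \<ge> 0" by (simp add: b1_def b0 sum_nonneg)
  have a0: "a \<ge> 0" using L0 R0' by (simp add: a_def)
  let ?C = "B2 + a * b1 + a\<^sup>2 * B0 + L / 2 * B0"
  have zero: "exp (- (\<i> * complex_of_real (h \<bullet> A (y - h /\<^sub>R 2)))) * complex_of_real (\<phi> (y - h)) - complex_of_real (\<phi> y)
       + (\<Sum>j\<in>UNIV. complex_of_real (h $ j) * mag_pderiv A \<phi> j y) = 0" if h: "norm h \<le> 1" and y: "norm y > R" for h y
  proof -
    have "norm (y - h) > R0" using norm_triangle_ineq[of "y - h" h] h y by (simp add: R_def)
    moreover have "norm y > R0" using y by (simp add: R_def)
    moreover have "norm y > r j" for j
    proof -
      have "r j \<le> Max (range r)" by (intro Max_ge) auto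
      then show ?thesis using y by (simp add: R_def)
    qed
    ultimately show ?thesis using 0(1) r by simp
  qed
  have main: "norm (exp (- (\<i> * complex_of_real (h \<bullet> A (y - h /\<^sub>R 2)))) * complex_of_real (\<phi> (y - h)) - complex_of_real (\<phi> y)
       + (\<Sum>j\<in>UNIV. complex_of_real (h $ j) * mag_pderiv A \<phi> j y)) \<le> ?C * (norm h)\<^sup>2" if h: "norm h \<le> 1" and y: "norm y \<le> R" for h y
  proof -
    define \<alpha> where "\<alpha> = h \<bullet> A (y - h /\<^sub>R 2)"
    define \<alpha>0 where "\<alpha>0 = h \<bullet> A y"
    define D where "D = (\<Sum>j\<in>UNIV. h $ j * pderiv_at j \<phi> y)"
    define e where "e = exp (- (\<i> * complex_of_real \<alpha>))"
    have ne: "norm e = 1" unfolding e_def by (rule exp_bound)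
    have sum: "(\<Sum>j\<in>UNIV. complex_of_real (h $ j) * mag_pderiv A \<phi> j y) = complex_of_real D + \<i> * complex_of_real (\<alpha>0 * \<phi> y)"
      by (simp add: mag_pderiv_def D_def \<alpha>0_def inner_vec_def algebra_simps sum.distrib sum_distrib_left sum_distrib_right)
    have eq: "e * complex_of_real (\<phi> (y - h)) - complex_of_real (\<phi> y) + (complex_of_real D + \<i> * complex_of_real (\<alpha>0 * \<phi> y)) =
       e * complex_of_real (\<phi> (y - h) - \<phi> y + D) - (e - 1) * complex_of_real D + (e - 1 + \<i> * complex_of_real \<alpha>) * complex_of_real (\<phi> y)
       + \<i> * complex_of_real ((\<alpha>0 - \<alpha>) * \<phi> y)"
      by (simp add: algebra_simps)
    have "norm (A (y - h /\<^sub>R 2)) \<le> a"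
    proof -
      have "norm (A (y - h /\<^sub>R 2)) \<le> norm (A 0) + norm (A (y - h /\<^sub>R 2) - A 0)" using norm_triangle_ineq[of "A 0" "A (y - h /\<^sub>R 2) - A 0"] by simp
      also have "norm (A (y - h /\<^sub>R 2) - A 0) \<le> L * norm (y - h /\<^sub>R 2)"
        using lipschitz_onD[OF L, of "y - h /\<^sub>R 2" 0] by (simp add: dist_norm)
      also have "norm (y - h /\<^sub>R 2) \<le> R + 1"
        using norm_triangle_ineq4[of y "h /\<^sub>R 2"] h y by simp
      finally show ?thesis using L0 by (simp add: a_def mult_left_mono)
    qed
    then have "norm h * norm (A (y - h /\<^sub>R 2)) \<le> norm h * a" by (intro mult_left_mono) auto
    with Cauchy_Schwarz_ineq2[of h "A (y - h /\<^sub>R 2)"] have \<alpha>: "\<bar>\<alpha>\<bar> \<le> a * norm h"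
      unfolding \<alpha>_def mult.commute[of a] by (rule order_trans)
    have \<alpha>\<alpha>: "\<bar>\<alpha>0 - \<alpha>\<bar> \<le> L / 2 * (norm h)\<^sup>2"
    proof -
      have "\<bar>\<alpha>0 - \<alpha>\<bar> \<le> norm h * norm (A y - A (y - h /\<^sub>R 2))"
        unfolding \<alpha>_def \<alpha>0_def using Cauchy_Schwarz_ineq2[of h "A y - A (y - h /\<^sub>R 2)"] by (simp add: inner_diff_right)
      also have "\<dots> \<le> norm h * (L * (norm h / 2))"
        using lipschitz_onD[OF L, of y "y - h /\<^sub>R 2"] by (intro mult_left_mono) (auto simp: dist_norm)
      finally show ?thesis by (simp add: power2_eq_square mult_ac)
    qed
    have D: "\<bar>D\<bar> \<le> b1 * norm h" unfolding D_def b1_def by (rule linear_sum_bound) (rule b)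
    have t1: "norm (e * complex_of_real (\<phi> (y - h) - \<phi> y + D)) \<le> B2 * (norm h)\<^sup>2"
      unfolding norm_mult ne norm_of_real using B2(2)[of y h] by (simp add: D_def)
    have t2: "norm ((e - 1) * complex_of_real D) \<le> a * b1 * (norm h)\<^sup>2"
    proof -
      have "norm (e - 1) \<le> a * norm h" unfolding e_def by (rule order_trans[OF exp_phase_1 \<alpha>])
      then have "norm (e - 1) * \<bar>D\<bar> \<le> (a * norm h) * (b1 * norm h)" using D a0 by (intro mult_mono) auto
      then show ?thesis by (simp add: norm_mult power2_eq_square mult_ac)
    qed
    have t3: "norm ((e - 1 + \<i> * complex_of_real \<alpha>) * complex_of_real (\<phi> y)) \<le> a\<^sup>2 * B0 * (norm h)\<^sup>2"
    proof -
      have "\<alpha>\<^sup>2 \<le> (a * norm h)\<^sup>2" using power_mono[OF \<alpha> abs_ge_zero, of 2] by simp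
      then have "norm (e - 1 + \<i> * complex_of_real \<alpha>) \<le> (a * norm h)\<^sup>2" unfolding e_def by (rule order_trans[OF exp_phase_2])
      then have "norm (e - 1 + \<i> * complex_of_real \<alpha>) * \<bar>\<phi> y\<bar> \<le> (a * norm h)\<^sup>2 * B0" using 0(2) by (intro mult_mono) auto
      then show ?thesis by (simp add: norm_mult power_mult_distrib mult_ac)
    qed
    have t4: "norm (\<i> * complex_of_real ((\<alpha>0 - \<alpha>) * \<phi> y)) \<le> L / 2 * B0 * (norm h)\<^sup>2"
    proof -
      have "\<bar>\<alpha>0 - \<alpha>\<bar> * \<bar>\<phi> y\<bar> \<le> (L / 2 * (norm h)\<^sup>2) * B0" using \<alpha>\<alpha> 0(2) L0 by (intro mult_mono) auto
      then show ?thesis unfolding norm_mult norm_of_real abs_mult by (simp add: mult_ac)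
    qed
    have "norm (e * complex_of_real (\<phi> (y - h)) - complex_of_real (\<phi> y) + (complex_of_real D + \<i> * complex_of_real (\<alpha>0 * \<phi> y)))
      \<le> B2 * (norm h)\<^sup>2 + a * b1 * (norm h)\<^sup>2 + a\<^sup>2 * B0 * (norm h)\<^sup>2 + L / 2 * B0 * (norm h)\<^sup>2"
      unfolding eq
      by (rule order_trans[OF norm_triangle_ineq] add_mono order_trans[OF norm_triangle_ineq4] t1 t2 t3 t4)+
    also have "\<dots> = ?C * (norm h)\<^sup>2" by (simp add: distrib_right)
    finally show ?thesis unfolding sum e_def \<alpha>_def .
  qed
  show thesis
  proof (rule that)
    show "?C \<ge> 0" using B2 a0 b1 0(3) L0 by simp
    fix h y :: "real^'n" assume "norm h \<le> 1"
    then show "norm (exp (- (\<i> * complex_of_real (h \<bullet> A (y - h /\<^sub>R 2)))) * complex_of_real (\<phi> (y - h)) - complex_of_real (\<phi> y)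
       + (\<Sum>j\<in>UNIV. complex_of_real (h $ j) * mag_pderiv A \<phi> j y)) \<le> ?C * (norm h)\<^sup>2 * indicator (cball 0 R) y"
      using main[of h y] zero[of h y] by (cases "norm y \<le> R") auto
  qed
qed

lemma mdiff_test_expansion:
  fixes v :: "real ^ 'n::finite \<Rightarrow> complex"
  assumes [measurable]: "v \<in> borel_measurable borel" and L: "L-lipschitz_on UNIV A"
    and M: "\<And>x. norm (v x) \<le> M" and t: "test_fun \<phi>"
  obtains C where "C \<ge> 0" "\<And>h. norm h \<le> 1 \<Longrightarrow>
     norm ((LINT x|lborel. mdiff A v h x * complex_of_real (\<phi> x)) + (\<Sum>j\<in>UNIV. complex_of_real (h $ j) * (LINT x|lborel. v x * mag_pderiv A \<phi> j x))) \<le> C * (norm h)\<^sup>2"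
proof -
  note v = bounded_loc_int[OF assms(1) M]
  have Am[measurable]: "A \<in> borel_measurable borel" by (rule lipschitz_measurable[OF L])
  have M0: "M \<ge> 0" using M[of 0] norm_ge_zero order_trans by blast
  have [measurable]: "\<phi> \<in> borel_measurable borel" by (rule test_fun_measurable[OF t])
  note [measurable] = mag_pderiv_measurable[OF t Am]
  have [measurable]: "(\<lambda>s. exp (- (\<i> * complex_of_real s))) \<in> borel_measurable borel"
    by (intro borel_measurable_continuous_onI continuous_intros)
  obtain R C where C: "C \<ge> 0" "\<And>h y. norm h \<le> 1 \<Longrightarrow>
     norm (exp (- (\<i> * complex_of_real (h \<bullet> A (y - h /\<^sub>R 2)))) * complex_of_real (\<phi> (y - h)) - complex_of_real (\<phi> y)
       + (\<Sum>j\<in>UNIV. complex_of_real (h $ j) * mag_pderiv A \<phi> j y)) \<le> C * (norm h)\<^sup>2 * indicator (cball 0 R) y"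
    by (rule test_fun_mag_taylor[OF t L]) blast
  have ip: "integrable lborel (\<lambda>y. v y * mag_pderiv A \<phi> j y)" for j
  proof -
    obtain R' B where "\<And>x. norm x > R' \<Longrightarrow> mag_pderiv A \<phi> j x = 0" "\<And>x. norm (mag_pderiv A \<phi> j x) \<le> B"
      using mag_pderiv_bounded_support[OF t L] by metis
    then show ?thesis by (intro loc_int_bounded_support[OF v]) auto
  qed
  let ?\<beta> = "measure lborel (cball 0 R :: (real^'n) set)"
  show thesis
  proof (rule that[of "C * M * ?\<beta>"])
    show "0 \<le> C * M * ?\<beta>" using C(1) M0 by simp
    fix h :: "real^'n" assume h: "norm h \<le> 1"
    let ?k = "\<lambda>y. exp (- (\<i> * complex_of_real (h \<bullet> A (y - h /\<^sub>R 2)))) * complex_of_real (\<phi> (y - h)) - complex_of_real (\<phi> y)"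
    let ?s = "\<lambda>y. \<Sum>j\<in>UNIV. complex_of_real (h $ j) * mag_pderiv A \<phi> j y"
    have isum: "integrable lborel (\<lambda>y. \<Sum>j\<in>UNIV. complex_of_real (h $ j) * (v y * mag_pderiv A \<phi> j y))"
      by (intro Bochner_Integration.integrable_sum integrable_mult_right ip)
    have ib: "integrable lborel (\<lambda>y::real^'n. C * (norm h)\<^sup>2 * M * indicator (cball 0 R) y :: real)"
      using emeasure_lborel_cball_finite[of "0::real^'n" R] by (intro integrable_mult_right integrable_real_indicator) auto
    have bd: "norm (v y * (?k y + ?s y)) \<le> C * (norm h)\<^sup>2 * M * indicator (cball 0 R) y" for y
    proof -
      have "norm (v y) * norm (?k y + ?s y) \<le> M * (C * (norm h)\<^sup>2 * indicator (cball 0 R) y)"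
        using M M0 C(2)[OF h] by (intro mult_mono) auto
      then show ?thesis by (simp only: norm_mult mult_ac)
    qed
    have ik: "integrable lborel (\<lambda>y. v y * (?k y + ?s y))"
    proof (rule Bochner_Integration.integrable_bound[OF ib])
      show "AE y in lborel. norm (v y * (?k y + ?s y)) \<le> norm (C * (norm h)\<^sup>2 * M * indicator (cball 0 R) y :: real)"
        using bd by (intro AE_I2) (auto intro: order_trans[OF _ abs_ge_self])
    qed measurable
    have "(LINT x|lborel. mdiff A v h x * complex_of_real (\<phi> x)) + (\<Sum>j\<in>UNIV. complex_of_real (h $ j) * (LINT x|lborel. v x * mag_pderiv A \<phi> j x))
      = (LINT y|lborel. v y * ?k y) + (LINT y|lborel. (\<Sum>j\<in>UNIV. complex_of_real (h $ j) * (v y * mag_pderiv A \<phi> j y)))"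
      unfolding mdiff_test_integral[OF assms(1) Am M t] integral_sum_cmult[OF ip] ..
    also have "\<dots> = (LINT y|lborel. v y * (?k y + ?s y))"
    proof -
      have d: "v y * (?k y + ?s y) - (\<Sum>j\<in>UNIV. complex_of_real (h $ j) * (v y * mag_pderiv A \<phi> j y)) = v y * ?k y" for y
      proof -
        have "v y * ?s y = (\<Sum>j\<in>UNIV. complex_of_real (h $ j) * (v y * mag_pderiv A \<phi> j y))"
          unfolding sum_distrib_left by (intro sum.cong) (auto simp: mult_ac)
        then show ?thesis by (simp only: distrib_left) simp
      qed
      show ?thesis using Bochner_Integration.integral_diff[OF ik isum] unfolding d by simp
    qed
    finally have "norm ((LINT x|lborel. mdiff A v h x * complex_of_real (\<phi> x)) + (\<Sum>j\<in>UNIV. complex_of_real (h $ j) * (LINT x|lborel. v x * mag_pderiv A \<phi> j x)))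
      = norm (LINT y|lborel. v y * (?k y + ?s y))" by simp
    also have "\<dots> \<le> (LINT y|lborel. norm (v y * (?k y + ?s y)))" by (rule integral_norm_bound)
    also have "\<dots> \<le> (LINT y::real^'n|lborel. C * (norm h)\<^sup>2 * M * indicator (cball 0 R) y)"
      by (rule integral_mono[OF integrable_norm[OF ik] ib]) (rule bd)
    also have "\<dots> = C * M * ?\<beta> * (norm h)\<^sup>2" by simp
    finally show "norm ((LINT x|lborel. mdiff A v h x * complex_of_real (\<phi> x)) + (\<Sum>j\<in>UNIV. complex_of_real (h $ j) * (LINT x|lborel. v x * mag_pderiv A \<phi> j x)))
      \<le> C * M * ?\<beta> * (norm h)\<^sup>2" .
  qed
qed

lemma annulus_weight_moments:
  assumes m: "m > 0"
  shows "integrable lborel (\<lambda>h::real^'n::finite. annulus_weight m h * (norm h)\<^sup>2)"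
    and "(LINT h::real^'n|lborel. annulus_weight m h * (h $ i * h $ j)) = (if i = j then ball_vol TYPE('n) * (m * ln 2) else 0)"
    and "integrable lborel (\<lambda>h::real^'n. annulus_weight m h * (h $ i * h $ j))"
proof -
  define w where "w = (\<lambda>r::real. if (1/2)^m < r \<and> r < 1 then 1 / r ^ (CARD('n) + 2) else 0)"
  have [measurable]: "w \<in> borel_measurable borel" unfolding w_def by measurable
  have aw: "annulus_weight m h = w (norm h)" for h :: "real^'n" by (simp add: annulus_weight_def w_def)
  have fin: "(\<integral>\<^sup>+h. ennreal (annulus_weight m h * (norm h)\<^sup>2) \<partial>(lborel :: (real^'n) measure)) = ennreal (CARD('n) * ball_vol TYPE('n) * (m * ln 2))"
    by (rule annulus_weight_moment2[OF m])
  show int: "integrable lborel (\<lambda>h::real^'n. annulus_weight m h * (norm h)\<^sup>2)"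
    using fin annulus_weight_nonneg by (intro integrableI_nonneg) (auto intro!: AE_I2 mult_nonneg_nonneg)
  have M: "(LINT h::real^'n|lborel. annulus_weight m h * (norm h)\<^sup>2) = CARD('n) * ball_vol TYPE('n) * (m * ln 2)"
    using fin nn_integral_eq_integral[OF int] annulus_weight_nonneg ball_vol_pos[where 'n='n]
    by (subst integral_eq_nn_integral) (auto intro!: AE_I2 mult_nonneg_nonneg)
  show "(LINT h::real^'n|lborel. annulus_weight m h * (h $ i * h $ j)) = (if i = j then ball_vol TYPE('n) * (m * ln 2) else 0)"
    unfolding aw radial_second_moments(2)[OF \<open>w \<in> borel_measurable borel\<close> int[unfolded aw]] using M[unfolded aw] by simp
  show "integrable lborel (\<lambda>h::real^'n. annulus_weight m h * (h $ i * h $ j))"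
    unfolding aw by (rule radial_second_moments(1)[OF \<open>w \<in> borel_measurable borel\<close> int[unfolded aw]])
qed

lemma test_fun_sq_integrable:
  fixes \<phi> :: "real ^ 'n::finite \<Rightarrow> real"
  assumes t: "test_fun \<phi>"
  shows "integrable lborel (\<lambda>x. (\<phi> x)\<^sup>2)"
proof -
  obtain R B where R: "\<And>x. norm x > R \<Longrightarrow> \<phi> x = 0" "\<And>x. \<bar>\<phi> x\<bar> \<le> B" "R > 0" "B > 0"
    using test_fun_support[OF t] by metis
  have [measurable]: "\<phi> \<in> borel_measurable borel" by (rule test_fun_measurable[OF t])
  show ?thesis
  proof (rule Bochner_Integration.integrable_bound)
    show "integrable lborel (\<lambda>x::real^'n. B\<^sup>2 * indicator (cball 0 R) x :: real)"
      using emeasure_lborel_cball_finite[of "0::real^'n" R] by (intro integrable_mult_right integrable_real_indicator) auto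
    show "AE x in lborel. norm ((\<phi> x)\<^sup>2) \<le> norm (B\<^sup>2 * indicator (cball 0 R) x :: real)" (is "AE x in _. ?P1 x")
    proof (rule AE_I2)
      fix x
      have "(\<phi> x)\<^sup>2 \<le> B\<^sup>2" using power_mono[OF R(2)[of x] abs_ge_zero, of 2] by simp
      then show "?P1 x"
        using R(1)[of x] by (cases "norm x \<le> R") auto
    qed
  qed measurable
qed

text \<open>Pairing the differences with a test function over the annulus \<open>(1/2)^m < norm h < 1\<close>, both the
  main term and its bound by the quadratic functional grow linearly in \<open>m\<close>, while all errors stay
  bounded.\<close>

lemma weak_bound_scaled:
  fixes v :: "real ^ 'n::finite \<Rightarrow> complex"
  assumes vm[measurable]: "v \<in> borel_measurable borel" and L: "L-lipschitz_on UNIV A"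
    and M: "\<And>x. norm (v x) \<le> M" and K: "\<And>\<delta>. 0 < \<delta> \<Longrightarrow> \<delta> < 1 \<Longrightarrow> J A \<delta> v \<le> ennreal K" and K0: "K \<ge> 0"
    and t: "test_fun \<phi>" and s: "s > 0"
  shows "ball_vol TYPE('n) * ln 2 * norm (LINT x|lborel. v x * mag_pderiv A \<phi> j x)
    \<le> s * (4 * K) + CARD('n) * ball_vol TYPE('n) * ln 2 * (LINT x|lborel. (\<phi> x)\<^sup>2) / s"
proof -
  let ?N = "CARD('n)"
  note v = bounded_loc_int[OF vm M]
  have Am[measurable]: "A \<in> borel_measurable borel" by (rule lipschitz_measurable[OF L])
  have \<phi>m[measurable]: "\<phi> \<in> borel_measurable borel" by (rule test_fun_measurable[OF t])
  define \<Lambda> where "\<Lambda> = (\<lambda>j. LINT x|lborel. v x * mag_pderiv A \<phi> j x)"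
  define I where "I = (\<lambda>h. LINT x|lborel. mdiff A v h x * complex_of_real (\<phi> x))"
  have Im[measurable]: "I \<in> borel_measurable borel"
    unfolding I_def by measurable
  obtain C2 where C2: "C2 \<ge> 0" "\<And>h. norm h \<le> 1 \<Longrightarrow> norm (I h + (\<Sum>j\<in>UNIV. complex_of_real (h $ j) * \<Lambda> j)) \<le> C2 * (norm h)\<^sup>2"
    using mdiff_test_expansion[OF vm L M t] unfolding I_def \<Lambda>_def by blast
  obtain R B where R: "\<And>x. norm x > R \<Longrightarrow> \<phi> x = 0" "\<And>x. \<bar>\<phi> x\<bar> \<le> B" "R > 0" "B > 0"
    using test_fun_support[OF t] by metis
  define n2 where "n2 = (LINT x|lborel. (\<phi> x)\<^sup>2)"
  note i2 = test_fun_sq_integrable[OF t]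
  have nn2: "(\<integral>\<^sup>+x. ennreal ((\<phi> x)\<^sup>2) \<partial>lborel) = ennreal n2"
    unfolding n2_def by (rule nn_integral_eq_integral[OF i2]) auto
  have n20: "n2 \<ge> 0" unfolding n2_def by simp
  obtain C0 where C0: "C0 \<ge> 0" and Qb: "\<And>m. m > 0 \<Longrightarrow> (\<integral>\<^sup>+h. ennreal (annulus_weight m h) * local_mdiff_sq A v R h \<partial>lborel)
     \<le> ennreal (4 * K * m + C0)"
    using quadratic_bound[OF vm Am M K K0, of R] by blast
  let ?\<omega> = "?N * ball_vol TYPE('n)"
  have \<omega>0: "?\<omega> \<ge> 0" using ball_vol_pos[where 'n='n] by simp
  \<comment> \<open>both sides grow linearly in \<open>m\<close>, except for terms that do not depend on \<open>m\<close>\<close>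
  have main: "ball_vol TYPE('n) * (m * ln 2) * norm (\<Lambda> j) \<le> s * (4 * K * m + C0) + ?\<omega> * (m * ln 2) * n2 / s + C2 * ?\<omega>" if m: "m > 0" for m :: nat
  proof -
    let ?w = "annulus_weight m :: real^'n \<Rightarrow> real"
    have w0: "?w h \<ge> 0" for h by (rule annulus_weight_nonneg)
    have w1: "?w h = 0" if "norm h > 1" for h using that by (simp add: annulus_weight_def)
    let ?V = "\<lambda>h. complex_of_real (?w h * h $ j)"
    define X where "X = (LINT h|lborel. ?V h * I h)"
    define S where "S = (\<lambda>h::real^'n. \<Sum>i\<in>UNIV. complex_of_real (h $ i) * \<Lambda> i)"
    have Sm[measurable]: "S \<in> borel_measurable borel" unfolding S_def by measurable
    define b where "b = (\<Sum>i\<in>UNIV. norm (\<Lambda> i))"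
    have Sb: "norm (S h) \<le> b * norm h" for h
    proof -
      have "norm (S h) \<le> (\<Sum>i\<in>UNIV. norm h * norm (\<Lambda> i))"
        unfolding S_def by (rule order_trans[OF norm_sum]) (auto simp: norm_mult intro!: sum_mono mult_right_mono component_le_norm_cart)
      then show ?thesis by (simp add: b_def sum_distrib_left mult.commute)
    qed
    have iw: "integrable lborel (\<lambda>h::real^'n. ?w h * (norm h)\<^sup>2)" by (rule annulus_weight_moments(1)[OF m])
    have iS: "integrable lborel (\<lambda>h. ?V h * S h)"
    proof (rule Bochner_Integration.integrable_bound[OF integrable_mult_right[OF iw, of b]])
      show "AE h in lborel. norm (?V h * S h) \<le> norm (b * (?w h * (norm h)\<^sup>2))" (is "AE x in _. ?P2 x")
      proof (rule AE_I2)
        fix h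
        have "(?w h * \<bar>h $ j\<bar>) * norm (S h) \<le> (?w h * norm h) * (b * norm h)"
          using w0 Sb component_le_norm_cart by (intro mult_mono mult_left_mono) auto
        then show "?P2 h"
          using w0[of h] by (simp add: norm_mult abs_mult power2_eq_square mult_ac b_def sum_nonneg)
      qed
    qed measurable
    have iE: "integrable lborel (\<lambda>h. ?V h * (I h + S h))"
      and Eb: "(\<integral>\<^sup>+h. ennreal (norm (?V h * (I h + S h))) \<partial>lborel) \<le> ennreal (C2 * ?\<omega>)"
    proof -
      have "(\<integral>\<^sup>+h. ennreal (norm (?V h * (I h + S h))) \<partial>lborel) \<le> (\<integral>\<^sup>+h. ennreal C2 * ennreal (?w h * (norm h * (norm h)\<^sup>2)) \<partial>lborel)" (is "nn_integral _ ?l3 \<le> nn_integral _ ?r3")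
      proof (rule nn_integral_mono)
        fix h
        show "?l3 h \<le> ?r3 h"
        proof (cases "norm h \<le> 1")
          case True
          have "(?w h * \<bar>h $ j\<bar>) * norm (I h + S h) \<le> (?w h * norm h) * (C2 * (norm h)\<^sup>2)"
            using w0 C2(2)[OF True] component_le_norm_cart unfolding S_def by (intro mult_mono mult_left_mono) auto
          then have "norm (?V h * (I h + S h)) \<le> C2 * (?w h * (norm h * (norm h)\<^sup>2))"
            using w0[of h] by (simp add: norm_mult abs_mult mult_ac)
          then have "ennreal (norm (?V h * (I h + S h))) \<le> ennreal (C2 * (?w h * (norm h * (norm h)\<^sup>2)))"
            by (rule ennreal_leI)
          then show ?thesis using C2(1) by (simp only: ennreal_mult')
        next
          case False
          then show ?thesis using w1[of h] by simp
        qed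
      qed
      also have "\<dots> \<le> ennreal C2 * ennreal ?\<omega>"
        by (subst nn_integral_cmult) (measurable, intro mult_left_mono annulus_weight_moment3, simp)
      also have "\<dots> = ennreal (C2 * ?\<omega>)" using C2(1) by (simp only: ennreal_mult')
      finally show "(\<integral>\<^sup>+h. ennreal (norm (?V h * (I h + S h))) \<partial>lborel) \<le> ennreal (C2 * ?\<omega>)" .
      then show "integrable lborel (\<lambda>h. ?V h * (I h + S h))"
        by (intro integrableI_bounded) (measurable, auto simp: less_top[symmetric] top_unique intro: order.strict_trans1)
    qed
    have SL: "(LINT h|lborel. ?V h * S h) = complex_of_real (ball_vol TYPE('n) * (m * ln 2)) * \<Lambda> j"
    proof -
      have ii: "integrable lborel (\<lambda>h. complex_of_real (?w h * (h $ j * h $ i)))" for i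
        using annulus_weight_moments(3)[OF m, of j i] by (rule integrable_of_real)
      have "(LINT h|lborel. ?V h * S h) = (LINT h|lborel. (\<Sum>i\<in>UNIV. \<Lambda> i * complex_of_real (?w h * (h $ j * h $ i))))"
        by (intro Bochner_Integration.integral_cong) (auto simp: S_def sum_distrib_left mult_ac)
      also have "\<dots> = (\<Sum>i\<in>UNIV. \<Lambda> i * (LINT h|lborel. complex_of_real (?w h * (h $ j * h $ i))))"
        by (rule integral_sum_cmult[OF ii])
      also have "\<dots> = (\<Sum>i\<in>UNIV. \<Lambda> i * complex_of_real (if j = i then ball_vol TYPE('n) * (m * ln 2) else 0))"
        by (simp only: integral_complex_of_real annulus_weight_moments(2)[OF m])
      also have "\<dots> = complex_of_real (ball_vol TYPE('n) * (m * ln 2)) * \<Lambda> j"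
        by (simp add: if_distrib cong: if_cong)
      finally show ?thesis .
    qed
    have "X = (LINT h|lborel. ?V h * (I h + S h) - ?V h * S h)"
      unfolding X_def by (simp add: algebra_simps)
    also have "\<dots> = (LINT h|lborel. ?V h * (I h + S h)) - complex_of_real (ball_vol TYPE('n) * (m * ln 2)) * \<Lambda> j"
      unfolding SL[symmetric] by (rule Bochner_Integration.integral_diff[OF iE iS])
    finally have Xeq: "complex_of_real (ball_vol TYPE('n) * (m * ln 2)) * \<Lambda> j = (LINT h|lborel. ?V h * (I h + S h)) - X" by simp
    have e1: "norm (LINT h|lborel. ?V h * (I h + S h)) \<le> C2 * ?\<omega>"
    proof -
      have "ennreal (norm (LINT h|lborel. ?V h * (I h + S h))) \<le> ennreal (C2 * ?\<omega>)"
        by (rule order_trans[OF norm_integral_le_nn_integral Eb])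
      then show ?thesis using C2(1) \<omega>0 by (subst (asm) ennreal_le_iff) auto
    qed
    have e2: "norm X \<le> s * (4 * K * m + C0) + ?\<omega> * (m * ln 2) * n2 / s"
    proof -
      have "ennreal (norm X) \<le> (\<integral>\<^sup>+h. ennreal (norm (?V h * I h)) \<partial>lborel)"
        unfolding X_def by (rule norm_integral_le_nn_integral)
      also have "\<dots> \<le> (\<integral>\<^sup>+h. ennreal s * (ennreal (?w h) * local_mdiff_sq A v R h)
          + ennreal (?w h * (norm h)\<^sup>2) * ennreal (n2 / s) \<partial>lborel)" (is "nn_integral _ ?l4 \<le> nn_integral _ ?r4")
      proof (rule nn_integral_mono)
        fix h
        have Ib: "ennreal (norm h * norm (I h)) \<le> ennreal s * local_mdiff_sq A v R h + ennreal ((norm h)\<^sup>2) * ennreal (n2 / s)"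
        proof -
          have "ennreal (norm h * norm (I h)) = ennreal (norm h) * ennreal (norm (I h))" by (simp only: ennreal_mult' norm_ge_zero)
          also have "\<dots> \<le> ennreal (norm h) * (\<integral>\<^sup>+x. ennreal (norm (mdiff A v h x * complex_of_real (\<phi> x))) \<partial>lborel)"
            unfolding I_def by (intro mult_left_mono norm_integral_le_nn_integral) auto
          also have "\<dots> = (\<integral>\<^sup>+x. ennreal (norm h) * ennreal (norm (mdiff A v h x * complex_of_real (\<phi> x))) \<partial>lborel)"
            by (rule nn_integral_cmult[symmetric]) measurable
          also have "\<dots> \<le> (\<integral>\<^sup>+x. ennreal s * (indicator (cball 0 R) x * ennreal ((norm (mdiff A v h x))\<^sup>2)) + ennreal ((norm h)\<^sup>2 / s) * ennreal ((\<phi> x)\<^sup>2) \<partial>lborel)" (is "nn_integral _ ?l5 \<le> nn_integral _ ?r5")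
          proof (rule nn_integral_mono)
            fix x
            show "?l5 x \<le> ?r5 x"
            proof (cases "norm x \<le> R")
              case True
              let ?d = "norm (mdiff A v h x)" and ?p = "norm h * \<bar>\<phi> x\<bar>"
              have "0 \<le> (s * ?d - ?p)\<^sup>2" by simp
              then have "s * (2 * (?d * ?p)) \<le> s * (s * ?d\<^sup>2) + ?p\<^sup>2" by (simp add: power2_eq_square algebra_simps)
              moreover have "0 \<le> s * (?d * ?p)" using s by simp
              ultimately have "s * (?d * ?p) \<le> s * (s * ?d\<^sup>2) + ?p\<^sup>2" by argo
              then have "?d * ?p \<le> s * ?d\<^sup>2 + ?p\<^sup>2 / s" using s by (simp add: field_simps)
              then have "norm h * (?d * \<bar>\<phi> x\<bar>) \<le> s * ?d\<^sup>2 + (norm h)\<^sup>2 / s * (\<phi> x)\<^sup>2" by (simp add: power_mult_distrib mult_ac)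
              then have "ennreal (norm h * (?d * \<bar>\<phi> x\<bar>)) \<le> ennreal (s * ?d\<^sup>2 + (norm h)\<^sup>2 / s * (\<phi> x)\<^sup>2)" by (rule ennreal_leI)
              also have "\<dots> = ennreal (s * ?d\<^sup>2) + ennreal ((norm h)\<^sup>2 / s * (\<phi> x)\<^sup>2)" using s by (intro ennreal_plus) auto
              also have "\<dots> = ennreal s * ennreal (?d\<^sup>2) + ennreal ((norm h)\<^sup>2 / s) * ennreal ((\<phi> x)\<^sup>2)"
                by (simp only: ennreal_mult''[OF zero_le_power2])
              also have "ennreal (norm h * (?d * \<bar>\<phi> x\<bar>)) = ennreal (norm h) * ennreal (norm (mdiff A v h x * complex_of_real (\<phi> x)))"
                by (simp add: ennreal_mult' norm_mult)
              finally show ?thesis using True by simp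
            next
              case False
              then show ?thesis using R(1)[of x] by simp
            qed
          qed
          also have "\<dots> = ennreal s * local_mdiff_sq A v R h + ennreal ((norm h)\<^sup>2 / s) * ennreal n2"
            by (subst nn_integral_add, measurable, subst nn_integral_cmult, measurable, subst nn_integral_cmult, measurable) (simp only: nn2)
          also have "ennreal ((norm h)\<^sup>2 / s) * ennreal n2 = ennreal ((norm h)\<^sup>2) * ennreal (n2 / s)"
            using s n20 by (subst (1 2) ennreal_mult[symmetric]) auto
          finally show ?thesis .
        qed
        have "norm (?V h * I h) \<le> ?w h * (norm h * norm (I h))"
          using w0[of h] component_le_norm_cart[of h j] by (auto simp: norm_mult abs_mult mult.assoc intro!: mult_left_mono mult_right_mono)
        then have "ennreal (norm (?V h * I h)) \<le> ennreal (?w h * (norm h * norm (I h)))" by (rule ennreal_leI)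
        also have "\<dots> = ennreal (?w h) * ennreal (norm h * norm (I h))" using w0 by (simp only: ennreal_mult')
        also have "\<dots> \<le> ennreal (?w h) * (ennreal s * local_mdiff_sq A v R h + ennreal ((norm h)\<^sup>2) * ennreal (n2 / s))"
          by (intro mult_left_mono Ib) simp
        also have "\<dots> = ennreal s * (ennreal (?w h) * local_mdiff_sq A v R h) + (ennreal (?w h) * ennreal ((norm h)\<^sup>2)) * ennreal (n2 / s)"
          by (simp only: distrib_left mult_ac)
        also have "ennreal (?w h) * ennreal ((norm h)\<^sup>2) = ennreal (?w h * (norm h)\<^sup>2)" using w0 by (simp only: ennreal_mult')
        finally show "?l4 h \<le> ?r4 h" .
      qed
      also have "\<dots> = ennreal s * (\<integral>\<^sup>+h. ennreal (?w h) * local_mdiff_sq A v R h \<partial>lborel)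
          + ennreal (?\<omega> * (m * ln 2)) * ennreal (n2 / s)"
      proof -
        have im[measurable]: "(\<lambda>h. \<integral>\<^sup>+x. indicator (cball 0 R) x * ennreal ((norm (mdiff A v h x))\<^sup>2) \<partial>lborel) \<in> borel_measurable borel"
        proof -
          have "(\<lambda>h. \<integral>\<^sup>+x. indicator (cball 0 R) x * ennreal ((norm (mdiff A v h x))\<^sup>2) \<partial>lborel) = (\<lambda>h. \<integral>\<^sup>+x. (if norm x \<le> R then 1 else 0) * ennreal ((norm (mdiff A v h x))\<^sup>2) \<partial>lborel)"
            by (intro ext nn_integral_cong) (auto simp: indicator_def)
          also have "\<dots> \<in> borel_measurable borel" by measurable
          finally show ?thesis .
        qed
        show ?thesis
          by (subst nn_integral_add, measurable, subst nn_integral_cmult, measurable, subst nn_integral_multc, measurable) (simp only: annulus_weight_moment2[OF m])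
      qed
      also have "\<dots> \<le> ennreal s * ennreal (4 * K * m + C0) + ennreal (?\<omega> * (m * ln 2)) * ennreal (n2 / s)"
        by (intro add_mono mult_left_mono Qb m order_refl) auto
      also have "\<dots> = ennreal (s * (4 * K * m + C0)) + ennreal (?\<omega> * (m * ln 2) * (n2 / s))"
        using s n20 by (simp only: ennreal_mult' ennreal_mult'' less_imp_le divide_nonneg_pos)
      also have "\<dots> = ennreal (s * (4 * K * m + C0) + ?\<omega> * (m * ln 2) * n2 / s)"
        using s n20 K0 C0 ball_vol_pos[where 'n='n] by (subst ennreal_plus[symmetric]) (auto intro!: mult_nonneg_nonneg)
      finally have "ennreal (norm X) \<le> ennreal (s * (4 * K * m + C0) + ?\<omega> * (m * ln 2) * n2 / s)" .
      moreover have "0 \<le> s * (4 * K * m + C0) + ?\<omega> * (m * ln 2) * n2 / s"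
        using s n20 K0 C0 ball_vol_pos[where 'n='n] by (intro add_nonneg_nonneg mult_nonneg_nonneg divide_nonneg_nonneg) auto
      ultimately show ?thesis by (simp only: ennreal_le_iff)
    qed
    have "ball_vol TYPE('n) * (m * ln 2) * norm (\<Lambda> j) = norm (complex_of_real (ball_vol TYPE('n) * (m * ln 2)) * \<Lambda> j)"
      using ball_vol_pos[where 'n='n] by (simp add: norm_mult)
    also have "\<dots> \<le> C2 * ?\<omega> + norm X" unfolding Xeq using norm_triangle_ineq4 e1 by (meson add_right_mono order_trans)
    finally show ?thesis using e2 by linarith
  qed
  \<comment> \<open>division by \<open>m\<close> removes the constant terms in the limit\<close>
  have lim: "(\<lambda>m. s * (4 * K) + ?\<omega> * ln 2 * n2 / s + (s * C0 + C2 * ?\<omega>) * inverse (real (Suc m))) \<longlonglongrightarrow> s * (4 * K) + ?\<omega> * ln 2 * n2 / s + (s * C0 + C2 * ?\<omega>) * 0"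
    by (intro tendsto_intros LIMSEQ_inverse_real_of_nat)
  have "ball_vol TYPE('n) * ln 2 * norm (\<Lambda> j) \<le> s * (4 * K) + ?\<omega> * ln 2 * n2 / s + (s * C0 + C2 * ?\<omega>) * inverse (real (Suc m))" for m
  proof -
    let ?m = "real (Suc m)"
    have mp: "?m > 0" by simp
    have "ball_vol TYPE('n) * (?m * ln 2) * norm (\<Lambda> j) \<le> s * (4 * K * ?m + C0) + ?\<omega> * (?m * ln 2) * n2 / s + C2 * ?\<omega>"
      by (rule main) simp
    then have "?m * (ball_vol TYPE('n) * ln 2 * norm (\<Lambda> j)) \<le> ?m * (s * (4 * K) + ?\<omega> * ln 2 * n2 / s + (s * C0 + C2 * ?\<omega>) * inverse ?m)"
    proof -
      have "?m * (s * (4 * K) + ?\<omega> * ln 2 * n2 / s + (s * C0 + C2 * ?\<omega>) * inverse ?m) = ?m * (s * (4 * K) + ?\<omega> * ln 2 * n2 / s) + (s * C0 + C2 * ?\<omega>)"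
        using mp by (simp only: distrib_left) (simp add: field_simps)
      then show ?thesis using \<open>ball_vol TYPE('n) * (?m * ln 2) * norm (\<Lambda> j) \<le> s * (4 * K * ?m + C0) + ?\<omega> * (?m * ln 2) * n2 / s + C2 * ?\<omega>\<close>
        by (simp only:) (simp add: algebra_simps del: of_nat_Suc)
    qed
    then show ?thesis using mp by (simp only: mult_le_cancel_left_pos)
  qed
  then have "ball_vol TYPE('n) * ln 2 * norm (\<Lambda> j) \<le> s * (4 * K) + ?\<omega> * ln 2 * n2 / s + (s * C0 + C2 * ?\<omega>) * 0"
    by (intro LIMSEQ_le_const[OF lim]) blast
  then show ?thesis by (simp add: \<Lambda>_def n2_def)
qed

text \<open>The parameter \<open>s\<close> is chosen as the norm of \<open>\<phi>\<close>, which makes the bound homogeneous.\<close>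

lemma weak_bound_bounded:
  fixes v :: "real ^ 'n::finite \<Rightarrow> complex"
  assumes vm: "v \<in> borel_measurable borel" and L: "L-lipschitz_on UNIV A"
    and M: "\<And>x. norm (v x) \<le> M" and K: "\<And>\<delta>. 0 < \<delta> \<Longrightarrow> \<delta> < 1 \<Longrightarrow> J A \<delta> v \<le> ennreal K" and K0: "K \<ge> 0"
    and t: "test_fun \<phi>"
  shows "norm (LINT x|lborel. v x * mag_pderiv A \<phi> j x)
    \<le> (4 * K + CARD('n) * ball_vol TYPE('n) * ln 2) / (ball_vol TYPE('n) * ln 2) * sqrt (LINT x|lborel. (\<phi> x)\<^sup>2)"
proof -
  let ?b = "ball_vol TYPE('n) * ln 2" and ?\<Lambda> = "norm (LINT x|lborel. v x * mag_pderiv A \<phi> j x)"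
  let ?n2 = "LINT x|lborel. (\<phi> x)\<^sup>2"
  let ?k = "CARD('n) * ball_vol TYPE('n) * ln 2"
  have b: "?b > 0" using ball_vol_pos[where 'n='n] by simp
  have n0: "?n2 \<ge> 0" by simp
  have S: "?b * ?\<Lambda> \<le> s * (4 * K) + ?k * ?n2 / s" if "s > 0" for s
    by (rule weak_bound_scaled[OF vm L M K K0 t that])
  have "?b * ?\<Lambda> \<le> (4 * K + ?k) * sqrt ?n2"
  proof (cases "?n2 = 0")
    case True
    have "?b * ?\<Lambda> \<le> 0 + e" if e: "e > 0" for e
    proof -
      have "?b * ?\<Lambda> \<le> e / (4 * K + 1) * (4 * K)" using S[of "e / (4 * K + 1)"] e K0 True by simp
      also have "\<dots> \<le> e" using e K0 by (simp add: field_simps)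
      finally show ?thesis by simp
    qed
    then have "?b * ?\<Lambda> \<le> 0" by (rule field_le_epsilon)
    then show ?thesis using True by simp
  next
    case False
    then have "?n2 > 0" using n0 by (simp only: order_less_le) simp
    then have s: "sqrt ?n2 > 0" by simp
    have "?n2 / sqrt ?n2 = sqrt ?n2" using n0 by (simp add: real_div_sqrt)
    then show ?thesis using S[OF s] by (simp add: algebra_simps flip: times_divide_eq_right)
  qed
  then show ?thesis using b by (simp add: field_simps)
qed

text \<open>The bound does not depend on the size of \<open>u\<close>, hence passes to the limit along radial truncations.\<close>

lemma weak_bound:
  fixes u :: "real ^ 'n::finite \<Rightarrow> complex"
  assumes um[measurable]: "u \<in> borel_measurable borel" and u: "loc_int u" and L: "L-lipschitz_on UNIV A"
    and K: "\<And>\<delta>. 0 < \<delta> \<Longrightarrow> \<delta> < 1 \<Longrightarrow> J A \<delta> u \<le> ennreal K" and K0: "K \<ge> 0"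
    and t: "test_fun \<phi>"
  shows "norm (LINT x|lborel. u x * mag_pderiv A \<phi> j x)
    \<le> (4 * K + CARD('n) * ball_vol TYPE('n) * ln 2) / (ball_vol TYPE('n) * ln 2) * sqrt (LINT x|lborel. (\<phi> x)\<^sup>2)"
proof -
  have Am[measurable]: "A \<in> borel_measurable borel" by (rule lipschitz_measurable[OF L])
  note pm[measurable] = mag_pderiv_measurable[OF t Am, of j]
  define v where "v = (\<lambda>n::nat. \<lambda>x. radial_proj (real n) (u x))"
  have vm[measurable]: "v n \<in> borel_measurable borel" for n
    unfolding v_def by (rule radial_proj_measurable) auto
  have b: "norm (LINT x|lborel. v n x * mag_pderiv A \<phi> j x)
    \<le> (4 * K + CARD('n) * ball_vol TYPE('n) * ln 2) / (ball_vol TYPE('n) * ln 2) * sqrt (LINT x|lborel. (\<phi> x)\<^sup>2)" for n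
  proof (rule weak_bound_bounded[OF vm L _ _ K0 t])
    show "norm (v n x) \<le> real n" for x unfolding v_def by (rule radial_proj_norm) simp
    show "J A \<delta> (v n) \<le> ennreal K" if "0 < \<delta>" "\<delta> < 1" for \<delta>
      unfolding v_def by (rule order_trans[OF J_truncation K[OF that]]) auto
  qed
  have "(\<lambda>n. LINT x|lborel. v n x * mag_pderiv A \<phi> j x) \<longlonglongrightarrow> (LINT x|lborel. u x * mag_pderiv A \<phi> j x)"
  proof (rule integral_dominated_convergence[where w="\<lambda>x. norm (u x * mag_pderiv A \<phi> j x)"])
    obtain R B where "\<And>x. norm x > R \<Longrightarrow> mag_pderiv A \<phi> j x = 0" "\<And>x. norm (mag_pderiv A \<phi> j x) \<le> B"
      using mag_pderiv_bounded_support[OF t L] by metis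
    then show "integrable lborel (\<lambda>x. norm (u x * mag_pderiv A \<phi> j x))"
      by (intro integrable_norm loc_int_bounded_support[OF u]) auto
    show "AE x in lborel. (\<lambda>n. v n x * mag_pderiv A \<phi> j x) \<longlonglongrightarrow> u x * mag_pderiv A \<phi> j x" (is "AE x in _. ?P1 x")
    proof (rule AE_I2)
      fix x
      obtain m where m: "norm (u x) \<le> real m" using real_arch_simple by blast
      have "eventually (\<lambda>n. v n x = u x) sequentially"
        using eventually_ge_at_top[of m] by eventually_elim (use m in \<open>auto simp: v_def intro!: radial_proj_id\<close>)
      then have "(\<lambda>n. v n x) \<longlonglongrightarrow> u x" by (rule tendsto_eventually)
      then show "?P1 x" by (intro tendsto_intros)
    qed
    show "AE x in lborel. norm (v n x * mag_pderiv A \<phi> j x) \<le> norm (u x * mag_pderiv A \<phi> j x)" for n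
      using radial_proj_le[of "real n"] by (intro AE_I2) (auto simp: v_def norm_mult intro!: mult_right_mono)
  qed measurable
  then show ?thesis by (intro LIMSEQ_le_const2[OF tendsto_norm]) (use b in blast)+
qed

lemma L2_loc_int:
  fixes f :: "'a::euclidean_space \<Rightarrow> 'b::{banach, second_countable_topology}"
  assumes [measurable]: "f \<in> borel_measurable borel" and fin: "L2_sq f < \<infinity>"
  shows "loc_int f"
  unfolding loc_int_def
proof (intro conjI allI)
  fix R
  have "integrable lborel (\<lambda>x. (norm (f x))\<^sup>2)" using fin by (intro integrableI_nonneg) auto
  then have "integrable lborel (\<lambda>x. indicator (cball 0 R) x + (norm (f x))\<^sup>2 :: real)"
    using emeasure_lborel_cball_finite[of "0::'a" R] by (intro Bochner_Integration.integrable_add integrable_real_indicator) auto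
  then show "integrable lborel (\<lambda>x. indicator (cball 0 R) x *\<^sub>R f x)"
  proof (rule Bochner_Integration.integrable_bound)
    show "AE x in lborel. norm (indicator (cball 0 R) x *\<^sub>R f x) \<le> norm (indicator (cball 0 R) x + (norm (f x))\<^sup>2 :: real)" (is "AE x in _. ?P1 x")
    proof (rule AE_I2)
      fix x
      have "0 \<le> (norm (f x) - 1)\<^sup>2" "0 \<le> (norm (f x))\<^sup>2" by simp_all
      then have "2 * norm (f x) \<le> 1 + (norm (f x))\<^sup>2" by (simp add: power2_eq_square algebra_simps)
      then have "norm (f x) \<le> 1 + (norm (f x))\<^sup>2" using norm_ge_zero[of "f x"] by linarith
      then show "?P1 x"
        by (auto simp: indicator_def)
    qed
  qed measurable
qed fact

lemma loc_int_vec: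
  fixes G :: "'a::euclidean_space \<Rightarrow> complex ^ 'n::finite"
  assumes [measurable]: "G \<in> borel_measurable borel" and G: "\<And>j. loc_int (\<lambda>x. G x $ j)"
  shows "loc_int G"
  unfolding loc_int_def
proof (intro conjI allI)
  fix R
  have "integrable lborel (\<lambda>x. \<Sum>j\<in>UNIV. norm (indicator (cball 0 R) x *\<^sub>R (G x $ j)))"
    using G by (intro Bochner_Integration.integrable_sum integrable_norm) (auto simp: loc_int_def)
  then show "integrable lborel (\<lambda>x. indicator (cball 0 R) x *\<^sub>R G x)"
  proof (rule Bochner_Integration.integrable_bound)
    show "AE x in lborel. norm (indicator (cball 0 R) x *\<^sub>R G x) \<le> norm (\<Sum>j\<in>UNIV. norm (indicator (cball 0 R) x *\<^sub>R (G x $ j)))" (is "AE x in _. ?P1 x")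
    proof (rule AE_I2)
      fix x
      have "norm (indicator (cball 0 R) x *\<^sub>R G x) \<le> (\<Sum>j\<in>UNIV. norm ((indicator (cball 0 R) x *\<^sub>R G x) $ j))"
        by (simp only: norm_vec_def) (rule L2_set_le_sum, simp)
      then show "?P1 x"
        by (simp add: sum_nonneg)
    qed
  qed measurable
qed fact

lemma pderiv_at_scale: "test_fun \<phi> \<Longrightarrow> pderiv_at j (\<lambda>x. c * \<phi> x) x = c * pderiv_at j \<phi> x"
  using pderiv_at_mult[of "\<lambda>_. c" x \<phi> j] pderiv_at_eqI[OF has_derivative_const[of c "at x"], of j]
  by (simp add: smooth_fun_differentiable test_fun_smooth)

lemma test_functional_linear:
  fixes u :: "real ^ 'n::finite \<Rightarrow> complex"
  assumes u: "loc_int u" and L: "L-lipschitz_on UNIV A"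
  shows "test_fun \<phi> \<Longrightarrow> test_fun \<psi> \<Longrightarrow> (LINT x|lborel. u x * mag_pderiv A (\<lambda>x. \<phi> x + \<psi> x) j x) =
      (LINT x|lborel. u x * mag_pderiv A \<phi> j x) + (LINT x|lborel. u x * mag_pderiv A \<psi> j x)"
    and "test_fun \<phi> \<Longrightarrow> (LINT x|lborel. u x * mag_pderiv A (\<lambda>x. c * \<phi> x) j x) = complex_of_real c * (LINT x|lborel. u x * mag_pderiv A \<phi> j x)"
proof -
  have i: "integrable lborel (\<lambda>x. u x * mag_pderiv A \<phi> j x)" if tt: "test_fun \<phi>" for \<phi>
  proof -
    obtain R B where "\<And>x. norm x > R \<Longrightarrow> mag_pderiv A \<phi> j x = 0" "\<And>x. norm (mag_pderiv A \<phi> j x) \<le> B"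
      using mag_pderiv_bounded_support[OF tt L] by metis
    then show ?thesis by (intro loc_int_bounded_support[OF u] mag_pderiv_measurable[OF tt lipschitz_measurable[OF L]]) auto
  qed
  {
    assume t: "test_fun \<phi>" "test_fun \<psi>"
    have "mag_pderiv A (\<lambda>x. \<phi> x + \<psi> x) j x = mag_pderiv A \<phi> j x + mag_pderiv A \<psi> j x" for x
      using t by (simp add: mag_pderiv_def pderiv_at_add smooth_fun_differentiable test_fun_smooth algebra_simps)
    then show "(LINT x|lborel. u x * mag_pderiv A (\<lambda>x. \<phi> x + \<psi> x) j x) =
      (LINT x|lborel. u x * mag_pderiv A \<phi> j x) + (LINT x|lborel. u x * mag_pderiv A \<psi> j x)"
      using i[OF t(1)] i[OF t(2)] by (simp add: distrib_left)
  }
  assume t: "test_fun \<phi>"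
  have "u x * mag_pderiv A (\<lambda>x. c * \<phi> x) j x = complex_of_real c * (u x * mag_pderiv A \<phi> j x)" for x
    using t by (simp add: mag_pderiv_def pderiv_at_scale algebra_simps)
  then show "(LINT x|lborel. u x * mag_pderiv A (\<lambda>x. c * \<phi> x) j x) = complex_of_real c * (LINT x|lborel. u x * mag_pderiv A \<phi> j x)"
    by (simp only: integral_mult_right_zero)
qed

text \<open>The functional is represented separately in its real and imaginary part; adding the term with the
  potential back turns the magnetic gradient into the ordinary weak gradient.\<close>

lemma weak_gradient_from_J_bound:
  fixes u :: "real ^ 'n::finite \<Rightarrow> complex"
  assumes um[measurable]: "u \<in> borel_measurable borel" and ufin: "L2_sq u < \<infinity>"
    and L: "L-lipschitz_on UNIV A"
    and K: "\<And>\<delta>. 0 < \<delta> \<Longrightarrow> \<delta> < 1 \<Longrightarrow> J A \<delta> u \<le> ennreal K" and K0: "K \<ge> 0"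
  shows "\<exists>G. wgrad u G \<and> L2_sq (mgrad A u G) < \<infinity>"
proof -
  have u: "loc_int u" by (rule L2_loc_int[OF um ufin])
  have Am[measurable]: "A \<in> borel_measurable borel" by (rule lipschitz_measurable[OF L])
  define C where "C = (4 * K + CARD('n) * ball_vol TYPE('n) * ln 2) / (ball_vol TYPE('n) * ln 2)"
  define \<Lambda> where "\<Lambda> = (\<lambda>j \<phi>. LINT x|lborel. u x * mag_pderiv A \<phi> j x)"
  have b: "norm (\<Lambda> j \<phi>) \<le> C * sqrt (LINT x|lborel. (\<phi> x)\<^sup>2)" if "test_fun \<phi>" for j \<phi>
    unfolding \<Lambda>_def C_def by (rule weak_bound[OF um u L K K0 that])
  have V0: "(\<lambda>_. 0) \<in> Collect (test_fun :: (real^'n \<Rightarrow> real) \<Rightarrow> bool)"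
    by (simp add: test_fun_def smooth_fun_const)
  have "\<exists>g\<in>borel_measurable lborel. integrable lborel (\<lambda>x. (g x)\<^sup>2) \<and> (\<forall>\<phi>\<in>Collect test_fun. - P (\<Lambda> j \<phi>) = (LINT x|lborel. g x * \<phi> x))"
    if P: "P = Re \<or> P = Im" for P j
  proof (rule L2_functional_representation[OF V0])
    have lin: "P (a + c) = P a + P c" "P (complex_of_real r * a) = r * P a" "\<bar>P a\<bar> \<le> norm a" for a c r
      using P by (auto simp: abs_Re_le_cmod abs_Im_le_cmod)
    fix \<phi> \<psi> :: "real^'n \<Rightarrow> real" and c :: real
    assume \<phi>: "\<phi> \<in> Collect test_fun"
    show "(\<lambda>x. c * \<phi> x) \<in> Collect test_fun" using \<phi> test_fun_scale by auto
    show "\<phi> \<in> borel_measurable lborel" using \<phi> test_fun_measurable by auto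
    show "integrable lborel (\<lambda>x. (\<phi> x)\<^sup>2)" using \<phi> test_fun_sq_integrable by auto
    show "- P (\<Lambda> j (\<lambda>x. c * \<phi> x)) = c * - P (\<Lambda> j \<phi>)"
      using \<phi> unfolding \<Lambda>_def by (simp add: test_functional_linear(2)[OF u L] lin)
    show "\<bar>- P (\<Lambda> j \<phi>)\<bar> \<le> C * sqrt (LINT x|lborel. (\<phi> x)\<^sup>2)"
      using \<phi> b[of \<phi> j] lin(3)[of "\<Lambda> j \<phi>"] by simp
    assume \<psi>: "\<psi> \<in> Collect test_fun"
    show "(\<lambda>x. \<phi> x + \<psi> x) \<in> Collect test_fun" using \<phi> \<psi> test_fun_add by auto
    show "- P (\<Lambda> j (\<lambda>x. \<phi> x + \<psi> x)) = - P (\<Lambda> j \<phi>) + - P (\<Lambda> j \<psi>)"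
      using \<phi> \<psi> unfolding \<Lambda>_def by (simp add: test_functional_linear(1)[OF u L] lin)
  qed
  then have rep: "\<forall>j. \<exists>g. g \<in> borel_measurable lborel \<and> integrable lborel (\<lambda>x. (g x)\<^sup>2) \<and> (\<forall>\<phi>. test_fun \<phi> \<longrightarrow> - P (\<Lambda> j \<phi>) = (LINT x|lborel. g x * \<phi> x))"
    if P: "P = Re \<or> P = Im" for P
    using P unfolding Bex_def Ball_def mem_Collect_eq by blast
  obtain a where a: "\<And>j. a j \<in> borel_measurable lborel" "\<And>j. integrable lborel (\<lambda>x. (a j x)\<^sup>2)" "\<And>j \<phi>. test_fun \<phi> \<Longrightarrow> - Re (\<Lambda> j \<phi>) = (LINT x|lborel. a j x * \<phi> x)"
    using choice[OF rep[of Re]] by blast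
  obtain c where c: "\<And>j. c j \<in> borel_measurable lborel" "\<And>j. integrable lborel (\<lambda>x. (c j x)\<^sup>2)" "\<And>j \<phi>. test_fun \<phi> \<Longrightarrow> - Im (\<Lambda> j \<phi>) = (LINT x|lborel. c j x * \<phi> x)"
    using choice[OF rep[of Im]] by blast
  have [measurable]: "a j \<in> borel_measurable borel" "c j \<in> borel_measurable borel" for j using a(1)[of j] c(1)[of j] by auto
  define g where "g = (\<lambda>j x. complex_of_real (a j x) + \<i> * complex_of_real (c j x))"
  have gm[measurable]: "g j \<in> borel_measurable borel" for j unfolding g_def by measurable
  have ng: "(norm (g j x))\<^sup>2 = (a j x)\<^sup>2 + (c j x)\<^sup>2" for j x by (simp add: g_def cmod_power2)
  have gfin: "L2_sq (g j) < \<infinity>" for j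
  proof -
    have "integrable lborel (\<lambda>x. (a j x)\<^sup>2 + (c j x)\<^sup>2)" using a(2) c(2) by (rule Bochner_Integration.integrable_add)
    then show ?thesis unfolding ng by (subst nn_integral_eq_integral) auto
  qed
  have gL: "\<Lambda> j \<phi> = - (LINT x|lborel. g j x * complex_of_real (\<phi> x))" if t: "test_fun \<phi>" for j \<phi>
  proof -
    have ia: "integrable lborel (\<lambda>x. a j x * \<phi> x)" and ic: "integrable lborel (\<lambda>x. c j x * \<phi> x)"
      using a c test_fun_measurable[OF t] test_fun_sq_integrable[OF t] by (auto intro!: integrable_mult_sq)
    have "(LINT x|lborel. g j x * complex_of_real (\<phi> x)) = (LINT x|lborel. complex_of_real (a j x * \<phi> x) + \<i> * complex_of_real (c j x * \<phi> x))"
      by (simp add: g_def algebra_simps)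
    also have "\<dots> = complex_of_real (LINT x|lborel. a j x * \<phi> x) + \<i> * complex_of_real (LINT x|lborel. c j x * \<phi> x)"
    proof (subst Bochner_Integration.integral_add)
      show "integrable lborel (\<lambda>x. complex_of_real (a j x * \<phi> x))" by (rule integrable_of_real[OF ia])
      show "integrable lborel (\<lambda>x. \<i> * complex_of_real (c j x * \<phi> x))" by (rule integrable_mult_right, rule integrable_of_real[OF ic])
    qed (simp only: integral_mult_right_zero integral_complex_of_real)
    also have "\<dots> = - \<Lambda> j \<phi>"
      unfolding a(3)[OF t, symmetric] c(3)[OF t, symmetric] by (simp add: complex_eq_iff)
    finally show ?thesis by simp
  qed
  define G where "G = (\<lambda>x. \<chi> j. g j x + \<i> * complex_of_real (A x $ j) * u x)"
  have mg: "mgrad A u G x = (\<chi> j. g j x)" for x by (simp add: mgrad_def G_def)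
  have Acont: "continuous_on UNIV (\<lambda>x. \<i> * complex_of_real (A x $ j))" for j
    by (intro continuous_intros lipschitz_on_continuous_on[OF L])
  have lAu: "loc_int (\<lambda>x. \<i> * complex_of_real (A x $ j) * u x)" for j
    by (rule loc_int_mult_continuous[OF u Acont])
  have lg: "loc_int (g j)" for j by (rule L2_loc_int[OF gm gfin])
  have lG: "loc_int G"
  proof (rule loc_int_vec)
    show "G \<in> borel_measurable borel" unfolding G_def
      using loc_int_measurable[OF loc_int_add[OF lg lAu]] by (rule borel_measurable_vec_lambda)
    show "loc_int (\<lambda>x. G x $ j)" for j using loc_int_add[OF lg lAu, of j j] by (simp add: G_def)
  qed
  have "wgrad u G"
    unfolding wgrad_def
  proof (intro conjI allI impI u lG)
    fix \<phi> :: "real^'n \<Rightarrow> real" and j assume t: "test_fun \<phi>"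
    note i1 = integrable_mult_test_fun[OF u test_fun_pderiv[OF t, of j]]
    note i2 = integrable_mult_test_fun[OF lAu t, of j]
    note i3 = integrable_mult_test_fun[OF lg t, of j]
    have "\<Lambda> j \<phi> = (LINT x|lborel. u x * complex_of_real (pderiv_at j \<phi> x) + \<i> * complex_of_real (A x $ j) * u x * complex_of_real (\<phi> x))"
      unfolding \<Lambda>_def mag_pderiv_def by (simp add: algebra_simps)
    also have "\<dots> = (LINT x|lborel. u x * complex_of_real (pderiv_at j \<phi> x)) + (LINT x|lborel. \<i> * complex_of_real (A x $ j) * u x * complex_of_real (\<phi> x))"
      by (rule Bochner_Integration.integral_add[OF i1 i2])
    finally have "(LINT x|lborel. u x * complex_of_real (pderiv_at j \<phi> x)) = - ((LINT x|lborel. g j x * complex_of_real (\<phi> x)) + (LINT x|lborel. \<i> * complex_of_real (A x $ j) * u x * complex_of_real (\<phi> x)))"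
      unfolding gL[OF t] by (simp add: algebra_simps)
    also have "(LINT x|lborel. g j x * complex_of_real (\<phi> x)) + (LINT x|lborel. \<i> * complex_of_real (A x $ j) * u x * complex_of_real (\<phi> x))
      = (LINT x|lborel. g j x * complex_of_real (\<phi> x) + \<i> * complex_of_real (A x $ j) * u x * complex_of_real (\<phi> x))"
      by (rule Bochner_Integration.integral_add[symmetric, OF i3 i2])
    also have "\<dots> = (LINT x|lborel. G x $ j * complex_of_real (\<phi> x))"
      by (simp add: G_def distrib_right)
    finally show "(LINT x|lborel. u x * complex_of_real (pderiv_at j \<phi> x)) = - (LINT x|lborel. G x $ j * complex_of_real (\<phi> x))" .
  qed
  moreover have "L2_sq (mgrad A u G) < \<infinity>"
  proof -
    have "L2_sq (mgrad A u G) = (\<integral>\<^sup>+x. (\<Sum>j\<in>UNIV. ennreal ((norm (g j x))\<^sup>2)) \<partial>lborel)"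
      unfolding mg by (intro nn_integral_cong) (simp add: norm_vec_def L2_set_def sum_nonneg sum_ennreal)
    also have "\<dots> = (\<Sum>j\<in>UNIV. \<integral>\<^sup>+x. ennreal ((norm (g j x))\<^sup>2) \<partial>lborel)"
      by (rule nn_integral_sum) measurable
    also have "\<dots> < \<infinity>" using gfin by simp
    finally show ?thesis .
  qed
  ultimately show ?thesis by blast
qed

section \<open>Differentiability of Lipschitz functions\<close>

text \<open>A compactly supported Lipschitz function has increments that exceed \<open>\<delta>\<close> only for steps longer
  than a multiple of \<open>\<delta>\<close>, and then only on a set of bounded measure; hence the functionals with zero
  potential stay bounded, and the converse half of the characterization, which has just been
  established, provides a weak gradient.\<close>

lemma lipschitz_compact_support_wgrad:
  fixes f :: "real ^ 'n::finite \<Rightarrow> real"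
  assumes L: "L-lipschitz_on UNIV f" and R: "R \<ge> 0" "\<And>x. norm x > R \<Longrightarrow> f x = 0"
  shows "\<exists>G. wgrad (\<lambda>x. complex_of_real (f x)) G"
proof -
  let ?u = "\<lambda>x. complex_of_real (f x)" and ?A = "\<lambda>_. 0 :: real^'n" and ?N = "CARD('n)"
  \<comment> \<open>enlarging the constant keeps \<open>\<delta> / M\<close> meaningful for constant functions\<close>
  define M where "M = L + 1"
  have M: "M > 0" using lipschitz_on_nonneg[OF L] by (simp add: M_def)
  have inc: "\<bar>f x - f y\<bar> \<le> M * norm (x - y)" for x y
    using lipschitz_onD[OF L, of x y] by (simp add: M_def dist_norm distrib_right add_increasing2)
  have fc: "continuous_on UNIV f" by (rule lipschitz_on_continuous_on[OF L])
  have [measurable]: "f \<in> borel_measurable borel" by (rule borel_measurable_continuous_onI[OF fc])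
  have um: "?u \<in> borel_measurable borel" by measurable
  have "bounded (f ` cball 0 R)"
    by (intro compact_imp_bounded compact_continuous_image continuous_on_subset[OF fc]) auto
  then obtain b where b: "\<And>x. norm x \<le> R \<Longrightarrow> \<bar>f x\<bar> \<le> b" unfolding bounded_iff by (force simp: dist_norm)
  define V where "V = measure lborel (cball 0 R :: (real^'n) set)"
  have V: "emeasure lborel (cball c R) = ennreal V" for c :: "real^'n"
    unfolding V_def using R(1) by (simp add: emeasure_cball content_cball)
  have "L2_sq ?u \<le> (\<integral>\<^sup>+x. ennreal (b\<^sup>2) * indicator (cball 0 R) (x::real^'n) \<partial>lborel)"
  proof (rule nn_integral_mono)
    fix x :: "real^'n"
    show "ennreal ((norm (?u x))\<^sup>2) \<le> ennreal (b\<^sup>2) * indicator (cball 0 R) x"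
    proof (cases "norm x \<le> R")
      case True
      then show ?thesis using power_mono[OF b[OF True], of 2] by (auto intro: ennreal_leI)
    qed (use R(2) in simp)
  qed
  also have "\<dots> = ennreal (b\<^sup>2) * ennreal V" by (subst nn_integral_cmult_indicator) (auto simp: V)
  finally have ufin: "L2_sq ?u < \<infinity>"
    by (rule le_less_trans) (simp add: ennreal_mult_less_top)
  have "J ?A \<delta> ?u \<le> ennreal (V * (?N * ball_vol TYPE('n) * M\<^sup>2))" if \<delta>: "\<delta> > 0" for \<delta>
  proof -
    have sl: "superlevel ?A ?u \<delta> h \<le> indicator {h. norm h > \<delta> / M} h * ennreal (2 * V)" for h
    proof (cases "norm h > \<delta> / M")
      case True
      have "{x. \<delta> < norm (mdiff ?A ?u h x)} \<subseteq> cball 0 R \<union> cball (- h) R"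
      proof (rule subsetI, rule ccontr)
        fix x assume x: "x \<in> {x. \<delta> < norm (mdiff ?A ?u h x)}" "x \<notin> cball 0 R \<union> cball (- h) R"
        then have "norm x > R" "norm (x + h) > R" by (auto simp: dist_norm norm_minus_commute add.commute)
        then show False using x(1) \<delta> R(2) by (simp add: mdiff_def)
      qed
      then have "superlevel ?A ?u \<delta> h \<le> emeasure lborel (cball 0 R \<union> cball (- h) R)"
        unfolding superlevel_def by (rule emeasure_mono) simp
      also have "\<dots> \<le> emeasure lborel (cball 0 R :: (real^'n) set) + emeasure lborel (cball (- h) R)"
        by (rule emeasure_subadditive) auto
      also have "\<dots> = ennreal (2 * V)" by (simp add: V V_def ennreal_plus[symmetric] del: ennreal_plus)
      finally show ?thesis using True by simp
    next
      case False
      have "M * norm h \<le> \<delta>" using False M by (simp add: field_simps)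
      then have "\<not> \<delta> < norm (mdiff ?A ?u h x)" for x
        using inc[of "x + h" x] by (simp add: mdiff_def of_real_diff[symmetric] del: of_real_diff)
      then show ?thesis by (simp add: superlevel_def)
    qed
    have "J ?A \<delta> ?u \<le> (\<integral>\<^sup>+h. ennreal (2 * V * \<delta>\<^sup>2) * (indicator {h. norm h > \<delta> / M} h * ennreal (1 / norm h ^ (?N + 2))) \<partial>(lborel :: (real^'n) measure))"
      unfolding J_eq_superlevel[OF um borel_measurable_const]
    proof (rule nn_integral_mono)
      fix h :: "real^'n"
      have "ennreal (\<delta>\<^sup>2 / norm h ^ (?N + 2)) * superlevel ?A ?u \<delta> h \<le> ennreal (\<delta>\<^sup>2 / norm h ^ (?N + 2)) * (indicator {h. norm h > \<delta> / M} h * ennreal (2 * V))"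
        by (rule mult_left_mono[OF sl]) simp
      also have "\<dots> = ennreal (2 * V * \<delta>\<^sup>2) * (indicator {h. norm h > \<delta> / M} h * ennreal (1 / norm h ^ (?N + 2)))"
        by (auto simp: indicator_def V_def ennreal_mult''[symmetric] mult_ac)
      finally show "ennreal (\<delta>\<^sup>2 / norm h ^ (?N + 2)) * superlevel ?A ?u \<delta> h \<le> \<dots>" .
    qed
    also have "\<dots> = ennreal (2 * V * \<delta>\<^sup>2) * ennreal (?N * ball_vol TYPE('n) / (2 * (\<delta> / M)\<^sup>2))"
    proof (subst nn_integral_cmult)
      have "(\<lambda>h::real^'n. (if norm h > \<delta> / M then 1 else 0) * ennreal (1 / norm h ^ (?N + 2))) \<in> borel_measurable lborel" by measurable
      then show "(\<lambda>h::real^'n. indicator {h. norm h > \<delta> / M} h * ennreal (1 / norm h ^ (?N + 2))) \<in> borel_measurable lborel"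
        by (simp add: indicator_def of_bool_def)
    qed (use nn_integral_norm_tail[of "\<delta> / M" 2, where 'n='n] \<delta> M in simp)
    also have "\<dots> = ennreal (2 * V * \<delta>\<^sup>2 * (?N * ball_vol TYPE('n) / (2 * (\<delta> / M)\<^sup>2)))"
      using ball_vol_pos[where 'n='n] by (intro ennreal_mult[symmetric]) (auto simp: V_def)
    also have "2 * V * \<delta>\<^sup>2 * (?N * ball_vol TYPE('n) / (2 * (\<delta> / M)\<^sup>2)) = V * (?N * ball_vol TYPE('n) * M\<^sup>2)"
      using \<delta> M by (simp add: field_simps)
    finally show ?thesis .
  qed
  moreover have "0-lipschitz_on UNIV ?A" by (simp add: lipschitz_on_def)
  moreover have "V * (?N * ball_vol TYPE('n) * M\<^sup>2) \<ge> 0" using ball_vol_pos[where 'n='n] by (simp add: V_def)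
  ultimately show ?thesis using weak_gradient_from_J_bound[OF um ufin] by blast
qed

text \<open>Clamping between \<open>\<plusminus>c\<close>, where \<open>c\<close> is a cone steeper than \<open>f\<close>, produces a compactly supported
  Lipschitz function without changing \<open>f\<close> on the given ball.\<close>

lemma lipschitz_local_wgrad:
  fixes f :: "real ^ 'n::finite \<Rightarrow> real"
  assumes L: "L-lipschitz_on UNIV f"
  shows "\<exists>g G M. wgrad (\<lambda>x. complex_of_real (g x)) G \<and> M-lipschitz_on UNIV g \<and> (\<forall>x. norm x \<le> R \<longrightarrow> g x = f x)"
proof -
  have L0: "L \<ge> 0" by (rule lipschitz_on_nonneg[OF L])
  have inc: "\<bar>f x - f y\<bar> \<le> L * norm (x - y)" for x y using lipschitz_onD[OF L, of x y] by (simp add: dist_norm)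
  \<comment> \<open>the height at which the cone with slope \<open>L + 1\<close> still dominates \<open>f\<close> at distance \<open>\<bar>R\<bar>\<close>\<close>
  define b where "b = \<bar>f 0\<bar> + (2 * L + 1) * \<bar>R\<bar>"
  define c where "c = (\<lambda>x::real^'n. max 0 (b - (L + 1) * norm x))"
  define g where "g = (\<lambda>x. max (- c x) (min (c x) (f x)))"
  have b0: "b \<ge> 0" using L0 by (simp add: b_def)
  have cinc: "\<bar>c x - c y\<bar> \<le> (L + 1) * norm (x - y)" for x y
  proof -
    have "\<bar>c x - c y\<bar> \<le> \<bar>(L + 1) * norm x - (L + 1) * norm y\<bar>" unfolding c_def by linarith
    also have "\<dots> = (L + 1) * \<bar>norm x - norm y\<bar>" using L0 by (simp add: right_diff_distrib[symmetric] abs_mult del: right_diff_distrib)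
    also have "\<dots> \<le> (L + 1) * norm (x - y)" using L0 by (intro mult_left_mono norm_triangle_ineq3) simp
    finally show ?thesis .
  qed
  have gL: "(L + 1)-lipschitz_on UNIV g"
  proof (rule lipschitz_onI)
    fix x y :: "real^'n"
    have "\<bar>f x - f y\<bar> \<le> (L + 1) * norm (x - y)" using inc[of x y] by (simp add: distrib_right add_increasing2)
    with cinc[of x y] have "\<bar>g x - g y\<bar> \<le> (L + 1) * norm (x - y)" unfolding g_def by linarith
    then show "dist (g x) (g y) \<le> (L + 1) * dist x y" by (simp add: dist_norm)
  qed (use L0 in simp)
  have "g x = 0" if "norm x > b / (L + 1)" for x
    using that L0 by (simp add: g_def c_def field_simps)
  then obtain G where "wgrad (\<lambda>x. complex_of_real (g x)) G"
    using lipschitz_compact_support_wgrad[OF gL, of "b / (L + 1)"] L0 b0 by auto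
  moreover have "g x = f x" if x: "norm x \<le> R" for x
  proof -
    have "\<bar>f x\<bar> \<le> \<bar>f 0\<bar> + L * norm x" using inc[of x 0] by simp
    also have "L * norm x \<le> L * R" using x L0 by (rule mult_left_mono)
    finally have "\<bar>f x\<bar> \<le> \<bar>f 0\<bar> + L * R" by simp
    moreover have "(L + 1) * norm x \<le> (L + 1) * R" using x L0 by (intro mult_left_mono) auto
    moreover have "R \<ge> 0" using x norm_ge_zero order_trans by blast
    ultimately have "\<bar>f x\<bar> \<le> c x" by (simp add: c_def b_def algebra_simps)
    then show ?thesis by (simp add: g_def)
  qed
  ultimately show ?thesis using gL by blast
qed

text \<open>By Fubini, a property holds almost everywhere as soon as it holds almost everywhere on almost every
  line in one direction, and conversely.\<close>

lemma AE_lines_iff: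
  fixes h :: "'a::euclidean_space" and P :: "'a \<Rightarrow> bool"
  assumes [measurable]: "Measurable.pred borel P"
  shows "(AE x in lborel. AE s in lborel. s \<in> {0<..<1::real} \<longrightarrow> P (x + s *\<^sub>R h)) \<longleftrightarrow> (AE x in lborel. P x)"
proof -
  have "(AE x in lborel. AE s in lborel. s \<in> {0<..<1::real} \<longrightarrow> P (x + s *\<^sub>R h)) \<longleftrightarrow>
    (AE s in lborel. AE x in lborel. s \<in> {0<..<1::real} \<longrightarrow> P (x + s *\<^sub>R h))"
  proof (rule lborel_pair.AE_commute)
    have "Measurable.pred (lborel \<Otimes>\<^sub>M lborel) (\<lambda>p::'a \<times> real. snd p \<in> {0<..<1} \<longrightarrow> P (fst p + snd p *\<^sub>R h))"
      by measurable
    then show "{p \<in> space (lborel \<Otimes>\<^sub>M lborel). snd p \<in> {0<..<1::real} \<longrightarrow> P (fst p + snd p *\<^sub>R h)} \<in> sets (lborel \<Otimes>\<^sub>M (lborel::real measure))"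
      unfolding pred_def .
  qed
  also have "\<dots> \<longleftrightarrow> (AE x in lborel. P x)"
  proof
    assume "AE x in lborel. P x"
    then have "AE x in lborel. P (x + s *\<^sub>R h)" for s
      using AE_lborel_translate[of P "s *\<^sub>R h"] by (simp add: add.commute)
    then show "AE s in lborel. AE x in lborel. s \<in> {0<..<1::real} \<longrightarrow> P (x + s *\<^sub>R h)"
      by simp
  next
    assume a: "AE s in lborel. AE x in lborel. s \<in> {0<..<1::real} \<longrightarrow> P (x + s *\<^sub>R h)"
    have "\<exists>s\<in>{0<..<1::real}. AE x in lborel. P (x + s *\<^sub>R h)"
    proof (rule ccontr)
      assume c: "\<not> ?thesis"
      have "AE s in lborel. s \<notin> {0<..<1::real}"
        using a by (rule eventually_mono) (use c in auto)
      then have "emeasure lborel {0<..<1::real} = 0"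
        by (subst (asm) AE_iff_null_sets[symmetric]) auto
      then show False by simp
    qed
    then obtain s where "AE x in lborel. P (x + s *\<^sub>R h)" by blast
    from AE_lborel_translate[OF this, of "- (s *\<^sub>R h)"] show "AE x in lborel. P x" by simp
  qed
  finally show ?thesis .
qed

lemma AE_lborel_open_nonempty:
  fixes S :: "'a::euclidean_space set"
  assumes "open S" "AE x in lborel. x \<notin> S"
  shows "S = {}"
proof -
  have "S \<in> null_sets lborel" using assms by (subst AE_iff_null_sets) auto
  then have "negligible S" by (simp add: negligible_iff_null_sets null_sets_completionI)
  then show ?thesis using open_not_negligible[OF assms(1)] by blast
qed

text \<open>The formula for segments holds for countably many lengths at once; both sides are continuous in the
  length, which yields all lengths outside a single null set.\<close>

lemma line_integral_formula:
  fixes f :: "real ^ 'n::finite \<Rightarrow> real"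
  assumes w: "wgrad (\<lambda>x. complex_of_real (f x)) G" and fc: "continuous_on UNIV f"
  shows "AE x in lborel. (\<lambda>s. Re (cdot h (G (x + s *\<^sub>R h)))) absolutely_integrable_on {0..1} \<and>
    (\<forall>r\<in>{0..1}. f (x + r *\<^sub>R h) - f x = integral {0..r} (\<lambda>s. Re (cdot h (G (x + s *\<^sub>R h)))))"
proof -
  have "AE x in lborel. \<forall>q\<in>\<rat> \<inter> {0<..<1}. f (x + q *\<^sub>R h) - f x = 
      Re (LINT t|lborel. indicator {0..1} t *\<^sub>R cdot (q *\<^sub>R h) (G (x + (t * q) *\<^sub>R h)))"
  proof (rule AE_ball_countable')
    show "countable (\<rat> \<inter> {0<..<1::real})" by (intro countable_Int1 countable_rat)
    fix q :: real
    show "AE x in lborel. f (x + q *\<^sub>R h) - f x = Re (LINT t|lborel. indicator {0..1} t *\<^sub>R cdot (q *\<^sub>R h) (G (x + (t * q) *\<^sub>R h)))"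
      using segment_formula[OF w, of "q *\<^sub>R h"]
    proof (rule eventually_mono, goal_cases)
      case (1 x)
      from 1[rule_format, of 0] show ?case by (simp add: of_real_diff[symmetric] del: of_real_diff) (metis Re_complex_of_real)
    qed
  qed
  with segment_formula[OF w, of h] show ?thesis
  proof eventually_elim
    case (elim x)
    let ?g = "\<lambda>s. Re (cdot h (G (x + s *\<^sub>R h)))"
    have i: "integrable lborel (\<lambda>t. indicator {0..1} t *\<^sub>R cdot h (G (x + t *\<^sub>R h)))"
      using elim(1)[rule_format, of 0] by simp
    from integrable_Re[OF i] have ig: "set_integrable lborel {0..1} ?g" by (simp add: set_integrable_def)
    then have ag: "?g absolutely_integrable_on {0..1}" unfolding set_integrable_def by (rule integrable_completion[THEN iffD2, rotated]) (use ig in \<open>auto simp: set_integrable_def dest: borel_measurable_integrable\<close>)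
    have rat: "f (x + q *\<^sub>R h) - f x = integral {0..q} ?g" if q: "q \<in> \<rat> \<inter> {0<..<1}" for q
    proof -
      have q0: "0 < q" "q < 1" using q by auto
      have iq: "set_integrable lborel {0..q} ?g" by (rule set_integrable_subset[OF ig]) (use q0 in auto)
      have iqc: "integrable lborel (\<lambda>t. indicator {0..q} t *\<^sub>R cdot h (G (x + t *\<^sub>R h)))"
      proof -
        have "set_integrable lborel {0..q} (\<lambda>t. cdot h (G (x + t *\<^sub>R h)))"
          by (rule set_integrable_subset[of _ "{0..1}"]) (use i q0 in \<open>auto simp: set_integrable_def\<close>)
        then show ?thesis by (simp add: set_integrable_def)
      qed
      have "(LINT t|lborel. indicator {0..1} t *\<^sub>R cdot (q *\<^sub>R h) (G (x + (t * q) *\<^sub>R h)))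
        = q *\<^sub>R (LINT t|lborel. indicator {0..q} (0 + q * t) *\<^sub>R cdot h (G (x + (0 + q * t) *\<^sub>R h)))"
        unfolding integral_scaleR_right[symmetric]
        using q0 by (intro Bochner_Integration.integral_cong)
          (auto simp: indicator_def cdot_scaleR mult.commute[of _ q] scaleR_conv_of_real[where 'a=complex] mult_le_cancel_left1 zero_le_mult_iff)
      also have "\<dots> = (LINT t|lborel. indicator {0..q} t *\<^sub>R cdot h (G (x + t *\<^sub>R h)))"
        using lborel_integral_real_affine[of q "\<lambda>t. indicator {0..q} t *\<^sub>R cdot h (G (x + t *\<^sub>R h))" 0] q0 by simp
      finally have "f (x + q *\<^sub>R h) - f x = Re (LINT t|lborel. indicator {0..q} t *\<^sub>R cdot h (G (x + t *\<^sub>R h)))"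
        using elim(2) q by simp
      also have "\<dots> = (LINT t|lborel. indicator {0..q} t *\<^sub>R ?g t)" by (subst integral_Re[OF iqc, symmetric]) simp
      also have "\<dots> = integral {0..q} ?g"
        using set_borel_integral_eq_integral(2)[OF iq] by (simp add: set_lebesgue_integral_def)
      finally show ?thesis .
    qed
    have gi: "?g integrable_on {0..1}" by (rule set_borel_integral_eq_integral(1)[OF ig])
    have cl: "closure (\<rat> \<inter> {0<..<1::real}) = {0..1}"
      using closure_open_Int_superset[of "{0<..<1::real}" \<rat>] by (simp add: Rats_closure_real Int_commute)
    have c: "continuous_on {0..1} (\<lambda>r. f (x + r *\<^sub>R h) - f x - integral {0..r} ?g)"
      by (intro continuous_intros continuous_on_compose2[OF fc] indefinite_integral_continuous_1[OF gi]) auto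
    have "f (x + r *\<^sub>R h) - f x - integral {0..r} ?g = 0" if r: "r \<in> {0..1}" for r
      by (rule continuous_constant_on_closure[of "\<rat> \<inter> {0<..<1}"]) (use c cl rat r in auto)
    with ag show ?case by auto
  qed
qed

text \<open>The differences are quantified over rational step lengths so that the set of points with a
  directional derivative is Borel.\<close>

definition dir_deriv :: "('a::real_normed_vector \<Rightarrow> real) \<Rightarrow> 'a \<Rightarrow> real \<Rightarrow> 'a \<Rightarrow> bool" where
  "dir_deriv f h c y \<longleftrightarrow> (\<forall>n::nat. \<exists>m::nat. \<forall>q::rat. 0 < real_of_rat q \<and> real_of_rat q < 1 / (real m + 1) \<longrightarrow>
     \<bar>f (y + real_of_rat q *\<^sub>R h) - f y - real_of_rat q * c\<bar> \<le> real_of_rat q / (real n + 1))"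

text \<open>On almost every line \<open>f\<close> is the primitive of an integrable function, so Lebesgue's
  differentiation theorem on the line applies; Fubini turns this into a statement about almost every
  point of the space.\<close>

lemma AE_dir_deriv:
  fixes f :: "real ^ 'n::finite \<Rightarrow> real"
  assumes w: "wgrad (\<lambda>x. complex_of_real (f x)) G" and fc: "continuous_on UNIV f"
  shows "AE x in lborel. dir_deriv f h (Re (cdot h (G x))) x"
proof -
  have [measurable]: "f \<in> borel_measurable borel" by (rule borel_measurable_continuous_onI[OF fc])
  have "loc_int G" using w by (simp add: wgrad_def)
  note [measurable] = loc_int_measurable[OF this]
  have "Measurable.pred borel (\<lambda>x. dir_deriv f h (Re (cdot h (G x))) x)"
    unfolding dir_deriv_def by measurable
  note iff = AE_lines_iff[OF this, of h, symmetric]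
  show ?thesis
    unfolding iff using line_integral_formula[OF w fc, of h]
  proof (rule eventually_mono)
    fix x
    let ?g = "\<lambda>s. Re (cdot h (G (x + s *\<^sub>R h)))"
    assume a: "?g absolutely_integrable_on {0..1} \<and> (\<forall>r\<in>{0..1}. f (x + r *\<^sub>R h) - f x = integral {0..r} ?g)"
    define g0 where "g0 = (\<lambda>s. if s \<in> {0..1} then ?g s else 0)"
    have "g0 absolutely_integrable_on UNIV" using a unfolding g0_def by (subst absolutely_integrable_restrict_UNIV) auto
    then have "g0 integrable_on UNIV" by (rule set_lebesgue_integral_eq_integral(1))
    then have "g0 integrable_on cbox s t" for s t by (rule integrable_on_subcbox) simp
    then obtain N where N: "negligible N" 
      and leb: "\<And>t e. t \<notin> N \<Longrightarrow> 0 < e \<Longrightarrow> \<exists>d>0. \<forall>r. 0 < r \<and> r < d \<longrightarrow> norm (integral (cbox t (t + r *\<^sub>R One)) g0 /\<^sub>R r ^ DIM(real) - g0 t) < e"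
      using integrable_ccontinuous_explicit[of g0] by blast
    have gi: "?g integrable_on {0..1}" using a set_lebesgue_integral_eq_integral(1) by blast
    have "dir_deriv f h (?g t) (x + t *\<^sub>R h)" if t: "t \<in> {0<..<1}" "t \<notin> N" for t
      unfolding dir_deriv_def
    proof
      fix n :: nat
      obtain d where d: "d > 0" "\<And>r. 0 < r \<Longrightarrow> r < d \<Longrightarrow> norm (integral (cbox t (t + r *\<^sub>R One)) g0 /\<^sub>R r ^ DIM(real) - g0 t) < 1 / (real n + 1)"
        using leb[OF t(2), of "1 / (real n + 1)"] by auto
      define d' where "d' = min d (1 - t)"
      have "d' > 0" using d t by (simp add: d'_def)
      then obtain m where m: "1 / (real m + 1) < d'"
        using reals_Archimedean[of d'] by (auto simp: inverse_eq_divide add.commute)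
      have "\<bar>f (x + t *\<^sub>R h + r *\<^sub>R h) - f (x + t *\<^sub>R h) - r * ?g t\<bar> \<le> r / (real n + 1)" if r: "0 < r" "r < 1 / (real m + 1)" for r
      proof -
        have r': "r < d" "r < 1 - t" using r m by (auto simp: d'_def)
        have "f (x + t *\<^sub>R h + r *\<^sub>R h) - f (x + t *\<^sub>R h) = (f (x + (t + r) *\<^sub>R h) - f x) - (f (x + t *\<^sub>R h) - f x)"
          by (simp add: scaleR_add_left add.assoc)
        also have "\<dots> = integral {0..t+r} ?g - integral {0..t} ?g"
          using a t r r' by simp
        also have "\<dots> = integral {t..t+r} ?g"
        proof -
          have "?g integrable_on {0..t+r}" by (rule integrable_on_subinterval[OF gi]) (use r' in auto)
          from Henstock_Kurzweil_Integration.integral_combine[OF _ _ this, of t] show ?thesis using t r by simp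
        qed
        also have "\<dots> = integral {t..t+r} g0"
          by (rule integral_cong) (use t r r' in \<open>auto simp: g0_def\<close>)
        finally have e: "f (x + t *\<^sub>R h + r *\<^sub>R h) - f (x + t *\<^sub>R h) = integral {t..t+r} g0" .
        have "\<bar>integral {t..t+r} g0 / r - ?g t\<bar> < 1 / (real n + 1)"
          using d(2)[OF r(1) r'(1)] t by (simp add: g0_def divide_inverse mult.commute)
        then have "r * \<bar>integral {t..t+r} g0 / r - ?g t\<bar> \<le> r * (1 / (real n + 1))" using r by (intro mult_left_mono) auto
        moreover have "r * \<bar>integral {t..t+r} g0 / r - ?g t\<bar> = \<bar>integral {t..t+r} g0 - r * ?g t\<bar>"
          using r abs_mult[of r "integral {t..t+r} g0 / r - ?g t"] by (simp add: right_diff_distrib)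
        ultimately show ?thesis unfolding e by simp
      qed
      then show "\<exists>m::nat. \<forall>q::rat. 0 < real_of_rat q \<and> real_of_rat q < 1 / (real m + 1) \<longrightarrow>
        \<bar>f (x + t *\<^sub>R h + real_of_rat q *\<^sub>R h) - f (x + t *\<^sub>R h) - real_of_rat q * ?g t\<bar> \<le> real_of_rat q / (real n + 1)"
        by blast
    qed
    moreover have "AE t in lebesgue. t \<notin> N"
      using N by (subst AE_iff_null_sets[symmetric]) (auto simp: negligible_iff_null_sets)
    then have "AE t in lborel. t \<notin> N" by (simp add: AE_completion_iff)
    ultimately show "AE t in lborel. t \<in> {0<..<1} \<longrightarrow> dir_deriv f h (Re (cdot h (G (x + t *\<^sub>R h)))) (x + t *\<^sub>R h)"
      by (auto elim!: eventually_mono)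
  qed
qed

text \<open>Rademacher's theorem. For a Lipschitz function, derivatives that depend linearly on the
  direction in a dense set of directions give total differentiability, because finitely many of
  these directions approximate the unit sphere.\<close>

lemma rademacher:
  fixes f :: "real ^ 'n::finite \<Rightarrow> real"
  assumes w: "wgrad (\<lambda>x. complex_of_real (f x)) G" and L: "L-lipschitz_on UNIV f"
  shows "AE x in lborel. (f has_derivative (\<lambda>h. Re (cdot h (G x)))) (at x)"
proof -
  have fc: "continuous_on UNIV f" by (rule lipschitz_on_continuous_on[OF L])
  have L0: "L \<ge> 0" by (rule lipschitz_on_nonneg[OF L])
  obtain D :: "(real^'n) set" where D: "countable D" "\<And>X. open X \<Longrightarrow> X \<noteq> {} \<Longrightarrow> \<exists>d\<in>D. d \<in> X"
    using countable_dense_setE by blast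
  have "AE x in lborel. \<forall>h\<in>D. dir_deriv f h (Re (cdot h (G x))) x"
    by (rule AE_ball_countable'[OF AE_dir_deriv[OF w fc] D(1)])
  then show ?thesis
  proof (rule eventually_mono)
    fix x assume dd: "\<forall>h\<in>D. dir_deriv f h (Re (cdot h (G x))) x"
    define l where "l = (\<lambda>h. Re (cdot h (G x)))"
    define K where "K = norm (G x)"
    have lK: "\<bar>l h\<bar> \<le> K * norm h" for h
      using abs_Re_le_cmod[of "cdot h (G x)"] norm_cdot_le[of h "G x"] by (simp add: l_def K_def mult.commute)
    have ladd: "l (a + b) = l a + l b" for a b by (simp add: l_def cdot_def sum.distrib algebra_simps)
    have lsc: "l (r *\<^sub>R a) = r * l a" for r a by (simp add: l_def cdot_scaleR)
    have bl: "bounded_linear l"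
      by (rule bounded_linear_intro[where K=K]) (use ladd lsc lK in \<open>auto simp: mult.commute\<close>)
    have "\<exists>d>0. \<forall>y. norm (y - x) < d \<longrightarrow> norm (f y - f x - l (y - x)) \<le> e * norm (y - x)" if e: "e > 0" for e
    proof -
      \<comment> \<open>replacing \<open>y - x\<close> by \<open>q p\<close> with a rational \<open>q\<close> costs at most \<open>3 \<eta> (L + K) norm (y - x)\<close>\<close>
      define \<eta> where "\<eta> = min (1/2) (e / (6 * (L + K + 1)))"
      have LK: "L + K + 1 > 0" using L0 by (simp add: K_def add_nonneg_pos)
      have \<eta>: "0 < \<eta>" "\<eta> \<le> 1/2" unfolding \<eta>_def by (use e LK in simp, rule min.cobounded1)
      have \<eta>e: "(L + K) * (3 * \<eta>) \<le> e / 2"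
      proof -
        have "(L + K) * (3 * \<eta>) \<le> (L + K + 1) * (3 * (e / (6 * (L + K + 1))))"
          using L0 LK \<eta> by (intro mult_mono) (auto simp: \<eta>_def K_def)
        also have "\<dots> = e / 2" using LK by (simp add: field_simps)
        finally show ?thesis .
      qed
      have "sphere 0 1 \<subseteq> (\<Union>p\<in>D. ball p \<eta>)"
      proof
        fix v :: "real^'n"
        obtain p where "p \<in> D" "p \<in> ball v \<eta>" using D(2)[of "ball v \<eta>"] \<eta> by auto
        then show "v \<in> (\<Union>p\<in>D. ball p \<eta>)" by (auto simp: dist_commute)
      qed
      then obtain D0 where D0: "D0 \<subseteq> D" "finite D0" "sphere 0 1 \<subseteq> (\<Union>p\<in>D0. ball p \<eta>)"
        using compactE_image[OF compact_sphere, of D "\<lambda>p. ball p \<eta>" 0 1] by auto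
      obtain n :: nat where n: "1 / (real n + 1) < e / 2"
        using reals_Archimedean[of "e/2"] e by (auto simp: inverse_eq_divide add.commute)
      have "\<forall>p\<in>D0. \<exists>m::nat. \<forall>q::rat. 0 < real_of_rat q \<and> real_of_rat q < 1 / (real m + 1) \<longrightarrow>
          \<bar>f (x + real_of_rat q *\<^sub>R p) - f x - real_of_rat q * l p\<bar> \<le> real_of_rat q / (real n + 1)"
        using dd D0(1) unfolding dir_deriv_def l_def by blast
      then obtain m :: "real^'n \<Rightarrow> nat" where m: "\<And>p q. p \<in> D0 \<Longrightarrow> 0 < real_of_rat q \<Longrightarrow> real_of_rat q < 1 / (real (m p) + 1) \<Longrightarrow>
          \<bar>f (x + real_of_rat q *\<^sub>R p) - f x - real_of_rat q * l p\<bar> \<le> real_of_rat q / (real n + 1)"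
        unfolding bchoice_iff by blast
      define d where "d = Min ((\<lambda>p. 1 / (real (m p) + 1)) ` D0 \<union> {1})"
      have d0: "d > 0" and dm: "\<And>p. p \<in> D0 \<Longrightarrow> d \<le> 1 / (real (m p) + 1)"
        using D0(2) by (auto simp: d_def)
      have "norm (f y - f x - l (y - x)) \<le> e * norm (y - x)" if y: "norm (y - x) < d" for y
      proof (cases "y = x")
        case True
        then show ?thesis using lsc[of 0 0] by simp
      next
        case False
        define \<rho> where "\<rho> = norm (y - x)"
        have \<rho>: "\<rho> > 0" using False by (simp add: \<rho>_def)
        define v where "v = (y - x) /\<^sub>R \<rho>"
        have yv: "y - x = \<rho> *\<^sub>R v" and nv: "norm v = 1" using \<rho> by (auto simp: v_def \<rho>_def)
        obtain p where p: "p \<in> D0" "norm (v - p) < \<eta>" using D0(3) nv by (force simp: dist_norm norm_minus_commute)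
        have "(1 - \<eta>) * \<rho> < \<rho>" using \<eta> \<rho> by (simp add: algebra_simps)
        then obtain q where q: "(1 - \<eta>) * \<rho> < real_of_rat q" "real_of_rat q < \<rho>" using of_rat_dense by blast
        let ?r = "real_of_rat q"
        have "0 \<le> (1 - \<eta>) * \<rho>" using \<eta> \<rho> by simp
        then have r0: "?r > 0" using q(1) by linarith
        have "norm p \<le> 2" using norm_triangle_ineq2[of p v] p(2) nv \<eta> by (simp add: norm_minus_commute)
        have dist: "norm (y - x - ?r *\<^sub>R p) \<le> 3 * \<eta> * \<rho>"
        proof -
          have "y - x - ?r *\<^sub>R p = \<rho> *\<^sub>R (v - p) + (\<rho> - ?r) *\<^sub>R p" by (simp add: yv algebra_simps)
          then have "norm (y - x - ?r *\<^sub>R p) \<le> \<rho> * norm (v - p) + (\<rho> - ?r) * norm p"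
            using norm_triangle_ineq[of "\<rho> *\<^sub>R (v - p)" "(\<rho> - ?r) *\<^sub>R p"] \<rho> q(2) by simp
          also have "\<dots> \<le> \<rho> * \<eta> + (\<eta> * \<rho>) * 2"
            using \<open>norm p \<le> 2\<close> p(2) \<rho> q \<eta> by (intro add_mono mult_mono) (auto simp: algebra_simps)
          finally show ?thesis by simp
        qed
        have "f y - f x - l (y - x) = (f (x + ?r *\<^sub>R p) - f x - ?r * l p) + (f y - f (x + ?r *\<^sub>R p)) - l (y - x - ?r *\<^sub>R p)"
          using ladd[of "y - x - ?r *\<^sub>R p" "?r *\<^sub>R p"] by (simp add: lsc)
        then have "norm (f y - f x - l (y - x)) \<le> \<bar>f (x + ?r *\<^sub>R p) - f x - ?r * l p\<bar> + \<bar>f y - f (x + ?r *\<^sub>R p)\<bar> + \<bar>l (y - x - ?r *\<^sub>R p)\<bar>"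
          by simp
        also have "\<bar>f (x + ?r *\<^sub>R p) - f x - ?r * l p\<bar> \<le> ?r / (real n + 1)"
          using m[OF p(1) r0] q(2) y dm[OF p(1)] by (simp add: \<rho>_def)
        also have "?r / (real n + 1) \<le> \<rho> * (e / 2)"
        proof -
          have "?r * (1 / (real n + 1)) \<le> \<rho> * (e / 2)" using q(2) r0 n \<rho> by (intro mult_mono) auto
          then show ?thesis by simp
        qed
        also have "\<bar>f y - f (x + ?r *\<^sub>R p)\<bar> \<le> L * norm (y - x - ?r *\<^sub>R p)"
          using lipschitz_onD[OF L, of y "x + ?r *\<^sub>R p"] by (simp add: dist_norm diff_diff_add)
        also have "\<bar>l (y - x - ?r *\<^sub>R p)\<bar> \<le> K * norm (y - x - ?r *\<^sub>R p)" by (rule lK)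
        finally have "norm (f y - f x - l (y - x)) \<le> \<rho> * (e / 2) + (L + K) * norm (y - x - ?r *\<^sub>R p)"
          by (simp add: distrib_right)
        also have "(L + K) * norm (y - x - ?r *\<^sub>R p) \<le> (L + K) * (3 * \<eta> * \<rho>)"
          using L0 by (intro mult_left_mono dist) (simp add: K_def)
        also have "(L + K) * (3 * \<eta> * \<rho>) \<le> e / 2 * \<rho>"
          using mult_right_mono[OF \<eta>e, of \<rho>] \<rho> by (simp add: mult.assoc)
        finally show ?thesis by (simp add: \<rho>_def mult.commute)
      qed
      with d0 show ?thesis by blast
    qed
    with bl show "(f has_derivative (\<lambda>h. Re (cdot h (G x)))) (at x)"
      unfolding has_derivative_at_alt l_def by blast
  qed
qed

lemma lipschitz_component:
  fixes A :: "real ^ 'n::finite \<Rightarrow> real ^ 'm::finite"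
  assumes "L-lipschitz_on UNIV A"
  shows "L-lipschitz_on UNIV (\<lambda>x. A x $ i)"
  using lipschitz_on_compose2[OF assms, of 1 "\<lambda>y. y $ i"] 
  by (simp add: lipschitz_on_def dist_vec_nth_le)

text \<open>The essential supremum of the Jacobian controls the increments of a Lipschitz map: by
  Rademacher's theorem the classical derivative is the weak one, which can be integrated along almost
  every segment in a given direction.\<close>

lemma lipschitz_by_jacobian_bound:
  fixes A :: "real ^ 'n::finite \<Rightarrow> real ^ 'n" and S :: real
  assumes L: "L-lipschitz_on UNIV A" and S: "AE x in lborel. norm (jacobian A (at x)) \<le> S" and S0: "S \<ge> 0"
  shows "(real CARD('n) * S)-lipschitz_on UNIV A"
proof -
  have Li: "L-lipschitz_on UNIV (\<lambda>x. A x $ i)" for i by (rule lipschitz_component[OF L])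
  have inc: "\<bar>A (x + h) $ i - A x $ i\<bar> \<le> S * norm h" for x h i
  proof -
    \<comment> \<open>a ball that contains all segments with direction \<open>h\<close> starting near \<open>x\<close>\<close>
    define R where "R = norm x + norm h + 1"
    have "\<forall>i. \<exists>g. \<exists>G M. wgrad (\<lambda>x. complex_of_real (g x)) G \<and> M-lipschitz_on UNIV g \<and> (\<forall>x. norm x \<le> R \<longrightarrow> g x = A x $ i)"
      using lipschitz_local_wgrad[OF Li] by blast
    from choice[OF this] obtain g where "\<forall>i. \<exists>G M. wgrad (\<lambda>x. complex_of_real (g i x)) G \<and> M-lipschitz_on UNIV (g i) \<and> (\<forall>x. norm x \<le> R \<longrightarrow> g i x = A x $ i)"
      by blast
    from choice[OF this] obtain G where G: "\<And>i. wgrad (\<lambda>x. complex_of_real (g i x)) (G i)"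
      and gL: "\<And>i. \<exists>M. M-lipschitz_on UNIV (g i)" and gA: "\<And>i x. norm x \<le> R \<Longrightarrow> g i x = A x $ i" by blast
    have "AE y in lborel. (g i has_derivative (\<lambda>h. Re (cdot h (G i y)))) (at y)" for i
      using gL[of i] rademacher[OF G] by blast
    then have "AE y in lborel. \<forall>i. (g i has_derivative (\<lambda>h. Re (cdot h (G i y)))) (at y)"
      unfolding AE_all_countable by blast
    with S have Gb: "AE y in lborel. norm y < R \<longrightarrow> norm (Re (cdot h (G i y))) \<le> S * norm h"
    proof eventually_elim
      case (elim y)
      show ?case
      proof
        assume y: "norm y < R"
        have "((\<lambda>x. A x $ i) has_derivative (\<lambda>h. Re (cdot h (G i y)))) (at y)" for i
          by (rule has_derivative_transform_within_open[OF elim(2)[rule_format, of i], of "ball 0 R"]) (use y gA in auto)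
        then have "(A has_derivative (\<lambda>h. \<chi> i. Re (cdot h (G i y)))) (at y)"
          by (subst has_derivative_componentwise_within) (auto simp: Basis_vec_def inner_axis)
        then have "jacobian A (at y) *v h = (\<chi> i. Re (cdot h (G i y)))"
          using jacobian_works[of A "at y"] has_derivative_unique unfolding differentiable_def by metis
        then have "Re (cdot h (G i y)) = jacobian A (at y) $ i \<bullet> h"
          by (simp add: vec_eq_iff matrix_vector_mult_def inner_vec_def)
        then have "norm (Re (cdot h (G i y))) \<le> norm (jacobian A (at y) $ i) * norm h"
          by (simp add: Cauchy_Schwarz_ineq2)
        also have "\<dots> \<le> S * norm h"
          using elim(1) Finite_Cartesian_Product.norm_nth_le[of "jacobian A (at y)" i] by (intro mult_right_mono) auto
        finally show "norm (Re (cdot h (G i y))) \<le> S * norm h" .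
      qed
    qed
    have [measurable]: "G i \<in> borel_measurable borel" using G[of i] by (auto simp: wgrad_def loc_int_measurable)
    have "Measurable.pred borel (\<lambda>y. norm y < R \<longrightarrow> norm (Re (cdot h (G i y))) \<le> S * norm h)" by measurable
    from AE_lines_iff[OF this, of h] Gb
    have ln: "AE y in lborel. AE s in lborel. s \<in> {0<..<1} \<longrightarrow> norm (y + s *\<^sub>R h) < R \<longrightarrow> norm (Re (cdot h (G i (y + s *\<^sub>R h)))) \<le> S * norm h"
      by auto
    have gc: "continuous_on UNIV (g i)" using gL[of i] lipschitz_on_continuous_on by blast
    \<comment> \<open>an open set of measure zero, hence empty\<close>
    define E where "E = {y. norm y < norm x + 1} \<inter> {y. S * norm h < \<bar>g i (y + h) - g i y\<bar>}"
    have "AE y in lborel. y \<notin> E"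
      using ln line_integral_formula[OF G gc, of h]
    proof eventually_elim
      case (elim y)
      let ?g = "\<lambda>s. Re (cdot h (G i (y + s *\<^sub>R h)))"
      have "\<bar>g i (y + h) - g i y\<bar> \<le> S * norm h" if y: "norm y < norm x + 1"
      proof -
        have yR: "norm (y + s *\<^sub>R h) < R" if "s \<in> {0<..<1}" for s
        proof -
          have "norm (s *\<^sub>R h) \<le> norm h" using that by (simp add: mult_left_le_one_le)
          then show ?thesis using y norm_triangle_ineq[of y "s *\<^sub>R h"] by (simp add: R_def)
        qed
        have ae: "AE s in lebesgue. s \<in> {0<..<1} \<longrightarrow> norm (?g s) \<le> S * norm h"
          using AE_completion[OF elim(1)] by eventually_elim (use yR in blast)
        obtain N where nN: "negligible N" and sN: "{s. \<not> (s \<in> {0<..<1} \<longrightarrow> norm (?g s) \<le> S * norm h)} \<subseteq> N"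
          using iffD1[OF eventually_ae_filter_negligible ae] by (elim exE conjE)
        have N: "negligible (N \<union> {0, 1})" using nN by simp
        have Ng: "norm (?g s) \<le> S * norm h" if "s \<in> {0..1}" "s \<notin> N \<union> {0, 1}" for s
        proof -
          have "s \<in> {0<..<1}" using that by auto
          moreover have "s \<in> {0<..<1} \<longrightarrow> norm (?g s) \<le> S * norm h" using sN that(2) by blast
          ultimately show ?thesis by blast
        qed
        let ?g' = "\<lambda>s. if s \<in> N \<union> {0, 1} then 0 else ?g s"
        have gi: "?g integrable_on {0..1}" using elim(2) set_lebesgue_integral_eq_integral(1) by blast
        have e: "integral {0..1} ?g = integral {0..1} ?g'" by (rule integral_spike[OF N]) auto
        have gi': "?g' integrable_on {0..1}" by (rule integrable_spike[OF gi N]) auto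
        have "norm (integral {0..1} ?g') \<le> integral {0..1} (\<lambda>s::real. S * norm h)"
          by (rule integral_norm_bound_integral[OF gi']) (use S0 Ng in auto)
        moreover have "g i (y + h) - g i y = integral {0..1} ?g" using elim(2)[THEN conjunct2, rule_format, of 1] by simp
        ultimately show ?thesis unfolding e by simp
      qed
      then show ?case by (auto simp: E_def)
    qed
    moreover have "open E" unfolding E_def
      by (intro open_Int open_Collect_less continuous_intros continuous_on_compose2[OF gc]) auto
    ultimately have "x \<notin> E" using AE_lborel_open_nonempty by blast
    moreover have "g i x = A x $ i" "g i (x + h) = A (x + h) $ i"
      using norm_triangle_ineq[of x h] by (auto intro!: gA simp: R_def)
    ultimately show ?thesis by (simp add: E_def)
  qed
  show ?thesis
  proof (rule lipschitz_onI)
    fix x y :: "real^'n"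
    have "dist (A x) (A y) \<le> (\<Sum>i\<in>UNIV. \<bar>A x $ i - A y $ i\<bar>)" using norm_le_l1_cart[of "A x - A y"] by (simp add: dist_norm)
    also have "\<dots> \<le> (\<Sum>i\<in>(UNIV::'n set). S * norm (x - y))" using inc[of y "x - y"] by (intro sum_mono) simp
    finally show "dist (A x) (A y) \<le> real CARD('n) * S * dist x y" by (simp add: dist_norm)
  qed (use S0 in simp)
qed

section \<open>Lebesgue measurable functions and the theorem\<close>

text \<open>Lebesgue measurable functions and weak gradients are now exchanged for Borel ones.  None of the
  quantities in the theorem is affected by a change on a null set.\<close>

lemma borel_version:
  fixes u :: "'a::euclidean_space \<Rightarrow> complex"
  assumes [measurable]: "u \<in> borel_measurable lebesgue"
  shows "\<exists>u'\<in>borel_measurable borel. AE x in lborel. u x = u' x"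
proof -
  obtain a where a: "a \<in> borel_measurable lborel" "AE x in lborel. Re (u x) = a x"
    using completion_ex_borel_measurable_real[of "\<lambda>x. Re (u x)" lborel] by auto
  obtain b where b: "b \<in> borel_measurable lborel" "AE x in lborel. Im (u x) = b x"
    using completion_ex_borel_measurable_real[of "\<lambda>x. Im (u x)" lborel] by auto
  have [measurable]: "a \<in> borel_measurable borel" "b \<in> borel_measurable borel" using a b by auto
  have "AE x in lborel. u x = complex_of_real (a x) + \<i> * complex_of_real (b x)"
    using a(2) b(2) by eventually_elim (simp add: complex_eq_iff)
  then show ?thesis by (intro bexI[of _ "\<lambda>x. complex_of_real (a x) + \<i> * complex_of_real (b x)"]) measurable
qed

lemma J_cong_AE:
  fixes u v :: "real ^ 'n::finite \<Rightarrow> complex"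
  assumes "AE x in lborel. u x = v x"
  shows "J A \<delta> u = J A \<delta> v"
proof -
  obtain N where N: "N \<in> null_sets lborel" "\<And>x. x \<notin> N \<Longrightarrow> u x = v x"
    using assms by (auto simp: eventually_ae_filter)
  have [measurable]: "N \<in> sets borel" using N(1) by auto
  have n: "AE x in lborel. x \<notin> N" by (rule AE_not_in[OF N(1)])
  have "AE p in lborel \<Otimes>\<^sub>M lborel. fst p \<notin> N \<and> snd p \<notin> N"
  proof (rule lborel_pair.AE_pair_measure)
    show "{p \<in> space (lborel \<Otimes>\<^sub>M lborel). fst p \<notin> N \<and> snd p \<notin> N} \<in> sets (lborel \<Otimes>\<^sub>M lborel)" by measurable
    show "AE x in lborel. AE y in lborel. fst (x, y) \<notin> N \<and> snd (x, y) \<notin> N"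
      using n by eventually_elim (use n in simp)
  qed
  then have "AE p in lebesgue. fst p \<notin> N \<and> snd p \<notin> N"
    unfolding lborel_prod by (rule AE_completion)
  then show ?thesis
    unfolding J_def
  proof (intro nn_integral_cong_AE, elim eventually_mono, goal_cases)
    case (1 p)
    then show ?case by (cases p) (simp add: Psi_def N(2) indicator_def)
  qed
qed

lemma nn_integral_lebesgue_version:
  assumes "AE x in lborel. f x = g x"
  shows "(\<integral>\<^sup>+x. f x \<partial>lebesgue) = (\<integral>\<^sup>+x. g x \<partial>lborel)"
  unfolding nn_integral_completion by (rule nn_integral_cong_AE[OF assms])

lemma locally_integrable_iff_loc_int:
  fixes f g :: "real ^ 'n::finite \<Rightarrow> complex"
  assumes f: "f \<in> borel_measurable lebesgue" and g[measurable]: "g \<in> borel_measurable borel"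
    and fg: "AE x in lborel. f x = g x"
  shows "locally_integrable f \<longleftrightarrow> loc_int g"
proof -
  have ball: "f absolutely_integrable_on cball 0 R \<longleftrightarrow> integrable lborel (\<lambda>x. indicator (cball 0 R) x *\<^sub>R g x)" for R :: real
  proof -
    have gm: "(\<lambda>x. indicator (cball 0 R) x *\<^sub>R g x) \<in> borel_measurable lborel" by measurable
    have "f absolutely_integrable_on cball 0 R \<longleftrightarrow> integrable lebesgue (\<lambda>x. indicator (cball 0 R) x *\<^sub>R g x)"
      unfolding set_integrable_def
    proof (rule integrable_cong_AE)
      show "(\<lambda>x. indicator (cball 0 R) x *\<^sub>R f x) \<in> borel_measurable lebesgue"
        using f by (intro borel_measurable_scaleR borel_measurable_indicator) auto
      show "(\<lambda>x. indicator (cball 0 R) x *\<^sub>R g x) \<in> borel_measurable lebesgue" using gm by (rule measurable_completion)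
      show "AE x in lebesgue. indicator (cball 0 R) x *\<^sub>R f x = indicator (cball 0 R) x *\<^sub>R g x"
        using AE_completion[OF fg] by eventually_elim simp
    qed
    also have "\<dots> \<longleftrightarrow> integrable lborel (\<lambda>x. indicator (cball 0 R) x *\<^sub>R g x)" by (rule integrable_completion[OF gm])
    finally show ?thesis .
  qed
  have "locally_integrable f \<longleftrightarrow> (\<forall>R. f absolutely_integrable_on cball 0 R)"
    unfolding locally_integrable_def
  proof (intro iffI allI impI)
    fix K :: "(real^'n) set" assume a: "\<forall>R. f absolutely_integrable_on cball 0 R" and K: "compact K"
    obtain R where "\<forall>x\<in>K. norm x \<le> R" using compact_imp_bounded[OF K] unfolding bounded_iff by blast
    then have R: "K \<subseteq> cball 0 R" by auto
    have "K \<in> sets lebesgue" by (rule sets_completionI_sets) (use borel_compact[OF K] in simp)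
    with a[rule_format, of R] show "f absolutely_integrable_on K" using R by (rule set_integrable_subset)
  next
    fix R assume "\<forall>K. compact K \<longrightarrow> f absolutely_integrable_on K"
    then show "f absolutely_integrable_on cball 0 R" using compact_cball by blast
  qed
  then show ?thesis unfolding loc_int_def using g ball by simp
qed

lemma locally_integrable_measurable:
  fixes f :: "real ^ 'n::finite \<Rightarrow> complex"
  assumes "locally_integrable f"
  shows "f \<in> borel_measurable lebesgue"
proof (rule borel_measurable_LIMSEQ_metric)
  fix n :: nat
  have "f absolutely_integrable_on cball 0 (real n)" using assms by (simp add: locally_integrable_def)
  then show "(\<lambda>x. indicator (cball 0 (real n)) x *\<^sub>R f x) \<in> borel_measurable lebesgue"
    unfolding set_integrable_def by (rule borel_measurable_integrable)
next
  fix x :: "real^'n"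
  obtain m :: nat where m: "norm x \<le> real m" using real_arch_simple by blast
  have "\<forall>\<^sub>F n in sequentially. indicator (cball 0 (real n)) x *\<^sub>R f x = f x"
    using eventually_ge_at_top[of m] by eventually_elim (use m in \<open>auto simp: indicator_def\<close>)
  then show "(\<lambda>n. indicator (cball 0 (real n)) x *\<^sub>R f x) \<longlonglongrightarrow> f x" by (rule tendsto_eventually)
qed

lemma integral_lebesgue_version:
  fixes f g :: "real ^ 'n::finite \<Rightarrow> complex"
  assumes f: "f \<in> borel_measurable lebesgue" and g: "g \<in> borel_measurable borel"
    and fg: "AE x in lborel. f x = g x" and t: "test_fun \<phi>"
  shows "(LINT x|lebesgue. f x * complex_of_real (\<phi> x)) = (LINT x|lborel. g x * complex_of_real (\<phi> x))"
proof -
  have [measurable]: "g \<in> borel_measurable borel" "\<phi> \<in> borel_measurable borel" using g test_fun_measurable[OF t] by auto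
  have gm: "(\<lambda>x. g x * complex_of_real (\<phi> x)) \<in> borel_measurable lborel" by measurable
  have "(\<lambda>x. complex_of_real (\<phi> x)) \<in> borel_measurable lborel" by measurable
  then have pm: "(\<lambda>x. complex_of_real (\<phi> x)) \<in> borel_measurable lebesgue" by (rule measurable_completion)
  have "(LINT x|lebesgue. f x * complex_of_real (\<phi> x)) = (LINT x|lebesgue. g x * complex_of_real (\<phi> x))"
  proof (rule integral_cong_AE)
    show "(\<lambda>x. f x * complex_of_real (\<phi> x)) \<in> borel_measurable lebesgue" using f pm by (rule borel_measurable_times)
    show "(\<lambda>x. g x * complex_of_real (\<phi> x)) \<in> borel_measurable lebesgue" using gm by (rule measurable_completion)
    show "AE x in lebesgue. f x * complex_of_real (\<phi> x) = g x * complex_of_real (\<phi> x)"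
      using AE_completion[OF fg] by eventually_elim simp
  qed
  also have "\<dots> = (LINT x|lborel. g x * complex_of_real (\<phi> x))" by (rule integral_completion[OF gm])
  finally show ?thesis .
qed

lemma has_weak_grad_iff_wgrad:
  fixes u :: "real ^ 'n::finite \<Rightarrow> complex"
  assumes u: "u \<in> borel_measurable lebesgue" "u' \<in> borel_measurable borel" "AE x in lborel. u x = u' x"
    and G: "\<And>j. (\<lambda>x. G x $ j) \<in> borel_measurable lebesgue" "G' \<in> borel_measurable borel" "AE x in lborel. G x = G' x"
  shows "has_weak_grad u G \<longleftrightarrow> wgrad u' G'"
proof -
  have G'j: "(\<lambda>x. G' x $ j) \<in> borel_measurable borel" for j by (rule measurable_compose[OF G(2) borel_measurable_vec_nth])
  have Gj: "AE x in lborel. G x $ j = G' x $ j" for j using G(3) by eventually_elim simp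
  have "loc_int G' \<longleftrightarrow> (\<forall>j. loc_int (\<lambda>x. G' x $ j))" using loc_int_vec[OF G(2)] loc_int_nth by blast
  then show ?thesis
    unfolding has_weak_grad_def wgrad_def
    by (simp add: locally_integrable_iff_loc_int[OF u] locally_integrable_iff_loc_int[OF G(1) G'j Gj]
        integral_lebesgue_version[OF u test_fun_pderiv] integral_lebesgue_version[OF G(1) G'j Gj])
qed

text \<open>The energy is defined through a choice of the weak gradient; uniqueness makes it independent of
  that choice.\<close>

lemma wgrad_unique:
  fixes u :: "real ^ 'n::finite \<Rightarrow> complex"
  assumes G: "wgrad u G" and H: "wgrad u H"
  shows "AE x in lborel. G x = H x"
proof -
  have "AE x in lborel. G x $ j - H x $ j = 0" for j
  proof (rule fundamental_lemma_variations)
    have lG: "loc_int (\<lambda>x. G x $ j)" and lH: "loc_int (\<lambda>x. H x $ j)" using G H by (auto simp: wgrad_def intro: loc_int_nth)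
    show "loc_int (\<lambda>x. G x $ j - H x $ j)" by (rule loc_int_diff[OF lG lH])
    fix \<phi> :: "real^'n \<Rightarrow> real" assume t: "test_fun \<phi>"
    have "(LINT x|lborel. (G x $ j - H x $ j) * complex_of_real (\<phi> x)) =
      (LINT x|lborel. G x $ j * complex_of_real (\<phi> x)) - (LINT x|lborel. H x $ j * complex_of_real (\<phi> x))"
      using integrable_mult_test_fun[OF lG t] integrable_mult_test_fun[OF lH t] by (simp add: left_diff_distrib)
    also have "(LINT x|lborel. G x $ j * complex_of_real (\<phi> x)) = - (LINT x|lborel. u x * complex_of_real (pderiv_at j \<phi> x))"
      using G t by (simp add: wgrad_def)
    also have "(LINT x|lborel. H x $ j * complex_of_real (\<phi> x)) = - (LINT x|lborel. u x * complex_of_real (pderiv_at j \<phi> x))"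
      using H t by (simp add: wgrad_def)
    finally show "(LINT x|lborel. (G x $ j - H x $ j) * complex_of_real (\<phi> x)) = 0" by simp
  qed
  then have "AE x in lborel. \<forall>j. G x $ j - H x $ j = 0" unfolding AE_all_countable by blast
  then show ?thesis by eventually_elim (simp add: vec_eq_iff)
qed

lemma mag_energy_version:
  fixes u :: "real ^ 'n::finite \<Rightarrow> complex"
  assumes u: "u \<in> borel_measurable lebesgue" "u' \<in> borel_measurable borel" "AE x in lborel. u x = u' x"
    and ex: "\<exists>G. has_weak_grad u G"
  shows "\<exists>G'. wgrad u' G' \<and> mag_energy A u = L2_sq (mgrad A u' G')"
proof -
  let ?G = "weak_grad u"
  have hw: "has_weak_grad u ?G" unfolding weak_grad_def by (rule someI_ex[OF ex])
  then have Gm: "(\<lambda>x. ?G x $ j) \<in> borel_measurable lebesgue" for j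
    by (auto simp: has_weak_grad_def intro: locally_integrable_measurable)
  have "\<forall>j. \<exists>g. g \<in> borel_measurable borel \<and> (AE x in lborel. ?G x $ j = g x)" using borel_version[OF Gm] by blast
  from choice[OF this] obtain g where g: "\<And>j. g j \<in> borel_measurable borel" "\<And>j. AE x in lborel. ?G x $ j = g j x" by blast
  define G' where "G' = (\<lambda>x. \<chi> j. g j x)"
  have G'm: "G' \<in> borel_measurable borel" unfolding G'_def using g(1) by (rule borel_measurable_vec_lambda)
  have "AE x in lborel. \<forall>j. ?G x $ j = g j x" unfolding AE_all_countable using g(2) by blast
  then have GG': "AE x in lborel. ?G x = G' x" by eventually_elim (simp add: G'_def vec_eq_iff)
  have "wgrad u' G'" using hw has_weak_grad_iff_wgrad[OF u Gm G'm GG'] by simp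
  moreover have "mag_energy A u = L2_sq (mgrad A u' G')"
    unfolding mag_energy_def
    by (rule nn_integral_lebesgue_version) (use u(3) GG' in eventually_elim, simp add: mag_grad_def mgrad_def)
  ultimately show ?thesis by blast
qed

text \<open>The dimensional factor in the constant absorbs the passage from the essential supremum of the
  Jacobian to the Lipschitz constant.\<close>

lemma J_upper_bound_jacobian:
  fixes u :: "real ^ 'n::finite \<Rightarrow> complex"
  assumes w: "wgrad u G" and L: "L-lipschitz_on UNIV A" and \<delta>: "\<delta> > 0"
  shows "J A \<delta> u \<le> ennreal (8 * real CARD('n) * ball_vol TYPE('n) * (real CARD('n))\<^sup>2) *
    (L2_sq (mgrad A u G) + ((grad_sup_norm A)\<^sup>2 + 1) * L2_sq u)"
    (is "_ \<le> ennreal (?c * ?N\<^sup>2) * (?E + (?S\<^sup>2 + 1) * ?U)")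
proof -
  have c0: "?c > 0" using ball_vol_pos[where 'n='n] by simp
  have N1: "?N\<^sup>2 \<ge> 1" by (simp add: one_le_power Suc_leI)
  show ?thesis
  proof (cases "?U = 0 \<or> ?S < top")
    case False
    then have "(?S\<^sup>2 + 1) * ?U = top" by (simp add: less_top[symmetric] ennreal_top_mult power2_eq_square)
    moreover have "ennreal (?c * ?N\<^sup>2) \<noteq> 0" using ball_vol_pos[where 'n='n] by simp
    ultimately show ?thesis by (simp add: ennreal_mult_top)
  next
    case True
    have "\<exists>M. M-lipschitz_on UNIV A \<and> ennreal (M\<^sup>2 + 1) * ?U \<le> ennreal (?N\<^sup>2) * ((?S\<^sup>2 + 1) * ?U)"
    proof (cases "?U = 0")
      case True
      then show ?thesis using L by auto
    next
      case False
      then obtain s where s: "?S = ennreal s" "s \<ge> 0" using True by (cases ?S) auto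
      have "AE x in lebesgue. ennreal (norm (jacobian A (at x))) \<le> ennreal s"
        using esssup_AE[of "\<lambda>x. ennreal (norm (jacobian A (at x)))" lebesgue] s(1) by (simp add: grad_sup_norm_def)
      then have "AE x in lborel. norm (jacobian A (at x)) \<le> s" using s(2) by (simp add: AE_completion_iff)
      from lipschitz_by_jacobian_bound[OF L this s(2)] have l: "(?N * s)-lipschitz_on UNIV A" .
      have "(?N * s)\<^sup>2 + 1 \<le> ?N\<^sup>2 * (s\<^sup>2 + 1)" using N1 by (simp add: power_mult_distrib distrib_left)
      then have "ennreal ((?N * s)\<^sup>2 + 1) \<le> ennreal (?N\<^sup>2 * (s\<^sup>2 + 1))" by (rule ennreal_leI)
      also have "\<dots> = ennreal (?N\<^sup>2) * (?S\<^sup>2 + 1)"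
        unfolding s(1) using s(2) by (subst ennreal_mult) (auto simp: ennreal_power)
      finally have "ennreal ((?N * s)\<^sup>2 + 1) * ?U \<le> ennreal (?N\<^sup>2) * (?S\<^sup>2 + 1) * ?U" by (rule mult_right_mono) simp
      then show ?thesis using l by (auto simp: mult.assoc)
    qed
    then obtain M where M: "M-lipschitz_on UNIV A" "ennreal (M\<^sup>2 + 1) * ?U \<le> ennreal (?N\<^sup>2) * ((?S\<^sup>2 + 1) * ?U)" by blast
    have "J A \<delta> u \<le> ennreal ?c * (?E + ennreal (M\<^sup>2 + 1) * ?U)" using J_upper_bound[OF w M(1) \<delta>] by simp
    also have "\<dots> \<le> ennreal ?c * (ennreal (?N\<^sup>2) * ?E + ennreal (?N\<^sup>2) * ((?S\<^sup>2 + 1) * ?U))"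
    proof (intro mult_left_mono add_mono M(2))
      have "1 * ?E \<le> ennreal (?N\<^sup>2) * ?E" using N1 by (intro mult_right_mono) (auto simp: one_ennreal.rep_eq ennreal_1[symmetric] simp del: ennreal_1 intro: ennreal_leI)
      then show "?E \<le> ennreal (?N\<^sup>2) * ?E" by simp
    qed simp
    also have "\<dots> = ennreal (?c * ?N\<^sup>2) * (?E + (?S\<^sup>2 + 1) * ?U)"
      using c0 by (subst ennreal_mult) (auto simp: distrib_left mult.assoc)
    finally show ?thesis .
  qed
qed

theorem theorem1p2:
  shows "\<exists>C::real. C > 0 \<and>
    (\<forall>A :: real ^ 'n::finite \<Rightarrow> real ^ 'n. (\<exists>L. L-lipschitz_on UNIV A) \<longrightarrow>
      (\<forall>u. u \<in> H1A A \<longleftrightarrow> u \<in> L2_fun \<and> (SUP \<delta>\<in>{0<..<1}. J A \<delta> u) < \<infinity>) \<and>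
      (\<forall>u \<in> H1A A. \<forall>\<omega> :: real ^ 'n. norm \<omega> = 1 \<longrightarrow>
         ((\<lambda>\<delta>. J A \<delta> u) \<longlongrightarrow> ennreal (Q \<omega>) * mag_energy A u) (at_right 0)) \<and>
      (\<forall>u \<in> H1A A. (SUP \<delta>\<in>{0<..}. J A \<delta> u) \<le>
         ennreal C * (mag_energy A u + ((grad_sup_norm A)\<^sup>2 + 1) * sq_integral u)))"
proof (intro exI[of _ "8 * real CARD('n) * ball_vol TYPE('n) * (real CARD('n))\<^sup>2"] conjI allI impI ballI)
  show "8 * real CARD('n) * ball_vol TYPE('n) * (real CARD('n))\<^sup>2 > 0" using ball_vol_pos[where 'n='n] by simp
  fix A :: "real ^ 'n \<Rightarrow> real ^ 'n" and u
  assume "\<exists>L. L-lipschitz_on UNIV A"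
  then obtain L where L: "L-lipschitz_on UNIV A" by blast
  have version: "\<exists>u'. u' \<in> borel_measurable borel \<and> (AE x in lborel. u x = u' x) \<and> (\<forall>\<delta>. J A \<delta> u = J A \<delta> u') \<and>
      sq_integral u = L2_sq u'" if u: "u \<in> L2_fun"
  proof -
    have "u \<in> borel_measurable lebesgue" using u by (simp add: L2_fun_def)
    then obtain u' where u': "u' \<in> borel_measurable borel" "AE x in lborel. u x = u' x" using borel_version by blast
    moreover have "sq_integral u = L2_sq u'"
      unfolding sq_integral_def by (rule nn_integral_lebesgue_version) (use u'(2) in eventually_elim, simp)
    ultimately show ?thesis using J_cong_AE[OF u'(2)] by blast
  qed
  have H1A_version: "\<exists>u' G'. wgrad u' G' \<and> (\<forall>\<delta>. J A \<delta> u = J A \<delta> u') \<and>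
      sq_integral u = L2_sq u' \<and> sq_integral u < \<infinity> \<and>
      mag_energy A u = L2_sq (mgrad A u' G') \<and> mag_energy A u < \<infinity>" if u: "u \<in> H1A A"
  proof -
    have um: "u \<in> L2_fun" "u \<in> borel_measurable lebesgue" "sq_integral u < \<infinity>" "mag_energy A u < \<infinity>" "\<exists>G. has_weak_grad u G"
      using u by (auto simp: H1A_def L2_fun_def)
    obtain u' where u': "u' \<in> borel_measurable borel" "AE x in lborel. u x = u' x" "\<forall>\<delta>. J A \<delta> u = J A \<delta> u'"
      "sq_integral u = L2_sq u'" using version[OF um(1)] by blast
    show ?thesis using mag_energy_version[OF um(2) u'(1,2) um(5), of A] u'(3,4) um(3,4) by blast
  qed
  show "(SUP \<delta>\<in>{0<..}. J A \<delta> u) \<le> ennreal (8 * real CARD('n) * ball_vol TYPE('n) * (real CARD('n))\<^sup>2) * (mag_energy A u + ((grad_sup_norm A)\<^sup>2 + 1) * sq_integral u)"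
    if "u \<in> H1A A"
  proof (rule SUP_least)
    fix \<delta> :: real assume "\<delta> \<in> {0<..}"
    then have d: "\<delta> > 0" by simp
    obtain u' G' where v: "wgrad u' G'" "J A \<delta> u = J A \<delta> u'" "sq_integral u = L2_sq u'"
      "mag_energy A u = L2_sq (mgrad A u' G')" using H1A_version[OF \<open>u \<in> H1A A\<close>] by blast
    show "J A \<delta> u \<le> ennreal (8 * real CARD('n) * ball_vol TYPE('n) * (real CARD('n))\<^sup>2) * (mag_energy A u + ((grad_sup_norm A)\<^sup>2 + 1) * sq_integral u)"
      unfolding v(2-4) by (rule J_upper_bound_jacobian[OF v(1) L d])
  qed
  show "((\<lambda>\<delta>. J A \<delta> u) \<longlongrightarrow> ennreal (Q \<omega>) * mag_energy A u) (at_right 0)" if u: "u \<in> H1A A" and \<omega>: "norm \<omega> = 1" for \<omega> :: "real^'n"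
  proof -
    obtain u' G' where v: "wgrad u' G'" "\<forall>\<delta>. J A \<delta> u = J A \<delta> u'" "sq_integral u = L2_sq u'" "sq_integral u < \<infinity>"
      "mag_energy A u = L2_sq (mgrad A u' G')" "mag_energy A u < \<infinity>" using H1A_version[OF u] by blast
    show ?thesis unfolding Q_eq[OF \<omega>] v(5) v(2)[rule_format]
      by (rule J_limit[OF v(1) L]) (use v(3-6) in simp_all)
  qed
  show "u \<in> H1A A \<longleftrightarrow> u \<in> L2_fun \<and> (SUP \<delta>\<in>{0<..<1}. J A \<delta> u) < \<infinity>"
  proof (intro iffI conjI)
    assume u: "u \<in> H1A A"
    then show "u \<in> L2_fun" by (simp add: H1A_def)
    obtain u' G' where v: "wgrad u' G'" "\<forall>\<delta>. J A \<delta> u = J A \<delta> u'" "sq_integral u = L2_sq u'" "sq_integral u < \<infinity>"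
      "mag_energy A u = L2_sq (mgrad A u' G')" "mag_energy A u < \<infinity>" using H1A_version[OF u] by blast
    have "(SUP \<delta>\<in>{0<..<1}. J A \<delta> u) \<le> ennreal (8 * real CARD('n) * ball_vol TYPE('n)) * (mag_energy A u + ennreal (L\<^sup>2 + 1) * sq_integral u)"
      unfolding v(3) v(5) using v(2) J_upper_bound[OF v(1) L] by (intro SUP_least) auto
    also have "\<dots> < \<infinity>" using v(4,6) by (auto simp: ennreal_mult_less_top)
    finally show "(SUP \<delta>\<in>{0<..<1}. J A \<delta> u) < \<infinity>" .
  next
    assume a: "u \<in> L2_fun \<and> (SUP \<delta>\<in>{0<..<1}. J A \<delta> u) < \<infinity>"
    then have u: "u \<in> L2_fun" "u \<in> borel_measurable lebesgue" "sq_integral u < \<infinity>" by (auto simp: L2_fun_def)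
    obtain u' where u': "u' \<in> borel_measurable borel" "AE x in lborel. u x = u' x" "\<forall>\<delta>. J A \<delta> u = J A \<delta> u'"
      "sq_integral u = L2_sq u'" using version[OF u(1)] by blast
    obtain K where K: "(SUP \<delta>\<in>{0<..<1}. J A \<delta> u) = ennreal K" "K \<ge> 0"
      using a by (cases "SUP \<delta>\<in>{0<..<1}. J A \<delta> u") auto
    have "J A \<delta> u' \<le> ennreal K" if "0 < \<delta>" "\<delta> < 1" for \<delta>
      unfolding u'(3)[rule_format, symmetric] K(1)[symmetric] using that by (intro SUP_upper) simp
    then obtain G where G: "wgrad u' G" "L2_sq (mgrad A u' G) < \<infinity>"
      using weak_gradient_from_J_bound[OF u'(1) _ L _ K(2)] u(3) u'(4) by auto
    have "(\<lambda>x. G x $ j) \<in> borel_measurable lebesgue" for j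
      using measurable_compose[OF wgrad_measurable(2)[OF G(1)] borel_measurable_vec_nth] by (intro measurable_completion) simp
    then have hw: "\<exists>G. has_weak_grad u G"
      using has_weak_grad_iff_wgrad[OF u(2) u'(1,2) _ wgrad_measurable(2)[OF G(1)]] G(1) by blast
    obtain G' where G': "wgrad u' G'" "mag_energy A u = L2_sq (mgrad A u' G')"
      using mag_energy_version[OF u(2) u'(1,2) hw] by blast
    have "mag_energy A u = L2_sq (mgrad A u' G)"
      unfolding G'(2) using wgrad_unique[OF G'(1) G(1)] by (intro nn_integral_cong_AE) (auto elim!: eventually_mono simp: mgrad_def)
    then show "u \<in> H1A A" using u(1) hw G(2) by (simp add: H1A_def)
  qed
qed

end
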